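(* Let $M=M_T\times_{f_1} M_\perp\times_{f_2} M_\theta$ be a bi-warped product submanifold of a nearly Kaehler manifold $\tilde M$, where $M_T$, $M_\perp$ and $M_\theta$ are holomorphic, totally real and proper slant (with slant angle $\theta$) submanifolds of $\tilde M$, respectively. Then: (i) The second fundamental form $h$ of $M$ in $\tilde M$ and the warping functions $f_1,f_2$ satisfy $$\|h\|^2\ \geq\ 2p\,\|\nabla(\ln f_1)\|^2+4q\left(1+\frac{10}{9}\cot^2\theta\right)\|\nabla(\ln f_2)\|^2 \qquad ( * )$$ where $p=\dim M_\perp$, $q=\frac12\dim M_\theta$, and $\nabla(\ln f_i)$ is the gradient of $\ln f_i$. (ii) If the equality sign in $( * )$ holds identically on $M$, then $M_T$ is totally geodesic in $\tilde M$, and $M_\perp$ and $M_\theta$ are totally umbilical in $\tilde M$. Moreover, if in addition $M$ is a proper bi-warped product, then $M$ is neither $\mathfrak{D}\oplus\mathfrak{D}^\perp$-mixed totally geodesic nor $\mathfrak{D}\oplus\mathfrak{D}^\theta$-mixed totally geodesic in $\tilde M$.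
   Context: Nearly Kaehler manifold: an even-dimensional manifold $\tilde M$ with Riemannian metric $g$ and almost complex structure $J$ such that $g(JX,JY)=g(X,Y)$ and $(\tilde\nabla_XJ)Y+(\tilde\nabla_YJ)X=0$ for all vector fields $X,Y$, where $\tilde\nabla$ is the Levi-Civita connection of $g$. Manifolds are smooth, connected and of positive dimension. Bi-warped product: for Riemannian manifolds $(M_0,g_0),(M_1,g_1),(M_2,g_2)$ and smooth positive functions $f_1,f_2$ on $M_0$, $M_0\times_{f_1}M_1\times_{f_2}M_2$ is the manifold $M_0\times M_1\times M_2$ with metric $\pi_0^*g_0+(f_1\circ\pi_0)^2\pi_1^*g_1+(f_2\circ\pi_0)^2\pi_2^*g_2$, where $\pi_i$ are the projections. It is proper if neither $f_1$ nor $f_2$ is constant. The functions $f_i$ are also regarded as functions on $M$ via $\pi_0$. Let $M$ be isometrically immersed in $\tilde M$. Its second fundamental form $h$ is defined by $\tilde\nabla_XY=\nabla_XY+h(X,Y)$ for $X,Y$ tangent to $M$ ($\nabla$ the Levi-Civita connection of $M$, $h(X,Y)$ normal), and $\|h\|^2=\sum_{i,j}g(h(e_i,e_j),h(e_i,e_j))$ for a local orthonormal frame $\{e_i\}$ of $TM$. A submanifold $N$ of $\tilde M$ is holomorphic if $J(T_pN)=T_pN$, and totally real if $J(T_pN)\subseteq T_p^\perp N$, for all $p\in N$. It is slant if the angle between $JX$ and $T_pN$ is the same constant $\theta$ (the slant angle) for all $p\in N$ and all nonzero $X\in T_pN$; it is proper slant if it is neither holomorphic nor totally real (so $0<\theta<\frac{\pi}{2}$).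 For a bi-warped product submanifold $M=M_T\times_{f_1}M_\perp\times_{f_2}M_\theta$, the base is $M_T$ (so $f_1,f_2$ are functions on $M_T$), and $M_T,M_\perp,M_\theta$ are identified with the corresponding leaves (slices) in $M$, regarded as submanifolds of $\tilde M$; statements about $M_T,M_\perp,M_\theta$ as submanifolds refer to all such leaves. Put $\mathfrak{D}=TM_T$, $\mathfrak{D}^\perp=TM_\perp$, $\mathfrak{D}^\theta=TM_\theta$, viewed as distributions on $M$, so $TM=\mathfrak{D}\oplus\mathfrak{D}^\perp\oplus\mathfrak{D}^\theta$. For $X$ tangent to $M$ write $JX=TX+FX$ with $TX$ tangent and $FX$ normal to $M$. As a standing assumption, the normal bundle decomposes orthogonally as $T^\perp M=J\mathfrak{D}^\perp\oplus F\mathfrak{D}^\theta\oplus\mu$ with $\mu$ a $J$-invariant subbundle (in particular $J\mathfrak{D}^\perp$ is normal to $M$). $M$ is $\mathfrak{D}\oplus\mathfrak{D}^\perp$-mixed totally geodesic if $h(X,Z)=0$ for all $X\in\mathfrak{D}$, $Z\in\mathfrak{D}^\perp$, and $\mathfrak{D}\oplus\mathfrak{D}^\theta$-mixed totally geodesic if $h(X,Y)=0$ for all $X\in\mathfrak{D}$, $Y\in\mathfrak{D}^\theta$. A submanifold is totally geodesic if its second fundamental form vanishes, and totally umbilical if its second fundamental form is $g(\cdot,\cdot)H$ for some normal vector field $H$. *)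

theory Defs
  imports "HOL-Analysis.Analysis"
begin

section \<open>Smooth manifolds\<close>

text \<open>All the sets below on which smoothness is considered are open.\<close>

primrec Ck_on :: "nat \<Rightarrow> ('e::euclidean_space \<Rightarrow> 'f::real_normed_vector) \<Rightarrow> 'e set \<Rightarrow> bool" where
  "Ck_on 0 f S \<longleftrightarrow> continuous_on S f"
| "Ck_on (Suc k) f S \<longleftrightarrow>
     f differentiable_on S \<and> (\<forall>v. Ck_on k (\<lambda>x. frechet_derivative f (at x) v) S)"

definition smooth_on :: "('e::euclidean_space \<Rightarrow> 'f::real_normed_vector) \<Rightarrow> 'e set \<Rightarrow> bool" where
  "smooth_on f S \<longleftrightarrow> (\<forall>k. Ck_on k f S)"

text \<open>A chart is its domain together with its coordinate map, whose inverse is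
  \<^term>\<open>inv_into U \<kappa>\<close>. A manifold is a whole type with a smooth atlas.\<close>

type_synonym ('m, 'e) chart = "'m set \<times> ('m \<Rightarrow> 'e)"

definition smooth_manifold ::
  "('m::{t2_space,second_countable_topology}, 'e::euclidean_space) chart set \<Rightarrow> bool" where
  "smooth_manifold A \<longleftrightarrow>
     connected (UNIV :: 'm set) \<and>
     (\<Union>(U, \<kappa>)\<in>A. U) = UNIV \<and>
     (\<forall>(U, \<kappa>)\<in>A. open U \<and> open (\<kappa> ` U) \<and> homeomorphism U (\<kappa> ` U) \<kappa> (inv_into U \<kappa>)) \<and>
     (\<forall>(U, \<kappa>)\<in>A. \<forall>(V, \<kappa>')\<in>A. smooth_on (\<kappa>' \<circ> inv_into U \<kappa>) (\<kappa> ` (U \<inter> V)))"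

definition prod_atlas ::
  "('m, 'e) chart set \<Rightarrow> ('n, 'f) chart set \<Rightarrow> ('m \<times> 'n, 'e \<times> 'f) chart set" where
  "prod_atlas A B = {(U \<times> V, map_prod \<kappa> \<kappa>') | U \<kappa> V \<kappa>'. (U, \<kappa>) \<in> A \<and> (V, \<kappa>') \<in> B}"

definition smooth_fun_on ::
  "('m::topological_space, 'e::euclidean_space) chart set \<Rightarrow> 'm set \<Rightarrow> ('m \<Rightarrow> real) \<Rightarrow> bool" where
  "smooth_fun_on A W f \<longleftrightarrow>
     open W \<and> (\<forall>(U, \<kappa>)\<in>A. smooth_on (f \<circ> inv_into U \<kappa>) (\<kappa> ` (U \<inter> W)))"

definition smooth_at ::
  "('m::topological_space, 'e::euclidean_space) chart set \<Rightarrow> 'm \<Rightarrow> ('m \<Rightarrow> real) \<Rightarrow> bool" where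
  "smooth_at A p f \<longleftrightarrow> (\<exists>W. p \<in> W \<and> smooth_fun_on A W f)"

definition smooth_map ::
  "('n::topological_space, 'f::euclidean_space) chart set \<Rightarrow>
   ('m::topological_space, 'e::euclidean_space) chart set \<Rightarrow> ('n \<Rightarrow> 'm) \<Rightarrow> bool" where
  "smooth_map B A \<phi> \<longleftrightarrow>
     continuous_on UNIV \<phi> \<and>
     (\<forall>(U, \<kappa>)\<in>B. \<forall>(V, \<kappa>')\<in>A. smooth_on (\<kappa>' \<circ> \<phi> \<circ> inv_into U \<kappa>) (\<kappa> ` (U \<inter> \<phi> -` V)))"

section \<open>Tangent vectors and vector fields\<close>

text \<open>Tangent vectors act on real functions as directional derivatives. The type
  \<open>'m tvec\<close> is the real vector space of all functionals on \<open>'m \<Rightarrow> real\<close>. The vectors tangent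
  at \<open>p\<close> are the directional derivatives in a chart around \<open>p\<close>; they are 0 by convention on
  functions that are not smooth near \<open>p\<close>, so that they are determined by their values on
  the functions smooth near \<open>p\<close>.\<close>

typedef 'm tvec = "UNIV :: (('m \<Rightarrow> real) \<Rightarrow> real) set"
  morphisms act Tvec ..

notation act (infixl "\<cdot>" 75)

instantiation tvec :: (type) real_vector
begin

definition "0 = Tvec (\<lambda>f. 0)"
definition "u + v = Tvec (\<lambda>f. u \<cdot> f + v \<cdot> f)"
definition "- u = Tvec (\<lambda>f. - (u \<cdot> f))"
definition "u - v = Tvec (\<lambda>f. u \<cdot> f - v \<cdot> f)"
definition "a *\<^sub>R u = Tvec (\<lambda>f. a * (u \<cdot> f))"

instance
  by standard
    (simp_all add: zero_tvec_def plus_tvec_def uminus_tvec_def minus_tvec_def scaleR_tvec_def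
      Tvec_inverse Tvec_inject act_inverse algebra_simps)

end

definition tangent_space ::
  "('m::topological_space, 'e::euclidean_space) chart set \<Rightarrow> 'm \<Rightarrow> 'm tvec set" where
  "tangent_space A p =
     {v. \<exists>(U, \<kappa>)\<in>A. p \<in> U \<and>
       (\<exists>\<xi>. \<forall>f. v \<cdot> f =
          (if smooth_at A p f then frechet_derivative (f \<circ> inv_into U \<kappa>) (at (\<kappa> p)) \<xi> else 0))}"

text \<open>The differential of \<open>\<phi>\<close> at \<open>p\<close>; \<open>A\<close> is the atlas of the codomain.\<close>

definition differential ::
  "('m::topological_space, 'e::euclidean_space) chart set \<Rightarrow>
   ('n \<Rightarrow> 'm) \<Rightarrow> 'n \<Rightarrow> 'n tvec \<Rightarrow> 'm tvec" where
  "differential A \<phi> p v = Tvec (\<lambda>f. if smooth_at A (\<phi> p) f then v \<cdot> (f \<circ> \<phi>) else 0)"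

definition smooth_field_along ::
  "('n::topological_space, 'f::euclidean_space) chart set \<Rightarrow>
   ('m::topological_space, 'e::euclidean_space) chart set \<Rightarrow>
   ('n \<Rightarrow> 'm) \<Rightarrow> 'n set \<Rightarrow> ('n \<Rightarrow> 'm tvec) \<Rightarrow> bool" where
  "smooth_field_along B A \<phi> W V \<longleftrightarrow>
     open W \<and> (\<forall>q\<in>W. V q \<in> tangent_space A (\<phi> q)) \<and>
     (\<forall>W' f. smooth_fun_on A W' f \<longrightarrow> smooth_fun_on B (W \<inter> \<phi> -` W') (\<lambda>q. V q \<cdot> f))"

definition vector_field_on ::
  "('m::topological_space, 'e::euclidean_space) chart set \<Rightarrow> 'm set \<Rightarrow> ('m \<Rightarrow> 'm tvec) \<Rightarrow> bool" where
  "vector_field_on A W X \<longleftrightarrow> smooth_field_along A A (\<lambda>q. q) W X"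

definition lie_bracket ::
  "('m::topological_space, 'e::euclidean_space) chart set \<Rightarrow>
   ('m \<Rightarrow> 'm tvec) \<Rightarrow> ('m \<Rightarrow> 'm tvec) \<Rightarrow> 'm \<Rightarrow> 'm tvec" where
  "lie_bracket A X Y p =
     Tvec (\<lambda>f. if smooth_at A p f then X p \<cdot> (\<lambda>q. Y q \<cdot> f) - Y p \<cdot> (\<lambda>q. X q \<cdot> f) else 0)"

definition subbundle_along ::
  "('n::topological_space, 'f::euclidean_space) chart set \<Rightarrow>
   ('m::topological_space, 'e::euclidean_space) chart set \<Rightarrow>
   ('n \<Rightarrow> 'm) \<Rightarrow> ('n \<Rightarrow> 'm tvec set) \<Rightarrow> bool" where
  "subbundle_along B A \<phi> \<mu> \<longleftrightarrow>
     (\<forall>p. \<exists>W (r::nat) s. p \<in> W \<and> open W \<and> (\<forall>i<r. smooth_field_along B A \<phi> W (s i)) \<and>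
        (\<forall>q\<in>W. inj_on (\<lambda>i. s i q) {..<r} \<and> independent ((\<lambda>i. s i q) ` {..<r}) \<and>
               \<mu> q = span ((\<lambda>i. s i q) ` {..<r})))"

section \<open>Riemannian metrics and connections\<close>

type_synonym 'm metric = "'m \<Rightarrow> 'm tvec \<Rightarrow> 'm tvec \<Rightarrow> real"

definition riemannian_manifold ::
  "('m::{t2_space,second_countable_topology}, 'e::euclidean_space) chart set \<Rightarrow>
   'm metric \<Rightarrow> bool" where
  "riemannian_manifold A g \<longleftrightarrow>
     smooth_manifold A \<and>
     (\<forall>p. \<forall>u\<in>tangent_space A p. \<forall>v\<in>tangent_space A p. g p u v = g p v u) \<and>
     (\<forall>p. \<forall>u\<in>tangent_space A p. \<forall>v\<in>tangent_space A p. \<forall>w\<in>tangent_space A p. \<forall>a b.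
        g p (a *\<^sub>R u + b *\<^sub>R v) w = a * g p u w + b * g p v w) \<and>
     (\<forall>p. \<forall>u\<in>tangent_space A p. u \<noteq> 0 \<longrightarrow> g p u u > 0) \<and>
     (\<forall>W X Y. vector_field_on A W X \<and> vector_field_on A W Y \<longrightarrow>
        smooth_fun_on A W (\<lambda>q. g q (X q) (Y q)))"

text \<open>A connection is evaluated at a point, a tangent vector and a vector field defined on
  some neighbourhood of the point: \<open>nab p u Y\<close> is the covariant derivative of \<open>Y\<close> in the
  direction \<open>u\<close> at \<open>p\<close>. That it depends only on the germ of \<open>Y\<close> at \<open>p\<close> follows from the
  product rule, since the indicator function of a neighbourhood of \<open>p\<close> is smooth near \<open>p\<close>.\<close>

type_synonym 'm connection = "'m \<Rightarrow> 'm tvec \<Rightarrow> ('m \<Rightarrow> 'm tvec) \<Rightarrow> 'm tvec"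

definition affine_connection ::
  "('m::topological_space, 'e::euclidean_space) chart set \<Rightarrow> 'm connection \<Rightarrow> bool" where
  "affine_connection A nab \<longleftrightarrow>
     (\<forall>W X Y. vector_field_on A W X \<and> vector_field_on A W Y \<longrightarrow>
        vector_field_on A W (\<lambda>q. nab q (X q) Y)) \<and>
     (\<forall>W p Y. p \<in> W \<and> vector_field_on A W Y \<longrightarrow>
        (\<forall>u\<in>tangent_space A p. nab p u Y \<in> tangent_space A p) \<and>
        (\<forall>u\<in>tangent_space A p. \<forall>v\<in>tangent_space A p. \<forall>a b.
           nab p (a *\<^sub>R u + b *\<^sub>R v) Y = a *\<^sub>R nab p u Y + b *\<^sub>R nab p v Y) \<and>
        (\<forall>u\<in>tangent_space A p. \<forall>Z. vector_field_on A W Z \<longrightarrow>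
           nab p u (\<lambda>q. Y q + Z q) = nab p u Y + nab p u Z) \<and>
        (\<forall>u\<in>tangent_space A p. \<forall>f. smooth_fun_on A W f \<longrightarrow>
           nab p u (\<lambda>q. f q *\<^sub>R Y q) = (u \<cdot> f) *\<^sub>R Y p + f p *\<^sub>R nab p u Y))"

definition levi_civita ::
  "('m::topological_space, 'e::euclidean_space) chart set \<Rightarrow>
   'm metric \<Rightarrow> 'm connection \<Rightarrow> bool" where
  "levi_civita A g nab \<longleftrightarrow>
     affine_connection A nab \<and>
     (\<forall>W p X Y. p \<in> W \<and> vector_field_on A W X \<and> vector_field_on A W Y \<longrightarrow>
        nab p (X p) Y - nab p (Y p) X = lie_bracket A X Y p) \<and>
     (\<forall>W p u Y Z. p \<in> W \<and> u \<in> tangent_space A p \<and>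
        vector_field_on A W Y \<and> vector_field_on A W Z \<longrightarrow>
        u \<cdot> (\<lambda>q. g q (Y q) (Z q)) = g p (nab p u Y) (Z p) + g p (Y p) (nab p u Z))"

definition gradient ::
  "('m::topological_space, 'e::euclidean_space) chart set \<Rightarrow>
   'm metric \<Rightarrow> ('m \<Rightarrow> real) \<Rightarrow> 'm \<Rightarrow> 'm tvec" where
  "gradient A g f p =
     (THE w. w \<in> tangent_space A p \<and> (\<forall>v\<in>tangent_space A p. g p w v = v \<cdot> f))"

definition grad_norm_sq ::
  "('m::topological_space, 'e::euclidean_space) chart set \<Rightarrow>
   'm metric \<Rightarrow> ('m \<Rightarrow> real) \<Rightarrow> 'm \<Rightarrow> real" where
  "grad_norm_sq A g f p = g p (gradient A g f p) (gradient A g f p)"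

definition orthonormal_basis ::
  "('m::topological_space, 'e::euclidean_space) chart set \<Rightarrow>
   'm metric \<Rightarrow> 'm \<Rightarrow> 'm tvec set \<Rightarrow> bool" where
  "orthonormal_basis A g p E \<longleftrightarrow>
     finite E \<and> span E = tangent_space A p \<and>
     (\<forall>u\<in>E. \<forall>v\<in>E. g p u v = (if u = v then 1 else 0))"

definition almost_complex_structure ::
  "('m::topological_space, 'e::euclidean_space) chart set \<Rightarrow>
   ('m \<Rightarrow> 'm tvec \<Rightarrow> 'm tvec) \<Rightarrow> bool" where
  "almost_complex_structure A J \<longleftrightarrow>
     (\<forall>p. \<forall>u\<in>tangent_space A p. J p u \<in> tangent_space A p \<and> J p (J p u) = - u) \<and>
     (\<forall>p. \<forall>u\<in>tangent_space A p. \<forall>v\<in>tangent_space A p. \<forall>a b.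
        J p (a *\<^sub>R u + b *\<^sub>R v) = a *\<^sub>R J p u + b *\<^sub>R J p v) \<and>
     (\<forall>W X. vector_field_on A W X \<longrightarrow> vector_field_on A W (\<lambda>q. J q (X q)))"

definition nabla_J ::
  "'m connection \<Rightarrow> ('m \<Rightarrow> 'm tvec \<Rightarrow> 'm tvec) \<Rightarrow>
   ('m \<Rightarrow> 'm tvec) \<Rightarrow> ('m \<Rightarrow> 'm tvec) \<Rightarrow> 'm \<Rightarrow> 'm tvec" where
  "nabla_J nab J X Y p = nab p (X p) (\<lambda>q. J q (Y q)) - J p (nab p (X p) Y)"

definition nearly_kaehler ::
  "('m::{t2_space,second_countable_topology}, 'e::euclidean_space) chart set \<Rightarrow>
   'm metric \<Rightarrow> ('m \<Rightarrow> 'm tvec \<Rightarrow> 'm tvec) \<Rightarrow> 'm connection \<Rightarrow> bool" where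
  "nearly_kaehler A g J nab \<longleftrightarrow>
     even DIM('e) \<and> riemannian_manifold A g \<and> almost_complex_structure A J \<and>
     levi_civita A g nab \<and>
     (\<forall>p. \<forall>u\<in>tangent_space A p. \<forall>v\<in>tangent_space A p. g p (J p u) (J p v) = g p u v) \<and>
     (\<forall>W p X Y. p \<in> W \<and> vector_field_on A W X \<and> vector_field_on A W Y \<longrightarrow>
        nabla_J nab J X Y p + nabla_J nab J Y X p = 0)"

section \<open>Immersed submanifolds\<close>

text \<open>Submanifolds are given by immersions \<open>\<phi>\<close> of a manifold with atlas \<open>B\<close> into the ambient
  manifold with atlas \<open>A\<close>.\<close>

definition pullback_metric ::
  "('m::topological_space, 'e::euclidean_space) chart set \<Rightarrow>
   'm metric \<Rightarrow> ('n \<Rightarrow> 'm) \<Rightarrow> 'n metric" where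
  "pullback_metric A g \<phi> p u v = g (\<phi> p) (differential A \<phi> p u) (differential A \<phi> p v)"

definition isometric_immersion ::
  "('n::topological_space, 'f::euclidean_space) chart set \<Rightarrow> 'n metric \<Rightarrow>
   ('m::topological_space, 'e::euclidean_space) chart set \<Rightarrow> 'm metric \<Rightarrow>
   ('n \<Rightarrow> 'm) \<Rightarrow> bool" where
  "isometric_immersion B gB A g \<phi> \<longleftrightarrow>
     smooth_map B A \<phi> \<and>
     (\<forall>p. inj_on (differential A \<phi> p) (tangent_space B p)) \<and>
     (\<forall>p. \<forall>u\<in>tangent_space B p. \<forall>v\<in>tangent_space B p. pullback_metric A g \<phi> p u v = gB p u v)"

definition normal_space ::
  "('n::topological_space, 'f::euclidean_space) chart set \<Rightarrow>
   ('m::topological_space, 'e::euclidean_space) chart set \<Rightarrow> 'm metric \<Rightarrow>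
   ('n \<Rightarrow> 'm) \<Rightarrow> 'n \<Rightarrow> 'm tvec set" where
  "normal_space B A g \<phi> p =
     {n \<in> tangent_space A (\<phi> p). \<forall>u\<in>tangent_space B p. g (\<phi> p) n (differential A \<phi> p u) = 0}"

text \<open>The ambient covariant derivative of a vector field \<open>V\<close> along \<open>\<phi>\<close>. Near \<open>p\<close>, write
  \<open>V = \<Sum>k. c k (E k \<circ> \<phi>)\<close> with functions \<open>c k\<close> and ambient vector fields \<open>E k\<close>, and apply the
  product rule; the result \<open>w\<close> does not depend on the choices. A single \<open>E\<close> with \<open>c = 1\<close>
  is an extension of \<open>V\<close> to the ambient manifold.\<close>

definition has_covariant_derivative_along ::
  "('n::topological_space, 'f::euclidean_space) chart set \<Rightarrow>
   ('m::topological_space, 'e::euclidean_space) chart set \<Rightarrow> 'm connection \<Rightarrow>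
   ('n \<Rightarrow> 'm) \<Rightarrow> 'n \<Rightarrow> 'n tvec \<Rightarrow> ('n \<Rightarrow> 'm tvec) \<Rightarrow> 'm tvec \<Rightarrow> bool" where
  "has_covariant_derivative_along B A nab \<phi> p u V w \<longleftrightarrow>
     (\<exists>W W' (K::nat set) c E.
        p \<in> W \<and> open W \<and> \<phi> ` W \<subseteq> W' \<and> finite K \<and>
        (\<forall>k\<in>K. smooth_fun_on B W (c k) \<and> vector_field_on A W' (E k)) \<and>
        (\<forall>q\<in>W. V q = (\<Sum>k\<in>K. c k q *\<^sub>R E k (\<phi> q))) \<and>
        w = (\<Sum>k\<in>K. (u \<cdot> c k) *\<^sub>R E k (\<phi> p) +
                      c k p *\<^sub>R nab (\<phi> p) (differential A \<phi> p u) (E k)))"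

text \<open>\<open>h\<close> is the second fundamental form of \<open>\<phi>\<close>: the Gauss formula holds with the Levi-Civita
  connection of the induced metric, and \<open>h\<close> is normal. Values of \<open>h\<close> on non-tangent
  arguments are irrelevant.\<close>

definition second_fundamental_form ::
  "('n::topological_space, 'f::euclidean_space) chart set \<Rightarrow>
   ('m::topological_space, 'e::euclidean_space) chart set \<Rightarrow> 'm metric \<Rightarrow> 'm connection \<Rightarrow>
   ('n \<Rightarrow> 'm) \<Rightarrow> ('n \<Rightarrow> 'n tvec \<Rightarrow> 'n tvec \<Rightarrow> 'm tvec) \<Rightarrow> bool" where
  "second_fundamental_form B A g nab \<phi> h \<longleftrightarrow>
     (\<exists>nabB. levi_civita B (pullback_metric A g \<phi>) nabB \<and>
        (\<forall>W p u Y. p \<in> W \<and> u \<in> tangent_space B p \<and> vector_field_on B W Y \<longrightarrow>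
           has_covariant_derivative_along B A nab \<phi> p u (\<lambda>q. differential A \<phi> q (Y q))
             (differential A \<phi> p (nabB p u Y) + h p u (Y p)))) \<and>
     (\<forall>p. \<forall>u\<in>tangent_space B p. \<forall>v\<in>tangent_space B p. h p u v \<in> normal_space B A g \<phi> p)"

definition totally_geodesic ::
  "('n::topological_space, 'f::euclidean_space) chart set \<Rightarrow>
   ('m::topological_space, 'e::euclidean_space) chart set \<Rightarrow> 'm metric \<Rightarrow> 'm connection \<Rightarrow>
   ('n \<Rightarrow> 'm) \<Rightarrow> bool" where
  "totally_geodesic B A g nab \<phi> \<longleftrightarrow> second_fundamental_form B A g nab \<phi> (\<lambda>p u v. 0)"

definition totally_umbilical ::
  "('n::topological_space, 'f::euclidean_space) chart set \<Rightarrow>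
   ('m::topological_space, 'e::euclidean_space) chart set \<Rightarrow> 'm metric \<Rightarrow> 'm connection \<Rightarrow>
   ('n \<Rightarrow> 'm) \<Rightarrow> bool" where
  "totally_umbilical B A g nab \<phi> \<longleftrightarrow>
     (\<exists>H. smooth_field_along B A \<phi> UNIV H \<and> (\<forall>p. H p \<in> normal_space B A g \<phi> p) \<and>
        second_fundamental_form B A g nab \<phi> (\<lambda>p u v. pullback_metric A g \<phi> p u v *\<^sub>R H p))"

text \<open>The squared length of \<open>h\<close>; \<open>gB\<close> is the metric of the submanifold. By bilinearity it
  does not depend on the orthonormal basis.\<close>

definition norm_sq_sff ::
  "('n::topological_space, 'f::euclidean_space) chart set \<Rightarrow> 'n metric \<Rightarrow> 'm metric \<Rightarrow>
   ('n \<Rightarrow> 'm) \<Rightarrow> ('n \<Rightarrow> 'n tvec \<Rightarrow> 'n tvec \<Rightarrow> 'm tvec) \<Rightarrow> 'n \<Rightarrow> real" where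
  "norm_sq_sff B gB g \<phi> h p =
     (let E = (SOME E. orthonormal_basis B gB p E)
      in \<Sum>u\<in>E. \<Sum>v\<in>E. g (\<phi> p) (h p u v) (h p u v))"

definition tangent_image ::
  "('n::topological_space, 'f::euclidean_space) chart set \<Rightarrow>
   ('m::topological_space, 'e::euclidean_space) chart set \<Rightarrow> ('n \<Rightarrow> 'm) \<Rightarrow> 'n \<Rightarrow> 'm tvec set" where
  "tangent_image B A \<phi> p = differential A \<phi> p ` tangent_space B p"

definition holomorphic_submanifold ::
  "('n::topological_space, 'f::euclidean_space) chart set \<Rightarrow>
   ('m::topological_space, 'e::euclidean_space) chart set \<Rightarrow>
   ('m \<Rightarrow> 'm tvec \<Rightarrow> 'm tvec) \<Rightarrow> ('n \<Rightarrow> 'm) \<Rightarrow> bool" where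
  "holomorphic_submanifold B A J \<phi> \<longleftrightarrow>
     (\<forall>p. J (\<phi> p) ` tangent_image B A \<phi> p = tangent_image B A \<phi> p)"

definition totally_real_submanifold ::
  "('n::topological_space, 'f::euclidean_space) chart set \<Rightarrow>
   ('m::topological_space, 'e::euclidean_space) chart set \<Rightarrow> 'm metric \<Rightarrow>
   ('m \<Rightarrow> 'm tvec \<Rightarrow> 'm tvec) \<Rightarrow> ('n \<Rightarrow> 'm) \<Rightarrow> bool" where
  "totally_real_submanifold B A g J \<phi> \<longleftrightarrow>
     (\<forall>p. J (\<phi> p) ` tangent_image B A \<phi> p \<subseteq> normal_space B A g \<phi> p)"

text \<open>The angle between a nonzero vector and a nonzero subspace is the least angle that the
  vector makes with a nonzero vector of the subspace.\<close>

definition angle_to_subspace :: "'m metric \<Rightarrow> 'm \<Rightarrow> 'm tvec \<Rightarrow> 'm tvec set \<Rightarrow> real" where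
  "angle_to_subspace g p w S =
     Inf {arccos (g p w s / (sqrt (g p w w) * sqrt (g p s s))) | s. s \<in> S \<and> s \<noteq> 0}"

definition slant_submanifold ::
  "('n::topological_space, 'f::euclidean_space) chart set \<Rightarrow>
   ('m::topological_space, 'e::euclidean_space) chart set \<Rightarrow> 'm metric \<Rightarrow>
   ('m \<Rightarrow> 'm tvec \<Rightarrow> 'm tvec) \<Rightarrow> ('n \<Rightarrow> 'm) \<Rightarrow> real \<Rightarrow> bool" where
  "slant_submanifold B A g J \<phi> \<theta> \<longleftrightarrow>
     (\<forall>p. \<forall>x\<in>tangent_image B A \<phi> p. x \<noteq> 0 \<longrightarrow>
        angle_to_subspace g (\<phi> p) (J (\<phi> p) x) (tangent_image B A \<phi> p) = \<theta>)"

definition proper_slant_submanifold ::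
  "('n::topological_space, 'f::euclidean_space) chart set \<Rightarrow>
   ('m::topological_space, 'e::euclidean_space) chart set \<Rightarrow> 'm metric \<Rightarrow>
   ('m \<Rightarrow> 'm tvec \<Rightarrow> 'm tvec) \<Rightarrow> ('n \<Rightarrow> 'm) \<Rightarrow> real \<Rightarrow> bool" where
  "proper_slant_submanifold B A g J \<phi> \<theta> \<longleftrightarrow>
     slant_submanifold B A g J \<phi> \<theta> \<and>
     \<not> holomorphic_submanifold B A J \<phi> \<and> \<not> totally_real_submanifold B A g J \<phi>"

section \<open>Bi-warped products\<close>

definition triple_atlas ::
  "('a, 'e0) chart set \<Rightarrow> ('b, 'e1) chart set \<Rightarrow> ('c, 'e2) chart set \<Rightarrow>
   ('a \<times> 'b \<times> 'c, 'e0 \<times> 'e1 \<times> 'e2) chart set" where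
  "triple_atlas A0 A1 A2 = prod_atlas A0 (prod_atlas A1 A2)"

definition proj0 :: "'a \<times> 'b \<times> 'c \<Rightarrow> 'a" where "proj0 p = fst p"
definition proj1 :: "'a \<times> 'b \<times> 'c \<Rightarrow> 'b" where "proj1 p = fst (snd p)"
definition proj2 :: "'a \<times> 'b \<times> 'c \<Rightarrow> 'c" where "proj2 p = snd (snd p)"

definition biwarped_metric ::
  "('a::topological_space, 'e0::euclidean_space) chart set \<Rightarrow> 'a metric \<Rightarrow>
   ('b::topological_space, 'e1::euclidean_space) chart set \<Rightarrow> 'b metric \<Rightarrow>
   ('c::topological_space, 'e2::euclidean_space) chart set \<Rightarrow> 'c metric \<Rightarrow>
   ('a \<Rightarrow> real) \<Rightarrow> ('a \<Rightarrow> real) \<Rightarrow> ('a \<times> 'b \<times> 'c) metric" where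
  "biwarped_metric A0 g0 A1 g1 A2 g2 f1 f2 p u v =
     pullback_metric A0 g0 proj0 p u v
     + (f1 (proj0 p))\<^sup>2 * pullback_metric A1 g1 proj1 p u v
     + (f2 (proj0 p))\<^sup>2 * pullback_metric A2 g2 proj2 p u v"

definition warping_function ::
  "('a::topological_space, 'e::euclidean_space) chart set \<Rightarrow> ('a \<Rightarrow> real) \<Rightarrow> bool" where
  "warping_function A f \<longleftrightarrow> smooth_fun_on A UNIV f \<and> (\<forall>a. f a > 0)"

definition slice0 :: "'b \<Rightarrow> 'c \<Rightarrow> 'a \<Rightarrow> 'a \<times> 'b \<times> 'c" where "slice0 b c = (\<lambda>a. (a, b, c))"
definition slice1 :: "'a \<Rightarrow> 'c \<Rightarrow> 'b \<Rightarrow> 'a \<times> 'b \<times> 'c" where "slice1 a c = (\<lambda>b. (a, b, c))"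
definition slice2 :: "'a \<Rightarrow> 'b \<Rightarrow> 'c \<Rightarrow> 'a \<times> 'b \<times> 'c" where "slice2 a b = (\<lambda>c. (a, b, c))"

text \<open>The distributions tangent to the leaves through a point of the product.\<close>

definition dist0 ::
  "('a::topological_space, 'e0::euclidean_space) chart set \<Rightarrow>
   ('b::topological_space, 'e1::euclidean_space) chart set \<Rightarrow>
   ('c::topological_space, 'e2::euclidean_space) chart set \<Rightarrow>
   'a \<times> 'b \<times> 'c \<Rightarrow> ('a \<times> 'b \<times> 'c) tvec set" where
  "dist0 A0 A1 A2 p =
     tangent_image A0 (triple_atlas A0 A1 A2) (slice0 (proj1 p) (proj2 p)) (proj0 p)"

definition dist1 ::
  "('a::topological_space, 'e0::euclidean_space) chart set \<Rightarrow>
   ('b::topological_space, 'e1::euclidean_space) chart set \<Rightarrow>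
   ('c::topological_space, 'e2::euclidean_space) chart set \<Rightarrow>
   'a \<times> 'b \<times> 'c \<Rightarrow> ('a \<times> 'b \<times> 'c) tvec set" where
  "dist1 A0 A1 A2 p =
     tangent_image A1 (triple_atlas A0 A1 A2) (slice1 (proj0 p) (proj2 p)) (proj1 p)"

definition dist2 ::
  "('a::topological_space, 'e0::euclidean_space) chart set \<Rightarrow>
   ('b::topological_space, 'e1::euclidean_space) chart set \<Rightarrow>
   ('c::topological_space, 'e2::euclidean_space) chart set \<Rightarrow>
   'a \<times> 'b \<times> 'c \<Rightarrow> ('a \<times> 'b \<times> 'c) tvec set" where
  "dist2 A0 A1 A2 p =
     tangent_image A2 (triple_atlas A0 A1 A2) (slice2 (proj0 p) (proj1 p)) (proj2 p)"

text \<open>The images of a distribution \<open>D\<close> on the submanifold under \<open>J\<close> and under \<open>F\<close>, where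
  \<open>F x\<close> is the normal part of \<open>J x\<close>.\<close>

definition J_image ::
  "('m::topological_space, 'e::euclidean_space) chart set \<Rightarrow>
   ('m \<Rightarrow> 'm tvec \<Rightarrow> 'm tvec) \<Rightarrow> ('n \<Rightarrow> 'm) \<Rightarrow> ('n \<Rightarrow> 'n tvec set) \<Rightarrow> 'n \<Rightarrow> 'm tvec set" where
  "J_image A J \<phi> D p = {J (\<phi> p) (differential A \<phi> p x) | x. x \<in> D p}"

definition F_image ::
  "('n::topological_space, 'f::euclidean_space) chart set \<Rightarrow>
   ('m::topological_space, 'e::euclidean_space) chart set \<Rightarrow> 'm metric \<Rightarrow>
   ('m \<Rightarrow> 'm tvec \<Rightarrow> 'm tvec) \<Rightarrow> ('n \<Rightarrow> 'm) \<Rightarrow> ('n \<Rightarrow> 'n tvec set) \<Rightarrow> 'n \<Rightarrow> 'm tvec set" where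
  "F_image B A g J \<phi> D p =
     {n \<in> normal_space B A g \<phi> p.
        \<exists>x\<in>D p. \<exists>t\<in>tangent_image B A \<phi> p. J (\<phi> p) (differential A \<phi> p x) = t + n}"

definition orthogonal_sets :: "'m metric \<Rightarrow> 'm \<Rightarrow> 'm tvec set \<Rightarrow> 'm tvec set \<Rightarrow> bool" where
  "orthogonal_sets g p S T \<longleftrightarrow> (\<forall>x\<in>S. \<forall>y\<in>T. g p x y = 0)"

definition normal_bundle_splits ::
  "('n::topological_space, 'f::euclidean_space) chart set \<Rightarrow>
   ('m::topological_space, 'e::euclidean_space) chart set \<Rightarrow> 'm metric \<Rightarrow>
   ('m \<Rightarrow> 'm tvec \<Rightarrow> 'm tvec) \<Rightarrow> ('n \<Rightarrow> 'm) \<Rightarrow>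
   ('n \<Rightarrow> 'n tvec set) \<Rightarrow> ('n \<Rightarrow> 'n tvec set) \<Rightarrow> ('n \<Rightarrow> 'm tvec set) \<Rightarrow> bool" where
  "normal_bundle_splits B A g J \<phi> D1 D2 \<mu> \<longleftrightarrow>
     subbundle_along B A \<phi> \<mu> \<and> (\<forall>p. J (\<phi> p) ` \<mu> p \<subseteq> \<mu> p) \<and>
     (\<forall>p. orthogonal_sets g (\<phi> p) (J_image A J \<phi> D1 p) (F_image B A g J \<phi> D2 p) \<and>
          orthogonal_sets g (\<phi> p) (J_image A J \<phi> D1 p) (\<mu> p) \<and>
          orthogonal_sets g (\<phi> p) (F_image B A g J \<phi> D2 p) (\<mu> p) \<and>
          normal_space B A g \<phi> p =
            {x + y + z | x y z. x \<in> J_image A J \<phi> D1 p \<and> y \<in> F_image B A g J \<phi> D2 p \<and> z \<in> \<mu> p})"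

definition mixed_totally_geodesic ::
  "('n \<Rightarrow> 'n tvec \<Rightarrow> 'n tvec \<Rightarrow> 'm tvec) \<Rightarrow>
   ('n \<Rightarrow> 'n tvec set) \<Rightarrow> ('n \<Rightarrow> 'n tvec set) \<Rightarrow> bool" where
  "mixed_totally_geodesic h D D' \<longleftrightarrow> (\<forall>p. \<forall>x\<in>D p. \<forall>z\<in>D' p. h p x z = 0)"

end

theory Submission
  imports Defs
begin

text \<open>For \<open>X\<close> tangent to \<open>M\<^sub>T\<close> and lifts \<open>U\<close>, \<open>V\<close> of vector fields on one fibre with warping function
  \<open>f\<close>, put \<open>\<omega>(U, V) = g(J U, V)\<close> and \<open>a(U, V) = g(h(X, U), J V)\<close>. Metric compatibility expresses
  \<open>g((\<nabla>\<^sub>X J) U, V)\<close> and \<open>g((\<nabla>\<^sub>U J) X, V)\<close> by \<open>a\<close>, \<open>\<omega>\<close> and \<open>ln f\<close>; since they cancel,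
  \<open>a(U, V) = - (J X ln f) g(U, V) + (X ln f) \<omega>(U, V) - X(\<omega>(U, V)) / 3\<close>.
  On the totally real fibre \<open>\<omega>\<close> vanishes. On the slant fibre \<open>\<omega>\<close> may rotate along \<open>M\<^sub>T\<close>, but its norm is
  prescribed by the slant angle, and this determines the component of the matrix \<open>a\<close> along \<open>\<omega>\<close>;
  Bessel's inequality, applied to \<open>h(X, U)\<close> and the vectors \<open>J V\<close> or \<open>F V\<close>, then gives the bound.
  In the equality case \<open>h\<close> vanishes on each of the three distributions, so the leaves inherit their second
  fundamental forms from the warped product, and the diagonal \<open>U = V\<close> of the identity shows that a
  mixed totally geodesic \<open>M\<close> has a constant warping function.\<close>

section \<open>Smooth functions on open sets\<close>

text \<open>The 1/3 comes from two linear equations for \<open>a(U, V)\<close> and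
  \<open>a(V, U)\<close>: interchanging \<open>U\<close> and \<open>V\<close> reverses the sign of
  \<omega>. The obstacle is \<open>X(\<omega>(U, V))\<close>, whose single entries nothing
  prescribes. On lifts of fixed fields the squared norm of \<omega> is a constant times the fourth
  power of \<open>f\<close> along the base, so the matrix of these derivatives pairs with \<omega>
  to 2 (X ln f) times that squared norm. Hence the coefficient of (X ln f) \<omega> - X(\<omega>)/3
  along \<omega> is (1 - 2/3) X ln f. With c = cos^2 \<theta> it adds c/9 times (X ln f)^2 to the
  term (J X ln f)^2 for each frame vector. The vectors \<open>F V\<close> have squared length 1 - c,
  and \<open>X\<close>, \<open>J X\<close> run through orthonormal bases together; so each fibre
  carries the factor (1 + c/9)/(1 - c) = 1 + (10/9) c/(1 - c), which is 1 + (10/9) cot^2 \<theta>,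
  and is 1 for c = 0. Fields tangent to an immersed manifold are represented by sums of ambient
  fields with coefficients. Metric compatibility, torsion and the condition on \<open>J\<close> are
  therefore proved first for arbitrary such representations.\<close>

lemma has_derivative_cong_open:
  assumes "open S" "x \<in> S" "\<And>y. y \<in> S \<Longrightarrow> f y = g y"
  shows "(f has_derivative D) (at x) \<longleftrightarrow> (g has_derivative D) (at x)"
proof
  assume "(f has_derivative D) (at x)"
  then show "(g has_derivative D) (at x)"
    by (rule has_derivative_transform_within_open[OF _ assms(1,2)]) (rule assms(3))
next
  assume "(g has_derivative D) (at x)"
  then show "(f has_derivative D) (at x)"
    by (rule has_derivative_transform_within_open[OF _ assms(1,2)]) (simp add: assms(3))
qed

lemma frechet_derivative_cong_open:
  assumes "open S" "x \<in> S" "\<And>y. y \<in> S \<Longrightarrow> f y = g y"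
  shows "frechet_derivative f (at x) = frechet_derivative g (at x)"
  unfolding frechet_derivative_def using has_derivative_cong_open[OF assms] by simp

lemma differentiable_on_open_at:
  "open S \<Longrightarrow> f differentiable_on S \<Longrightarrow> x \<in> S \<Longrightarrow> f differentiable (at x)"
  by (simp add: differentiable_on_eq_differentiable_at)

lemma Ck_on_Suc_has_derivative:
  assumes "open S" "Ck_on (Suc k) f S" "x \<in> S"
  shows "(f has_derivative frechet_derivative f (at x)) (at x)"
proof -
  have "f differentiable (at x)"
    using assms(2) by (intro differentiable_on_open_at[OF assms(1) _ assms(3)]) simp
  then show ?thesis unfolding frechet_derivative_works .
qed

lemma Ck_on_cong:
  assumes "open S" "\<And>y. y \<in> S \<Longrightarrow> f y = g y"
  shows "Ck_on k f S \<longleftrightarrow> Ck_on k g S"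
  using assms(2)
proof (induction k arbitrary: f g)
  case 0
  then show ?case by (simp cong: continuous_on_cong)
next
  case (Suc k)
  have "f differentiable_on S \<longleftrightarrow> g differentiable_on S"
    unfolding differentiable_on_eq_differentiable_at[OF assms(1)] differentiable_def
    by (rule ball_cong[OF refl], subst has_derivative_cong_open[OF assms(1) _ Suc.prems]) auto
  moreover have "Ck_on k (\<lambda>x. frechet_derivative f (at x) v) S
      \<longleftrightarrow> Ck_on k (\<lambda>x. frechet_derivative g (at x) v) S" for v
    by (rule Suc.IH) (use frechet_derivative_cong_open[OF assms(1) _ Suc.prems] in simp)
  ultimately show ?case by simp
qed

lemma Ck_on_subset:
  "Ck_on k f S \<Longrightarrow> T \<subseteq> S \<Longrightarrow> Ck_on k f T"
  by (induction k arbitrary: f) (auto intro: continuous_on_subset differentiable_on_subset)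

text \<open>\<open>frechet_derivative\<close> at a point does not refer to \<open>S\<close>, so the
  induction can pass from neighbourhoods of the points to all of \<open>S\<close>.\<close>

lemma Ck_on_local:
  assumes "\<And>x. x \<in> S \<Longrightarrow> \<exists>T. open T \<and> x \<in> T \<and> Ck_on k f T"
  shows "Ck_on k f S"
  using assms
proof (induction k arbitrary: f)
  case 0
  show ?case
    unfolding Ck_on.simps continuous_on_eq_continuous_within
  proof
    fix x assume "x \<in> S"
    then obtain T where "open T" "x \<in> T" "continuous_on T f" using 0 by auto
    then show "continuous (at x within S) f"
      using continuous_at_imp_continuous_at_within continuous_on_eq_continuous_at by blast
  qed
next
  case (Suc k)
  have "f differentiable_on S"
    unfolding differentiable_on_def
  proof
    fix x assume "x \<in> S"
    then obtain T where "open T" "x \<in> T" "f differentiable_on T" using Suc.prems by (meson Ck_on.simps(2))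
    then show "f differentiable (at x within S)"
      using differentiable_on_open_at differentiable_at_withinI by blast
  qed
  moreover have "Ck_on k (\<lambda>x. frechet_derivative f (at x) v) S" for v
  proof (rule Suc.IH)
    fix x assume "x \<in> S"
    then obtain T where "open T" "x \<in> T" "Ck_on (Suc k) f T" using Suc.prems by blast
    then show "\<exists>T. open T \<and> x \<in> T \<and> Ck_on k (\<lambda>x. frechet_derivative f (at x) v) T"
      by (intro exI[of _ T]) simp
  qed
  ultimately show ?case by simp
qed

lemma Ck_on_Suc_imp: "Ck_on (Suc k) f S \<Longrightarrow> Ck_on k f S"
proof (induction k arbitrary: f)
  case 0
  then show ?case by (simp add: differentiable_imp_continuous_on)
next
  case (Suc k)
  have "Ck_on k (\<lambda>x. frechet_derivative f (at x) v) S" for v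
    by (rule Suc.IH) (use Suc.prems in simp)
  then show ?case using Suc.prems by simp
qed

lemma Ck_on_const: "open S \<Longrightarrow> Ck_on k (\<lambda>x. c) S"
  by (induction k arbitrary: c) auto

lemma Ck_on_bounded_linear_compose:
  assumes "open S" "bounded_linear L" "Ck_on k f S"
  shows "Ck_on k (\<lambda>x. L (f x)) S"
  using assms(3)
proof (induction k arbitrary: f)
  case 0
  then show ?case using assms(2)
    by (auto intro: bounded_linear.continuous_on)
next
  case (Suc k)
  have fd: "\<And>x. x \<in> S \<Longrightarrow> (f has_derivative frechet_derivative f (at x)) (at x)"
    using Ck_on_Suc_has_derivative[OF assms(1)] Suc.prems by blast+
  have Ld: "((\<lambda>x. L (f x)) has_derivative (\<lambda>v. L (frechet_derivative f (at x) v))) (at x)"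
    if "x \<in> S" for x
    using bounded_linear.has_derivative[OF assms(2) fd[OF that]] by simp
  have "Ck_on k (\<lambda>x. frechet_derivative (\<lambda>x. L (f x)) (at x) v) S" for v
  proof -
    have "Ck_on k (\<lambda>x. L (frechet_derivative f (at x) v)) S"
      using Suc by simp
    then show ?thesis
      by (subst Ck_on_cong[OF assms(1)]) (auto simp flip: frechet_derivative_at[OF Ld])
  qed
  then show ?case using Ld
    by (auto simp: differentiable_on_eq_differentiable_at[OF assms(1)] differentiable_def)
qed

lemma Ck_on_bounded_linear:
  fixes L :: "'e::euclidean_space \<Rightarrow> 'f::real_normed_vector"
  assumes "open S" "bounded_linear L"
  shows "Ck_on k L S"
proof (cases k)
  case 0
  then show ?thesis using assms by (auto intro: linear_continuous_on)
next
  case (Suc j)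
  have "(L has_derivative L) (at x)" for x
    using assms(2) by (simp add: bounded_linear_imp_has_derivative)
  then have "frechet_derivative L (at x) = L" for x
    by (rule frechet_derivative_at[symmetric])
  moreover have "L differentiable_on S"
    using assms(2) bounded_linear_imp_differentiable_on by blast
  ultimately show ?thesis using Suc by (simp add: Ck_on_const assms(1))
qed

lemma Ck_on_add:
  assumes "open S" "Ck_on k f S" "Ck_on k g S"
  shows "Ck_on k (\<lambda>x. f x + g x) S"
  using assms(2,3)
proof (induction k arbitrary: f g)
  case 0
  then show ?case by (auto intro: continuous_intros)
next
  case (Suc k)
  have fd: "\<And>x. x \<in> S \<Longrightarrow> (f has_derivative frechet_derivative f (at x)) (at x)"
   and gd: "\<And>x. x \<in> S \<Longrightarrow> (g has_derivative frechet_derivative g (at x)) (at x)"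
    using Ck_on_Suc_has_derivative[OF assms(1)] Suc.prems by blast+
  have D: "((\<lambda>x. f x + g x) has_derivative
      (\<lambda>v. frechet_derivative f (at x) v + frechet_derivative g (at x) v)) (at x)"
    if "x \<in> S" for x
    using has_derivative_add[OF fd[OF that] gd[OF that]] by simp
  have "Ck_on k (\<lambda>x. frechet_derivative (\<lambda>x. f x + g x) (at x) v) S" for v
  proof -
    have "Ck_on k (\<lambda>x. frechet_derivative f (at x) v + frechet_derivative g (at x) v) S"
      using Suc by simp
    then show ?thesis
      by (subst Ck_on_cong[OF assms(1)]) (auto simp flip: frechet_derivative_at[OF D])
  qed
  then show ?case using D
    by (auto simp: differentiable_on_eq_differentiable_at[OF assms(1)] differentiable_def)
qed

lemma Ck_on_scaleR:
  fixes f :: "'e::euclidean_space \<Rightarrow> real"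
  assumes "open S" "Ck_on k f S" "Ck_on k g S"
  shows "Ck_on k (\<lambda>x. f x *\<^sub>R g x) S"
  using assms(2,3)
proof (induction k arbitrary: f g)
  case 0
  then show ?case by (auto intro: continuous_intros)
next
  case (Suc k)
  have fd: "\<And>x. x \<in> S \<Longrightarrow> (f has_derivative frechet_derivative f (at x)) (at x)"
   and gd: "\<And>x. x \<in> S \<Longrightarrow> (g has_derivative frechet_derivative g (at x)) (at x)"
    using Ck_on_Suc_has_derivative[OF assms(1)] Suc.prems by blast+
  have D: "((\<lambda>x. f x *\<^sub>R g x) has_derivative
      (\<lambda>v. f x *\<^sub>R frechet_derivative g (at x) v + frechet_derivative f (at x) v *\<^sub>R g x)) (at x)"
    if "x \<in> S" for x
    using has_derivative_scaleR[OF fd[OF that] gd[OF that]] by simp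
  have "Ck_on k (\<lambda>x. frechet_derivative (\<lambda>x. f x *\<^sub>R g x) (at x) v) S" for v
  proof -
    have "Ck_on k (\<lambda>x. f x *\<^sub>R frechet_derivative g (at x) v
        + frechet_derivative f (at x) v *\<^sub>R g x) S"
      using Suc.prems Ck_on_Suc_imp[OF Suc.prems(1)] Ck_on_Suc_imp[OF Suc.prems(2)]
      by (auto intro!: Ck_on_add[OF assms(1)] Suc.IH)
    then show ?thesis
      by (subst Ck_on_cong[OF assms(1)]) (auto simp flip: frechet_derivative_at[OF D])
  qed
  then show ?case using D
    by (auto simp: differentiable_on_eq_differentiable_at[OF assms(1)] differentiable_def)
qed

lemma Ck_on_sum:
  assumes "open S" "\<And>i. i \<in> I \<Longrightarrow> Ck_on k (f i) S"
  shows "Ck_on k (\<lambda>x. \<Sum>i\<in>I. f i x) S"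
  using assms(2)
  by (induction I rule: infinite_finite_induct) (auto intro: Ck_on_const Ck_on_add assms(1))

text \<open>Induction over \<open>g\<close> with \<open>f\<close> fixed: expanding the inner
  derivative in the basis turns the chain rule into a sum of products, in which the derivatives of
  \<open>g\<close> in basis directions are again composed with \<open>f\<close> and have one order
  less.\<close>

lemma Ck_on_compose:
  fixes f :: "'e::euclidean_space \<Rightarrow> 'f::euclidean_space" and g :: "'f \<Rightarrow> 'g::real_normed_vector"
  assumes "open S" "open T" "f ` S \<subseteq> T" "Ck_on k f S" "Ck_on k g T"
  shows "Ck_on k (\<lambda>x. g (f x)) S"
  using assms(4,5)
proof (induction k arbitrary: g)
  case 0
  then show ?case using assms(3)
    using continuous_on_compose2 by auto
next
  case (Suc k)
  have fd: "\<And>x. x \<in> S \<Longrightarrow> (f has_derivative frechet_derivative f (at x)) (at x)"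
   and gd: "\<And>y. y \<in> T \<Longrightarrow> (g has_derivative frechet_derivative g (at y)) (at y)"
    using Ck_on_Suc_has_derivative[OF assms(1)] Ck_on_Suc_has_derivative[OF assms(2)] Suc.prems
    by blast+
  have D: "((\<lambda>x. g (f x)) has_derivative
      (\<lambda>v. frechet_derivative g (at (f x)) (frechet_derivative f (at x) v))) (at x)"
    if "x \<in> S" for x
    using has_derivative_compose[OF fd[OF that] gd] assms(3) that by auto
  have "Ck_on k (\<lambda>x. frechet_derivative (\<lambda>x. g (f x)) (at x) v) S" for v
  proof -
    have "Ck_on k (\<lambda>x. \<Sum>b\<in>Basis. (frechet_derivative f (at x) v \<bullet> b) *\<^sub>R
        frechet_derivative g (at (f x)) b) S"
    proof (intro Ck_on_sum Ck_on_scaleR assms(1))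
      fix b :: 'f
      show "Ck_on k (\<lambda>x. frechet_derivative f (at x) v \<bullet> b) S"
        using Suc.prems(1)
        by (intro Ck_on_bounded_linear_compose[OF assms(1) bounded_linear_inner_left]) simp
      show "Ck_on k (\<lambda>x. frechet_derivative g (at (f x)) b) S"
        using Suc.prems by (intro Suc.IH Ck_on_Suc_imp[OF Suc.prems(1)]) simp
    qed
    moreover have "frechet_derivative (\<lambda>x. g (f x)) (at x) v
        = (\<Sum>b\<in>Basis. (frechet_derivative f (at x) v \<bullet> b) *\<^sub>R frechet_derivative g (at (f x)) b)"
      if "x \<in> S" for x
    proof -
      have L: "linear (frechet_derivative g (at (f x)))"
        using gd assms(3) that has_derivative_linear by blast
      have "frechet_derivative (\<lambda>x. g (f x)) (at x) v
          = frechet_derivative g (at (f x)) (frechet_derivative f (at x) v)"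
        by (simp flip: frechet_derivative_at[OF D[OF that]])
      also have "\<dots> = frechet_derivative g (at (f x))
          (\<Sum>b\<in>Basis. (frechet_derivative f (at x) v \<bullet> b) *\<^sub>R b)"
        by (simp add: euclidean_representation)
      finally show ?thesis by (simp add: linear_sum[OF L] linear_scale[OF L])
    qed
    ultimately show ?thesis
      by (subst Ck_on_cong[OF assms(1)]) auto
  qed
  then show ?case using D
    by (auto simp: differentiable_on_eq_differentiable_at[OF assms(1)] differentiable_def)
qed

lemma Ck_on_euclidean:
  fixes f :: "'e::euclidean_space \<Rightarrow> 'f::euclidean_space"
  assumes "open S" "\<And>b. b \<in> Basis \<Longrightarrow> Ck_on k (\<lambda>x. f x \<bullet> b) S"
  shows "Ck_on k f S"
proof -
  have "Ck_on k (\<lambda>x. \<Sum>b\<in>Basis. (f x \<bullet> b) *\<^sub>R b) S"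
    using assms by (intro Ck_on_sum Ck_on_scaleR Ck_on_const)
  then show ?thesis by (simp add: euclidean_representation)
qed

text \<open>The derivative is \<open>- v\<close> times the square of \<open>inverse\<close>, so the
  induction closes with the product rule alone.\<close>

lemma Ck_on_inverse: "Ck_on k (inverse :: real \<Rightarrow> real) (- {0})"
proof (induction k)
  case 0
  show ?case by (auto intro!: continuous_intros)
next
  case (Suc k)
  have o: "open (- {0::real})" by (simp add: open_Compl)
  have D: "((inverse :: real \<Rightarrow> real) has_derivative (\<lambda>v. (- v) *\<^sub>R (inverse x *\<^sub>R inverse x))) (at x)"
    if "x \<in> - {0}" for x :: real
    using that by (auto intro!: derivative_eq_intros simp: power2_eq_square)
  have "Ck_on k (\<lambda>x. frechet_derivative inverse (at x) v) (- {0::real})" for v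
  proof -
    have "Ck_on k (\<lambda>x::real. (- v) *\<^sub>R (inverse x *\<^sub>R inverse x)) (- {0})"
      using o by (intro Ck_on_scaleR Ck_on_const Suc)
    then show ?thesis
      by (subst Ck_on_cong[OF o]) (auto simp flip: frechet_derivative_at[OF D])
  qed
  then show ?case using D
    by (auto simp: differentiable_on_eq_differentiable_at[OF o] differentiable_def)
qed

lemma Ck_on_ln: "Ck_on k (ln :: real \<Rightarrow> real) {0<..}"
proof (cases k)
  case 0
  then show ?thesis by (auto intro!: continuous_intros)
next
  case (Suc j)
  have o: "open {(0::real)<..}" by simp
  have D: "((ln :: real \<Rightarrow> real) has_derivative (\<lambda>v. v *\<^sub>R inverse x)) (at x)" if "x \<in> {0<..}" for x :: real
    using that by (auto intro!: derivative_eq_intros simp: field_simps)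
  have "Ck_on j (\<lambda>x. frechet_derivative ln (at x) v) {(0::real)<..}" for v
  proof -
    have "Ck_on j (\<lambda>x::real. v *\<^sub>R inverse x) {0<..}"
      using o by (intro Ck_on_scaleR Ck_on_const Ck_on_subset[OF Ck_on_inverse]) auto
    then show ?thesis
      by (subst Ck_on_cong[OF o]) (auto simp flip: frechet_derivative_at[OF D])
  qed
  then show ?thesis using D Suc
    by (auto simp: differentiable_on_eq_differentiable_at[OF o] differentiable_def)
qed

lemma smooth_on_cong:
  "open S \<Longrightarrow> (\<And>y. y \<in> S \<Longrightarrow> f y = g y) \<Longrightarrow> smooth_on f S \<longleftrightarrow> smooth_on g S"
  unfolding smooth_on_def using Ck_on_cong by blast

lemma smooth_on_transfer:
  "open S \<Longrightarrow> smooth_on f S \<Longrightarrow> (\<And>y. y \<in> S \<Longrightarrow> f y = g y) \<Longrightarrow> smooth_on g S"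
  using smooth_on_cong by blast

lemma smooth_on_subset: "smooth_on f S \<Longrightarrow> T \<subseteq> S \<Longrightarrow> smooth_on f T"
  unfolding smooth_on_def using Ck_on_subset by blast

lemma smooth_on_local:
  assumes "\<And>x. x \<in> S \<Longrightarrow> \<exists>T. open T \<and> x \<in> T \<and> smooth_on f T"
  shows "smooth_on f S"
  unfolding smooth_on_def
proof (intro allI, rule Ck_on_local)
  fix k x assume "x \<in> S"
  then obtain T where "open T" "x \<in> T" "smooth_on f T" using assms by blast
  then show "\<exists>T. open T \<and> x \<in> T \<and> Ck_on k f T"
    unfolding smooth_on_def by blast
qed

lemma smooth_on_compose:
  fixes f :: "'e::euclidean_space \<Rightarrow> 'f::euclidean_space" and g :: "'f \<Rightarrow> 'g::real_normed_vector"
  assumes "open S" "open T" "f ` S \<subseteq> T" "smooth_on f S" "smooth_on g T"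
  shows "smooth_on (\<lambda>x. g (f x)) S"
  using assms Ck_on_compose[of S T f _ g] unfolding smooth_on_def by blast

lemma smooth_on_const: "open S \<Longrightarrow> smooth_on (\<lambda>x. c) S"
  unfolding smooth_on_def by (simp add: Ck_on_const)

lemma smooth_on_add:
  "open S \<Longrightarrow> smooth_on f S \<Longrightarrow> smooth_on g S \<Longrightarrow> smooth_on (\<lambda>x. f x + g x) S"
  unfolding smooth_on_def by (simp add: Ck_on_add)

lemma smooth_on_mult:
  fixes f g :: "'e::euclidean_space \<Rightarrow> real"
  shows "open S \<Longrightarrow> smooth_on f S \<Longrightarrow> smooth_on g S \<Longrightarrow> smooth_on (\<lambda>x. f x * g x) S"
  unfolding smooth_on_def using Ck_on_scaleR[of S _ f g] by simp

lemma smooth_on_bounded_linear: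
  fixes L :: "'e::euclidean_space \<Rightarrow> 'f::real_normed_vector"
  shows "open S \<Longrightarrow> bounded_linear L \<Longrightarrow> smooth_on L S"
  unfolding smooth_on_def by (simp add: Ck_on_bounded_linear)

lemma smooth_on_bounded_linear_compose:
  "open S \<Longrightarrow> bounded_linear L \<Longrightarrow> smooth_on f S \<Longrightarrow> smooth_on (\<lambda>x. L (f x)) S"
  unfolding smooth_on_def by (simp add: Ck_on_bounded_linear_compose)

lemma smooth_on_euclidean:
  fixes f :: "'e::euclidean_space \<Rightarrow> 'f::euclidean_space"
  assumes "open S" "\<And>b. b \<in> Basis \<Longrightarrow> smooth_on (\<lambda>x. f x \<bullet> b) S"
  shows "smooth_on f S"
  using assms unfolding smooth_on_def by (simp add: Ck_on_euclidean)

lemma smooth_on_Pair: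
  fixes f :: "'e::euclidean_space \<Rightarrow> 'f::euclidean_space"
    and g :: "'e::euclidean_space \<Rightarrow> 'g::euclidean_space"
  assumes "open S" "smooth_on f S" "smooth_on g S"
  shows "smooth_on (\<lambda>x. (f x, g x)) S"
proof (rule smooth_on_euclidean[OF assms(1)])
  fix b :: "'f \<times> 'g" assume "b \<in> Basis"
  have "smooth_on (\<lambda>x. f x \<bullet> fst b) S" "smooth_on (\<lambda>x. g x \<bullet> snd b) S"
    using assms smooth_on_bounded_linear_compose[OF assms(1) bounded_linear_inner_left] by blast+
  then show "smooth_on (\<lambda>x. (f x, g x) \<bullet> b) S"
    unfolding inner_prod_def using smooth_on_add[OF assms(1)] by simp
qed

lemma smooth_on_frechet_derivative:
  "smooth_on f S \<Longrightarrow> smooth_on (\<lambda>x. frechet_derivative f (at x) v) S"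
  unfolding smooth_on_def by (metis Ck_on.simps(2))

lemma smooth_on_has_derivative:
  assumes "open S" "smooth_on f S" "x \<in> S"
  shows "(f has_derivative frechet_derivative f (at x)) (at x)"
proof -
  have "Ck_on (Suc 0) f S" using assms(2) unfolding smooth_on_def by blast
  then show ?thesis by (rule Ck_on_Suc_has_derivative[OF assms(1) _ assms(3)])
qed

lemma smooth_on_inverse: "smooth_on (inverse :: real \<Rightarrow> real) (- {0})"
  unfolding smooth_on_def using Ck_on_inverse by blast

lemma smooth_on_ln: "smooth_on (ln :: real \<Rightarrow> real) {0<..}"
  unfolding smooth_on_def using Ck_on_ln by blast

section \<open>Smooth functions on manifolds\<close>

lemma chart_open: "smooth_manifold A \<Longrightarrow> (U, \<kappa>) \<in> A \<Longrightarrow> open U"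
  and chart_image_open: "smooth_manifold A \<Longrightarrow> (U, \<kappa>) \<in> A \<Longrightarrow> open (\<kappa> ` U)"
  and chart_homeomorphism:
    "smooth_manifold A \<Longrightarrow> (U, \<kappa>) \<in> A \<Longrightarrow> homeomorphism U (\<kappa> ` U) \<kappa> (inv_into U \<kappa>)"
  unfolding smooth_manifold_def by auto

lemma chart_transition:
  "smooth_manifold A \<Longrightarrow> (U, \<kappa>) \<in> A \<Longrightarrow> (V, \<kappa>') \<in> A \<Longrightarrow>
    smooth_on (\<kappa>' \<circ> inv_into U \<kappa>) (\<kappa> ` (U \<inter> V))"
  unfolding smooth_manifold_def by blast

lemma chart_inv: "smooth_manifold A \<Longrightarrow> (U, \<kappa>) \<in> A \<Longrightarrow> p \<in> U \<Longrightarrow> inv_into U \<kappa> (\<kappa> p) = p"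
  using chart_homeomorphism[of A U \<kappa>] by (simp add: homeomorphism_def)

lemma chart_exists:
  assumes "smooth_manifold A"
  obtains U \<kappa> where "(U, \<kappa>) \<in> A" "p \<in> U"
proof -
  have "p \<in> (\<Union>(U, \<kappa>)\<in>A. U)" using assms unfolding smooth_manifold_def by auto
  then show ?thesis using that by auto
qed

lemma chart_image_Int_open:
  assumes "smooth_manifold A" "(U, \<kappa>) \<in> A" "open W"
  shows "open (\<kappa> ` (U \<inter> W))"
proof -
  have "openin (top_of_set (\<kappa> ` U)) (\<kappa> ` (U \<inter> W))"
    using homeomorphism_imp_open_map[OF chart_homeomorphism[OF assms(1,2)]] assms(3)
    by (simp add: openin_open_Int)
  then show ?thesis
    using chart_image_open[OF assms(1,2)] openin_open_trans by blast
qed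

lemma smooth_fun_on_open: "smooth_fun_on A W f \<Longrightarrow> open W"
  unfolding smooth_fun_on_def by blast

lemma smooth_fun_on_chart:
  "smooth_fun_on A W f \<Longrightarrow> (U, \<kappa>) \<in> A \<Longrightarrow> smooth_on (f \<circ> inv_into U \<kappa>) (\<kappa> ` (U \<inter> W))"
  unfolding smooth_fun_on_def by blast

text \<open>Smoothness is required in every chart, but one chart around each point is enough, since
  any other is reached through a smooth transition map.\<close>

lemma smooth_fun_onI:
  assumes A: "smooth_manifold A" and W: "open W"
    and loc: "\<And>p. p \<in> W \<Longrightarrow> \<exists>U \<kappa> W'. (U, \<kappa>) \<in> A \<and> p \<in> U \<and> p \<in> W' \<and> open W' \<and>
        smooth_on (f \<circ> inv_into U \<kappa>) (\<kappa> ` (U \<inter> W'))"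
  shows "smooth_fun_on A W f"
  unfolding smooth_fun_on_def
proof (intro conjI W, clarify)
  fix V \<kappa>' assume V: "(V, \<kappa>') \<in> A"
  show "smooth_on (f \<circ> inv_into V \<kappa>') (\<kappa>' ` (V \<inter> W))"
  proof (rule smooth_on_local)
    fix x assume "x \<in> \<kappa>' ` (V \<inter> W)"
    then obtain p where p: "p \<in> V" "p \<in> W" "x = \<kappa>' p" by auto
    obtain U \<kappa> W' where U: "(U, \<kappa>) \<in> A" "p \<in> U" "p \<in> W'" "open W'"
      "smooth_on (f \<circ> inv_into U \<kappa>) (\<kappa> ` (U \<inter> W'))"
      using loc[OF p(2)] by blast
    define T where "T = \<kappa>' ` (V \<inter> (U \<inter> W'))"
    have T: "open T"
      unfolding T_def using chart_image_Int_open[OF A V] chart_open[OF A U(1)] U(4) by auto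
    have inv: "inv_into V \<kappa>' y \<in> U \<inter> W'" if "y \<in> T" for y
      using that chart_inv[OF A V] unfolding T_def by auto
    have sm: "smooth_on (\<kappa> \<circ> inv_into V \<kappa>') T"
      using chart_transition[OF A V U(1)] by (rule smooth_on_subset) (auto simp: T_def)
    have "smooth_on (\<lambda>x. (f \<circ> inv_into U \<kappa>) ((\<kappa> \<circ> inv_into V \<kappa>') x)) T"
      by (rule smooth_on_compose[OF T _ _ sm U(5)])
        (use chart_image_Int_open[OF A U(1,4)] inv in auto)
    moreover have "(f \<circ> inv_into U \<kappa>) ((\<kappa> \<circ> inv_into V \<kappa>') y) = (f \<circ> inv_into V \<kappa>') y"
      if "y \<in> T" for y
      using inv[OF that] chart_inv[OF A U(1)] by simp
    ultimately have "smooth_on (f \<circ> inv_into V \<kappa>') T"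
      by (rule smooth_on_transfer[OF T])
    then show "\<exists>T. open T \<and> x \<in> T \<and> smooth_on (f \<circ> inv_into V \<kappa>') T"
      using T p U unfolding T_def by blast
  qed
qed

lemma smooth_fun_on_subset:
  "smooth_fun_on A W f \<Longrightarrow> open W' \<Longrightarrow> W' \<subseteq> W \<Longrightarrow> smooth_fun_on A W' f"
  unfolding smooth_fun_on_def by (fast intro: smooth_on_subset)

lemma smooth_fun_on_local:
  assumes A: "smooth_manifold A" and W: "open W"
    and loc: "\<And>p. p \<in> W \<Longrightarrow> \<exists>W'. p \<in> W' \<and> smooth_fun_on A W' f"
  shows "smooth_fun_on A W f"
proof (rule smooth_fun_onI[OF A W])
  fix p assume "p \<in> W"
  then obtain W' where "p \<in> W'" "smooth_fun_on A W' f" using loc by blast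
  then show "\<exists>U \<kappa> W'. (U, \<kappa>) \<in> A \<and> p \<in> U \<and> p \<in> W' \<and> open W' \<and>
        smooth_on (f \<circ> inv_into U \<kappa>) (\<kappa> ` (U \<inter> W'))"
    using chart_exists[OF A, of p] smooth_fun_on_chart smooth_fun_on_open by metis
qed

lemma smooth_fun_on_cong:
  assumes A: "smooth_manifold A" and "smooth_fun_on A W f" "\<And>q. q \<in> W \<Longrightarrow> f q = g q"
  shows "smooth_fun_on A W g"
  unfolding smooth_fun_on_def
proof (intro conjI smooth_fun_on_open[OF assms(2)], clarify)
  fix U \<kappa> assume U: "(U, \<kappa>) \<in> A"
  have "open (\<kappa> ` (U \<inter> W))"
    using chart_image_Int_open[OF A U] smooth_fun_on_open[OF assms(2)] .
  moreover have "(f \<circ> inv_into U \<kappa>) y = (g \<circ> inv_into U \<kappa>) y" if "y \<in> \<kappa> ` (U \<inter> W)" for y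
    using that chart_inv[OF A U] assms(3) by auto
  ultimately show "smooth_on (g \<circ> inv_into U \<kappa>) (\<kappa> ` (U \<inter> W))"
    using smooth_on_transfer[OF _ smooth_fun_on_chart[OF assms(2) U]] by blast
qed

lemma smooth_fun_on_const: "smooth_manifold A \<Longrightarrow> open W \<Longrightarrow> smooth_fun_on A W (\<lambda>q. c)"
  unfolding smooth_fun_on_def comp_def by (auto intro: smooth_on_const chart_image_Int_open)

lemma smooth_fun_on_add:
  assumes "smooth_manifold A" "smooth_fun_on A W f" "smooth_fun_on A W g"
  shows "smooth_fun_on A W (\<lambda>q. f q + g q)"
  using assms chart_image_Int_open[OF assms(1)] unfolding smooth_fun_on_def comp_def
  by (fast intro: smooth_on_add)

lemma smooth_fun_on_mult:
  assumes "smooth_manifold A" "smooth_fun_on A W f" "smooth_fun_on A W g"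
  shows "smooth_fun_on A W (\<lambda>q. f q * g q)"
  using assms chart_image_Int_open[OF assms(1)] unfolding smooth_fun_on_def comp_def
  by (fast intro: smooth_on_mult)

lemma smooth_fun_on_sum:
  assumes "smooth_manifold A" "open W" "\<And>i. i \<in> I \<Longrightarrow> smooth_fun_on A W (f i)"
  shows "smooth_fun_on A W (\<lambda>q. \<Sum>i\<in>I. f i q)"
  using assms(3)
  by (induction I rule: infinite_finite_induct)
    (auto intro: smooth_fun_on_const smooth_fun_on_add assms(1,2))

lemma smooth_fun_on_compose_real:
  assumes A: "smooth_manifold A" and f: "smooth_fun_on A W f"
    and h: "smooth_on (h :: real \<Rightarrow> real) T" "open T" "f ` W \<subseteq> T"
  shows "smooth_fun_on A W (\<lambda>q. h (f q))"
  unfolding smooth_fun_on_def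
proof (intro conjI smooth_fun_on_open[OF f], clarify)
  fix U \<kappa> assume U: "(U, \<kappa>) \<in> A"
  have "(f \<circ> inv_into U \<kappa>) ` (\<kappa> ` (U \<inter> W)) \<subseteq> T"
    using h(3) chart_inv[OF A U] by auto
  from smooth_on_compose[OF _ h(2) this smooth_fun_on_chart[OF f U] h(1)]
  show "smooth_on ((\<lambda>q. h (f q)) \<circ> inv_into U \<kappa>) (\<kappa> ` (U \<inter> W))"
    using chart_image_Int_open[OF A U smooth_fun_on_open[OF f]] by (simp add: comp_def)
qed

lemma smooth_atI: "smooth_fun_on A W f \<Longrightarrow> p \<in> W \<Longrightarrow> smooth_at A p f"
  unfolding smooth_at_def by blast

lemma smooth_at_transfer:
  assumes A: "smooth_manifold A" and W: "open W" "p \<in> W"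
    and eq: "\<And>q. q \<in> W \<Longrightarrow> f q = g q" and f: "smooth_at A p f"
  shows "smooth_at A p g"
proof -
  obtain W' where W': "p \<in> W'" "smooth_fun_on A W' f"
    using f unfolding smooth_at_def by (elim exE conjE)
  have "smooth_fun_on A (W \<inter> W') f"
    by (rule smooth_fun_on_subset[OF W'(2) open_Int[OF W(1) smooth_fun_on_open[OF W'(2)]]]) simp
  then have "smooth_fun_on A (W \<inter> W') g"
    by (rule smooth_fun_on_cong[OF A]) (rule eq, simp)
  then show ?thesis by (rule smooth_atI) (simp add: W W')
qed

lemma smooth_at_cong:
  assumes A: "smooth_manifold A" and W: "open W" "p \<in> W"
    and eq: "\<And>q. q \<in> W \<Longrightarrow> f q = g q"
  shows "smooth_at A p f \<longleftrightarrow> smooth_at A p g"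
  using smooth_at_transfer[OF A W eq] smooth_at_transfer[OF A W eq[symmetric]] by (rule iffI)

lemma smooth_at_common:
  assumes "smooth_at A p f" "smooth_at A p g"
  obtains W where "p \<in> W" "smooth_fun_on A W f" "smooth_fun_on A W g"
proof -
  obtain W W' where W: "p \<in> W" "smooth_fun_on A W f" "p \<in> W'" "smooth_fun_on A W' g"
    using assms unfolding smooth_at_def by blast
  then have "smooth_fun_on A (W \<inter> W') f" "smooth_fun_on A (W \<inter> W') g"
    using smooth_fun_on_subset[of A W f "W \<inter> W'"] smooth_fun_on_subset[of A W' g "W \<inter> W'"]
      smooth_fun_on_open[of A W f] smooth_fun_on_open[of A W' g] by auto
  then show ?thesis using that W by blast
qed

lemma smooth_at_const: "smooth_manifold A \<Longrightarrow> smooth_at A p (\<lambda>q. c)"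
  using smooth_fun_on_const[of A UNIV] smooth_atI by blast

lemma smooth_at_add:
  "smooth_manifold A \<Longrightarrow> smooth_at A p f \<Longrightarrow> smooth_at A p g \<Longrightarrow> smooth_at A p (\<lambda>q. f q + g q)"
  by (erule (1) smooth_at_common[of A p f g]) (blast intro: smooth_fun_on_add smooth_atI)

lemma smooth_at_mult:
  "smooth_manifold A \<Longrightarrow> smooth_at A p f \<Longrightarrow> smooth_at A p g \<Longrightarrow> smooth_at A p (\<lambda>q. f q * g q)"
  by (erule (1) smooth_at_common[of A p f g]) (blast intro: smooth_fun_on_mult smooth_atI)

lemma smooth_at_sum:
  "smooth_manifold A \<Longrightarrow> (\<And>i. i \<in> I \<Longrightarrow> smooth_at A p (f i)) \<Longrightarrow> smooth_at A p (\<lambda>q. \<Sum>i\<in>I. f i q)"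
  by (induction I rule: infinite_finite_induct) (auto intro: smooth_at_const smooth_at_add)

lemma smooth_at_has_derivative:
  assumes A: "smooth_manifold A" and "smooth_at A p f" "(U, \<kappa>) \<in> A" "p \<in> U"
  shows "((f \<circ> inv_into U \<kappa>) has_derivative frechet_derivative (f \<circ> inv_into U \<kappa>) (at (\<kappa> p)))
    (at (\<kappa> p))"
proof -
  obtain W where W: "p \<in> W" "smooth_fun_on A W f" using assms(2) unfolding smooth_at_def by blast
  show ?thesis
    by (rule smooth_on_has_derivative[OF _ smooth_fun_on_chart[OF W(2) assms(3)]])
      (use chart_image_Int_open[OF A assms(3) smooth_fun_on_open[OF W(2)]] W assms in auto)
qed

lemma smooth_fun_on_coordinate:
  assumes A: "smooth_manifold A" and U: "(U, \<kappa>) \<in> A"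
  shows "smooth_fun_on A U (\<lambda>q. \<kappa> q \<bullet> b)"
proof (rule smooth_fun_onI[OF A chart_open[OF A U]])
  fix p assume "p \<in> U"
  have o: "open (\<kappa> ` U)" using chart_image_open[OF A U] .
  have "smooth_on (\<lambda>x. x \<bullet> b) (\<kappa> ` U)"
    by (rule smooth_on_bounded_linear[OF o bounded_linear_inner_left])
  then have "smooth_on ((\<lambda>q. \<kappa> q \<bullet> b) \<circ> inv_into U \<kappa>) (\<kappa> ` U)"
    by (subst smooth_on_cong[OF o, of _ "\<lambda>x. x \<bullet> b"]) (auto simp: chart_inv[OF A U])
  then show "\<exists>V \<kappa>' W'. (V, \<kappa>') \<in> A \<and> p \<in> V \<and> p \<in> W' \<and> open W' \<and>
      smooth_on ((\<lambda>q. \<kappa> q \<bullet> b) \<circ> inv_into V \<kappa>') (\<kappa>' ` (V \<inter> W'))"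
    using U \<open>p \<in> U\<close> chart_open[OF A U] by (metis Int_absorb)
qed

section \<open>Tangent vectors\<close>

lemma act_zero [simp]: "0 \<cdot> f = 0"
  and act_add [simp]: "(u + v) \<cdot> f = u \<cdot> f + v \<cdot> f"
  and act_minus [simp]: "(- u) \<cdot> f = - (u \<cdot> f)"
  and act_diff [simp]: "(u - v) \<cdot> f = u \<cdot> f - v \<cdot> f"
  and act_scaleR [simp]: "(a *\<^sub>R u) \<cdot> f = a * (u \<cdot> f)"
  by (simp_all add: zero_tvec_def plus_tvec_def uminus_tvec_def minus_tvec_def scaleR_tvec_def
      Tvec_inverse)

lemma act_sum: "(\<Sum>i\<in>I. u i) \<cdot> f = (\<Sum>i\<in>I. u i \<cdot> f)"
  by (induction I rule: infinite_finite_induct) auto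

lemma tvec_eqI: "(\<And>f. u \<cdot> f = v \<cdot> f) \<Longrightarrow> u = v"
  using act_inject by blast

text \<open>The derivation with components \<xi> in the chart \<kappa>. As a function of \<xi> it is
  a linear isomorphism onto the tangent space, and this is how tangent vectors are computed in
  coordinates.\<close>

definition coord_vec ::
  "('m::topological_space, 'e::euclidean_space) chart set \<Rightarrow> 'm set \<Rightarrow> ('m \<Rightarrow> 'e) \<Rightarrow> 'm \<Rightarrow> 'e \<Rightarrow> 'm tvec"
where
  "coord_vec A U \<kappa> p \<xi> = Tvec (\<lambda>f.
     if smooth_at A p f then frechet_derivative (f \<circ> inv_into U \<kappa>) (at (\<kappa> p)) \<xi> else 0)"

lemma coord_vec_act: "coord_vec A U \<kappa> p \<xi> \<cdot> f =
    (if smooth_at A p f then frechet_derivative (f \<circ> inv_into U \<kappa>) (at (\<kappa> p)) \<xi> else 0)"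
  by (simp add: coord_vec_def Tvec_inverse)

lemma tangent_space_iff:
  "v \<in> tangent_space A p \<longleftrightarrow> (\<exists>(U, \<kappa>)\<in>A. p \<in> U \<and> (\<exists>\<xi>. v = coord_vec A U \<kappa> p \<xi>))"
proof -
  have "v = coord_vec A U \<kappa> p \<xi> \<longleftrightarrow> (\<forall>f. v \<cdot> f = (if smooth_at A p f
      then frechet_derivative (f \<circ> inv_into U \<kappa>) (at (\<kappa> p)) \<xi> else 0))" for U \<kappa> \<xi>
    by (metis coord_vec_act tvec_eqI)
  then show ?thesis unfolding tangent_space_def by simp
qed

lemma coord_vec_tangent: "(U, \<kappa>) \<in> A \<Longrightarrow> p \<in> U \<Longrightarrow> coord_vec A U \<kappa> p \<xi> \<in> tangent_space A p"
  unfolding tangent_space_iff by blast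

lemma linear_coord_vec:
  assumes A: "smooth_manifold A" and U: "(U, \<kappa>) \<in> A" "p \<in> U"
  shows "linear (coord_vec A U \<kappa> p)"
proof -
  have L: "linear (frechet_derivative (f \<circ> inv_into U \<kappa>) (at (\<kappa> p)))" if "smooth_at A p f" for f
    using smooth_at_has_derivative[OF A that U] has_derivative_linear by blast
  show ?thesis
    by (rule linearI; rule tvec_eqI) (auto simp: coord_vec_act linear_add[OF L] linear_scale[OF L])
qed

text \<open>Smoothness of a map as preservation of smooth functions. This form is closed under
  composition without mention of charts and fits differentials, which act through composition of
  functions.\<close>

definition smooth_pullback ::
  "('n::topological_space, 'f::euclidean_space) chart set \<Rightarrow>
   ('m::topological_space, 'e::euclidean_space) chart set \<Rightarrow> ('n \<Rightarrow> 'm) \<Rightarrow> bool" where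
  "smooth_pullback B A \<phi> \<longleftrightarrow>
     (\<forall>W f. smooth_fun_on A W f \<longrightarrow> smooth_fun_on B (\<phi> -` W) (\<lambda>q. f (\<phi> q)))"

lemma smooth_pullbackD:
  "smooth_pullback B A \<phi> \<Longrightarrow> smooth_fun_on A W f \<Longrightarrow> smooth_fun_on B (\<phi> -` W) (\<lambda>q. f (\<phi> q))"
  unfolding smooth_pullback_def by blast

lemma smooth_pullback_at:
  "smooth_pullback B A \<phi> \<Longrightarrow> smooth_at A (\<phi> p) f \<Longrightarrow> smooth_at B p (\<lambda>q. f (\<phi> q))"
  unfolding smooth_pullback_def smooth_at_def by blast

lemma smooth_pullback_id: "smooth_pullback A A (\<lambda>q. q)"
  unfolding smooth_pullback_def by simp

lemma smooth_pullback_comp: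
  "smooth_pullback B A \<phi> \<Longrightarrow> smooth_pullback C B \<psi> \<Longrightarrow> smooth_pullback C A (\<phi> \<circ> \<psi>)"
  unfolding smooth_pullback_def by (fastforce simp: vimage_comp[symmetric])

text \<open>Openness of the domain is part of \<open>smooth_fun_on\<close>, so pulling back a
  constant function already gives continuity.\<close>

lemma smooth_pullback_continuous:
  assumes "smooth_manifold A" "smooth_pullback B A \<phi>" "open W"
  shows "open (\<phi> -` W)"
  using smooth_pullbackD[OF assms(2) smooth_fun_on_const[OF assms(1,3)]] smooth_fun_on_open by blast

lemma smooth_map_imp_pullback:
  assumes A: "smooth_manifold A" and B: "smooth_manifold B" and \<phi>: "smooth_map B A \<phi>"
  shows "smooth_pullback B A \<phi>"
  unfolding smooth_pullback_def
proof (intro allI impI)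
  fix W f assume f: "smooth_fun_on A W f"
  have cont: "open (\<phi> -` X)" if "open X" for X
    using \<phi> that open_vimage unfolding smooth_map_def by blast
  show "smooth_fun_on B (\<phi> -` W) (\<lambda>q. f (\<phi> q))"
  proof (rule smooth_fun_onI[OF B cont[OF smooth_fun_on_open[OF f]]])
    fix p assume p: "p \<in> \<phi> -` W"
    obtain U \<kappa> where U: "(U, \<kappa>) \<in> B" "p \<in> U" by (rule chart_exists[OF B])
    obtain V \<kappa>' where V: "(V, \<kappa>') \<in> A" "\<phi> p \<in> V" by (rule chart_exists[OF A])
    define O' where "O' = \<phi> -` (V \<inter> W)"
    have O': "open O'" "p \<in> O'"
      unfolding O'_def using cont chart_open[OF A V(1)] smooth_fun_on_open[OF f] V p by auto
    have T: "open (\<kappa> ` (U \<inter> O'))" by (rule chart_image_Int_open[OF B U(1) O'(1)])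
    have s1: "smooth_on (\<kappa>' \<circ> \<phi> \<circ> inv_into U \<kappa>) (\<kappa> ` (U \<inter> O'))"
    proof (rule smooth_on_subset)
      show "smooth_on (\<kappa>' \<circ> \<phi> \<circ> inv_into U \<kappa>) (\<kappa> ` (U \<inter> \<phi> -` V))"
        using \<phi> U V unfolding smooth_map_def by blast
    qed (auto simp: O'_def)
    have "smooth_on (\<lambda>x. (f \<circ> inv_into V \<kappa>') ((\<kappa>' \<circ> \<phi> \<circ> inv_into U \<kappa>) x)) (\<kappa> ` (U \<inter> O'))"
      by (rule smooth_on_compose[OF T _ _ s1 smooth_fun_on_chart[OF f V(1)]])
        (use chart_image_Int_open[OF A V(1) smooth_fun_on_open[OF f]] chart_inv[OF B U(1)]
          in \<open>auto simp: O'_def\<close>)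
    moreover have "(f \<circ> inv_into V \<kappa>') ((\<kappa>' \<circ> \<phi> \<circ> inv_into U \<kappa>) y) = ((\<lambda>q. f (\<phi> q)) \<circ> inv_into U \<kappa>) y"
      if "y \<in> \<kappa> ` (U \<inter> O')" for y
      using that chart_inv[OF A V(1)] chart_inv[OF B U(1)] by (auto simp: O'_def)
    ultimately have "smooth_on ((\<lambda>q. f (\<phi> q)) \<circ> inv_into U \<kappa>) (\<kappa> ` (U \<inter> O'))"
      by (rule smooth_on_transfer[OF T])
    then show "\<exists>U \<kappa> W'. (U, \<kappa>) \<in> B \<and> p \<in> U \<and> p \<in> W' \<and> open W' \<and>
        smooth_on ((\<lambda>q. f (\<phi> q)) \<circ> inv_into U \<kappa>) (\<kappa> ` (U \<inter> W'))"
      using U O' by blast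
  qed
qed

text \<open>The components of the coordinate expression are pullbacks of coordinate functions, so
  differentiability in charts is recovered from the pullback of functions.\<close>

lemma pullback_chart_differentiable:
  assumes A: "smooth_manifold A" and B: "smooth_manifold B" and \<phi>: "smooth_pullback B A \<phi>"
    and U: "(U, \<kappa>) \<in> B" "p \<in> U" and V: "(V, \<kappa>') \<in> A" "\<phi> p \<in> V"
  shows "\<exists>D. ((\<kappa>' \<circ> \<phi> \<circ> inv_into U \<kappa>) has_derivative D) (at (\<kappa> p))"
proof -
  have o: "open (\<phi> -` V)" by (rule smooth_pullback_continuous[OF A \<phi> chart_open[OF A V(1)]])
  have T: "open (\<kappa> ` (U \<inter> \<phi> -` V))" by (rule chart_image_Int_open[OF B U(1) o])
  have "smooth_on (\<kappa>' \<circ> \<phi> \<circ> inv_into U \<kappa>) (\<kappa> ` (U \<inter> \<phi> -` V))"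
    by (rule smooth_on_euclidean[OF T])
      (use smooth_fun_on_chart[OF smooth_pullbackD[OF \<phi> smooth_fun_on_coordinate[OF A V(1)]] U(1)]
        in \<open>simp add: comp_def\<close>)
  from smooth_on_has_derivative[OF T this] show ?thesis using U V by blast
qed

lemma pullback_derivative:
  assumes A: "smooth_manifold A" and B: "smooth_manifold B" and \<phi>: "smooth_pullback B A \<phi>"
    and U: "(U, \<kappa>) \<in> B" "p \<in> U" and V: "(V, \<kappa>') \<in> A" "\<phi> p \<in> V"
    and D: "((\<kappa>' \<circ> \<phi> \<circ> inv_into U \<kappa>) has_derivative D) (at (\<kappa> p))"
    and f: "smooth_at A (\<phi> p) f"
  shows "coord_vec B U \<kappa> p \<xi> \<cdot> (\<lambda>q. f (\<phi> q)) = coord_vec A V \<kappa>' (\<phi> p) (D \<xi>) \<cdot> f"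
proof -
  have o: "open (\<phi> -` V)" by (rule smooth_pullback_continuous[OF A \<phi> chart_open[OF A V(1)]])
  have T: "open (\<kappa> ` (U \<inter> \<phi> -` V))" by (rule chart_image_Int_open[OF B U(1) o])
  let ?g = "\<lambda>x. (f \<circ> inv_into V \<kappa>') ((\<kappa>' \<circ> \<phi> \<circ> inv_into U \<kappa>) x)"
  have k: "(\<kappa>' \<circ> \<phi> \<circ> inv_into U \<kappa>) (\<kappa> p) = \<kappa>' (\<phi> p)" using chart_inv[OF B U] by simp
  have "(?g has_derivative
      (\<lambda>\<xi>. frechet_derivative (f \<circ> inv_into V \<kappa>') (at (\<kappa>' (\<phi> p))) (D \<xi>))) (at (\<kappa> p))"
    by (rule has_derivative_compose[OF D])
      (use smooth_at_has_derivative[OF A f V] in \<open>unfold k\<close>)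
  moreover have "frechet_derivative ((\<lambda>q. f (\<phi> q)) \<circ> inv_into U \<kappa>) (at (\<kappa> p)) = frechet_derivative ?g (at (\<kappa> p))"
    by (rule frechet_derivative_cong_open[OF T])
      (use U V chart_inv[OF A V(1)] chart_inv[OF B U(1)] in auto)
  ultimately have "frechet_derivative ((\<lambda>q. f (\<phi> q)) \<circ> inv_into U \<kappa>) (at (\<kappa> p)) \<xi>
      = frechet_derivative (f \<circ> inv_into V \<kappa>') (at (\<kappa>' (\<phi> p))) (D \<xi>)"
    using frechet_derivative_at by metis
  then show ?thesis using f smooth_pullback_at[OF \<phi> f] by (simp add: coord_vec_act)
qed

lemma differential_act: "differential A \<phi> p v \<cdot> f = (if smooth_at A (\<phi> p) f then v \<cdot> (\<lambda>q. f (\<phi> q)) else 0)"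
  by (simp add: differential_def Tvec_inverse comp_def)

text \<open>In charts the differential is the derivative of the coordinate expression; the
  differentials of projections and slices are computed through this.\<close>

lemma differential_coord_vec:
  assumes A: "smooth_manifold A" and B: "smooth_manifold B" and \<phi>: "smooth_pullback B A \<phi>"
    and U: "(U, \<kappa>) \<in> B" "p \<in> U" and V: "(V, \<kappa>') \<in> A" "\<phi> p \<in> V"
    and D: "((\<kappa>' \<circ> \<phi> \<circ> inv_into U \<kappa>) has_derivative D) (at (\<kappa> p))"
  shows "differential A \<phi> p (coord_vec B U \<kappa> p \<xi>) = coord_vec A V \<kappa>' (\<phi> p) (D \<xi>)"
  by (rule tvec_eqI)
    (use pullback_derivative[OF A B \<phi> U V D] in \<open>auto simp: differential_act coord_vec_act\<close>)

lemma differential_tangent: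
  assumes A: "smooth_manifold A" and B: "smooth_manifold B" and \<phi>: "smooth_pullback B A \<phi>"
    and v: "v \<in> tangent_space B p"
  shows "differential A \<phi> p v \<in> tangent_space A (\<phi> p)"
proof -
  obtain U \<kappa> \<xi> where U: "(U, \<kappa>) \<in> B" "p \<in> U" "v = coord_vec B U \<kappa> p \<xi>"
    using v unfolding tangent_space_iff by blast
  obtain V \<kappa>' where V: "(V, \<kappa>') \<in> A" "\<phi> p \<in> V" by (rule chart_exists[OF A])
  obtain D where "((\<kappa>' \<circ> \<phi> \<circ> inv_into U \<kappa>) has_derivative D) (at (\<kappa> p))"
    using pullback_chart_differentiable[OF A B \<phi> U(1,2) V] by blast
  from differential_coord_vec[OF A B \<phi> U(1,2) V this] show ?thesis
    using U(3) coord_vec_tangent[OF V] by simp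
qed

lemma linear_differential: "linear (differential A \<phi> p)"
  by (rule linearI; rule tvec_eqI) (auto simp: differential_act)

lemma differential_comp:
  assumes "smooth_pullback B A \<phi>"
  shows "differential A (\<phi> \<circ> \<psi>) p v = differential A \<phi> (\<psi> p) (differential B \<psi> p v)"
  by (rule tvec_eqI) (use smooth_pullback_at[OF assms] in \<open>auto simp: differential_act\<close>)

text \<open>Tangent vectors are defined by some chart around the point; the identity map, read in
  two charts, shows that one fixed chart produces all of them.\<close>

lemma tangent_space_eq_range:
  assumes A: "smooth_manifold A" and U: "(U, \<kappa>) \<in> A" "p \<in> U"
  shows "tangent_space A p = range (coord_vec A U \<kappa> p)"
proof
  show "range (coord_vec A U \<kappa> p) \<subseteq> tangent_space A p" using coord_vec_tangent[OF U] by auto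
  show "tangent_space A p \<subseteq> range (coord_vec A U \<kappa> p)"
  proof
    fix v assume "v \<in> tangent_space A p"
    then obtain V \<kappa>' \<xi> where V: "(V, \<kappa>') \<in> A" "p \<in> V" and v: "v = coord_vec A V \<kappa>' p \<xi>"
      unfolding tangent_space_iff by blast
    obtain D where D: "((\<kappa> \<circ> (\<lambda>q. q) \<circ> inv_into V \<kappa>') has_derivative D) (at (\<kappa>' p))"
      using pullback_chart_differentiable[OF A A smooth_pullback_id V U] by blast
    have "v = differential A (\<lambda>q. q) p v"
      by (rule tvec_eqI) (auto simp: differential_act v coord_vec_act)
    then show "v \<in> range (coord_vec A U \<kappa> p)"
      using differential_coord_vec[OF A A smooth_pullback_id V U D] v by auto
  qed
qed

lemma subspace_tangent_space: "smooth_manifold A \<Longrightarrow> subspace (tangent_space A p)"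
  by (metis chart_exists linear_coord_vec linear_subspace_image subspace_UNIV tangent_space_eq_range)

lemma coord_vec_coordinate:
  assumes A: "smooth_manifold A" and U: "(U, \<kappa>) \<in> A" "p \<in> U"
  shows "coord_vec A U \<kappa> p \<xi> \<cdot> (\<lambda>q. \<kappa> q \<bullet> b) = \<xi> \<bullet> b"
proof -
  have "frechet_derivative ((\<lambda>q. \<kappa> q \<bullet> b) \<circ> inv_into U \<kappa>) (at (\<kappa> p)) = frechet_derivative (\<lambda>x. x \<bullet> b) (at (\<kappa> p))"
    by (rule frechet_derivative_cong_open[OF chart_image_open[OF A U(1)]])
      (use U chart_inv[OF A U(1)] in auto)
  also have "\<dots> = (\<lambda>x. x \<bullet> b)"
    by (rule frechet_derivative_at[symmetric])
      (rule bounded_linear_imp_has_derivative[OF bounded_linear_inner_left])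
  finally show ?thesis
    using smooth_atI[OF smooth_fun_on_coordinate[OF A U(1)] U(2)] by (simp add: coord_vec_act)
qed

lemma inj_coord_vec:
  assumes A: "smooth_manifold A" and U: "(U, \<kappa>) \<in> A" "p \<in> U"
  shows "inj (coord_vec A U \<kappa> p)"
  by (rule injI) (metis coord_vec_coordinate[OF assms] euclidean_eqI)

lemma coord_vec_components:
  assumes A: "smooth_manifold A" and U: "(U, \<kappa>) \<in> A" "p \<in> U" and v: "v \<in> tangent_space A p"
  shows "v = coord_vec A U \<kappa> p (\<Sum>b\<in>Basis. (v \<cdot> (\<lambda>q. \<kappa> q \<bullet> b)) *\<^sub>R b)"
proof -
  obtain \<xi> where \<xi>: "v = coord_vec A U \<kappa> p \<xi>" using v tangent_space_eq_range[OF A U] by auto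
  have "(\<Sum>b\<in>Basis. (v \<cdot> (\<lambda>q. \<kappa> q \<bullet> b)) *\<^sub>R b) = \<xi>"
    unfolding \<xi> coord_vec_coordinate[OF A U] by (rule euclidean_representation)
  then show ?thesis using \<xi> by simp
qed

lemma dim_tangent_space:
  fixes A :: "('m::{t2_space,second_countable_topology}, 'e::euclidean_space) chart set"
  assumes A: "smooth_manifold A"
  shows "\<exists>S. finite S \<and> independent S \<and> card S = DIM('e) \<and> span S = tangent_space A p"
proof -
  obtain U \<kappa> where U: "(U, \<kappa>) \<in> A" "p \<in> U" by (rule chart_exists[OF A])
  have L: "linear (coord_vec A U \<kappa> p)" and I: "inj (coord_vec A U \<kappa> p)"
    using linear_coord_vec[OF A U] inj_coord_vec[OF A U] by auto
  let ?S = "coord_vec A U \<kappa> p ` (Basis :: 'e set)"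
  have "independent ?S"
    by (rule linear_independent_injective_image[OF L independent_Basis])
      (use I in \<open>simp add: inj_on_subset\<close>)
  moreover have "span ?S = tangent_space A p"
    using linear_span_image[OF L, of Basis] tangent_space_eq_range[OF A U] by simp
  moreover have "card ?S = DIM('e)"
    using I by (meson card_image inj_on_subset subset_UNIV)
  ultimately show ?thesis by (intro exI[of _ ?S]) auto
qed

lemma tangent_act_not_smooth: "v \<in> tangent_space A p \<Longrightarrow> \<not> smooth_at A p f \<Longrightarrow> v \<cdot> f = 0"
  unfolding tangent_space_iff by (auto simp: coord_vec_act)

text \<open>Derivations are local, also on functions that are not smooth at \<open>p\<close>:
  smoothness at \<open>p\<close> is itself local, so both functions fall under the same case of the
  convention.\<close>

lemma tangent_act_cong:
  assumes A: "smooth_manifold A" and v: "v \<in> tangent_space A p"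
    and W: "open W" "p \<in> W" "\<And>q. q \<in> W \<Longrightarrow> f q = g q"
  shows "v \<cdot> f = v \<cdot> g"
proof -
  obtain U \<kappa> \<xi> where U: "(U, \<kappa>) \<in> A" "p \<in> U" "v = coord_vec A U \<kappa> p \<xi>"
    using v unfolding tangent_space_iff by blast
  have "frechet_derivative (f \<circ> inv_into U \<kappa>) (at (\<kappa> p)) = frechet_derivative (g \<circ> inv_into U \<kappa>) (at (\<kappa> p))"
    by (rule frechet_derivative_cong_open[OF chart_image_Int_open[OF A U(1) W(1)]])
      (use U W chart_inv[OF A U(1)] in auto)
  then show ?thesis using smooth_at_cong[OF A W] by (simp add: U(3) coord_vec_act)
qed

lemma tangent_act_const:
  assumes A: "smooth_manifold A" and v: "v \<in> tangent_space A p"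
  shows "v \<cdot> (\<lambda>q. c) = 0"
  using v unfolding tangent_space_iff by (auto simp: coord_vec_act comp_def frechet_derivative_const)

lemma tangent_act_add:
  assumes A: "smooth_manifold A" and v: "v \<in> tangent_space A p"
    and f: "smooth_at A p f" and g: "smooth_at A p g"
  shows "v \<cdot> (\<lambda>q. f q + g q) = v \<cdot> f + v \<cdot> g"
proof -
  obtain U \<kappa> \<xi> where U: "(U, \<kappa>) \<in> A" "p \<in> U" "v = coord_vec A U \<kappa> p \<xi>"
    using v unfolding tangent_space_iff by blast
  have "frechet_derivative ((\<lambda>q. f q + g q) \<circ> inv_into U \<kappa>) (at (\<kappa> p)) =
    (\<lambda>\<xi>. frechet_derivative (f \<circ> inv_into U \<kappa>) (at (\<kappa> p)) \<xi> + frechet_derivative (g \<circ> inv_into U \<kappa>) (at (\<kappa> p)) \<xi>)"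
    using has_derivative_add[OF smooth_at_has_derivative[OF A f U(1,2)] smooth_at_has_derivative[OF A g U(1,2)]]
    by (intro frechet_derivative_at[symmetric]) (simp add: comp_def)
  then show ?thesis
    using f g smooth_at_add[OF A f g] by (simp add: U(3) coord_vec_act)
qed

lemma tangent_act_mult:
  assumes A: "smooth_manifold A" and v: "v \<in> tangent_space A p"
    and f: "smooth_at A p f" and g: "smooth_at A p g"
  shows "v \<cdot> (\<lambda>q. f q * g q) = (v \<cdot> f) * g p + f p * (v \<cdot> g)"
proof -
  obtain U \<kappa> \<xi> where U: "(U, \<kappa>) \<in> A" "p \<in> U" "v = coord_vec A U \<kappa> p \<xi>"
    using v unfolding tangent_space_iff by blast
  have "frechet_derivative ((\<lambda>q. f q * g q) \<circ> inv_into U \<kappa>) (at (\<kappa> p)) =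
    (\<lambda>\<xi>. f p * frechet_derivative (g \<circ> inv_into U \<kappa>) (at (\<kappa> p)) \<xi> + frechet_derivative (f \<circ> inv_into U \<kappa>) (at (\<kappa> p)) \<xi> * g p)"
    using has_derivative_mult[OF smooth_at_has_derivative[OF A f U(1,2)] smooth_at_has_derivative[OF A g U(1,2)]]
    by (intro frechet_derivative_at[symmetric]) (simp add: comp_def chart_inv[OF A U(1,2)])
  then show ?thesis
    using f g smooth_at_mult[OF A f g] by (simp add: U(3) coord_vec_act)
qed

lemma tangent_act_sum:
  assumes A: "smooth_manifold A" and v: "v \<in> tangent_space A p"
    and f: "\<And>i. i \<in> I \<Longrightarrow> smooth_at A p (f i)"
  shows "v \<cdot> (\<lambda>q. \<Sum>i\<in>I. f i q) = (\<Sum>i\<in>I. v \<cdot> f i)"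
  using f
  by (induction I rule: infinite_finite_induct)
    (auto simp: tangent_act_const[OF A v] tangent_act_add[OF A v] smooth_at_sum[OF A])

lemma tangent_act_compose_real:
  assumes A: "smooth_manifold A" and v: "v \<in> tangent_space A p"
    and f: "smooth_at A p f" and hf: "smooth_at A p (\<lambda>q. h (f q))"
    and h: "(h has_real_derivative d) (at (f p))"
  shows "v \<cdot> (\<lambda>q. h (f q)) = d * (v \<cdot> f)"
proof -
  obtain U \<kappa> \<xi> where U: "(U, \<kappa>) \<in> A" "p \<in> U" "v = coord_vec A U \<kappa> p \<xi>"
    using v unfolding tangent_space_iff by blast
  have "(h has_derivative (*) d) (at ((f \<circ> inv_into U \<kappa>) (\<kappa> p)))"
    using h chart_inv[OF A U(1,2)] by (simp add: has_field_derivative_def)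
  from has_derivative_compose[OF smooth_at_has_derivative[OF A f U(1,2)] this]
  have "frechet_derivative ((\<lambda>q. h (f q)) \<circ> inv_into U \<kappa>) (at (\<kappa> p)) =
    (\<lambda>\<xi>. d * frechet_derivative (f \<circ> inv_into U \<kappa>) (at (\<kappa> p)) \<xi>)"
    by (intro frechet_derivative_at[symmetric]) (simp add: comp_def)
  then show ?thesis
    using f hf by (simp add: U(3) coord_vec_act)
qed

lemma tangent_act_eq_0I:
  assumes A: "smooth_manifold A" and v: "v \<in> tangent_space A p"
    and W: "open W" "p \<in> W" "\<And>q. q \<in> W \<Longrightarrow> f q = c"
  shows "v \<cdot> f = 0"
  using tangent_act_cong[OF A v W] tangent_act_const[OF A v] by simp

text \<open>In a coordinate ball the derivative vanishes, so \<open>f\<close> is locally constant.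
  Preimages of arbitrary sets are then open, level sets are open and closed, and connectedness
  finishes.\<close>

lemma constant_if_tangent_act_0:
  assumes A: "smooth_manifold A" and f: "smooth_fun_on A UNIV f"
    and 0: "\<And>p v. v \<in> tangent_space A p \<Longrightarrow> v \<cdot> f = 0"
  shows "f constant_on UNIV"
proof -
  have loc: "\<exists>W. open W \<and> p \<in> W \<and> (\<forall>q\<in>W. f q = f p)" for p
  proof -
    obtain U \<kappa> where U: "(U, \<kappa>) \<in> A" "p \<in> U" by (rule chart_exists[OF A])
    obtain e where e: "e > 0" "ball (\<kappa> p) e \<subseteq> \<kappa> ` U"
      using chart_image_open[OF A U(1)] U(2) by (meson image_eqI open_contains_ball)
    have D: "((f \<circ> inv_into U \<kappa>) has_derivative (\<lambda>\<xi>. 0)) (at x)" if "x \<in> ball (\<kappa> p) e" for x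
    proof -
      have "x \<in> \<kappa> ` U" using that e(2) by (rule rev_subsetD)
      then obtain q where q: "q \<in> U" "x = \<kappa> q" by (rule imageE) simp
      have s: "smooth_at A q f" using smooth_atI[OF f] by simp
      have "frechet_derivative (f \<circ> inv_into U \<kappa>) (at (\<kappa> q)) \<xi> = 0" for \<xi>
        using 0[OF coord_vec_tangent[OF U(1) q(1)], of \<xi>] s by (simp add: coord_vec_act)
      then have "frechet_derivative (f \<circ> inv_into U \<kappa>) (at (\<kappa> q)) = (\<lambda>\<xi>. 0)" by blast
      then show ?thesis using smooth_at_has_derivative[OF A s U(1) q(1)] q by simp
    qed
    have "\<exists>c. \<forall>x\<in>ball (\<kappa> p) e. (f \<circ> inv_into U \<kappa>) x = c"
      by (rule has_derivative_zero_constant[OF convex_ball]) (use D has_derivative_at_withinI in blast)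
    then obtain c where c: "\<And>x. x \<in> ball (\<kappa> p) e \<Longrightarrow> f (inv_into U \<kappa> x) = c" by auto
    define W where "W = U \<inter> \<kappa> -` ball (\<kappa> p) e"
    have "open W" unfolding W_def
      using chart_homeomorphism[OF A U(1)] chart_open[OF A U(1)]
      by (intro continuous_open_preimage) (auto simp: homeomorphism_def)
    moreover have "f q = c" if "q \<in> W" for q
      using c[of "\<kappa> q"] that chart_inv[OF A U(1)] unfolding W_def by auto
    moreover have "p \<in> W" using U e unfolding W_def by simp
    ultimately show ?thesis by (intro exI[of _ W]) auto
  qed
  have op: "open (f -` S)" for S
  proof (subst open_subopen, intro ballI)
    fix p assume p: "p \<in> f -` S"
    obtain W where W: "open W" "p \<in> W" "\<forall>q\<in>W. f q = f p" using loc[of p] by (elim exE conjE)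
    have "W \<subseteq> f -` S" using bspec[OF W(3)] p by (metis subsetI vimageD vimageI2)
    with W(1,2) show "\<exists>T. open T \<and> p \<in> T \<and> T \<subseteq> f -` S" by blast
  qed
  have clopen: "open (f -` {c}) \<and> closed (f -` {c})" for c
    unfolding closed_def vimage_Compl[symmetric] using op[of "{c}"] op[of "- {c}"] by (rule conjI)
  have "connected (UNIV :: 'a set)" using A unfolding smooth_manifold_def by blast
  then have "f -` {c} = {} \<or> f -` {c} = UNIV" for c
    using clopen[of c] unfolding connected_clopen by simp
  from this[of "f undefined"] have "f -` {f undefined} = UNIV" by blast
  then have "f q = f undefined" for q by blast
  then show ?thesis unfolding constant_on_def by blast
qed

section \<open>Vector fields\<close>

lemma vector_field_open: "vector_field_on A W X \<Longrightarrow> open W"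
  and vector_field_tangent: "vector_field_on A W X \<Longrightarrow> q \<in> W \<Longrightarrow> X q \<in> tangent_space A q"
  and vector_field_act: "vector_field_on A W X \<Longrightarrow> smooth_fun_on A W' f \<Longrightarrow>
    smooth_fun_on A (W \<inter> W') (\<lambda>q. X q \<cdot> f)"
  unfolding vector_field_on_def smooth_field_along_def by fastforce+

lemma vector_field_onI:
  assumes "open W" "\<And>q. q \<in> W \<Longrightarrow> X q \<in> tangent_space A q"
    "\<And>W' f. smooth_fun_on A W' f \<Longrightarrow> smooth_fun_on A (W \<inter> W') (\<lambda>q. X q \<cdot> f)"
  shows "vector_field_on A W X"
  using assms unfolding vector_field_on_def smooth_field_along_def by simp

lemma vector_field_act_at:
  "vector_field_on A W X \<Longrightarrow> q \<in> W \<Longrightarrow> smooth_at A q f \<Longrightarrow> smooth_at A q (\<lambda>q. X q \<cdot> f)"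
  unfolding smooth_at_def using vector_field_act by (metis IntI)

lemma vector_field_subset:
  assumes "vector_field_on A W X" "open W'" "W' \<subseteq> W"
  shows "vector_field_on A W' X"
proof (rule vector_field_onI[OF assms(2)])
  fix W'' f assume f: "smooth_fun_on A W'' f"
  show "smooth_fun_on A (W' \<inter> W'') (\<lambda>q. X q \<cdot> f)"
    by (rule smooth_fun_on_subset[OF vector_field_act[OF assms(1) f]])
      (use assms smooth_fun_on_open[OF f] in auto)
qed (use assms vector_field_tangent in blast)

lemma vector_field_scale:
  assumes A: "smooth_manifold A" and f: "smooth_fun_on A W f" and Y: "vector_field_on A W Y"
  shows "vector_field_on A W (\<lambda>q. f q *\<^sub>R Y q)"
proof (rule vector_field_onI[OF vector_field_open[OF Y]])
  show "f q *\<^sub>R Y q \<in> tangent_space A q" if "q \<in> W" for q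
    using vector_field_tangent[OF Y that] subspace_tangent_space[OF A] subspace_scale by blast
  show "smooth_fun_on A (W \<inter> W') (\<lambda>q. (f q *\<^sub>R Y q) \<cdot> g)" if g: "smooth_fun_on A W' g" for W' g
    using smooth_fun_on_mult[OF A smooth_fun_on_subset[OF f] vector_field_act[OF Y g]]
      smooth_fun_on_open[OF f] smooth_fun_on_open[OF g] by (simp add: open_Int)
qed

lemma vector_field_coord_vec:
  assumes A: "smooth_manifold A" and U: "(U, \<kappa>) \<in> A"
  shows "vector_field_on A U (\<lambda>q. coord_vec A U \<kappa> q \<xi>)"
proof (rule vector_field_onI[OF chart_open[OF A U] coord_vec_tangent[OF U]])
  fix W' f assume f: "smooth_fun_on A W' f"
  let ?S = "\<kappa> ` (U \<inter> W')"
  have W': "open W'" by (rule smooth_fun_on_open[OF f])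
  have o: "open ?S" by (rule chart_image_Int_open[OF A U W'])
  have "smooth_on (\<lambda>x. frechet_derivative (f \<circ> inv_into U \<kappa>) (at x) \<xi>) ?S"
    by (rule smooth_on_frechet_derivative[OF smooth_fun_on_chart[OF f U]])
  moreover have "frechet_derivative (f \<circ> inv_into U \<kappa>) (at x) \<xi>
      = ((\<lambda>q. coord_vec A U \<kappa> q \<xi> \<cdot> f) \<circ> inv_into U \<kappa>) x" if "x \<in> ?S" for x
    using that smooth_atI[OF f] chart_inv[OF A U] by (auto simp: coord_vec_act)
  ultimately have s: "smooth_on ((\<lambda>q. coord_vec A U \<kappa> q \<xi> \<cdot> f) \<circ> inv_into U \<kappa>) ?S"
    by (rule smooth_on_transfer[OF o])
  show "smooth_fun_on A (U \<inter> W') (\<lambda>q. coord_vec A U \<kappa> q \<xi> \<cdot> f)"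
    by (rule smooth_fun_onI[OF A]) (use s W' U chart_open[OF A U] in \<open>blast intro: open_Int\<close>)+
qed

lemma tangent_vector_extends:
  assumes A: "smooth_manifold A" and v: "v \<in> tangent_space A p"
  obtains W X where "p \<in> W" "vector_field_on A W X" "X p = v"
proof -
  obtain U \<kappa> \<xi> where "(U, \<kappa>) \<in> A" "p \<in> U" "v = coord_vec A U \<kappa> p \<xi>"
    using v unfolding tangent_space_iff by blast
  then show ?thesis using that vector_field_coord_vec[OF A] by metis
qed

lemma lie_bracket_act:
  "lie_bracket A X Y p \<cdot> f =
     (if smooth_at A p f then X p \<cdot> (\<lambda>q. Y q \<cdot> f) - Y p \<cdot> (\<lambda>q. X q \<cdot> f) else 0)"
  by (simp add: lie_bracket_def Tvec_inverse)

text \<open>In the given charts the differentials of the slices have the constant matrix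
  \<open>L\<close>. The lift is therefore a combination of coordinate fields whose coefficients are
  the components of \<open>Y\<close> pulled back along \<pi>, and these are smooth.\<close>

lemma lift_vector_field:
  assumes A: "smooth_manifold A" and B: "smooth_manifold B" and \<pi>: "smooth_pullback A B \<pi>"
    and charts: "\<And>x. \<exists>U \<kappa> V \<kappa>' L. (U, \<kappa>) \<in> A \<and> x \<in> U \<and> (V, \<kappa>') \<in> B \<and> \<pi> ` U \<subseteq> V \<and> linear L \<and>
       (\<forall>y\<in>U. \<forall>\<eta>. differential A (s y) (\<pi> y) (coord_vec B V \<kappa>' (\<pi> y) \<eta>) = coord_vec A U \<kappa> y (L \<eta>))"
    and Y: "vector_field_on B W Y"
  shows "vector_field_on A (\<pi> -` W) (\<lambda>x. differential A (s x) (\<pi> x) (Y (\<pi> x)))"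
proof -
  have W: "open W" by (rule vector_field_open[OF Y])
  have o: "open (\<pi> -` W)" by (rule smooth_pullback_continuous[OF B \<pi> W])
  let ?Y = "\<lambda>x. differential A (s x) (\<pi> x) (Y (\<pi> x))"
  \<comment> \<open>An elimination rule for the coordinate formula of the lift; it serves both the
    tangency and the smoothness below.\<close>
  have *: thesis
    if "\<And>U \<kappa> V \<kappa>' L. (U, \<kappa>) \<in> A \<Longrightarrow> x \<in> U \<Longrightarrow> (V, \<kappa>') \<in> B \<Longrightarrow> \<pi> ` U \<subseteq> V \<Longrightarrow>
     (\<And>y. y \<in> U \<inter> \<pi> -` W \<Longrightarrow>
       ?Y y = (\<Sum>b\<in>Basis. (Y (\<pi> y) \<cdot> (\<lambda>q. \<kappa>' q \<bullet> b)) *\<^sub>R coord_vec A U \<kappa> y (L b))) \<Longrightarrow> thesis"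
    for x thesis
  proof -
    obtain U \<kappa> V \<kappa>' L where U: "(U, \<kappa>) \<in> A" "x \<in> U" and V: "(V, \<kappa>') \<in> B" "\<pi> ` U \<subseteq> V"
      and L: "linear L" "\<And>y \<eta>. y \<in> U \<Longrightarrow>
        differential A (s y) (\<pi> y) (coord_vec B V \<kappa>' (\<pi> y) \<eta>) = coord_vec A U \<kappa> y (L \<eta>)"
      using charts[of x] by blast
    have "?Y y = (\<Sum>b\<in>Basis. (Y (\<pi> y) \<cdot> (\<lambda>q. \<kappa>' q \<bullet> b)) *\<^sub>R coord_vec A U \<kappa> y (L b))"
      if "y \<in> U \<inter> \<pi> -` W" for y
    proof -
      have y: "y \<in> U" "\<pi> y \<in> W" using that by auto
      have "Y (\<pi> y) = coord_vec B V \<kappa>' (\<pi> y) (\<Sum>b\<in>Basis. (Y (\<pi> y) \<cdot> (\<lambda>q. \<kappa>' q \<bullet> b)) *\<^sub>R b)"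
        by (rule coord_vec_components[OF B V(1) _ vector_field_tangent[OF Y y(2)]]) (use V y in auto)
      then have "?Y y = coord_vec A U \<kappa> y (L (\<Sum>b\<in>Basis. (Y (\<pi> y) \<cdot> (\<lambda>q. \<kappa>' q \<bullet> b)) *\<^sub>R b))"
        using L(2)[OF y(1)] by metis
      then show ?thesis
        using linear_coord_vec[OF A U(1) y(1)] L(1) by (simp add: linear_sum linear_scale)
    qed
    from that[OF U V this] show thesis .
  qed
  show ?thesis
  proof (rule vector_field_onI[OF o])
    fix x assume x: "x \<in> \<pi> -` W"
    obtain U \<kappa> V \<kappa>' L where U: "(U, \<kappa>) \<in> A" "x \<in> U" and V: "(V, \<kappa>') \<in> B" "\<pi> ` U \<subseteq> V"
      and eq: "\<And>y. y\<in>U \<inter> \<pi> -` W \<Longrightarrow>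
        ?Y y = (\<Sum>b\<in>Basis. (Y (\<pi> y) \<cdot> (\<lambda>q. \<kappa>' q \<bullet> b)) *\<^sub>R coord_vec A U \<kappa> y (L b))"
      by (rule *[of x]; rule that)
    show "?Y x \<in> tangent_space A x"
      using eq[of x] U x coord_vec_tangent[OF U] subspace_tangent_space[OF A]
      by (auto intro!: subspace_sum subspace_scale)
  next
    fix W' f assume f: "smooth_fun_on A W' f"
    show "smooth_fun_on A (\<pi> -` W \<inter> W') (\<lambda>q. ?Y q \<cdot> f)"
    proof (rule smooth_fun_on_local[OF A])
      show "open (\<pi> -` W \<inter> W')" using o smooth_fun_on_open[OF f] by blast
      fix x assume x: "x \<in> \<pi> -` W \<inter> W'"
      obtain U \<kappa> V \<kappa>' L where U: "(U, \<kappa>) \<in> A" "x \<in> U" and V: "(V, \<kappa>') \<in> B" "\<pi> ` U \<subseteq> V"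
        and eq: "\<And>y. y\<in>U \<inter> \<pi> -` W \<Longrightarrow>
          ?Y y = (\<Sum>b\<in>Basis. (Y (\<pi> y) \<cdot> (\<lambda>q. \<kappa>' q \<bullet> b)) *\<^sub>R coord_vec A U \<kappa> y (L b))"
        by (rule *[of x]; rule that)
      let ?O = "U \<inter> \<pi> -` W \<inter> W'"
      have O: "open ?O" using o smooth_fun_on_open[OF f] chart_open[OF A U(1)] by blast
      have "smooth_fun_on A ?O (\<lambda>y. \<Sum>b\<in>Basis. (Y (\<pi> y) \<cdot> (\<lambda>q. \<kappa>' q \<bullet> b)) * (coord_vec A U \<kappa> y (L b) \<cdot> f))"
      proof (intro smooth_fun_on_sum[OF A O] smooth_fun_on_mult[OF A])
        fix b :: 'd
        show "smooth_fun_on A ?O (\<lambda>y. Y (\<pi> y) \<cdot> (\<lambda>q. \<kappa>' q \<bullet> b))"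
          by (rule smooth_fun_on_subset[OF smooth_pullbackD[OF \<pi> vector_field_act[OF Y smooth_fun_on_coordinate[OF B V(1)]]] O])
            (use V in auto)
        show "smooth_fun_on A ?O (\<lambda>y. coord_vec A U \<kappa> y (L b) \<cdot> f)"
          by (rule smooth_fun_on_subset[OF vector_field_act[OF vector_field_coord_vec[OF A U(1)] f] O])
            auto
      qed
      then have "smooth_fun_on A ?O (\<lambda>q. ?Y q \<cdot> f)"
        by (rule smooth_fun_on_cong[OF A]) (use eq in \<open>simp add: act_sum\<close>)
      with x U show "\<exists>W'. x \<in> W' \<and> smooth_fun_on A W' (\<lambda>q. ?Y q \<cdot> f)"
        by (intro exI[of _ ?O] conjI) simp_all
    qed
  qed
qed

section \<open>Products\<close>

lemma inv_into_map_prod: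
  assumes "inj_on \<kappa> U" "inj_on \<kappa>' V" "p \<in> U" "q \<in> V"
  shows "inv_into (U \<times> V) (map_prod \<kappa> \<kappa>') (\<kappa> p, \<kappa>' q) = (p, q)"
  using inv_into_f_f[of "map_prod \<kappa> \<kappa>'" "U \<times> V" "(p, q)"] assms
  by (simp add: map_prod_inj_on)

lemma chart_inj: "smooth_manifold A \<Longrightarrow> (U, \<kappa>) \<in> A \<Longrightarrow> inj_on \<kappa> U"
  using chart_inv by (metis inj_onI)

lemma prod_chart_inv:
  assumes "smooth_manifold A" "smooth_manifold B" "(U, \<kappa>) \<in> A" "(V, \<kappa>') \<in> B" "p \<in> U" "q \<in> V"
  shows "inv_into (U \<times> V) (map_prod \<kappa> \<kappa>') (\<kappa> p, \<kappa>' q) = (p, q)"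
  using inv_into_map_prod[OF chart_inj[OF assms(1,3)] chart_inj[OF assms(2,4)] assms(5,6)] .

lemma prod_chart: "(U, \<kappa>) \<in> A \<Longrightarrow> (V, \<kappa>') \<in> B \<Longrightarrow> (U \<times> V, map_prod \<kappa> \<kappa>') \<in> prod_atlas A B"
  unfolding prod_atlas_def by blast

lemma prod_chartE:
  assumes "(O', \<tau>) \<in> prod_atlas A B"
  obtains U \<kappa> V \<kappa>' where "(U, \<kappa>) \<in> A" "(V, \<kappa>') \<in> B" "O' = U \<times> V" "\<tau> = map_prod \<kappa> \<kappa>'"
  using assms unfolding prod_atlas_def by blast

lemma prod_chart_homeomorphism:
  assumes A: "smooth_manifold A" and B: "smooth_manifold B"
    and U: "(U, \<kappa>) \<in> A" and V: "(V, \<kappa>') \<in> B"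
  shows "homeomorphism (U \<times> V) (map_prod \<kappa> \<kappa>' ` (U \<times> V)) (map_prod \<kappa> \<kappa>')
    (inv_into (U \<times> V) (map_prod \<kappa> \<kappa>'))"
  unfolding homeomorphism_def
proof (intro conjI ballI)
  note inv = prod_chart_inv[OF A B U V]
  note hU = chart_homeomorphism[OF A U] and hV = chart_homeomorphism[OF B V]
  show "inv_into (U \<times> V) (map_prod \<kappa> \<kappa>') (map_prod \<kappa> \<kappa>' x) = x" if "x \<in> U \<times> V" for x
    using that inv by auto
  show "map_prod \<kappa> \<kappa>' (inv_into (U \<times> V) (map_prod \<kappa> \<kappa>') y) = y"
    if "y \<in> map_prod \<kappa> \<kappa>' ` (U \<times> V)" for y
    using that by (rule f_inv_into_f)
  show "inv_into (U \<times> V) (map_prod \<kappa> \<kappa>') ` map_prod \<kappa> \<kappa>' ` (U \<times> V) = U \<times> V"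
    using inv by (force simp: image_image)
  show "continuous_on (U \<times> V) (map_prod \<kappa> \<kappa>')"
    unfolding map_prod_def case_prod_beta
    using hU hV by (auto intro!: continuous_on_Pair continuous_on_compose2[OF _ continuous_on_fst[OF continuous_on_id]]
        continuous_on_compose2[OF _ continuous_on_snd[OF continuous_on_id]] simp: homeomorphism_def)
  have "continuous_on (\<kappa> ` U \<times> \<kappa>' ` V) (\<lambda>y. (inv_into U \<kappa> (fst y), inv_into V \<kappa>' (snd y)))"
    using hU hV by (auto intro!: continuous_on_Pair continuous_on_compose2[OF _ continuous_on_fst[OF continuous_on_id]]
        continuous_on_compose2[OF _ continuous_on_snd[OF continuous_on_id]] simp: homeomorphism_def)
  then have "continuous_on (\<kappa> ` U \<times> \<kappa>' ` V) (inv_into (U \<times> V) (map_prod \<kappa> \<kappa>'))"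
    by (rule continuous_on_eq) (use inv chart_inv[OF A U] chart_inv[OF B V] in auto)
  then show "continuous_on (map_prod \<kappa> \<kappa>' ` (U \<times> V)) (inv_into (U \<times> V) (map_prod \<kappa> \<kappa>'))"
    by (simp add: map_prod_surj_on)
qed auto

lemma smooth_manifold_prod:
  assumes A: "smooth_manifold A" and B: "smooth_manifold B"
  shows "smooth_manifold (prod_atlas A B)"
proof -
  have c1: "connected (UNIV :: ('a \<times> 'c) set)"
    using A B connected_Times[of "UNIV :: 'a set" "UNIV :: 'c set"] unfolding smooth_manifold_def by simp
  have c2: "p \<in> (\<Union>(U, \<kappa>)\<in>prod_atlas A B. U)" for p
  proof -
    obtain U \<kappa> where U: "(U, \<kappa>) \<in> A" "fst p \<in> U" by (rule chart_exists[OF A])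
    obtain V \<kappa>' where V: "(V, \<kappa>') \<in> B" "snd p \<in> V" by (rule chart_exists[OF B])
    show ?thesis
      by (rule UN_I[OF prod_chart[OF U(1) V(1)]]) (simp add: mem_Times_iff U V)
  qed
  have c3: "open O' \<and> open (\<tau> ` O') \<and> homeomorphism O' (\<tau> ` O') \<tau> (inv_into O' \<tau>)"
    if "(O', \<tau>) \<in> prod_atlas A B" for O' \<tau>
    using that
  proof (rule prod_chartE)
    fix U \<kappa> V \<kappa>' assume U: "(U, \<kappa>) \<in> A" and V: "(V, \<kappa>') \<in> B" and eq: "O' = U \<times> V" "\<tau> = map_prod \<kappa> \<kappa>'"
    show ?thesis
      using prod_chart_homeomorphism[OF A B U V] chart_open[OF A U] chart_open[OF B V]
        chart_image_open[OF A U] chart_image_open[OF B V]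
      by (simp add: eq open_Times map_prod_surj_on)
  qed
  have c4: "smooth_on (\<tau>' \<circ> inv_into O' \<tau>) (\<tau> ` (O' \<inter> O''))"
    if O': "(O', \<tau>) \<in> prod_atlas A B" and O'': "(O'', \<tau>') \<in> prod_atlas A B" for O' \<tau> O'' \<tau>'
  proof -
    obtain U \<kappa> V \<kappa>' where U: "(U, \<kappa>) \<in> A" and V: "(V, \<kappa>') \<in> B" and eq: "O' = U \<times> V" "\<tau> = map_prod \<kappa> \<kappa>'"
      using O' by (rule prod_chartE)
    obtain X \<alpha> Y \<beta> where X: "(X, \<alpha>) \<in> A" and Y: "(Y, \<beta>) \<in> B" and eq': "O'' = X \<times> Y" "\<tau>' = map_prod \<alpha> \<beta>"
      using O'' by (rule prod_chartE)
    let ?S = "\<kappa> ` (U \<inter> X)" and ?T = "\<kappa>' ` (V \<inter> Y)"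
    have S: "open ?S" "open ?T"
      using chart_image_Int_open[OF A U chart_open[OF A X]] chart_image_Int_open[OF B V chart_open[OF B Y]] .
    have o: "open (?S \<times> ?T)" using S by (rule open_Times)
    have "smooth_on (\<lambda>z. ((\<alpha> \<circ> inv_into U \<kappa>) (fst z), (\<beta> \<circ> inv_into V \<kappa>') (snd z))) (?S \<times> ?T)"
      by (rule smooth_on_Pair[OF o
            smooth_on_compose[OF o S(1) _ smooth_on_bounded_linear[OF o bounded_linear_fst] chart_transition[OF A U X]]
            smooth_on_compose[OF o S(2) _ smooth_on_bounded_linear[OF o bounded_linear_snd] chart_transition[OF B V Y]]])
        auto
    then have "smooth_on (\<tau>' \<circ> inv_into O' \<tau>) (?S \<times> ?T)"
      by (rule smooth_on_transfer[OF o])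
        (auto simp: eq eq' prod_chart_inv[OF A B U V] chart_inv[OF A U] chart_inv[OF B V])
    moreover have "\<tau> ` (O' \<inter> O'') = ?S \<times> ?T"
      by (auto simp: eq eq' map_prod_surj_on Times_Int_Times)
    ultimately show ?thesis by simp
  qed
  show ?thesis
    unfolding smooth_manifold_def
  proof (intro conjI)
    show "(\<Union>(U, \<kappa>)\<in>prod_atlas A B. U) = UNIV" using c2 by (intro equalityI subsetI UNIV_I)
    show "\<forall>(U, \<kappa>)\<in>prod_atlas A B. open U \<and> open (\<kappa> ` U) \<and> homeomorphism U (\<kappa> ` U) \<kappa> (inv_into U \<kappa>)"
      by (clarify, rule c3)
    show "\<forall>(U, \<kappa>)\<in>prod_atlas A B. \<forall>(V, \<kappa>')\<in>prod_atlas A B.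
        smooth_on (\<kappa>' \<circ> inv_into U \<kappa>) (\<kappa> ` (U \<inter> V))"
      by (clarify, rule c4)
  qed (rule c1)
qed

lemma smooth_pullback_fst:
  assumes A: "smooth_manifold A" and B: "smooth_manifold B"
  shows "smooth_pullback (prod_atlas A B) A fst"
proof (rule smooth_map_imp_pullback[OF A smooth_manifold_prod[OF A B]])
  have "smooth_on (\<alpha> \<circ> fst \<circ> inv_into O' \<tau>) (\<tau> ` (O' \<inter> fst -` X))"
    if O': "(O', \<tau>) \<in> prod_atlas A B" and X: "(X, \<alpha>) \<in> A" for O' \<tau> X \<alpha>
  proof -
    obtain U \<kappa> V \<kappa>' where U: "(U, \<kappa>) \<in> A" and V: "(V, \<kappa>') \<in> B" and eq: "O' = U \<times> V" "\<tau> = map_prod \<kappa> \<kappa>'"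
      using O' by (rule prod_chartE)
    let ?S = "\<kappa> ` (U \<inter> X)" and ?T = "\<kappa>' ` V"
    have S: "open ?S" "open ?T"
      using chart_image_Int_open[OF A U chart_open[OF A X]] chart_image_open[OF B V] .
    have o: "open (?S \<times> ?T)" using S by (rule open_Times)
    have "smooth_on (\<lambda>z. (\<alpha> \<circ> inv_into U \<kappa>) (fst z)) (?S \<times> ?T)"
      by (rule smooth_on_compose[OF o S(1) _ smooth_on_bounded_linear[OF o bounded_linear_fst]
          chart_transition[OF A U X]]) auto
    then have "smooth_on (\<alpha> \<circ> fst \<circ> inv_into O' \<tau>) (?S \<times> ?T)"
      by (rule smooth_on_transfer[OF o])
        (auto simp: eq prod_chart_inv[OF A B U V] chart_inv[OF A U])
    moreover have "\<tau> ` (O' \<inter> fst -` X) \<subseteq> ?S \<times> ?T" by (auto simp: eq)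
    ultimately show ?thesis by (rule smooth_on_subset)
  qed
  then show "smooth_map (prod_atlas A B) A fst"
    unfolding smooth_map_def by (auto intro: continuous_on_fst continuous_on_id)
qed

lemma smooth_pullback_snd:
  assumes A: "smooth_manifold A" and B: "smooth_manifold B"
  shows "smooth_pullback (prod_atlas A B) B snd"
proof (rule smooth_map_imp_pullback[OF B smooth_manifold_prod[OF A B]])
  have "smooth_on (\<alpha> \<circ> snd \<circ> inv_into O' \<tau>) (\<tau> ` (O' \<inter> snd -` X))"
    if O': "(O', \<tau>) \<in> prod_atlas A B" and X: "(X, \<alpha>) \<in> B" for O' \<tau> X \<alpha>
  proof -
    obtain U \<kappa> V \<kappa>' where U: "(U, \<kappa>) \<in> A" and V: "(V, \<kappa>') \<in> B" and eq: "O' = U \<times> V" "\<tau> = map_prod \<kappa> \<kappa>'"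
      using O' by (rule prod_chartE)
    let ?S = "\<kappa> ` U" and ?T = "\<kappa>' ` (V \<inter> X)"
    have S: "open ?S" "open ?T"
      using chart_image_open[OF A U] chart_image_Int_open[OF B V chart_open[OF B X]] .
    have o: "open (?S \<times> ?T)" using S by (rule open_Times)
    have "smooth_on (\<lambda>z. (\<alpha> \<circ> inv_into V \<kappa>') (snd z)) (?S \<times> ?T)"
      by (rule smooth_on_compose[OF o S(2) _ smooth_on_bounded_linear[OF o bounded_linear_snd]
          chart_transition[OF B V X]]) auto
    then have "smooth_on (\<alpha> \<circ> snd \<circ> inv_into O' \<tau>) (?S \<times> ?T)"
      by (rule smooth_on_transfer[OF o])
        (auto simp: eq prod_chart_inv[OF A B U V] chart_inv[OF B V])
    moreover have "\<tau> ` (O' \<inter> snd -` X) \<subseteq> ?S \<times> ?T" by (auto simp: eq)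
    ultimately show ?thesis by (rule smooth_on_subset)
  qed
  then show "smooth_map (prod_atlas A B) B snd"
    unfolding smooth_map_def by (auto intro: continuous_on_snd continuous_on_id)
qed

lemma smooth_pullback_slice_fst:
  assumes A: "smooth_manifold A" and B: "smooth_manifold B"
  shows "smooth_pullback A (prod_atlas A B) (\<lambda>a. (a, b))"
proof (rule smooth_map_imp_pullback[OF smooth_manifold_prod[OF A B] A])
  have "smooth_on (\<tau> \<circ> (\<lambda>a. (a, b)) \<circ> inv_into X \<alpha>) (\<alpha> ` (X \<inter> (\<lambda>a. (a, b)) -` O'))"
    if O': "(O', \<tau>) \<in> prod_atlas A B" and X: "(X, \<alpha>) \<in> A" for O' \<tau> X \<alpha>
  proof -
    obtain U \<kappa> V \<kappa>' where U: "(U, \<kappa>) \<in> A" and V: "(V, \<kappa>') \<in> B" and eq: "O' = U \<times> V" "\<tau> = map_prod \<kappa> \<kappa>'"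
      using O' by (rule prod_chartE)
    let ?S = "\<alpha> ` (X \<inter> U)"
    have o: "open ?S" using chart_image_Int_open[OF A X chart_open[OF A U]] .
    have "smooth_on (\<lambda>z. ((\<kappa> \<circ> inv_into X \<alpha>) z, \<kappa>' b)) ?S"
      by (rule smooth_on_Pair[OF o chart_transition[OF A X U] smooth_on_const[OF o]])
    then have "smooth_on (\<tau> \<circ> (\<lambda>a. (a, b)) \<circ> inv_into X \<alpha>) ?S"
      by (rule smooth_on_transfer[OF o]) (auto simp: eq)
    then show ?thesis by (rule smooth_on_subset) (auto simp: eq)
  qed
  then show "smooth_map A (prod_atlas A B) (\<lambda>a. (a, b))"
    unfolding smooth_map_def by (auto intro!: continuous_intros)
qed

lemma smooth_pullback_slice_snd:
  assumes A: "smooth_manifold A" and B: "smooth_manifold B"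
  shows "smooth_pullback B (prod_atlas A B) (\<lambda>b. (a, b))"
proof (rule smooth_map_imp_pullback[OF smooth_manifold_prod[OF A B] B])
  have "smooth_on (\<tau> \<circ> (\<lambda>b. (a, b)) \<circ> inv_into X \<alpha>) (\<alpha> ` (X \<inter> (\<lambda>b. (a, b)) -` O'))"
    if O': "(O', \<tau>) \<in> prod_atlas A B" and X: "(X, \<alpha>) \<in> B" for O' \<tau> X \<alpha>
  proof -
    obtain U \<kappa> V \<kappa>' where U: "(U, \<kappa>) \<in> A" and V: "(V, \<kappa>') \<in> B" and eq: "O' = U \<times> V" "\<tau> = map_prod \<kappa> \<kappa>'"
      using O' by (rule prod_chartE)
    let ?S = "\<alpha> ` (X \<inter> V)"
    have o: "open ?S" using chart_image_Int_open[OF B X chart_open[OF B V]] .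
    have "smooth_on (\<lambda>z. (\<kappa> a, (\<kappa>' \<circ> inv_into X \<alpha>) z)) ?S"
      by (rule smooth_on_Pair[OF o smooth_on_const[OF o] chart_transition[OF B X V]])
    then have "smooth_on (\<tau> \<circ> (\<lambda>b. (a, b)) \<circ> inv_into X \<alpha>) ?S"
      by (rule smooth_on_transfer[OF o]) (auto simp: eq)
    then show ?thesis by (rule smooth_on_subset) (auto simp: eq)
  qed
  then show "smooth_map B (prod_atlas A B) (\<lambda>b. (a, b))"
    unfolding smooth_map_def by (auto intro!: continuous_intros)
qed

section \<open>Differentials of projections and slices in product charts\<close>

context
  fixes A :: "('a::{t2_space,second_countable_topology}, 'e::euclidean_space) chart set"
    and B :: "('b::{t2_space,second_countable_topology}, 'f::euclidean_space) chart set"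
    and U \<kappa> V \<kappa>' a b
  assumes A: "smooth_manifold A" and B: "smooth_manifold B"
    and U: "(U, \<kappa>) \<in> A" "a \<in> U" and V: "(V, \<kappa>') \<in> B" "b \<in> V"
begin

lemma differential_fst_coord_vec:
  "differential A fst (a, b) (coord_vec (prod_atlas A B) (U \<times> V) (map_prod \<kappa> \<kappa>') (a, b) \<xi>) =
     coord_vec A U \<kappa> a (fst \<xi>)"
proof -
  have "(fst has_derivative fst) (at (\<kappa> a, \<kappa>' b))"
    by (rule bounded_linear_imp_has_derivative[OF bounded_linear_fst])
  then have "((\<kappa> \<circ> fst \<circ> inv_into (U \<times> V) (map_prod \<kappa> \<kappa>')) has_derivative fst) (at (\<kappa> a, \<kappa>' b))"
    by (subst has_derivative_cong_open[OF open_Times[OF chart_image_open[OF A U(1)] chart_image_open[OF B V(1)]], where g = fst])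
      (use U V in \<open>auto simp: prod_chart_inv[OF A B U(1) V(1)]\<close>)
  then show ?thesis
    using differential_coord_vec[OF A smooth_manifold_prod[OF A B] smooth_pullback_fst[OF A B]
        prod_chart[OF U(1) V(1)], of "(a, b)"] U V by simp
qed

lemma differential_snd_coord_vec:
  "differential B snd (a, b) (coord_vec (prod_atlas A B) (U \<times> V) (map_prod \<kappa> \<kappa>') (a, b) \<xi>) =
     coord_vec B V \<kappa>' b (snd \<xi>)"
proof -
  have "(snd has_derivative snd) (at (\<kappa> a, \<kappa>' b))"
    by (rule bounded_linear_imp_has_derivative[OF bounded_linear_snd])
  then have "((\<kappa>' \<circ> snd \<circ> inv_into (U \<times> V) (map_prod \<kappa> \<kappa>')) has_derivative snd) (at (\<kappa> a, \<kappa>' b))"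
    by (subst has_derivative_cong_open[OF open_Times[OF chart_image_open[OF A U(1)] chart_image_open[OF B V(1)]], where g = snd])
      (use U V in \<open>auto simp: prod_chart_inv[OF A B U(1) V(1)]\<close>)
  then show ?thesis
    using differential_coord_vec[OF B smooth_manifold_prod[OF A B] smooth_pullback_snd[OF A B]
        prod_chart[OF U(1) V(1)], of "(a, b)"] U V by simp
qed

lemma differential_slice_fst_coord_vec:
  "differential (prod_atlas A B) (\<lambda>a. (a, b)) a (coord_vec A U \<kappa> a \<eta>) =
     coord_vec (prod_atlas A B) (U \<times> V) (map_prod \<kappa> \<kappa>') (a, b) (\<eta>, 0)"
proof -
  have "((\<lambda>x. (x, \<kappa>' b)) has_derivative (\<lambda>x. (x, 0))) (at (\<kappa> a))"
    by (auto intro!: derivative_eq_intros)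
  then have "((map_prod \<kappa> \<kappa>' \<circ> (\<lambda>a. (a, b)) \<circ> inv_into U \<kappa>) has_derivative (\<lambda>x. (x, 0))) (at (\<kappa> a))"
    by (subst has_derivative_cong_open[OF chart_image_open[OF A U(1)]])
      (use U V in \<open>auto simp: chart_inv[OF A U(1)]\<close>)
  then show ?thesis
    using differential_coord_vec[OF smooth_manifold_prod[OF A B] A smooth_pullback_slice_fst[OF A B]
        U prod_chart[OF U(1) V(1)], of b] U V by simp
qed

lemma differential_slice_snd_coord_vec:
  "differential (prod_atlas A B) (\<lambda>b. (a, b)) b (coord_vec B V \<kappa>' b \<eta>) =
     coord_vec (prod_atlas A B) (U \<times> V) (map_prod \<kappa> \<kappa>') (a, b) (0, \<eta>)"
proof -
  have "((\<lambda>x. (\<kappa> a, x)) has_derivative (\<lambda>x. (0, x))) (at (\<kappa>' b))"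
    by (auto intro!: derivative_eq_intros)
  then have "((map_prod \<kappa> \<kappa>' \<circ> (\<lambda>b. (a, b)) \<circ> inv_into V \<kappa>') has_derivative (\<lambda>x. (0, x))) (at (\<kappa>' b))"
    by (subst has_derivative_cong_open[OF chart_image_open[OF B V(1)]])
      (use U V in \<open>auto simp: chart_inv[OF B V(1)]\<close>)
  then show ?thesis
    using differential_coord_vec[OF smooth_manifold_prod[OF A B] B smooth_pullback_slice_snd[OF A B]
        V prod_chart[OF U(1) V(1)], of a] U V by simp
qed

end

text \<open>In a product chart this is the splitting of the component vector into its two
  halves.\<close>

lemma tangent_prod_split:
  assumes A: "smooth_manifold A" and B: "smooth_manifold B"
    and v: "v \<in> tangent_space (prod_atlas A B) (a, b)"
  shows "v = differential (prod_atlas A B) (\<lambda>a. (a, b)) a (differential A fst (a, b) v)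
    + differential (prod_atlas A B) (\<lambda>b. (a, b)) b (differential B snd (a, b) v)"
proof -
  obtain U \<kappa> where U: "(U, \<kappa>) \<in> A" "a \<in> U" by (rule chart_exists[OF A])
  obtain V \<kappa>' where V: "(V, \<kappa>') \<in> B" "b \<in> V" by (rule chart_exists[OF B])
  have p: "(a, b) \<in> U \<times> V" using U V by simp
  note AB = smooth_manifold_prod[OF A B] and W = prod_chart[OF U(1) V(1)]
  obtain \<xi> where v: "v = coord_vec (prod_atlas A B) (U \<times> V) (map_prod \<kappa> \<kappa>') (a, b) \<xi>"
    using v tangent_space_eq_range[OF AB W p] by auto
  have "\<xi> = (fst \<xi>, 0) + (0, snd \<xi>)" by simp
  then show ?thesis
    unfolding v differential_fst_coord_vec[OF A B U V] differential_snd_coord_vec[OF A B U V]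
      differential_slice_fst_coord_vec[OF A B U V] differential_slice_snd_coord_vec[OF A B U V]
    using linear_add[OF linear_coord_vec[OF AB W p]] by metis
qed

text \<open>Tangency matters: the differential is 0 on functions that are not smooth at the point,
  and tangent vectors obey the same convention.\<close>

lemma differential_id:
  assumes "v \<in> tangent_space A p"
  shows "differential A (\<lambda>q. q) p v = v"
  by (rule tvec_eqI) (use tangent_act_not_smooth[OF assms] in \<open>auto simp: differential_act\<close>)

text \<open>One factor of a product: \<open>\<pi>\<close> is the projection onto it and \<open>s x\<close> parametrizes the leaf
  through \<open>x\<close>.\<close>

locale factor =
  fixes A :: "('m::{t2_space,second_countable_topology}, 'e::euclidean_space) chart set"
    and B :: "('n::{t2_space,second_countable_topology}, 'f::euclidean_space) chart set"
    and \<pi> :: "'m \<Rightarrow> 'n" and s :: "'m \<Rightarrow> 'n \<Rightarrow> 'm"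
  assumes A: "smooth_manifold A" and B: "smooth_manifold B"
    and proj: "smooth_pullback A B \<pi>" and slice: "\<And>x. smooth_pullback B A (s x)"
    and proj_slice: "\<And>x q. \<pi> (s x q) = q" and slice_proj: "\<And>x. s x (\<pi> x) = x"
    and slice_slice: "\<And>x q. s (s x q) = s x"
    and lift_smooth: "\<And>W Y. vector_field_on B W Y \<Longrightarrow>
       vector_field_on A (\<pi> -` W) (\<lambda>x. differential A (s x) (\<pi> x) (Y (\<pi> x)))"
begin

definition lift :: "('n \<Rightarrow> 'n tvec) \<Rightarrow> 'm \<Rightarrow> 'm tvec" where
  "lift Y x = differential A (s x) (\<pi> x) (Y (\<pi> x))"

lemma lift_field: "vector_field_on B W Y \<Longrightarrow> vector_field_on A (\<pi> -` W) (lift Y)"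
  using lift_smooth unfolding lift_def by blast

lemma lift_slice: "lift Y (s x q) = differential A (s x) q (Y q)"
  unfolding lift_def proj_slice slice_slice ..

lemma differential_proj_slice:
  assumes "v \<in> tangent_space B q"
  shows "differential B \<pi> (s x q) (differential A (s x) q v) = v"
  using differential_comp[OF proj, of "s x" q v] differential_id[OF assms] proj_slice
  by (simp add: comp_def)

lemma differential_proj_lift:
  "vector_field_on B W Y \<Longrightarrow> \<pi> x \<in> W \<Longrightarrow> differential B \<pi> x (lift Y x) = Y (\<pi> x)"
  using differential_proj_slice[OF vector_field_tangent, of W Y "\<pi> x" x] slice_proj[of x]
  unfolding lift_def by simp

lemma lift_act_proj:
  assumes Y: "vector_field_on B W Y" and x: "\<pi> x \<in> W" and f: "smooth_at B (\<pi> x) f"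
  shows "lift Y x \<cdot> (\<lambda>q. f (\<pi> q)) = Y (\<pi> x) \<cdot> f"
proof -
  have "differential B \<pi> x (lift Y x) \<cdot> f = Y (\<pi> x) \<cdot> f"
    using differential_proj_lift[OF Y x] by simp
  then show ?thesis using f by (simp add: differential_act)
qed

text \<open>The tangent space at \<open>x\<close> of the leaf through \<open>x\<close>, as a
  subspace of the tangent space of the product.\<close>

definition leaf :: "'m \<Rightarrow> 'm tvec set" where
  "leaf x = differential A (s x) (\<pi> x) ` tangent_space B (\<pi> x)"

lemma leaf_tangent: "leaf x \<subseteq> tangent_space A x"
  unfolding leaf_def using differential_tangent[OF A B slice[of x], of _ "\<pi> x"] slice_proj by auto

lemma subspace_leaf: "subspace (leaf x)"
  unfolding leaf_def by (rule linear_subspace_image[OF linear_differential subspace_tangent_space[OF B]])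

lemma lift_leaf: "vector_field_on B W Y \<Longrightarrow> \<pi> x \<in> W \<Longrightarrow> lift Y x \<in> leaf x"
  unfolding leaf_def lift_def by (rule imageI) (rule vector_field_tangent)

lemma slice_leaf: "v \<in> tangent_space B q \<Longrightarrow> differential A (s x) q v \<in> leaf (s x q)"
  unfolding leaf_def proj_slice slice_slice by blast

lemma leaf_fixed: "v \<in> leaf x \<Longrightarrow> differential A (s x) (\<pi> x) (differential B \<pi> x v) = v"
  unfolding leaf_def using differential_proj_slice[of _ "\<pi> x" x] slice_proj[of x] by auto

end

section \<open>The three factors of a triple product\<close>

context
  fixes A0 :: "('a::{t2_space,second_countable_topology}, 'e0::euclidean_space) chart set"
    and A1 :: "('b::{t2_space,second_countable_topology}, 'e1::euclidean_space) chart set"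
    and A2 :: "('c::{t2_space,second_countable_topology}, 'e2::euclidean_space) chart set"
  assumes A0: "smooth_manifold A0" and A1: "smooth_manifold A1" and A2: "smooth_manifold A2"
begin

lemma smooth_manifold_triple: "smooth_manifold (triple_atlas A0 A1 A2)"
  unfolding triple_atlas_def by (intro smooth_manifold_prod A0 A1 A2)

lemma smooth_pullback_projs:
  "smooth_pullback (triple_atlas A0 A1 A2) A0 proj0"
  "smooth_pullback (triple_atlas A0 A1 A2) A1 proj1"
  "smooth_pullback (triple_atlas A0 A1 A2) A2 proj2"
proof -
  note A12 = smooth_manifold_prod[OF A1 A2]
  have e: "proj0 = fst" "proj1 = fst \<circ> snd" "proj2 = snd \<circ> snd"
    by (auto simp: proj0_def proj1_def proj2_def)
  show "smooth_pullback (triple_atlas A0 A1 A2) A0 proj0"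
    unfolding e triple_atlas_def by (rule smooth_pullback_fst[OF A0 A12])
  show "smooth_pullback (triple_atlas A0 A1 A2) A1 proj1"
    unfolding e triple_atlas_def
    by (rule smooth_pullback_comp[OF smooth_pullback_fst[OF A1 A2] smooth_pullback_snd[OF A0 A12]])
  show "smooth_pullback (triple_atlas A0 A1 A2) A2 proj2"
    unfolding e triple_atlas_def
    by (rule smooth_pullback_comp[OF smooth_pullback_snd[OF A1 A2] smooth_pullback_snd[OF A0 A12]])
qed

lemma slice_comp:
  "slice0 b c = (\<lambda>a. (a, (b, c)))"
  "slice1 a c = (\<lambda>y. (a, y)) \<circ> (\<lambda>b. (b, c))"
  "slice2 a b = (\<lambda>y. (a, y)) \<circ> (\<lambda>c. (b, c))"
  by (auto simp: slice0_def slice1_def slice2_def)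

lemma smooth_pullback_slices:
  "smooth_pullback A0 (triple_atlas A0 A1 A2) (slice0 b c)"
  "smooth_pullback A1 (triple_atlas A0 A1 A2) (slice1 a c)"
  "smooth_pullback A2 (triple_atlas A0 A1 A2) (slice2 a b)"
proof -
  note A12 = smooth_manifold_prod[OF A1 A2]
  show "smooth_pullback A0 (triple_atlas A0 A1 A2) (slice0 b c)"
    unfolding slice_comp triple_atlas_def by (rule smooth_pullback_slice_fst[OF A0 A12])
  show "smooth_pullback A1 (triple_atlas A0 A1 A2) (slice1 a c)"
    unfolding slice_comp triple_atlas_def
    by (rule smooth_pullback_comp[OF smooth_pullback_slice_snd[OF A0 A12] smooth_pullback_slice_fst[OF A1 A2]])
  show "smooth_pullback A2 (triple_atlas A0 A1 A2) (slice2 a b)"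
    unfolding slice_comp triple_atlas_def
    by (rule smooth_pullback_comp[OF smooth_pullback_slice_snd[OF A0 A12] smooth_pullback_slice_snd[OF A1 A2]])
qed

text \<open>These formulas exhibit the constant matrices that \<open>lift_vector_field\<close> asks
  for.\<close>

lemma differential_slices_coord_vec:
  assumes U0: "(U0, \<kappa>0) \<in> A0" "a \<in> U0" and U1: "(U1, \<kappa>1) \<in> A1" "b \<in> U1"
    and U2: "(U2, \<kappa>2) \<in> A2" "c \<in> U2"
  defines "C \<equiv> coord_vec (triple_atlas A0 A1 A2) (U0 \<times> U1 \<times> U2) (map_prod \<kappa>0 (map_prod \<kappa>1 \<kappa>2)) (a, b, c)"
  shows "differential (triple_atlas A0 A1 A2) (slice0 b c) a (coord_vec A0 U0 \<kappa>0 a \<eta>0) = C (\<eta>0, 0, 0)"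
    "differential (triple_atlas A0 A1 A2) (slice1 a c) b (coord_vec A1 U1 \<kappa>1 b \<eta>1) = C (0, \<eta>1, 0)"
    "differential (triple_atlas A0 A1 A2) (slice2 a b) c (coord_vec A2 U2 \<kappa>2 c \<eta>2) = C (0, 0, \<eta>2)"
proof -
  note A12 = smooth_manifold_prod[OF A1 A2]
  have U12: "(U1 \<times> U2, map_prod \<kappa>1 \<kappa>2) \<in> prod_atlas A1 A2" "(b, c) \<in> U1 \<times> U2"
    using prod_chart[OF U1(1) U2(1)] U1 U2 by auto
  note D = smooth_pullback_slice_snd[OF A0 A12, THEN differential_comp]
  show "differential (triple_atlas A0 A1 A2) (slice0 b c) a (coord_vec A0 U0 \<kappa>0 a \<eta>0) = C (\<eta>0, 0, 0)"
    unfolding slice_comp triple_atlas_def C_def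
    using differential_slice_fst_coord_vec[OF A0 A12 U0 U12] by (simp add: zero_prod_def)
  show "differential (triple_atlas A0 A1 A2) (slice1 a c) b (coord_vec A1 U1 \<kappa>1 b \<eta>1) = C (0, \<eta>1, 0)"
    unfolding slice_comp triple_atlas_def C_def D
    using differential_slice_fst_coord_vec[OF A1 A2 U1 U2] differential_slice_snd_coord_vec[OF A0 A12 U0 U12]
    by simp
  show "differential (triple_atlas A0 A1 A2) (slice2 a b) c (coord_vec A2 U2 \<kappa>2 c \<eta>2) = C (0, 0, \<eta>2)"
    unfolding slice_comp triple_atlas_def C_def D
    using differential_slice_snd_coord_vec[OF A1 A2 U1 U2] differential_slice_snd_coord_vec[OF A0 A12 U0 U12]
    by simp
qed

lemma triple_chart_exists:
  obtains U0 \<kappa>0 U1 \<kappa>1 U2 \<kappa>2 where "(U0, \<kappa>0) \<in> A0" "(U1, \<kappa>1) \<in> A1" "(U2, \<kappa>2) \<in> A2"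
    "x \<in> U0 \<times> U1 \<times> U2" "(U0 \<times> U1 \<times> U2, map_prod \<kappa>0 (map_prod \<kappa>1 \<kappa>2)) \<in> triple_atlas A0 A1 A2"
proof -
  obtain U0 \<kappa>0 where U0: "(U0, \<kappa>0) \<in> A0" "fst x \<in> U0" by (rule chart_exists[OF A0])
  obtain U1 \<kappa>1 where U1: "(U1, \<kappa>1) \<in> A1" "fst (snd x) \<in> U1" by (rule chart_exists[OF A1])
  obtain U2 \<kappa>2 where U2: "(U2, \<kappa>2) \<in> A2" "snd (snd x) \<in> U2" by (rule chart_exists[OF A2])
  show ?thesis
    by (rule that[OF U0(1) U1(1) U2(1)])
      (use U0 U1 U2 prod_chart[OF U0(1) prod_chart[OF U1(1) U2(1)]] in
        \<open>auto simp: triple_atlas_def mem_Times_iff\<close>)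
qed

lemma factor0: "factor (triple_atlas A0 A1 A2) A0 proj0 (\<lambda>x. slice0 (proj1 x) (proj2 x))"
proof
  fix W Y assume Y: "vector_field_on A0 W Y"
  show "vector_field_on (triple_atlas A0 A1 A2) (proj0 -` W)
     (\<lambda>x. differential (triple_atlas A0 A1 A2) (slice0 (proj1 x) (proj2 x)) (proj0 x) (Y (proj0 x)))"
  proof (rule lift_vector_field[OF smooth_manifold_triple A0 smooth_pullback_projs(1) _ Y])
    fix x :: "'a \<times> 'b \<times> 'c"
    obtain U0 \<kappa>0 U1 \<kappa>1 U2 \<kappa>2 where U: "(U0, \<kappa>0) \<in> A0" "(U1, \<kappa>1) \<in> A1" "(U2, \<kappa>2) \<in> A2"
      "x \<in> U0 \<times> U1 \<times> U2" "(U0 \<times> U1 \<times> U2, map_prod \<kappa>0 (map_prod \<kappa>1 \<kappa>2)) \<in> triple_atlas A0 A1 A2"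
      by (rule triple_chart_exists)
    have "linear (\<lambda>\<eta>::'e0. (\<eta>, 0::'e1, 0::'e2))" by (rule linearI) auto
    then show "\<exists>U \<kappa> V \<kappa>' L. (U, \<kappa>) \<in> triple_atlas A0 A1 A2 \<and> x \<in> U \<and> (V, \<kappa>') \<in> A0 \<and> proj0 ` U \<subseteq> V \<and> linear L \<and>
       (\<forall>y\<in>U. \<forall>\<eta>. differential (triple_atlas A0 A1 A2) (slice0 (proj1 y) (proj2 y)) (proj0 y)
          (coord_vec A0 V \<kappa>' (proj0 y) \<eta>) = coord_vec (triple_atlas A0 A1 A2) U \<kappa> y (L \<eta>))"
      using U differential_slices_coord_vec(1)[OF U(1) _ U(2) _ U(3)]
      by (intro exI conjI ballI allI; (assumption)?) (auto simp: proj0_def proj1_def proj2_def)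
  qed
qed (use smooth_pullback_slices(1) in \<open>auto simp: A0 smooth_manifold_triple smooth_pullback_projs
    slice0_def proj0_def proj1_def proj2_def\<close>)

lemma factor1: "factor (triple_atlas A0 A1 A2) A1 proj1 (\<lambda>x. slice1 (proj0 x) (proj2 x))"
proof
  fix W Y assume Y: "vector_field_on A1 W Y"
  show "vector_field_on (triple_atlas A0 A1 A2) (proj1 -` W)
     (\<lambda>x. differential (triple_atlas A0 A1 A2) (slice1 (proj0 x) (proj2 x)) (proj1 x) (Y (proj1 x)))"
  proof (rule lift_vector_field[OF smooth_manifold_triple A1 smooth_pullback_projs(2) _ Y])
    fix x :: "'a \<times> 'b \<times> 'c"
    obtain U0 \<kappa>0 U1 \<kappa>1 U2 \<kappa>2 where U: "(U0, \<kappa>0) \<in> A0" "(U1, \<kappa>1) \<in> A1" "(U2, \<kappa>2) \<in> A2"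
      "x \<in> U0 \<times> U1 \<times> U2" "(U0 \<times> U1 \<times> U2, map_prod \<kappa>0 (map_prod \<kappa>1 \<kappa>2)) \<in> triple_atlas A0 A1 A2"
      by (rule triple_chart_exists)
    have "linear (\<lambda>\<eta>::'e1. (0::'e0, \<eta>, 0::'e2))" by (rule linearI) auto
    then show "\<exists>U \<kappa> V \<kappa>' L. (U, \<kappa>) \<in> triple_atlas A0 A1 A2 \<and> x \<in> U \<and> (V, \<kappa>') \<in> A1 \<and> proj1 ` U \<subseteq> V \<and> linear L \<and>
       (\<forall>y\<in>U. \<forall>\<eta>. differential (triple_atlas A0 A1 A2) (slice1 (proj0 y) (proj2 y)) (proj1 y)
          (coord_vec A1 V \<kappa>' (proj1 y) \<eta>) = coord_vec (triple_atlas A0 A1 A2) U \<kappa> y (L \<eta>))"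
      using U differential_slices_coord_vec(2)[OF U(1) _ U(2) _ U(3)]
      by (intro exI conjI ballI allI; (assumption)?) (auto simp: proj0_def proj1_def proj2_def)
  qed
qed (use smooth_pullback_slices(2) in \<open>auto simp: A1 smooth_manifold_triple smooth_pullback_projs
    slice1_def proj0_def proj1_def proj2_def\<close>)

lemma factor2: "factor (triple_atlas A0 A1 A2) A2 proj2 (\<lambda>x. slice2 (proj0 x) (proj1 x))"
proof
  fix W Y assume Y: "vector_field_on A2 W Y"
  show "vector_field_on (triple_atlas A0 A1 A2) (proj2 -` W)
     (\<lambda>x. differential (triple_atlas A0 A1 A2) (slice2 (proj0 x) (proj1 x)) (proj2 x) (Y (proj2 x)))"
  proof (rule lift_vector_field[OF smooth_manifold_triple A2 smooth_pullback_projs(3) _ Y])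
    fix x :: "'a \<times> 'b \<times> 'c"
    obtain U0 \<kappa>0 U1 \<kappa>1 U2 \<kappa>2 where U: "(U0, \<kappa>0) \<in> A0" "(U1, \<kappa>1) \<in> A1" "(U2, \<kappa>2) \<in> A2"
      "x \<in> U0 \<times> U1 \<times> U2" "(U0 \<times> U1 \<times> U2, map_prod \<kappa>0 (map_prod \<kappa>1 \<kappa>2)) \<in> triple_atlas A0 A1 A2"
      by (rule triple_chart_exists)
    have "linear (\<lambda>\<eta>::'e2. (0::'e0, 0::'e1, \<eta>))" by (rule linearI) auto
    then show "\<exists>U \<kappa> V \<kappa>' L. (U, \<kappa>) \<in> triple_atlas A0 A1 A2 \<and> x \<in> U \<and> (V, \<kappa>') \<in> A2 \<and> proj2 ` U \<subseteq> V \<and> linear L \<and>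
       (\<forall>y\<in>U. \<forall>\<eta>. differential (triple_atlas A0 A1 A2) (slice2 (proj0 y) (proj1 y)) (proj2 y)
          (coord_vec A2 V \<kappa>' (proj2 y) \<eta>) = coord_vec (triple_atlas A0 A1 A2) U \<kappa> y (L \<eta>))"
      using U differential_slices_coord_vec(3)[OF U(1) _ U(2) _ U(3)]
      by (intro exI conjI ballI allI; (assumption)?) (auto simp: proj0_def proj1_def proj2_def)
  qed
qed (use smooth_pullback_slices(3) in \<open>auto simp: A2 smooth_manifold_triple smooth_pullback_projs
    slice2_def proj0_def proj1_def proj2_def\<close>)

lemma tangent_triple_split:
  assumes v: "v \<in> tangent_space (triple_atlas A0 A1 A2) x"
  shows "v = differential (triple_atlas A0 A1 A2) (slice0 (proj1 x) (proj2 x)) (proj0 x) (differential A0 proj0 x v)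
     + differential (triple_atlas A0 A1 A2) (slice1 (proj0 x) (proj2 x)) (proj1 x) (differential A1 proj1 x v)
     + differential (triple_atlas A0 A1 A2) (slice2 (proj0 x) (proj1 x)) (proj2 x) (differential A2 proj2 x v)"
proof -
  note A12 = smooth_manifold_prod[OF A1 A2]
  obtain a b c where x: "x = (a, b, c)" by (cases x) auto
  have e: "proj0 = fst" "proj1 = fst \<circ> snd" "proj2 = snd \<circ> snd"
    by (auto simp: proj0_def proj1_def proj2_def)
  define w where "w = differential (prod_atlas A1 A2) snd (a, b, c) v"
  have w: "w \<in> tangent_space (prod_atlas A1 A2) (b, c)"
    using differential_tangent[OF A12 smooth_manifold_triple smooth_pullback_snd[OF A0 A12, folded triple_atlas_def] v]
    unfolding w_def x by simp
  have 1: "differential A1 (fst \<circ> snd) (a, b, c) v = differential A1 fst (b, c) w"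
    unfolding w_def using differential_comp[OF smooth_pullback_fst[OF A1 A2], of snd "(a, b, c)" v] by simp
  have 2: "differential A2 (snd \<circ> snd) (a, b, c) v = differential A2 snd (b, c) w"
    unfolding w_def using differential_comp[OF smooth_pullback_snd[OF A1 A2], of snd "(a, b, c)" v] by simp
  note D = smooth_pullback_slice_snd[OF A0 A12, THEN differential_comp, folded triple_atlas_def]
  have "v = differential (triple_atlas A0 A1 A2) (slice0 b c) a (differential A0 fst (a, b, c) v)
     + differential (triple_atlas A0 A1 A2) (\<lambda>y. (a, y)) (b, c) w"
    using tangent_prod_split[OF A0 A12, folded triple_atlas_def, OF v[unfolded x]]
    unfolding w_def slice_comp .
  also have "w = differential (prod_atlas A1 A2) (\<lambda>b. (b, c)) b (differential A1 fst (b, c) w)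
    + differential (prod_atlas A1 A2) (\<lambda>c. (b, c)) c (differential A2 snd (b, c) w)"
    by (rule tangent_prod_split[OF A1 A2 w])
  finally show ?thesis
    unfolding e x using 1 2 by (simp add: slice_comp D linear_add[OF linear_differential] add.assoc)
qed

end

section \<open>Inner products on subspaces\<close>

text \<open>Tangent spaces are subspaces of the one vector space \<open>tvec\<close>, and a metric
  is prescribed only on them; hence inner products are taken relative to a subspace
  \<open>S\<close>, and the laws carry membership hypotheses.\<close>

definition inner_on :: "'v::real_vector set \<Rightarrow> ('v \<Rightarrow> 'v \<Rightarrow> real) \<Rightarrow> bool" where
  "inner_on S b \<longleftrightarrow> subspace S \<and> (\<forall>u\<in>S. \<forall>v\<in>S. b u v = b v u) \<and>
     (\<forall>u\<in>S. \<forall>v\<in>S. \<forall>w\<in>S. \<forall>x y. b (x *\<^sub>R u + y *\<^sub>R v) w = x * b u w + y * b v w) \<and>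
     (\<forall>u\<in>S. u \<noteq> 0 \<longrightarrow> b u u > 0)"

locale inner_space =
  fixes S :: "'v::real_vector set" and b :: "'v \<Rightarrow> 'v \<Rightarrow> real"
  assumes inner_on: "inner_on S b"
begin

lemma sub: "subspace S" using inner_on unfolding inner_on_def by blast

lemma mem_add [intro]: "u \<in> S \<Longrightarrow> v \<in> S \<Longrightarrow> u + v \<in> S"
  and mem_diff [intro]: "u \<in> S \<Longrightarrow> v \<in> S \<Longrightarrow> u - v \<in> S"
  and mem_minus [intro]: "u \<in> S \<Longrightarrow> - u \<in> S"
  and mem_scale [intro]: "u \<in> S \<Longrightarrow> x *\<^sub>R u \<in> S"
  and mem_zero [intro, simp]: "0 \<in> S"
  by (rule subspace_add[OF sub] subspace_diff[OF sub] subspace_neg[OF sub] subspace_scale[OF sub]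
      subspace_0[OF sub]; assumption)+

lemma mem_sum [intro]: "(\<And>i. i \<in> I \<Longrightarrow> u i \<in> S) \<Longrightarrow> (\<Sum>i\<in>I. u i) \<in> S"
  using sub by (rule subspace_sum)

lemma sym: "u \<in> S \<Longrightarrow> v \<in> S \<Longrightarrow> b u v = b v u"
  by (rule inner_on[unfolded inner_on_def, THEN conjunct2, THEN conjunct1, rule_format])

lemma lin: "u \<in> S \<Longrightarrow> v \<in> S \<Longrightarrow> w \<in> S \<Longrightarrow> b (x *\<^sub>R u + y *\<^sub>R v) w = x * b u w + y * b v w"
  by (rule inner_on[unfolded inner_on_def, THEN conjunct2, THEN conjunct2, THEN conjunct1, rule_format])

lemma pos: "u \<in> S \<Longrightarrow> u \<noteq> 0 \<Longrightarrow> b u u > 0"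
  by (rule inner_on[unfolded inner_on_def, THEN conjunct2, THEN conjunct2, THEN conjunct2, rule_format])

lemma add_left: "u \<in> S \<Longrightarrow> v \<in> S \<Longrightarrow> w \<in> S \<Longrightarrow> b (u + v) w = b u w + b v w"
  using lin[of u v w 1 1] by simp

lemma scale_left: "u \<in> S \<Longrightarrow> w \<in> S \<Longrightarrow> b (x *\<^sub>R u) w = x * b u w"
  using lin[of u u w x 0] by simp

lemma diff_left: "u \<in> S \<Longrightarrow> v \<in> S \<Longrightarrow> w \<in> S \<Longrightarrow> b (u - v) w = b u w - b v w"
  using lin[of u v w 1 "-1"] by simp

lemma minus_left: "u \<in> S \<Longrightarrow> w \<in> S \<Longrightarrow> b (- u) w = - b u w"
  using scale_left[of u w "-1"] by simp

lemma zero_left [simp]: "w \<in> S \<Longrightarrow> b 0 w = 0"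
  using scale_left[of w w 0] by simp

lemma sum_left: "(\<And>i. i \<in> I \<Longrightarrow> u i \<in> S) \<Longrightarrow> w \<in> S \<Longrightarrow> b (\<Sum>i\<in>I. u i) w = (\<Sum>i\<in>I. b (u i) w)"
  by (induction I rule: infinite_finite_induct) (auto simp: add_left mem_sum)

lemma add_right: "u \<in> S \<Longrightarrow> v \<in> S \<Longrightarrow> w \<in> S \<Longrightarrow> b w (u + v) = b w u + b w v"
  using add_left[of u v w] sym[of w "u + v"] sym[of w u] sym[of w v] by auto

lemma scale_right: "u \<in> S \<Longrightarrow> w \<in> S \<Longrightarrow> b w (x *\<^sub>R u) = x * b w u"
  using scale_left[of u w x] sym[of w "x *\<^sub>R u"] sym[of w u] by auto

lemma diff_right: "u \<in> S \<Longrightarrow> v \<in> S \<Longrightarrow> w \<in> S \<Longrightarrow> b w (u - v) = b w u - b w v"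
  using diff_left[of u v w] sym[of w "u - v"] sym[of w u] sym[of w v] by auto

lemma zero_right [simp]: "w \<in> S \<Longrightarrow> b w 0 = 0"
  using sym[of w 0] by simp

lemma sum_right: "(\<And>i. i \<in> I \<Longrightarrow> u i \<in> S) \<Longrightarrow> w \<in> S \<Longrightarrow> b w (\<Sum>i\<in>I. u i) = (\<Sum>i\<in>I. b w (u i))"
  by (induction I rule: infinite_finite_induct) (auto simp: add_right mem_sum)

lemma nonneg: "u \<in> S \<Longrightarrow> b u u \<ge> 0"
  using pos[of u] by (cases "u = 0") auto

lemma eq_0_iff: "u \<in> S \<Longrightarrow> b u u = 0 \<longleftrightarrow> u = 0"
  using pos[of u] by (cases "u = 0") auto

lemma eqI:
  assumes "u \<in> S" "v \<in> S" "\<And>w. w \<in> S \<Longrightarrow> b u w = b v w"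
  shows "u = v"
proof -
  have "b (u - v) (u - v) = 0"
    using assms mem_diff[OF assms(1,2)] by (simp add: diff_left)
  then show ?thesis using eq_0_iff[OF mem_diff[OF assms(1,2)]] by simp
qed

lemma sum_sum_scale:
  assumes "\<And>i. i \<in> I \<Longrightarrow> u i \<in> S" "\<And>j. j \<in> K \<Longrightarrow> v j \<in> S"
  shows "b (\<Sum>i\<in>I. x i *\<^sub>R u i) (\<Sum>j\<in>K. y j *\<^sub>R v j) = (\<Sum>i\<in>I. \<Sum>j\<in>K. x i * y j * b (u i) (v j))"
proof -
  have m: "(\<Sum>j\<in>K. y j *\<^sub>R v j) \<in> S" using assms by auto
  have "b (\<Sum>i\<in>I. x i *\<^sub>R u i) (\<Sum>j\<in>K. y j *\<^sub>R v j) = (\<Sum>i\<in>I. x i * b (u i) (\<Sum>j\<in>K. y j *\<^sub>R v j))"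
    using assms m by (subst sum_left) (auto simp: scale_left)
  also have "\<dots> = (\<Sum>i\<in>I. \<Sum>j\<in>K. x i * y j * b (u i) (v j))"
  proof (rule sum.cong[OF refl])
    fix i assume "i \<in> I"
    then show "x i * b (u i) (\<Sum>j\<in>K. y j *\<^sub>R v j) = (\<Sum>j\<in>K. x i * y j * b (u i) (v j))"
      using assms by (subst sum_right) (auto simp: scale_right sum_distrib_left mult.assoc)
  qed
  finally show ?thesis .
qed

end

lemma inner_on_tangent:
  assumes "riemannian_manifold A g"
  shows "inner_space (tangent_space A p) (g p)"
proof -
  have "smooth_manifold A" using assms unfolding riemannian_manifold_def by blast
  from subspace_tangent_space[OF this] assms show ?thesis
    unfolding riemannian_manifold_def inner_space_def inner_on_def by (elim conjE) (intro conjI; simp)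
qed

section \<open>Covariant derivatives along a map\<close>

lemma affine_connection_tangent:
  "affine_connection A nab \<Longrightarrow> p \<in> W \<Longrightarrow> vector_field_on A W Y \<Longrightarrow> u \<in> tangent_space A p \<Longrightarrow>
    nab p u Y \<in> tangent_space A p"
  and affine_connection_linear:
  "affine_connection A nab \<Longrightarrow> p \<in> W \<Longrightarrow> vector_field_on A W Y \<Longrightarrow> u \<in> tangent_space A p \<Longrightarrow>
    v \<in> tangent_space A p \<Longrightarrow> nab p (a *\<^sub>R u + b *\<^sub>R v) Y = a *\<^sub>R nab p u Y + b *\<^sub>R nab p v Y"
  and affine_connection_add:
  "affine_connection A nab \<Longrightarrow> p \<in> W \<Longrightarrow> vector_field_on A W Y \<Longrightarrow> vector_field_on A W Z \<Longrightarrow>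
    u \<in> tangent_space A p \<Longrightarrow> nab p u (\<lambda>q. Y q + Z q) = nab p u Y + nab p u Z"
  and affine_connection_scale:
  "affine_connection A nab \<Longrightarrow> p \<in> W \<Longrightarrow> vector_field_on A W Y \<Longrightarrow> smooth_fun_on A W f \<Longrightarrow>
    u \<in> tangent_space A p \<Longrightarrow> nab p u (\<lambda>q. f q *\<^sub>R Y q) = (u \<cdot> f) *\<^sub>R Y p + f p *\<^sub>R nab p u Y"
  and affine_connection_field:
  "affine_connection A nab \<Longrightarrow> vector_field_on A W X \<Longrightarrow> vector_field_on A W Y \<Longrightarrow>
    vector_field_on A W (\<lambda>q. nab q (X q) Y)"
  unfolding affine_connection_def by meson+

lemma levi_civita_affine: "levi_civita A g nab \<Longrightarrow> affine_connection A nab"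
  and levi_civita_torsion:
  "levi_civita A g nab \<Longrightarrow> p \<in> W \<Longrightarrow> vector_field_on A W X \<Longrightarrow> vector_field_on A W Y \<Longrightarrow>
    nab p (X p) Y - nab p (Y p) X = lie_bracket A X Y p"
  and levi_civita_metric:
  "levi_civita A g nab \<Longrightarrow> p \<in> W \<Longrightarrow> u \<in> tangent_space A p \<Longrightarrow> vector_field_on A W Y \<Longrightarrow>
    vector_field_on A W Z \<Longrightarrow>
    u \<cdot> (\<lambda>q. g q (Y q) (Z q)) = g p (nab p u Y) (Z p) + g p (Y p) (nab p u Z)"
  unfolding levi_civita_def by meson+

lemma affine_connection_sum_left:
  assumes A: "smooth_manifold A" and nab: "affine_connection A nab" and p: "p \<in> W"
    and Y: "vector_field_on A W Y" and v: "\<And>i. i \<in> I \<Longrightarrow> v i \<in> tangent_space A p"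
  shows "nab p (\<Sum>i\<in>I. a i *\<^sub>R v i) Y = (\<Sum>i\<in>I. a i *\<^sub>R nab p (v i) Y)"
  using v
proof (induction I rule: infinite_finite_induct)
  case (insert i I)
  have "(\<Sum>i\<in>I. a i *\<^sub>R v i) \<in> tangent_space A p"
    using insert.prems by (intro subspace_sum subspace_scale subspace_tangent_space[OF A]) auto
  then show ?case
    using insert affine_connection_linear[OF nab p Y, of "v i" "\<Sum>i\<in>I. a i *\<^sub>R v i" "a i" 1] by simp
next
  case (infinite I)
  have "0 \<in> tangent_space A p" by (rule subspace_0[OF subspace_tangent_space[OF A]])
  then have "nab p 0 Y = 0"
    using affine_connection_linear[OF nab p Y, of 0 0 0 0] by simp
  then show ?case using infinite by simp
next
  case empty
  have "0 \<in> tangent_space A p" by (rule subspace_0[OF subspace_tangent_space[OF A]])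
  then have "nab p 0 Y = 0"
    using affine_connection_linear[OF nab p Y, of 0 0 0 0] by simp
  then show ?case by simp
qed

locale along =
  fixes B :: "('n::{t2_space,second_countable_topology}, 'f::euclidean_space) chart set"
    and A :: "('m::{t2_space,second_countable_topology}, 'e::euclidean_space) chart set"
    and g :: "'m metric" and nab :: "'m connection" and \<phi> :: "'n \<Rightarrow> 'm"
  assumes B: "smooth_manifold B" and riem: "riemannian_manifold A g"
    and lc: "levi_civita A g nab" and \<phi>: "smooth_pullback B A \<phi>"
begin

lemma A: "smooth_manifold A" using riem unfolding riemannian_manifold_def by blast

sublocale T: inner_space "tangent_space A p" "g p" for p
  by (rule inner_on_tangent[OF riem])

abbreviation d where "d p \<equiv> differential A \<phi> p"
abbreviation hcd where "hcd \<equiv> has_covariant_derivative_along B A nab \<phi>"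

lemma d_tangent: "u \<in> tangent_space B p \<Longrightarrow> d p u \<in> tangent_space A (\<phi> p)"
  by (rule differential_tangent[OF A B \<phi>])

lemma metric_smooth:
  "vector_field_on A W X \<Longrightarrow> vector_field_on A W Y \<Longrightarrow> smooth_fun_on A W (\<lambda>q. g q (X q) (Y q))"
  using riem unfolding riemannian_manifold_def by blast

lemma hcdE:
  assumes "hcd p u V w"
  obtains W W' c E and K :: "nat set" where "p \<in> W" "open W" "\<And>q. q \<in> W \<Longrightarrow> \<phi> q \<in> W'" "finite K"
    "\<And>k. k \<in> K \<Longrightarrow> smooth_fun_on B W (c k)" "\<And>k. k \<in> K \<Longrightarrow> vector_field_on A W' (E k)"
    "\<And>q. q \<in> W \<Longrightarrow> V q = (\<Sum>k\<in>K. c k q *\<^sub>R E k (\<phi> q))"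
    "w = (\<Sum>k\<in>K. (u \<cdot> c k) *\<^sub>R E k (\<phi> p) + c k p *\<^sub>R nab (\<phi> p) (d p u) (E k))"
proof -
  obtain W W' c E and K :: "nat set" where
    "p \<in> W \<and> open W \<and> \<phi> ` W \<subseteq> W' \<and> finite K \<and>
        (\<forall>k\<in>K. smooth_fun_on B W (c k) \<and> vector_field_on A W' (E k)) \<and>
        (\<forall>q\<in>W. V q = (\<Sum>k\<in>K. c k q *\<^sub>R E k (\<phi> q))) \<and>
        w = (\<Sum>k\<in>K. (u \<cdot> c k) *\<^sub>R E k (\<phi> p) + c k p *\<^sub>R nab (\<phi> p) (d p u) (E k))"
    using assms unfolding has_covariant_derivative_along_def by (elim exE) (rule that)
  then show ?thesis by (intro that[of W W' K c E]) (auto simp: image_subset_iff)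
qed

lemma hcdI:
  fixes K :: "nat set"
  assumes "p \<in> W" "open W" "\<And>q. q \<in> W \<Longrightarrow> \<phi> q \<in> W'" "finite K"
    "\<And>k. k \<in> K \<Longrightarrow> smooth_fun_on B W (c k)" "\<And>k. k \<in> K \<Longrightarrow> vector_field_on A W' (E k)"
    "\<And>q. q \<in> W \<Longrightarrow> V q = (\<Sum>k\<in>K. c k q *\<^sub>R E k (\<phi> q))"
    "w = (\<Sum>k\<in>K. (u \<cdot> c k) *\<^sub>R E k (\<phi> p) + c k p *\<^sub>R nab (\<phi> p) (d p u) (E k))"
  shows "hcd p u V w"
  unfolding has_covariant_derivative_along_def
  by (rule exI[of _ W], rule exI[of _ W'], rule exI[of _ K], rule exI[of _ c], rule exI[of _ E])
    (use assms in \<open>simp add: image_subset_iff\<close>)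

lemma hcd_tangent:
  assumes V: "hcd p u V w" and u: "u \<in> tangent_space B p"
  shows "V p \<in> tangent_space A (\<phi> p)" "w \<in> tangent_space A (\<phi> p)"
proof -
  obtain W W' c E and K :: "nat set" where H: "p \<in> W" "open W" "\<And>q. q \<in> W \<Longrightarrow> \<phi> q \<in> W'" "finite K"
    "\<And>k. k \<in> K \<Longrightarrow> smooth_fun_on B W (c k)" "\<And>k. k \<in> K \<Longrightarrow> vector_field_on A W' (E k)"
    "\<And>q. q \<in> W \<Longrightarrow> V q = (\<Sum>k\<in>K. c k q *\<^sub>R E k (\<phi> q))"
    "w = (\<Sum>k\<in>K. (u \<cdot> c k) *\<^sub>R E k (\<phi> p) + c k p *\<^sub>R nab (\<phi> p) (d p u) (E k))"
    by (rule hcdE[OF V]; rule that)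
  have E: "E k (\<phi> p) \<in> tangent_space A (\<phi> p)" "nab (\<phi> p) (d p u) (E k) \<in> tangent_space A (\<phi> p)"
    if "k \<in> K" for k
    using vector_field_tangent[OF H(6)[OF that]] H(1,3)
      affine_connection_tangent[OF levi_civita_affine[OF lc] _ H(6)[OF that] d_tangent[OF u]] by auto
  show "V p \<in> tangent_space A (\<phi> p)" "w \<in> tangent_space A (\<phi> p)"
    unfolding H(7)[OF H(1)] H(8) using E by (auto intro!: T.mem_sum T.mem_add T.mem_scale)
qed

text \<open>Metric compatibility holds for every representation of the fields; this is what makes the
  covariant derivative along \<open>\<phi>\<close> well defined.\<close>

lemma hcd_metric:
  assumes V: "hcd p u V w" and V': "hcd p u V' w'" and u: "u \<in> tangent_space B p"
  shows "u \<cdot> (\<lambda>q. g (\<phi> q) (V q) (V' q)) = g (\<phi> p) w (V' p) + g (\<phi> p) (V p) w'"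
    and "smooth_at B p (\<lambda>q. g (\<phi> q) (V q) (V' q))"
proof -
  obtain W W' c E and K :: "nat set" where H: "p \<in> W" "open W" "\<And>q. q \<in> W \<Longrightarrow> \<phi> q \<in> W'" "finite K"
    "\<And>k. k \<in> K \<Longrightarrow> smooth_fun_on B W (c k)" "\<And>k. k \<in> K \<Longrightarrow> vector_field_on A W' (E k)"
    "\<And>q. q \<in> W \<Longrightarrow> V q = (\<Sum>k\<in>K. c k q *\<^sub>R E k (\<phi> q))"
    "w = (\<Sum>k\<in>K. (u \<cdot> c k) *\<^sub>R E k (\<phi> p) + c k p *\<^sub>R nab (\<phi> p) (d p u) (E k))"
    by (rule hcdE[OF V]; rule that)
  obtain O' O'' b F and L :: "nat set" where H': "p \<in> O'" "open O'" "\<And>q. q \<in> O' \<Longrightarrow> \<phi> q \<in> O''" "finite L"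
    "\<And>k. k \<in> L \<Longrightarrow> smooth_fun_on B O' (b k)" "\<And>k. k \<in> L \<Longrightarrow> vector_field_on A O'' (F k)"
    "\<And>q. q \<in> O' \<Longrightarrow> V' q = (\<Sum>k\<in>L. b k q *\<^sub>R F k (\<phi> q))"
    "w' = (\<Sum>k\<in>L. (u \<cdot> b k) *\<^sub>R F k (\<phi> p) + b k p *\<^sub>R nab (\<phi> p) (d p u) (F k))"
    by (rule hcdE[OF V']; rule that)
  note aff = levi_civita_affine[OF lc]
  have E: "E k (\<phi> q) \<in> tangent_space A (\<phi> q)" if "k \<in> K" "q \<in> W" for k q
    using vector_field_tangent[OF H(6)[OF that(1)] H(3)[OF that(2)]] .
  have F: "F k (\<phi> q) \<in> tangent_space A (\<phi> q)" if "k \<in> L" "q \<in> O'" for k q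
    using vector_field_tangent[OF H'(6)[OF that(1)] H'(3)[OF that(2)]] .
  have nE: "nab (\<phi> p) (d p u) (E k) \<in> tangent_space A (\<phi> p)" if "k \<in> K" for k
    using affine_connection_tangent[OF aff H(3)[OF H(1)] H(6)[OF that] d_tangent[OF u]] .
  have nF: "nab (\<phi> p) (d p u) (F k) \<in> tangent_space A (\<phi> p)" if "k \<in> L" for k
    using affine_connection_tangent[OF aff H'(3)[OF H'(1)] H'(6)[OF that] d_tangent[OF u]] .
  have EF: "smooth_at A (\<phi> p) (\<lambda>x. g x (E k x) (F l x))"
    "d p u \<cdot> (\<lambda>x. g x (E k x) (F l x)) =
       g (\<phi> p) (nab (\<phi> p) (d p u) (E k)) (F l (\<phi> p)) + g (\<phi> p) (E k (\<phi> p)) (nab (\<phi> p) (d p u) (F l))"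
    if "k \<in> K" "l \<in> L" for k l
  proof -
    have o: "open (W' \<inter> O'')"
      using vector_field_open[OF H(6)[OF that(1)]] vector_field_open[OF H'(6)[OF that(2)]] by (rule open_Int)
    have s: "vector_field_on A (W' \<inter> O'') (E k)" "vector_field_on A (W' \<inter> O'') (F l)"
      using vector_field_subset[OF H(6)[OF that(1)] o] vector_field_subset[OF H'(6)[OF that(2)] o] by auto
    have p: "\<phi> p \<in> W' \<inter> O''" using H(1,3) H'(1,3) by blast
    show "smooth_at A (\<phi> p) (\<lambda>x. g x (E k x) (F l x))"
      using smooth_atI[OF metric_smooth[OF s] p] .
    show "d p u \<cdot> (\<lambda>x. g x (E k x) (F l x)) =
       g (\<phi> p) (nab (\<phi> p) (d p u) (E k)) (F l (\<phi> p)) + g (\<phi> p) (E k (\<phi> p)) (nab (\<phi> p) (d p u) (F l))"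
      using levi_civita_metric[OF lc p d_tangent[OF u] s] .
  qed
  have cs: "smooth_at B p (c k)" if "k \<in> K" for k using smooth_atI[OF H(5)[OF that] H(1)] .
  have bs: "smooth_at B p (b k)" if "k \<in> L" for k using smooth_atI[OF H'(5)[OF that] H'(1)] .
  let ?f = "\<lambda>k l q. g (\<phi> q) (E k (\<phi> q)) (F l (\<phi> q))"
  let ?h = "\<lambda>q. \<Sum>k\<in>K. \<Sum>l\<in>L. c k q * b l q * ?f k l q"
  have fs: "smooth_at B p (?f k l)" "u \<cdot> ?f k l =
       g (\<phi> p) (nab (\<phi> p) (d p u) (E k)) (F l (\<phi> p)) + g (\<phi> p) (E k (\<phi> p)) (nab (\<phi> p) (d p u) (F l))"
    if "k \<in> K" "l \<in> L" for k l
    using smooth_pullback_at[OF \<phi> EF(1)[OF that]] EF(2)[OF that] EF(1)[OF that] by (simp_all add: differential_act)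
  have eq: "g (\<phi> q) (V q) (V' q) = ?h q" if "q \<in> W \<inter> O'" for q
    using that unfolding H(7)[OF IntD1[OF that]] H'(7)[OF IntD2[OF that]]
    by (intro T.sum_sum_scale) (auto intro: E F)
  have prod_smooth: "smooth_at B p (\<lambda>q. c k q * b l q * ?f k l q)" if "k \<in> K" "l \<in> L" for k l
    using that by (intro smooth_at_mult[OF B] cs bs fs)
  have hs: "smooth_at B p ?h"
    by (intro smooth_at_sum[OF B] prod_smooth)
  show "smooth_at B p (\<lambda>q. g (\<phi> q) (V q) (V' q))"
    using smooth_at_cong[OF B open_Int[OF H(2) H'(2)], of p "\<lambda>q. g (\<phi> q) (V q) (V' q)" ?h] hs H(1) H'(1) eq
    by blast
  have "u \<cdot> (\<lambda>q. g (\<phi> q) (V q) (V' q)) = u \<cdot> ?h"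
    by (rule tangent_act_cong[OF B u open_Int[OF H(2) H'(2)]]) (use H(1) H'(1) eq in auto)
  also have "\<dots> = (\<Sum>k\<in>K. u \<cdot> (\<lambda>q. \<Sum>l\<in>L. c k q * b l q * ?f k l q))"
    by (rule tangent_act_sum[OF B u smooth_at_sum[OF B prod_smooth]])
  also have "\<dots> = (\<Sum>k\<in>K. \<Sum>l\<in>L. u \<cdot> (\<lambda>q. c k q * b l q * ?f k l q))"
    by (intro sum.cong[OF refl] tangent_act_sum[OF B u prod_smooth])
  also have "\<dots> = (\<Sum>k\<in>K. \<Sum>l\<in>L. ((u \<cdot> c k) * b l p + c k p * (u \<cdot> b l)) * ?f k l p + c k p * b l p * (u \<cdot> ?f k l))"
    by (intro sum.cong[OF refl])
      (simp add: tangent_act_mult[OF B u] smooth_at_mult[OF B] cs bs fs(1))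
  \<comment> \<open>Regrouping by factor: the terms that differentiate \<open>c\<close> or
    \<open>E\<close> form the derivative of \<open>V\<close>, those that differentiate
    \<open>b\<close> or \<open>F\<close> the derivative of \<open>V'\<close>.\<close>
  also have "\<dots> = (\<Sum>k\<in>K. \<Sum>l\<in>L. (u \<cdot> c k) * b l p * ?f k l p
         + c k p * b l p * g (\<phi> p) (nab (\<phi> p) (d p u) (E k)) (F l (\<phi> p)))
       + (\<Sum>k\<in>K. \<Sum>l\<in>L. c k p * (u \<cdot> b l) * ?f k l p
         + c k p * b l p * g (\<phi> p) (E k (\<phi> p)) (nab (\<phi> p) (d p u) (F l)))"
    unfolding sum.distrib[symmetric] by (intro sum.cong[OF refl]) (simp add: fs(2) algebra_simps)
  also have "(\<Sum>k\<in>K. \<Sum>l\<in>L. (u \<cdot> c k) * b l p * ?f k l p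
         + c k p * b l p * g (\<phi> p) (nab (\<phi> p) (d p u) (E k)) (F l (\<phi> p))) = g (\<phi> p) w (V' p)"
    unfolding H(8) H'(7)[OF H'(1)] sum.distrib using E[OF _ H(1)] F[OF _ H'(1)] nE
    by (subst T.add_left) (auto simp: T.sum_sum_scale intro!: T.mem_sum T.mem_scale)
  also have "(\<Sum>k\<in>K. \<Sum>l\<in>L. c k p * (u \<cdot> b l) * ?f k l p
         + c k p * b l p * g (\<phi> p) (E k (\<phi> p)) (nab (\<phi> p) (d p u) (F l))) = g (\<phi> p) (V p) w'"
    unfolding H'(8) H(7)[OF H(1)] sum.distrib using E[OF _ H(1)] F[OF _ H'(1)] nF
    by (subst T.add_right) (auto simp: T.sum_sum_scale intro!: T.mem_sum T.mem_scale)
  finally show "u \<cdot> (\<lambda>q. g (\<phi> q) (V q) (V' q)) = g (\<phi> p) w (V' p) + g (\<phi> p) (V p) w'" .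
qed

lemma hcd_ambient:
  assumes E: "vector_field_on A W E" and p: "\<phi> p \<in> W" and u: "u \<in> tangent_space B p"
  shows "hcd p u (\<lambda>q. E (\<phi> q)) (nab (\<phi> p) (d p u) E)"
proof (rule hcdI[where K = "{0}" and c = "\<lambda>k q. 1" and E = "\<lambda>k. E" and W = "\<phi> -` W" and W' = W])
  have o: "open (\<phi> -` W)" by (rule smooth_pullback_continuous[OF A \<phi> vector_field_open[OF E]])
  then show "open (\<phi> -` W)" "\<And>k. smooth_fun_on B (\<phi> -` W) (\<lambda>q. 1)"
    using smooth_fun_on_const[OF B] by auto
qed (use E p tangent_act_const[OF B u] in auto)

text \<open>Torsion-freeness along the map. The two derivatives may be represented by unrelated
  ambient fields: the connection terms combine to brackets of the \<open>F l\<close> with the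
  \<open>E k\<close>, and evaluation on a function \<open>f\<close> accounts for the derivatives of
  the coefficients.\<close>

lemma hcd_lie_bracket:
  assumes X: "vector_field_on B W0 X" and Y: "vector_field_on B W0 Y" and p: "p \<in> W0"
    and w: "hcd p (X p) (\<lambda>q. d q (Y q)) w" and w': "hcd p (Y p) (\<lambda>q. d q (X q)) w'"
  shows "w - w' = d p (lie_bracket B X Y p)"
proof -
  note u = vector_field_tangent[OF X p] and v = vector_field_tangent[OF Y p]
  obtain W W' c E and K :: "nat set" where H: "p \<in> W" "open W" "\<And>q. q \<in> W \<Longrightarrow> \<phi> q \<in> W'" "finite K"
    "\<And>k. k \<in> K \<Longrightarrow> smooth_fun_on B W (c k)" "\<And>k. k \<in> K \<Longrightarrow> vector_field_on A W' (E k)"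
    "\<And>q. q \<in> W \<Longrightarrow> d q (Y q) = (\<Sum>k\<in>K. c k q *\<^sub>R E k (\<phi> q))"
    "w = (\<Sum>k\<in>K. (X p \<cdot> c k) *\<^sub>R E k (\<phi> p) + c k p *\<^sub>R nab (\<phi> p) (d p (X p)) (E k))"
    by (rule hcdE[OF w]; rule that)
  obtain O' O'' b F and L :: "nat set" where H': "p \<in> O'" "open O'" "\<And>q. q \<in> O' \<Longrightarrow> \<phi> q \<in> O''" "finite L"
    "\<And>k. k \<in> L \<Longrightarrow> smooth_fun_on B O' (b k)" "\<And>k. k \<in> L \<Longrightarrow> vector_field_on A O'' (F k)"
    "\<And>q. q \<in> O' \<Longrightarrow> d q (X q) = (\<Sum>k\<in>L. b k q *\<^sub>R F k (\<phi> q))"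
    "w' = (\<Sum>k\<in>L. (Y p \<cdot> b k) *\<^sub>R F k (\<phi> p) + b k p *\<^sub>R nab (\<phi> p) (d p (Y p)) (F k))"
    by (rule hcdE[OF w']; rule that)
  note aff = levi_civita_affine[OF lc]
  have E: "E k (\<phi> p) \<in> tangent_space A (\<phi> p)" if "k \<in> K" for k
    using vector_field_tangent[OF H(6)[OF that(1)] H(3)[OF H(1)]] .
  have F: "F k (\<phi> p) \<in> tangent_space A (\<phi> p)" if "k \<in> L" for k
    using vector_field_tangent[OF H'(6)[OF that(1)] H'(3)[OF H'(1)]] .
  have tor: "nab (\<phi> p) (F l (\<phi> p)) (E k) - nab (\<phi> p) (E k (\<phi> p)) (F l) = lie_bracket A (F l) (E k) (\<phi> p)"
    if "k \<in> K" "l \<in> L" for k l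
  proof -
    have o: "open (W' \<inter> O'')"
      using vector_field_open[OF H(6)[OF that(1)]] vector_field_open[OF H'(6)[OF that(2)]] by (rule open_Int)
    have s: "vector_field_on A (W' \<inter> O'') (E k)" "vector_field_on A (W' \<inter> O'') (F l)"
      using vector_field_subset[OF H(6)[OF that(1)] o] vector_field_subset[OF H'(6)[OF that(2)] o] by auto
    have "\<phi> p \<in> W' \<inter> O''" using H(1,3) H'(1,3) by blast
    from levi_civita_torsion[OF lc this s(2,1)] show ?thesis .
  qed
  have nE: "nab (\<phi> p) (d p (X p)) (E k) = (\<Sum>l\<in>L. b l p *\<^sub>R nab (\<phi> p) (F l (\<phi> p)) (E k))" if "k \<in> K" for k
    unfolding H'(7)[OF H'(1)]
    by (rule affine_connection_sum_left[OF A aff H(3)[OF H(1)] H(6)[OF that] F])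
  have nF: "nab (\<phi> p) (d p (Y p)) (F l) = (\<Sum>k\<in>K. c k p *\<^sub>R nab (\<phi> p) (E k (\<phi> p)) (F l))" if "l \<in> L" for l
    unfolding H(7)[OF H(1)]
    by (rule affine_connection_sum_left[OF A aff H'(3)[OF H'(1)] H'(6)[OF that] E])
  \<comment> \<open>The direction \<open>X\<close> is expanded in the \<open>F l\<close> and the
    direction \<open>Y\<close> in the \<open>E k\<close>; each pair then contributes one torsion
    term.\<close>
  have eq1: "(\<Sum>k\<in>K. c k p *\<^sub>R nab (\<phi> p) (d p (X p)) (E k)) - (\<Sum>l\<in>L. b l p *\<^sub>R nab (\<phi> p) (d p (Y p)) (F l))
      = (\<Sum>k\<in>K. \<Sum>l\<in>L. (c k p * b l p) *\<^sub>R lie_bracket A (F l) (E k) (\<phi> p))"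
  proof -
    have "(\<Sum>k\<in>K. c k p *\<^sub>R nab (\<phi> p) (d p (X p)) (E k))
        = (\<Sum>k\<in>K. \<Sum>l\<in>L. (c k p * b l p) *\<^sub>R nab (\<phi> p) (F l (\<phi> p)) (E k))"
      by (intro sum.cong[OF refl]) (simp add: nE scaleR_sum_right)
    moreover have "(\<Sum>l\<in>L. b l p *\<^sub>R nab (\<phi> p) (d p (Y p)) (F l))
        = (\<Sum>l\<in>L. \<Sum>k\<in>K. (c k p * b l p) *\<^sub>R nab (\<phi> p) (E k (\<phi> p)) (F l))"
      by (intro sum.cong[OF refl]) (simp add: nF scaleR_sum_right mult.commute)
    moreover have "\<dots> = (\<Sum>k\<in>K. \<Sum>l\<in>L. (c k p * b l p) *\<^sub>R nab (\<phi> p) (E k (\<phi> p)) (F l))"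
      by (rule sum.swap)
    ultimately show ?thesis
      by (simp add: sum_subtractf[symmetric] tor[symmetric] scaleR_diff_right)
  qed
  have eq2: "w - w' = (\<Sum>k\<in>K. (X p \<cdot> c k) *\<^sub>R E k (\<phi> p)) - (\<Sum>l\<in>L. (Y p \<cdot> b l) *\<^sub>R F l (\<phi> p))
      + (\<Sum>k\<in>K. \<Sum>l\<in>L. (c k p * b l p) *\<^sub>R lie_bracket A (F l) (E k) (\<phi> p))"
    unfolding H(8) H'(8) sum.distrib eq1[symmetric] by simp
  show ?thesis
  proof (rule tvec_eqI)
    fix f
    show "(w - w') \<cdot> f = d p (lie_bracket B X Y p) \<cdot> f"
    proof (cases "smooth_at A (\<phi> p) f")
      \<comment> \<open>On functions that are not smooth at the point both sides vanish by
        convention.\<close>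
      case False
      then have "E k (\<phi> p) \<cdot> f = 0" if "k \<in> K" for k using tangent_act_not_smooth[OF E[OF that]] by simp
      moreover from False have "F l (\<phi> p) \<cdot> f = 0" if "l \<in> L" for l
        using tangent_act_not_smooth[OF F[OF that]] by simp
      ultimately show ?thesis
        unfolding eq2 using False by (simp add: act_sum differential_act lie_bracket_act)
    next
      case True
      then obtain Wf where Wf: "\<phi> p \<in> Wf" "smooth_fun_on A Wf f" unfolding smooth_at_def by blast
      \<comment> \<open>A neighbourhood on which both representations hold and \<open>f\<close> is
        smooth, so that the derivatives of the pullback of \<open>f\<close> along \<open>X\<close>
        and \<open>Y\<close> can be replaced by coefficient sums before they are differentiated
        again.\<close>
      define N where "N = W \<inter> O' \<inter> \<phi> -` Wf \<inter> W0"
      have N: "open N" "p \<in> N"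
        unfolding N_def using smooth_pullback_continuous[OF A \<phi> smooth_fun_on_open[OF Wf(2)]]
          H(1,2) H'(1,2) Wf(1) p vector_field_open[OF X] by auto
      have fq: "smooth_at A (\<phi> q) f" if "q \<in> N" for q
        using that smooth_atI[OF Wf(2)] unfolding N_def by blast
      have Yf: "Y q \<cdot> (\<lambda>q. f (\<phi> q)) = (\<Sum>k\<in>K. c k q * (E k (\<phi> q) \<cdot> f))" if "q \<in> N" for q
      proof -
        have "Y q \<cdot> (\<lambda>q. f (\<phi> q)) = d q (Y q) \<cdot> f" using fq[OF that] by (simp add: differential_act)
        also have "\<dots> = (\<Sum>k\<in>K. c k q * (E k (\<phi> q) \<cdot> f))"
          using that H(7)[of q] unfolding N_def by (simp add: act_sum)
        finally show ?thesis .
      qed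
      have Xf: "X q \<cdot> (\<lambda>q. f (\<phi> q)) = (\<Sum>l\<in>L. b l q * (F l (\<phi> q) \<cdot> f))" if "q \<in> N" for q
      proof -
        have "X q \<cdot> (\<lambda>q. f (\<phi> q)) = d q (X q) \<cdot> f" using fq[OF that] by (simp add: differential_act)
        also have "\<dots> = (\<Sum>l\<in>L. b l q * (F l (\<phi> q) \<cdot> f))"
          using that H'(7)[of q] unfolding N_def by (simp add: act_sum)
        finally show ?thesis .
      qed
      have cs: "smooth_at B p (c k)" if "k \<in> K" for k using smooth_atI[OF H(5)[OF that] H(1)] .
      have bs: "smooth_at B p (b k)" if "k \<in> L" for k using smooth_atI[OF H'(5)[OF that] H'(1)] .
      have Ef: "smooth_at A (\<phi> p) (\<lambda>x. E k x \<cdot> f)" if "k \<in> K" for k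
        using vector_field_act_at[OF H(6)[OF that] H(3)[OF H(1)] True] .
      have Ff: "smooth_at A (\<phi> p) (\<lambda>x. F k x \<cdot> f)" if "k \<in> L" for k
        using vector_field_act_at[OF H'(6)[OF that] H'(3)[OF H'(1)] True] .
      have Efs: "smooth_at B p (\<lambda>q. E k (\<phi> q) \<cdot> f)" if "k \<in> K" for k
        using smooth_pullback_at[OF \<phi> Ef[OF that]] .
      have Ffs: "smooth_at B p (\<lambda>q. F k (\<phi> q) \<cdot> f)" if "k \<in> L" for k
        using smooth_pullback_at[OF \<phi> Ff[OF that]] .
      have XE: "X p \<cdot> (\<lambda>q. E k (\<phi> q) \<cdot> f) = (\<Sum>l\<in>L. b l p * (F l (\<phi> p) \<cdot> (\<lambda>x. E k x \<cdot> f)))" if "k \<in> K" for k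
      proof -
        have "X p \<cdot> (\<lambda>q. E k (\<phi> q) \<cdot> f) = d p (X p) \<cdot> (\<lambda>x. E k x \<cdot> f)"
          using Ef[OF that] by (simp add: differential_act)
        then show ?thesis by (simp add: H'(7)[OF H'(1)] act_sum)
      qed
      have YF: "Y p \<cdot> (\<lambda>q. F l (\<phi> q) \<cdot> f) = (\<Sum>k\<in>K. c k p * (E k (\<phi> p) \<cdot> (\<lambda>x. F l x \<cdot> f)))" if "l \<in> L" for l
      proof -
        have "Y p \<cdot> (\<lambda>q. F l (\<phi> q) \<cdot> f) = d p (Y p) \<cdot> (\<lambda>x. F l x \<cdot> f)"
          using Ff[OF that] by (simp add: differential_act)
        then show ?thesis by (simp add: H(7)[OF H(1)] act_sum)
      qed
      have 1: "X p \<cdot> (\<lambda>q. Y q \<cdot> (\<lambda>q. f (\<phi> q))) = (\<Sum>k\<in>K. (X p \<cdot> c k) * (E k (\<phi> p) \<cdot> f))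
          + (\<Sum>k\<in>K. \<Sum>l\<in>L. c k p * b l p * (F l (\<phi> p) \<cdot> (\<lambda>x. E k x \<cdot> f)))"
      proof -
        have "X p \<cdot> (\<lambda>q. Y q \<cdot> (\<lambda>q. f (\<phi> q))) = X p \<cdot> (\<lambda>q. \<Sum>k\<in>K. c k q * (E k (\<phi> q) \<cdot> f))"
          by (rule tangent_act_cong[OF B u N Yf])
        also have "\<dots> = (\<Sum>k\<in>K. X p \<cdot> (\<lambda>q. c k q * (E k (\<phi> q) \<cdot> f)))"
          by (rule tangent_act_sum[OF B u smooth_at_mult[OF B cs Efs]])
        also have "\<dots> = (\<Sum>k\<in>K. (X p \<cdot> c k) * (E k (\<phi> p) \<cdot> f)
            + c k p * (\<Sum>l\<in>L. b l p * (F l (\<phi> p) \<cdot> (\<lambda>x. E k x \<cdot> f))))"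
          by (intro sum.cong[OF refl]) (simp add: tangent_act_mult[OF B u cs Efs] XE)
        finally show ?thesis by (simp add: sum.distrib sum_distrib_left mult.assoc)
      qed
      have 2: "Y p \<cdot> (\<lambda>q. X q \<cdot> (\<lambda>q. f (\<phi> q))) = (\<Sum>l\<in>L. (Y p \<cdot> b l) * (F l (\<phi> p) \<cdot> f))
          + (\<Sum>k\<in>K. \<Sum>l\<in>L. c k p * b l p * (E k (\<phi> p) \<cdot> (\<lambda>x. F l x \<cdot> f)))"
      proof -
        have "Y p \<cdot> (\<lambda>q. X q \<cdot> (\<lambda>q. f (\<phi> q))) = Y p \<cdot> (\<lambda>q. \<Sum>l\<in>L. b l q * (F l (\<phi> q) \<cdot> f))"
          by (rule tangent_act_cong[OF B v N Xf])
        also have "\<dots> = (\<Sum>l\<in>L. Y p \<cdot> (\<lambda>q. b l q * (F l (\<phi> q) \<cdot> f)))"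
          by (rule tangent_act_sum[OF B v smooth_at_mult[OF B bs Ffs]])
        also have "\<dots> = (\<Sum>l\<in>L. (Y p \<cdot> b l) * (F l (\<phi> p) \<cdot> f)
            + b l p * (\<Sum>k\<in>K. c k p * (E k (\<phi> p) \<cdot> (\<lambda>x. F l x \<cdot> f))))"
          by (intro sum.cong[OF refl]) (simp add: tangent_act_mult[OF B v bs Ffs] YF)
        also have "\<dots> = (\<Sum>l\<in>L. (Y p \<cdot> b l) * (F l (\<phi> p) \<cdot> f))
            + (\<Sum>l\<in>L. \<Sum>k\<in>K. c k p * b l p * (E k (\<phi> p) \<cdot> (\<lambda>x. F l x \<cdot> f)))"
          by (simp add: sum.distrib sum_distrib_left mult.assoc mult.left_commute)
        finally show ?thesis by (subst sum.swap)
      qed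
      have "d p (lie_bracket B X Y p) \<cdot> f = X p \<cdot> (\<lambda>q. Y q \<cdot> (\<lambda>q. f (\<phi> q))) - Y p \<cdot> (\<lambda>q. X q \<cdot> (\<lambda>q. f (\<phi> q)))"
        using True smooth_pullback_at[OF \<phi> True] by (simp add: differential_act lie_bracket_act)
      also have "\<dots> = (w - w') \<cdot> f"
        unfolding 1 2 eq2 using True
        by (simp add: act_sum lie_bracket_act sum_subtractf[symmetric] right_diff_distrib)
      finally show ?thesis by simp
    qed
  qed
qed

end

section \<open>Immersions into nearly Kaehler manifolds\<close>

locale nk_immersion = along B A g nab \<phi>
  for B :: "('n::{t2_space,second_countable_topology}, 'f::euclidean_space) chart set"
    and A :: "('m::{t2_space,second_countable_topology}, 'e::euclidean_space) chart set"
    and g nab \<phi> +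
  fixes J :: "'m \<Rightarrow> 'm tvec \<Rightarrow> 'm tvec" and nabB :: "'n connection"
    and h :: "'n \<Rightarrow> 'n tvec \<Rightarrow> 'n tvec \<Rightarrow> 'm tvec"
  assumes nk: "nearly_kaehler A g J nab"
    and inj: "\<And>p. inj_on (d p) (tangent_space B p)"
    and lcB: "levi_civita B (pullback_metric A g \<phi>) nabB"
    and gauss: "\<And>W p u Y. p \<in> W \<Longrightarrow> u \<in> tangent_space B p \<Longrightarrow> vector_field_on B W Y \<Longrightarrow>
       hcd p u (\<lambda>q. d q (Y q)) (d p (nabB p u Y) + h p u (Y p))"
    and normal: "\<And>p u v. u \<in> tangent_space B p \<Longrightarrow> v \<in> tangent_space B p \<Longrightarrow>
       h p u v \<in> normal_space B A g \<phi> p"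
begin

abbreviation G :: "'n metric" where "G \<equiv> pullback_metric A g \<phi>"

lemma G_eq: "G p u v = g (\<phi> p) (d p u) (d p v)"
  by (rule pullback_metric_def)

lemma d_add: "d p (u + v) = d p u + d p v" and d_scale: "d p (a *\<^sub>R u) = a *\<^sub>R d p u"
  using linear_differential[of A \<phi> p] by (simp_all add: linear_add linear_scale)

lemma inner_on_G: "inner_space (tangent_space B p) (G p)"
proof (unfold inner_space_def inner_on_def, intro conjI ballI allI impI)
  show "subspace (tangent_space B p)" by (rule subspace_tangent_space[OF B])
next
  fix u v assume "u \<in> tangent_space B p" "v \<in> tangent_space B p"
  then show "G p u v = G p v u" unfolding G_eq by (intro T.sym d_tangent)
next
  fix u v w a b assume "u \<in> tangent_space B p" "v \<in> tangent_space B p" "w \<in> tangent_space B p"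
  then show "G p (a *\<^sub>R u + b *\<^sub>R v) w = a * G p u w + b * G p v w"
    unfolding G_eq d_add d_scale by (intro T.lin d_tangent)
next
  fix u assume u: "u \<in> tangent_space B p" "u \<noteq> 0"
  have 0: "0 \<in> tangent_space B p" by (rule subspace_0[OF subspace_tangent_space[OF B]])
  have "d p u \<noteq> d p 0" using inj_onD[OF inj _ u(1) 0] u(2) by blast
  then have "d p u \<noteq> 0" using linear_0[OF linear_differential] by metis
  then show "G p u u > 0" unfolding G_eq by (rule T.pos[OF d_tangent[OF u(1)]])
qed

sublocale G: inner_space "tangent_space B p" "G p" for p
  by (rule inner_on_G)

lemma J_tangent: "u \<in> tangent_space A x \<Longrightarrow> J x u \<in> tangent_space A x"
  and J_J: "u \<in> tangent_space A x \<Longrightarrow> J x (J x u) = - u"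
  and J_lin: "u \<in> tangent_space A x \<Longrightarrow> v \<in> tangent_space A x \<Longrightarrow>
    J x (a *\<^sub>R u + b *\<^sub>R v) = a *\<^sub>R J x u + b *\<^sub>R J x v"
  and J_field: "vector_field_on A W X \<Longrightarrow> vector_field_on A W (\<lambda>q. J q (X q))"
  using nk unfolding nearly_kaehler_def almost_complex_structure_def by meson+

lemma hermitian: "u \<in> tangent_space A x \<Longrightarrow> v \<in> tangent_space A x \<Longrightarrow> g x (J x u) (J x v) = g x u v"
  using nk unfolding nearly_kaehler_def by meson

lemma nabla_J_skew: "x \<in> W \<Longrightarrow> vector_field_on A W X \<Longrightarrow> vector_field_on A W Y \<Longrightarrow>
    nabla_J nab J X Y x + nabla_J nab J Y X x = 0"
  using nk unfolding nearly_kaehler_def by meson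

lemma J_add: "u \<in> tangent_space A x \<Longrightarrow> v \<in> tangent_space A x \<Longrightarrow> J x (u + v) = J x u + J x v"
  using J_lin[of u x v 1 1] by simp

lemma J_scale: "u \<in> tangent_space A x \<Longrightarrow> J x (a *\<^sub>R u) = a *\<^sub>R J x u"
  using J_lin[of u x u a 0] by simp

lemma J_sum: "(\<And>i. i \<in> I \<Longrightarrow> u i \<in> tangent_space A x) \<Longrightarrow>
    J x (\<Sum>i\<in>I. a i *\<^sub>R u i) = (\<Sum>i\<in>I. a i *\<^sub>R J x (u i))"
proof (induction I rule: infinite_finite_induct)
  case (insert i I)
  have "(\<Sum>i\<in>I. a i *\<^sub>R u i) \<in> tangent_space A x" using insert.prems by (auto intro!: T.mem_sum T.mem_scale)
  then show ?case using insert by (simp add: J_add J_scale T.mem_scale)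
qed (use J_scale[of 0 x 0] in \<open>simp_all add: subspace_0[OF subspace_tangent_space[OF A]]\<close>)

lemma J_skew:
  assumes u: "u \<in> tangent_space A x" and v: "v \<in> tangent_space A x"
  shows "g x (J x u) v = - g x u (J x v)"
  using hermitian[OF J_tangent[OF u] v] J_J[OF u] T.minus_left[OF u J_tangent[OF v]] by simp

text \<open>The nearly Kaehler condition for fields along the map. Applying \<open>J\<close> to the
  ambient fields of a representation keeps its coefficients, so the terms with differentiated
  coefficients cancel in \<open>z - J w\<close>; what remains is bilinear in the values at
  \<open>p\<close>, and the two sums cancel term by term.\<close>

lemma hcd_J:
  assumes X: "vector_field_on B W0 X" and Y: "vector_field_on B W0 Y" and p: "p \<in> W0"
    and w: "hcd p (X p) (\<lambda>q. d q (Y q)) w" and w': "hcd p (Y p) (\<lambda>q. d q (X q)) w'"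
  shows "\<exists>z z'. hcd p (X p) (\<lambda>q. J (\<phi> q) (d q (Y q))) z \<and> hcd p (Y p) (\<lambda>q. J (\<phi> q) (d q (X q))) z' \<and>
    (z - J (\<phi> p) w) + (z' - J (\<phi> p) w') = 0"
proof -
  note u = vector_field_tangent[OF X p] and v = vector_field_tangent[OF Y p]
  obtain W W' c E and K :: "nat set" where H: "p \<in> W" "open W" "\<And>q. q \<in> W \<Longrightarrow> \<phi> q \<in> W'" "finite K"
    "\<And>k. k \<in> K \<Longrightarrow> smooth_fun_on B W (c k)" "\<And>k. k \<in> K \<Longrightarrow> vector_field_on A W' (E k)"
    "\<And>q. q \<in> W \<Longrightarrow> d q (Y q) = (\<Sum>k\<in>K. c k q *\<^sub>R E k (\<phi> q))"
    "w = (\<Sum>k\<in>K. (X p \<cdot> c k) *\<^sub>R E k (\<phi> p) + c k p *\<^sub>R nab (\<phi> p) (d p (X p)) (E k))"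
    by (rule hcdE[OF w]; rule that)
  obtain O' O'' b F and L :: "nat set" where H': "p \<in> O'" "open O'" "\<And>q. q \<in> O' \<Longrightarrow> \<phi> q \<in> O''" "finite L"
    "\<And>k. k \<in> L \<Longrightarrow> smooth_fun_on B O' (b k)" "\<And>k. k \<in> L \<Longrightarrow> vector_field_on A O'' (F k)"
    "\<And>q. q \<in> O' \<Longrightarrow> d q (X q) = (\<Sum>k\<in>L. b k q *\<^sub>R F k (\<phi> q))"
    "w' = (\<Sum>k\<in>L. (Y p \<cdot> b k) *\<^sub>R F k (\<phi> p) + b k p *\<^sub>R nab (\<phi> p) (d p (Y p)) (F k))"
    by (rule hcdE[OF w']; rule that)
  note aff = levi_civita_affine[OF lc]
  have E: "E k (\<phi> q) \<in> tangent_space A (\<phi> q)" if "k \<in> K" "q \<in> W" for k q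
    using vector_field_tangent[OF H(6)[OF that(1)] H(3)[OF that(2)]] .
  have F: "F k (\<phi> q) \<in> tangent_space A (\<phi> q)" if "k \<in> L" "q \<in> O'" for k q
    using vector_field_tangent[OF H'(6)[OF that(1)] H'(3)[OF that(2)]] .
  have nE: "nab (\<phi> p) (d p (X p)) (E k) \<in> tangent_space A (\<phi> p)" if "k \<in> K" for k
    using affine_connection_tangent[OF aff H(3)[OF H(1)] H(6)[OF that] d_tangent[OF u]] .
  have nF: "nab (\<phi> p) (d p (Y p)) (F k) \<in> tangent_space A (\<phi> p)" if "k \<in> L" for k
    using affine_connection_tangent[OF aff H'(3)[OF H'(1)] H'(6)[OF that] d_tangent[OF v]] .
  define z where "z = (\<Sum>k\<in>K. (X p \<cdot> c k) *\<^sub>R J (\<phi> p) (E k (\<phi> p))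
      + c k p *\<^sub>R nab (\<phi> p) (d p (X p)) (\<lambda>x. J x (E k x)))"
  define z' where "z' = (\<Sum>k\<in>L. (Y p \<cdot> b k) *\<^sub>R J (\<phi> p) (F k (\<phi> p))
      + b k p *\<^sub>R nab (\<phi> p) (d p (Y p)) (\<lambda>x. J x (F k x)))"
  have 1: "hcd p (X p) (\<lambda>q. J (\<phi> q) (d q (Y q))) z"
  proof (rule hcdI[OF H(1-5) J_field[OF H(6)] _ z_def])
    show "J (\<phi> q) (d q (Y q)) = (\<Sum>k\<in>K. c k q *\<^sub>R J (\<phi> q) (E k (\<phi> q)))" if "q \<in> W" for q
      unfolding H(7)[OF that] by (rule J_sum[OF E[OF _ that]])
  qed
  have 2: "hcd p (Y p) (\<lambda>q. J (\<phi> q) (d q (X q))) z'"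
  proof (rule hcdI[OF H'(1-5) J_field[OF H'(6)] _ z'_def])
    show "J (\<phi> q) (d q (X q)) = (\<Sum>k\<in>L. b k q *\<^sub>R J (\<phi> q) (F k (\<phi> q)))" if "q \<in> O'" for q
      unfolding H'(7)[OF that] by (rule J_sum[OF F[OF _ that]])
  qed
  have Jw: "J (\<phi> p) w = (\<Sum>k\<in>K. (X p \<cdot> c k) *\<^sub>R J (\<phi> p) (E k (\<phi> p))
      + c k p *\<^sub>R J (\<phi> p) (nab (\<phi> p) (d p (X p)) (E k)))"
    unfolding H(8) sum.distrib using E[OF _ H(1)] nE
    by (subst J_add) (auto intro!: T.mem_sum T.mem_scale simp: J_sum)
  have Jw': "J (\<phi> p) w' = (\<Sum>k\<in>L. (Y p \<cdot> b k) *\<^sub>R J (\<phi> p) (F k (\<phi> p))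
      + b k p *\<^sub>R J (\<phi> p) (nab (\<phi> p) (d p (Y p)) (F k)))"
    unfolding H'(8) sum.distrib using F[OF _ H'(1)] nF
    by (subst J_add) (auto intro!: T.mem_sum T.mem_scale simp: J_sum)
  have 3: "z - J (\<phi> p) w = (\<Sum>k\<in>K. \<Sum>l\<in>L. (c k p * b l p) *\<^sub>R nabla_J nab J (F l) (E k) (\<phi> p))"
  proof -
    have "z - J (\<phi> p) w = (\<Sum>k\<in>K. c k p *\<^sub>R
        (nab (\<phi> p) (d p (X p)) (\<lambda>x. J x (E k x)) - J (\<phi> p) (nab (\<phi> p) (d p (X p)) (E k))))"
      unfolding z_def Jw by (simp add: sum_subtractf[symmetric] scaleR_diff_right)
    also have "\<dots> = (\<Sum>k\<in>K. c k p *\<^sub>R (\<Sum>l\<in>L. b l p *\<^sub>R nabla_J nab J (F l) (E k) (\<phi> p)))"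
    proof (rule sum.cong[OF refl])
      fix k assume k: "k \<in> K"
      have Fp: "F l (\<phi> p) \<in> tangent_space A (\<phi> p)" if "l \<in> L" for l using F[OF that H'(1)] .
      have "nab (\<phi> p) (d p (X p)) (\<lambda>x. J x (E k x)) = (\<Sum>l\<in>L. b l p *\<^sub>R nab (\<phi> p) (F l (\<phi> p)) (\<lambda>x. J x (E k x)))"
        unfolding H'(7)[OF H'(1)]
        by (rule affine_connection_sum_left[OF A aff H(3)[OF H(1)] J_field[OF H(6)[OF k]] Fp])
      moreover have "J (\<phi> p) (nab (\<phi> p) (d p (X p)) (E k)) = (\<Sum>l\<in>L. b l p *\<^sub>R J (\<phi> p) (nab (\<phi> p) (F l (\<phi> p)) (E k)))"
        unfolding H'(7)[OF H'(1)]
        by (subst affine_connection_sum_left[OF A aff H(3)[OF H(1)] H(6)[OF k] Fp], assumption)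
          (intro J_sum affine_connection_tangent[OF aff H(3)[OF H(1)] H(6)[OF k]] Fp)
      ultimately show "c k p *\<^sub>R (nab (\<phi> p) (d p (X p)) (\<lambda>x. J x (E k x)) - J (\<phi> p) (nab (\<phi> p) (d p (X p)) (E k)))
          = c k p *\<^sub>R (\<Sum>l\<in>L. b l p *\<^sub>R nabla_J nab J (F l) (E k) (\<phi> p))"
        by (simp add: nabla_J_def sum_subtractf scaleR_diff_right)
    qed
    finally show ?thesis by (simp add: scaleR_sum_right)
  qed
  have 4: "z' - J (\<phi> p) w' = (\<Sum>l\<in>L. \<Sum>k\<in>K. (c k p * b l p) *\<^sub>R nabla_J nab J (E k) (F l) (\<phi> p))"
  proof -
    have "z' - J (\<phi> p) w' = (\<Sum>l\<in>L. b l p *\<^sub>R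
        (nab (\<phi> p) (d p (Y p)) (\<lambda>x. J x (F l x)) - J (\<phi> p) (nab (\<phi> p) (d p (Y p)) (F l))))"
      unfolding z'_def Jw' by (simp add: sum_subtractf[symmetric] scaleR_diff_right)
    also have "\<dots> = (\<Sum>l\<in>L. b l p *\<^sub>R (\<Sum>k\<in>K. c k p *\<^sub>R nabla_J nab J (E k) (F l) (\<phi> p)))"
    proof (rule sum.cong[OF refl])
      fix l assume l: "l \<in> L"
      have Ep: "E k (\<phi> p) \<in> tangent_space A (\<phi> p)" if "k \<in> K" for k using E[OF that H(1)] .
      have "nab (\<phi> p) (d p (Y p)) (\<lambda>x. J x (F l x)) = (\<Sum>k\<in>K. c k p *\<^sub>R nab (\<phi> p) (E k (\<phi> p)) (\<lambda>x. J x (F l x)))"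
        unfolding H(7)[OF H(1)]
        by (rule affine_connection_sum_left[OF A aff H'(3)[OF H'(1)] J_field[OF H'(6)[OF l]] Ep])
      moreover have "J (\<phi> p) (nab (\<phi> p) (d p (Y p)) (F l)) = (\<Sum>k\<in>K. c k p *\<^sub>R J (\<phi> p) (nab (\<phi> p) (E k (\<phi> p)) (F l)))"
        unfolding H(7)[OF H(1)]
        by (subst affine_connection_sum_left[OF A aff H'(3)[OF H'(1)] H'(6)[OF l] Ep], assumption)
          (intro J_sum affine_connection_tangent[OF aff H'(3)[OF H'(1)] H'(6)[OF l]] Ep)
      ultimately show "b l p *\<^sub>R (nab (\<phi> p) (d p (Y p)) (\<lambda>x. J x (F l x)) - J (\<phi> p) (nab (\<phi> p) (d p (Y p)) (F l)))
          = b l p *\<^sub>R (\<Sum>k\<in>K. c k p *\<^sub>R nabla_J nab J (E k) (F l) (\<phi> p))"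
        by (simp add: nabla_J_def sum_subtractf scaleR_diff_right)
    qed
    finally show ?thesis by (simp add: scaleR_sum_right mult.commute)
  qed
  have 5: "nabla_J nab J (F l) (E k) (\<phi> p) + nabla_J nab J (E k) (F l) (\<phi> p) = 0"
    if "k \<in> K" "l \<in> L" for k l
  proof -
    have o: "open (W' \<inter> O'')"
      using vector_field_open[OF H(6)[OF that(1)]] vector_field_open[OF H'(6)[OF that(2)]] by (rule open_Int)
    have s: "vector_field_on A (W' \<inter> O'') (E k)" "vector_field_on A (W' \<inter> O'') (F l)"
      using vector_field_subset[OF H(6)[OF that(1)] o] vector_field_subset[OF H'(6)[OF that(2)] o] by auto
    have "\<phi> p \<in> W' \<inter> O''" using H(1,3) H'(1,3) by blast
    from nabla_J_skew[OF this s(2,1)] show ?thesis .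
  qed
  have "(z - J (\<phi> p) w) + (z' - J (\<phi> p) w') = (\<Sum>k\<in>K. \<Sum>l\<in>L. (c k p * b l p) *\<^sub>R
      (nabla_J nab J (F l) (E k) (\<phi> p) + nabla_J nab J (E k) (F l) (\<phi> p)))"
    unfolding 3 4 by (subst (2) sum.swap) (simp add: sum.distrib scaleR_add_right)
  also have "\<dots> = 0" by (simp add: 5)
  finally show ?thesis using 1 2 by blast
qed

section \<open>The second fundamental form\<close>

lemma nabB_tangent: "p \<in> W \<Longrightarrow> vector_field_on B W Y \<Longrightarrow> u \<in> tangent_space B p \<Longrightarrow>
    nabB p u Y \<in> tangent_space B p"
  by (rule affine_connection_tangent[OF levi_civita_affine[OF lcB]])

lemma h_tangent: "u \<in> tangent_space B p \<Longrightarrow> v \<in> tangent_space B p \<Longrightarrow> h p u v \<in> tangent_space A (\<phi> p)"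
  using normal unfolding normal_space_def by blast

lemma h_normal: "u \<in> tangent_space B p \<Longrightarrow> v \<in> tangent_space B p \<Longrightarrow> w \<in> tangent_space B p \<Longrightarrow>
    g (\<phi> p) (h p u v) (d p w) = 0"
  using normal unfolding normal_space_def by blast

text \<open>Bilinearity is not part of the definition of \<open>h\<close>. By metric compatibility
  the inner products of the derivative \<open>D u\<close> with ambient fields are linear in
  \<open>u\<close>; nondegeneracy makes \<open>D\<close> linear, and its tangential part is linear
  because \<open>nabB\<close> is.\<close>

lemma h_lin_left:
  assumes u: "u \<in> tangent_space B p" and v: "v \<in> tangent_space B p" and y: "y \<in> tangent_space B p"
  shows "h p (a *\<^sub>R u + b *\<^sub>R v) y = a *\<^sub>R h p u y + b *\<^sub>R h p v y"
proof -
  obtain W Y where Y: "p \<in> W" "vector_field_on B W Y" "Y p = y" using tangent_vector_extends[OF B y] .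
  define D where "D u = d p (nabB p u Y) + h p u y" for u
  have D: "hcd p u (\<lambda>q. d q (Y q)) (D u)" if "u \<in> tangent_space B p" for u
    using gauss[OF Y(1) that Y(2)] unfolding D_def Y(3) .
  have ab: "a *\<^sub>R u + b *\<^sub>R v \<in> tangent_space B p" using u v by auto
  have Dt: "D u \<in> tangent_space A (\<phi> p)" if "u \<in> tangent_space B p" for u
    using hcd_tangent(2)[OF D[OF that] that] .
  have "D (a *\<^sub>R u + b *\<^sub>R v) = a *\<^sub>R D u + b *\<^sub>R D v"
  proof (rule T.eqI)
    show "D (a *\<^sub>R u + b *\<^sub>R v) \<in> tangent_space A (\<phi> p)" by (rule Dt[OF ab])
    show "a *\<^sub>R D u + b *\<^sub>R D v \<in> tangent_space A (\<phi> p)" using Dt[OF u] Dt[OF v] by auto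
    fix e assume e: "e \<in> tangent_space A (\<phi> p)"
    obtain O' E where E: "\<phi> p \<in> O'" "vector_field_on A O' E" "E (\<phi> p) = e" using tangent_vector_extends[OF A e] .
    have *: "g (\<phi> p) (D u) e = u \<cdot> (\<lambda>q. g (\<phi> q) (d q (Y q)) (E (\<phi> q))) - g (\<phi> p) (d p y) (nab (\<phi> p) (d p u) E)"
      if "u \<in> tangent_space B p" for u
      using hcd_metric(1)[OF D[OF that] hcd_ambient[OF E(2,1) that] that] E(3) Y(3) by simp
    have n: "nab (\<phi> p) (d p u) E \<in> tangent_space A (\<phi> p)" if "u \<in> tangent_space B p" for u
      using affine_connection_tangent[OF levi_civita_affine[OF lc] E(1,2) d_tangent[OF that]] .
    have "nab (\<phi> p) (d p (a *\<^sub>R u + b *\<^sub>R v)) E = a *\<^sub>R nab (\<phi> p) (d p u) E + b *\<^sub>R nab (\<phi> p) (d p v) E"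
      unfolding d_add d_scale
      by (rule affine_connection_linear[OF levi_civita_affine[OF lc] E(1,2) d_tangent[OF u] d_tangent[OF v]])
    then have "g (\<phi> p) (d p y) (nab (\<phi> p) (d p (a *\<^sub>R u + b *\<^sub>R v)) E)
        = a * g (\<phi> p) (d p y) (nab (\<phi> p) (d p u) E) + b * g (\<phi> p) (d p y) (nab (\<phi> p) (d p v) E)"
      using n[OF u] n[OF v] d_tangent[OF y] by (simp add: T.add_right T.scale_right T.mem_scale)
    moreover have "g (\<phi> p) (a *\<^sub>R D u + b *\<^sub>R D v) e = a * g (\<phi> p) (D u) e + b * g (\<phi> p) (D v) e"
      by (rule T.lin[OF Dt[OF u] Dt[OF v] e])
    ultimately show "g (\<phi> p) (D (a *\<^sub>R u + b *\<^sub>R v)) e = g (\<phi> p) (a *\<^sub>R D u + b *\<^sub>R D v) e"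
      unfolding *[OF u] *[OF v] *[OF ab] by (simp add: algebra_simps)
  qed
  moreover have "d p (nabB p (a *\<^sub>R u + b *\<^sub>R v) Y) = a *\<^sub>R d p (nabB p u Y) + b *\<^sub>R d p (nabB p v Y)"
    by (simp add: affine_connection_linear[OF levi_civita_affine[OF lcB] Y(1,2) u v] d_add d_scale)
  ultimately show ?thesis unfolding D_def by (simp add: algebra_simps)
qed

text \<open>Both connections are torsion-free, so the antisymmetric part of the Gauss formula
  contains only brackets, which cancel.\<close>

lemma h_sym:
  assumes u: "u \<in> tangent_space B p" and v: "v \<in> tangent_space B p"
  shows "h p u v = h p v u"
proof -
  obtain W X where X: "p \<in> W" "vector_field_on B W X" "X p = u" using tangent_vector_extends[OF B u] .
  obtain W' Y where Y: "p \<in> W'" "vector_field_on B W' Y" "Y p = v" using tangent_vector_extends[OF B v] .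
  have o: "open (W \<inter> W')" "p \<in> W \<inter> W'"
    using vector_field_open[OF X(2)] vector_field_open[OF Y(2)] X(1) Y(1) by auto
  have X': "vector_field_on B (W \<inter> W') X" and Y': "vector_field_on B (W \<inter> W') Y"
    using vector_field_subset[OF X(2) o(1)] vector_field_subset[OF Y(2) o(1)] by auto
  have Xu: "X p \<in> tangent_space B p" and Yv: "Y p \<in> tangent_space B p" using u v X Y by auto
  have "d p (nabB p (X p) Y) + h p (X p) (Y p) - (d p (nabB p (Y p) X) + h p (Y p) (X p))
      = d p (nabB p (X p) Y - nabB p (Y p) X)"
    unfolding levi_civita_torsion[OF lcB o(2) X' Y']
    by (rule hcd_lie_bracket[OF X' Y' o(2) gauss[OF o(2) Xu Y'] gauss[OF o(2) Yv X']])
  then show ?thesis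
    unfolding X(3) Y(3) linear_diff[OF linear_differential] by (simp add: algebra_simps)
qed

text \<open>The covariant derivatives of \<open>J\<close> in the directions \<open>X\<close> and \<open>U\<close> cancel, and each of them is
  computed by metric compatibility; \<open>F\<close> stands for the derivative of the logarithm of the warping
  function in the direction \<open>X\<close> and \<open>F'\<close> for that in the direction \<open>J X\<close>.\<close>

lemma nk_identity_aux:
  assumes p: "p \<in> W" and X: "vector_field_on B W X" and U: "vector_field_on B W U"
    and V: "vector_field_on B W V"
    and perp: "\<And>q. q \<in> W \<Longrightarrow> g (\<phi> q) (J (\<phi> q) (d q (X q))) (d q (V q)) = 0"
    and Z: "Z \<in> tangent_space B p" "d p Z = J (\<phi> p) (d p (X p))"
    and XU: "nabB p (X p) U = F *\<^sub>R U p" and UX: "nabB p (U p) X = F *\<^sub>R U p"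
    and XV: "nabB p (X p) V = F *\<^sub>R V p"
    and UV: "G p (nabB p (U p) V) Z = - F' * G p (U p) (V p)"
  defines "\<omega> \<equiv> \<lambda>q. g (\<phi> q) (J (\<phi> q) (d q (U q))) (d q (V q))"
  shows "X p \<cdot> \<omega> - 3 * F * \<omega> p + 2 * g (\<phi> p) (h p (X p) (U p)) (J (\<phi> p) (d p (V p)))
      - g (\<phi> p) (h p (X p) (V p)) (J (\<phi> p) (d p (U p))) + F' * G p (U p) (V p) = 0"
    and "smooth_at B p \<omega>"
proof -
  note x = vector_field_tangent[OF X p] and u = vector_field_tangent[OF U p]
    and v = vector_field_tangent[OF V p]
  note dx = d_tangent[OF x] and du = d_tangent[OF u] and dv = d_tangent[OF v] and dz = d_tangent[OF Z(1)]
  note Ju = J_tangent[OF du] and Jv = J_tangent[OF dv]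
  define w where "w = d p (nabB p (X p) U) + h p (X p) (U p)"
  define w' where "w' = d p (nabB p (U p) X) + h p (U p) (X p)"
  have w: "hcd p (X p) (\<lambda>q. d q (U q)) w" unfolding w_def by (rule gauss[OF p x U])
  have w': "hcd p (U p) (\<lambda>q. d q (X q)) w'" unfolding w'_def by (rule gauss[OF p u X])
  obtain z z' where z: "hcd p (X p) (\<lambda>q. J (\<phi> q) (d q (U q))) z"
    and z': "hcd p (U p) (\<lambda>q. J (\<phi> q) (d q (X q))) z'"
    and zz: "(z - J (\<phi> p) w) + (z' - J (\<phi> p) w') = 0"
    using hcd_J[OF X U p w w'] by blast
  note wt = hcd_tangent(2)[OF w x] and wt' = hcd_tangent(2)[OF w' u]
    and zt = hcd_tangent(2)[OF z x] and zt' = hcd_tangent(2)[OF z' u]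
  let ?a = "g (\<phi> p) (h p (X p) (U p)) (J (\<phi> p) (d p (V p)))"
  let ?b = "g (\<phi> p) (h p (X p) (V p)) (J (\<phi> p) (d p (U p)))"
  have uJv: "g (\<phi> p) (d p (U p)) (J (\<phi> p) (d p (V p))) = - \<omega> p"
    using J_skew[OF du dv] unfolding \<omega>_def by simp
  have "X p \<cdot> \<omega> = g (\<phi> p) z (d p (V p))
      + g (\<phi> p) (J (\<phi> p) (d p (U p))) (d p (nabB p (X p) V) + h p (X p) (V p))"
    unfolding \<omega>_def by (rule hcd_metric(1)[OF z gauss[OF p x V] x])
  also have "g (\<phi> p) (J (\<phi> p) (d p (U p))) (d p (nabB p (X p) V) + h p (X p) (V p)) = F * \<omega> p + ?b"
    unfolding XV d_scale \<omega>_def using T.sym[OF Ju h_tangent[OF x v]] Ju dv h_tangent[OF x v]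
    by (simp add: T.add_right T.scale_right T.mem_scale)
  finally have 1: "g (\<phi> p) z (d p (V p)) = X p \<cdot> \<omega> - F * \<omega> p - ?b" by simp
  have 2: "g (\<phi> p) (J (\<phi> p) w) (d p (V p)) = F * \<omega> p - ?a"
    unfolding J_skew[OF wt dv] unfolding w_def XU d_scale
    using du h_tangent[OF x u] Jv uJv by (simp add: T.add_left T.scale_left T.mem_scale)
  \<comment> \<open>Differentiating the constant relation \<open>g(J X, V) = 0\<close> trades the
    derivative of \<open>J X\<close> for that of \<open>V\<close>. Since \<open>J X\<close> is
    tangent and \<open>h\<close> is normal, only the intrinsic connection enters.\<close>
  have "U p \<cdot> (\<lambda>q. g (\<phi> q) (J (\<phi> q) (d q (X q))) (d q (V q))) = 0"
    by (rule tangent_act_eq_0I[OF B u vector_field_open[OF X] p perp])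
  then have 3: "g (\<phi> p) z' (d p (V p)) = - g (\<phi> p) (J (\<phi> p) (d p (X p))) (d p (nabB p (U p) V) + h p (U p) (V p))"
    using hcd_metric(1)[OF z' gauss[OF p u V] u] by simp
  have "g (\<phi> p) (J (\<phi> p) (d p (X p))) (d p (nabB p (U p) V) + h p (U p) (V p)) = G p (nabB p (U p) V) Z"
    unfolding Z(2)[symmetric] G_eq
    using dz d_tangent[OF nabB_tangent[OF p V u]] h_tangent[OF u v] h_normal[OF u v Z(1)]
      T.sym[OF dz h_tangent[OF u v]] T.sym[OF dz d_tangent[OF nabB_tangent[OF p V u]]]
    by (simp add: T.add_right)
  then have 3: "g (\<phi> p) z' (d p (V p)) = F' * G p (U p) (V p)" using 3 UV by simp
  have 4: "g (\<phi> p) (J (\<phi> p) w') (d p (V p)) = F * \<omega> p - ?a"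
    unfolding J_skew[OF wt' dv] unfolding w'_def UX d_scale h_sym[OF u x]
    using du h_tangent[OF x u] Jv uJv by (simp add: T.add_left T.scale_left T.mem_scale)
  have "g (\<phi> p) ((z - J (\<phi> p) w) + (z' - J (\<phi> p) w')) (d p (V p)) = 0"
    unfolding zz using dv by simp
  moreover have "g (\<phi> p) ((z - J (\<phi> p) w) + (z' - J (\<phi> p) w')) (d p (V p)) =
     g (\<phi> p) z (d p (V p)) - g (\<phi> p) (J (\<phi> p) w) (d p (V p))
     + (g (\<phi> p) z' (d p (V p)) - g (\<phi> p) (J (\<phi> p) w') (d p (V p)))"
    using zt zt' J_tangent[OF wt] J_tangent[OF wt'] dv
    by (simp add: T.add_left T.diff_left T.mem_diff)
  ultimately show "X p \<cdot> \<omega> - 3 * F * \<omega> p + 2 * ?a - ?b + F' * G p (U p) (V p) = 0"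
    unfolding 1 2 3 4 by (simp add: algebra_simps)
  show "smooth_at B p \<omega>" unfolding \<omega>_def by (rule hcd_metric(2)[OF z gauss[OF p x V] x])
qed

text \<open>The auxiliary relation involves \<open>a(U, V)\<close> and \<open>a(V, U)\<close>.
  Interchanging \<open>U\<close> and \<open>V\<close> reverses the sign of \<omega> and gives a
  second relation; twice the first plus the second eliminates \<open>a(V, U)\<close> and leaves 3
  times \<open>a(U, V)\<close>.\<close>

lemma nk_identity:
  assumes p: "p \<in> W" and X: "vector_field_on B W X" and U: "vector_field_on B W U"
    and V: "vector_field_on B W V"
    and perp: "\<And>q. q \<in> W \<Longrightarrow> g (\<phi> q) (J (\<phi> q) (d q (X q))) (d q (U q)) = 0"
      "\<And>q. q \<in> W \<Longrightarrow> g (\<phi> q) (J (\<phi> q) (d q (X q))) (d q (V q)) = 0"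
    and Z: "Z \<in> tangent_space B p" "d p Z = J (\<phi> p) (d p (X p))"
    and nabXU: "nabB p (X p) U = F *\<^sub>R U p" "nabB p (U p) X = F *\<^sub>R U p"
    and nabXV: "nabB p (X p) V = F *\<^sub>R V p" "nabB p (V p) X = F *\<^sub>R V p"
    and nabUV: "G p (nabB p (U p) V) Z = - F' * G p (U p) (V p)"
      "G p (nabB p (V p) U) Z = - F' * G p (V p) (U p)"
  defines "\<omega> \<equiv> \<lambda>q. g (\<phi> q) (J (\<phi> q) (d q (U q))) (d q (V q))"
  shows "g (\<phi> p) (h p (X p) (U p)) (J (\<phi> p) (d p (V p)))
      = - F' * G p (U p) (V p) + F * \<omega> p - (X p \<cdot> \<omega>) / 3"
    and "smooth_at B p \<omega>"
proof -
  define \<omega>' where "\<omega>' = (\<lambda>q. g (\<phi> q) (J (\<phi> q) (d q (V q))) (d q (U q)))"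
  let ?a = "g (\<phi> p) (h p (X p) (U p)) (J (\<phi> p) (d p (V p)))"
  let ?b = "g (\<phi> p) (h p (X p) (V p)) (J (\<phi> p) (d p (U p)))"
  have 1: "X p \<cdot> \<omega> - 3 * F * \<omega> p + 2 * ?a - ?b + F' * G p (U p) (V p) = 0"
    unfolding \<omega>_def by (rule nk_identity_aux(1)[OF p X U V perp(2) Z nabXU nabXV(1) nabUV(1)])
  have \<omega>: "smooth_at B p \<omega>"
    unfolding \<omega>_def by (rule nk_identity_aux(2)[OF p X U V perp(2) Z nabXU nabXV(1) nabUV(1)])
  have 2: "X p \<cdot> \<omega>' - 3 * F * \<omega>' p + 2 * ?b - ?a + F' * G p (V p) (U p) = 0"
    unfolding \<omega>'_def by (rule nk_identity_aux(1)[OF p X V U perp(1) Z nabXV nabXU(1) nabUV(2)])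
  note x = vector_field_tangent[OF X p]
  have \<omega>': "\<omega>' q = - 1 * \<omega> q" if "q \<in> W" for q
  proof -
    note u = d_tangent[OF vector_field_tangent[OF U that]] and v = d_tangent[OF vector_field_tangent[OF V that]]
    show ?thesis
      using J_skew[OF v u] T.sym[OF v J_tangent[OF u]] unfolding \<omega>_def \<omega>'_def by simp
  qed
  have "X p \<cdot> \<omega>' = X p \<cdot> (\<lambda>q. - 1 * \<omega> q)"
    by (rule tangent_act_cong[OF B x vector_field_open[OF X] p \<omega>'])
  also have "\<dots> = - (X p \<cdot> \<omega>)"
    using tangent_act_mult[OF B x smooth_at_const[OF B, of p "- 1"] \<omega>] tangent_act_const[OF B x, of "- 1"] by simp
  finally have 3: "X p \<cdot> \<omega>' = - (X p \<cdot> \<omega>)" .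
  have 4: "G p (V p) (U p) = G p (U p) (V p)"
    using G.sym vector_field_tangent[OF U p] vector_field_tangent[OF V p] by blast
  show "g (\<phi> p) (h p (X p) (U p)) (J (\<phi> p) (d p (V p)))
      = - F' * G p (U p) (V p) + F * \<omega> p - (X p \<cdot> \<omega>) / 3"
    using 1 2[unfolded 3 4 \<omega>'[OF p]] by (simp add: algebra_simps)
  show "smooth_at B p \<omega>" by (rule \<omega>)
qed

end

section \<open>The Levi-Civita connection of a warped product\<close>

lemma koszul:
  assumes A: "smooth_manifold A" and inner: "inner_space (tangent_space A p) (G p)"
    and sym: "\<And>q u v. u \<in> tangent_space A q \<Longrightarrow> v \<in> tangent_space A q \<Longrightarrow> G q u v = G q v u"
    and lc: "levi_civita A G nab" and p: "p \<in> W"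
    and X: "vector_field_on A W X" and Y: "vector_field_on A W Y" and Z: "vector_field_on A W Z"
  shows "2 * G p (nab p (X p) Y) (Z p) =
      X p \<cdot> (\<lambda>q. G q (Y q) (Z q)) + Y p \<cdot> (\<lambda>q. G q (X q) (Z q)) - Z p \<cdot> (\<lambda>q. G q (X q) (Y q))
      + G p (lie_bracket A X Y p) (Z p) - G p (lie_bracket A X Z p) (Y p) - G p (lie_bracket A Y Z p) (X p)"
proof -
  interpret inner_space "tangent_space A p" "G p" by (rule inner)
  note x = vector_field_tangent[OF X p] and y = vector_field_tangent[OF Y p] and z = vector_field_tangent[OF Z p]
  note tan = affine_connection_tangent[OF levi_civita_affine[OF lc] p]
  show ?thesis
    unfolding levi_civita_metric[OF lc p x Y Z] levi_civita_metric[OF lc p y X Z]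
      levi_civita_metric[OF lc p z X Y]
      levi_civita_torsion[OF lc p X Y, symmetric] levi_civita_torsion[OF lc p X Z, symmetric]
      levi_civita_torsion[OF lc p Y Z, symmetric]
    using tan[OF Y x] tan[OF X y] tan[OF Z x] tan[OF X z] tan[OF Z y] tan[OF Y z] x y z
      sym[OF x tan[OF Z y]] sym[OF x tan[OF Y z]] sym[OF y tan[OF Z x]]
    by (simp add: diff_left)
qed

text \<open>\<open>D i\<close> is the distribution tangent to the \<open>i\<close>-th factor, \<open>Lf i W X\<close> says that \<open>X\<close> is on \<open>W\<close> the
  lift of a vector field on the \<open>i\<close>-th factor, \<open>bas i W f\<close> that \<open>f\<close> is on \<open>W\<close> a function on the
  \<open>i\<close>-th factor, and \<open>F i\<close> is the logarithm of the warping function of the \<open>i\<close>-th factor.\<close>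

locale warped_split =
  fixes B :: "('n::{t2_space,second_countable_topology}, 'f::euclidean_space) chart set"
    and G :: "'n metric" and nabB :: "'n connection"
    and D :: "nat \<Rightarrow> 'n \<Rightarrow> 'n tvec set"
    and Lf :: "nat \<Rightarrow> 'n set \<Rightarrow> ('n \<Rightarrow> 'n tvec) \<Rightarrow> bool"
    and bas :: "nat \<Rightarrow> 'n set \<Rightarrow> ('n \<Rightarrow> real) \<Rightarrow> bool"
    and F :: "nat \<Rightarrow> 'n \<Rightarrow> real"
  assumes mB: "smooth_manifold B"
    and G_inner: "\<And>p. inner_space (tangent_space B p) (G p)"
    and G_lc: "levi_civita B G nabB"
    and D_subspace: "\<And>i p. i < 3 \<Longrightarrow> subspace (D i p)"
    and D_tangent: "\<And>i p v. i < 3 \<Longrightarrow> v \<in> D i p \<Longrightarrow> v \<in> tangent_space B p"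
    and D_split: "\<And>p v. v \<in> tangent_space B p \<Longrightarrow>
       \<exists>v0\<in>D 0 p. \<exists>v1\<in>D 1 p. \<exists>v2\<in>D 2 p. v = v0 + v1 + v2"
    and D_orth: "\<And>i j p u v. i < 3 \<Longrightarrow> j < 3 \<Longrightarrow> i \<noteq> j \<Longrightarrow> u \<in> D i p \<Longrightarrow> v \<in> D j p \<Longrightarrow> G p u v = 0"
    and D_annihilator: "\<And>i p v. i < 3 \<Longrightarrow> v \<in> tangent_space B p \<Longrightarrow>
       (\<And>k W f. k < 3 \<Longrightarrow> k \<noteq> i \<Longrightarrow> bas k W f \<Longrightarrow> p \<in> W \<Longrightarrow> v \<cdot> f = 0) \<Longrightarrow> v \<in> D i p"
    and bas_smooth: "\<And>k W f. k < 3 \<Longrightarrow> bas k W f \<Longrightarrow> smooth_fun_on B W f"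
    and D_bas: "\<And>i k p v W f. i < 3 \<Longrightarrow> k < 3 \<Longrightarrow> i \<noteq> k \<Longrightarrow> v \<in> D i p \<Longrightarrow> bas k W f \<Longrightarrow> p \<in> W \<Longrightarrow> v \<cdot> f = 0"
    and Lf_field: "\<And>i W X. i < 3 \<Longrightarrow> Lf i W X \<Longrightarrow> vector_field_on B W X"
    and Lf_D: "\<And>i W X q. i < 3 \<Longrightarrow> Lf i W X \<Longrightarrow> q \<in> W \<Longrightarrow> X q \<in> D i q"
    and Lf_bas: "\<And>i W X W' f. i < 3 \<Longrightarrow> Lf i W X \<Longrightarrow> bas i W' f \<Longrightarrow>
       \<exists>W'' f'. bas i W'' f' \<and> W \<inter> W' \<subseteq> W'' \<and> (\<forall>q\<in>W \<inter> W'. X q \<cdot> f = f' q)"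
    and Lf_subset: "\<And>i W X W'. i < 3 \<Longrightarrow> Lf i W X \<Longrightarrow> open W' \<Longrightarrow> W' \<subseteq> W \<Longrightarrow> Lf i W' X"
    and Lf_extends: "\<And>i p v. i < 3 \<Longrightarrow> v \<in> D i p \<Longrightarrow> \<exists>W X. p \<in> W \<and> Lf i W X \<and> X p = v"
    and F_0: "\<And>p. F 0 p = 0"
    and F_D: "\<And>i k p v. i < 3 \<Longrightarrow> k < 3 \<Longrightarrow> i \<noteq> 0 \<Longrightarrow> v \<in> D i p \<Longrightarrow> v \<cdot> F k = 0"
    and metric_deriv: "\<And>i j W Y Z p v. i < 3 \<Longrightarrow> j < 3 \<Longrightarrow> i \<noteq> j \<Longrightarrow> Lf i W Y \<Longrightarrow> Lf i W Z \<Longrightarrow> p \<in> W \<Longrightarrow>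
       v \<in> D j p \<Longrightarrow> v \<cdot> (\<lambda>q. G q (Y q) (Z q)) = 2 * (v \<cdot> F i) * G p (Y p) (Z p)"
begin

sublocale GG: inner_space "tangent_space B p" "G p" for p
  by (rule G_inner)

lemma nabB_mem: "p \<in> W \<Longrightarrow> vector_field_on B W Y \<Longrightarrow> u \<in> tangent_space B p \<Longrightarrow> nabB p u Y \<in> tangent_space B p"
  by (rule affine_connection_tangent[OF levi_civita_affine[OF G_lc]])

lemma lie_bracket_tangent:
  assumes "vector_field_on B W X" "vector_field_on B W Y" "p \<in> W"
  shows "lie_bracket B X Y p \<in> tangent_space B p"
  unfolding levi_civita_torsion[OF G_lc assms(3,1,2), symmetric]
  by (intro GG.mem_diff nabB_mem[OF assms(3)] assms vector_field_tangent[OF _ assms(3)])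

text \<open>A lift kills the basic functions of the other factors and sends those of its own factor
  to basic functions again. So a composition of two lifts kills \<open>f\<close> unless both belong
  to the factor of \<open>f\<close>.\<close>

lemma lie_bracket_basic:
  assumes i: "i < 3" and j: "j < 3" and X: "Lf i W X" and Y: "Lf j W Y" and p: "p \<in> W"
    and k: "k < 3" "k \<noteq> i \<or> k \<noteq> j" and f: "bas k W' f" "p \<in> W'"
  shows "lie_bracket B X Y p \<cdot> f = 0"
proof -
  note XW = Lf_field[OF i X] and YW = Lf_field[OF j Y]
  have o: "open (W \<inter> W')" "p \<in> W \<inter> W'"
    using vector_field_open[OF XW] smooth_fun_on_open[OF bas_smooth[OF k(1) f(1)]] p f by auto
  have *: "Y' p \<cdot> (\<lambda>q. X' q \<cdot> f) = 0"
    if l: "l < 3" "l' < 3" and "Lf l W X'" "Lf l' W Y'" "k \<noteq> l \<or> k \<noteq> l'" for X' Y' l l'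
  proof (cases "k = l")
    case False
    then have "X' q \<cdot> f = 0" if "q \<in> W \<inter> W'" for q
      using D_bas[OF l(1) k(1) _ Lf_D[OF l(1) \<open>Lf l W X'\<close>] f(1)] that by auto
    then show ?thesis
      by (rule tangent_act_eq_0I[OF mB vector_field_tangent[OF Lf_field[OF l(2) \<open>Lf l' W Y'\<close>] p] o])
  next
    case True
    then have kl: "l' \<noteq> k" using that by auto
    obtain W'' f' where W'': "bas k W'' f'" "W \<inter> W' \<subseteq> W''" "\<forall>q\<in>W \<inter> W'. X' q \<cdot> f = f' q"
      using Lf_bas[OF l(1) \<open>Lf l W X'\<close>, of W' f] f True by metis
    have "Y' p \<cdot> (\<lambda>q. X' q \<cdot> f) = Y' p \<cdot> f'"
      by (rule tangent_act_cong[OF mB vector_field_tangent[OF Lf_field[OF l(2) \<open>Lf l' W Y'\<close>] p] o])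
        (use W''(3) in blast)
    also have "\<dots> = 0"
      by (rule D_bas[OF l(2) k(1) kl Lf_D[OF l(2) \<open>Lf l' W Y'\<close> p] W''(1)]) (use W''(2) o in blast)
    finally show ?thesis .
  qed
  have "X p \<cdot> (\<lambda>q. Y q \<cdot> f) = 0" "Y p \<cdot> (\<lambda>q. X q \<cdot> f) = 0"
    using *[OF j i Y X] *[OF i j X Y] k(2) by auto
  then show ?thesis by (simp add: lie_bracket_act)
qed

lemma lie_bracket_same:
  assumes i: "i < 3" and X: "Lf i W X" and Y: "Lf i W Y" and p: "p \<in> W"
  shows "lie_bracket B X Y p \<in> D i p"
  by (rule D_annihilator[OF i lie_bracket_tangent[OF Lf_field[OF i X] Lf_field[OF i Y] p]])
    (rule lie_bracket_basic[OF i i X Y p], auto)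

text \<open>The bracket lies in both distributions, and these are orthogonal.\<close>

lemma lie_bracket_different:
  assumes i: "i < 3" and j: "j < 3" and ij: "i \<noteq> j" and X: "Lf i W X" and Y: "Lf j W Y" and p: "p \<in> W"
  shows "lie_bracket B X Y p = 0"
proof -
  note t = lie_bracket_tangent[OF Lf_field[OF i X] Lf_field[OF j Y] p]
  have "lie_bracket B X Y p \<in> D i p"
    by (rule D_annihilator[OF i t]) (rule lie_bracket_basic[OF i j X Y p], auto)
  moreover have "lie_bracket B X Y p \<in> D j p"
    by (rule D_annihilator[OF j t]) (rule lie_bracket_basic[OF i j X Y p], auto)
  ultimately show ?thesis using D_orth[OF i j ij] GG.eq_0_iff[OF t] by blast
qed

lemma G_different:
  assumes i: "i < 3" and j: "j < 3" and ij: "i \<noteq> j" and X: "Lf i W X" and Y: "Lf j W Y" and p: "p \<in> W"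
    and v: "v \<in> tangent_space B p"
  shows "v \<cdot> (\<lambda>q. G q (X q) (Y q)) = 0"
  by (rule tangent_act_eq_0I[OF mB v vector_field_open[OF Lf_field[OF i X]] p])
    (rule D_orth[OF i j ij Lf_D[OF i X] Lf_D[OF j Y]])

lemma Lf_extends_within:
  assumes i: "i < 3" and v: "v \<in> D i p" and W: "open W" "p \<in> W"
  obtains W' X where "p \<in> W'" "W' \<subseteq> W" "open W'" "Lf i W' X" "X p = v"
proof -
  obtain W' X where X: "p \<in> W'" "Lf i W' X" "X p = v" using Lf_extends[OF i v] by blast
  have o: "open (W \<inter> W')" using W vector_field_open[OF Lf_field[OF i X(2)]] by blast
  have "Lf i (W \<inter> W') X" by (rule Lf_subset[OF i X(2) o]) simp
  then show ?thesis using that[of "W \<inter> W'" X] o X W by blast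
qed

text \<open>In the Koszul formula only the derivative of \<open>G(U, V)\<close> along the other
  factor survives: brackets of lifts from different factors vanish, and brackets within one factor
  stay in it.\<close>

lemma nabB_same_other:
  assumes i: "i < 3" and j: "j < 3" and ij: "i \<noteq> j" and U: "Lf i W U" and V: "Lf i W V" and p: "p \<in> W"
    and y: "y \<in> D j p"
  shows "G p (nabB p (U p) V) y = - (y \<cdot> F i) * G p (U p) (V p)"
proof -
  obtain W' Y where W': "p \<in> W'" "W' \<subseteq> W" "open W'" and Y: "Lf j W' Y" "Y p = y"
    using Lf_extends_within[OF j y vector_field_open[OF Lf_field[OF i U]] p] by metis
  have U': "Lf i W' U" and V': "Lf i W' V" using Lf_subset[OF i] U V W' by auto
  note yt = vector_field_tangent[OF Lf_field[OF j Y(1)] W'(1)]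
  have "2 * G p (nabB p (U p) V) (Y p) =
      U p \<cdot> (\<lambda>q. G q (V q) (Y q)) + V p \<cdot> (\<lambda>q. G q (U q) (Y q)) - Y p \<cdot> (\<lambda>q. G q (U q) (V q))
      + G p (lie_bracket B U V p) (Y p) - G p (lie_bracket B U Y p) (V p) - G p (lie_bracket B V Y p) (U p)"
    by (rule koszul[OF mB G_inner GG.sym G_lc W'(1) Lf_field[OF i U'] Lf_field[OF i V'] Lf_field[OF j Y(1)]])
  also have "\<dots> = - 2 * (y \<cdot> F i) * G p (U p) (V p)"
    using G_different[OF i j ij V' Y(1) W'(1)] G_different[OF i j ij U' Y(1) W'(1)]
      metric_deriv[OF i j ij U' V' W'(1), of "Y p"] Lf_D[OF j Y(1) W'(1)]
      D_orth[OF i j ij lie_bracket_same[OF i U' V' W'(1)] Lf_D[OF j Y(1) W'(1)]]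
      lie_bracket_different[OF i j ij U' Y(1) W'(1)] lie_bracket_different[OF i j ij V' Y(1) W'(1)]
      vector_field_tangent[OF Lf_field[OF i U'] W'(1)] vector_field_tangent[OF Lf_field[OF i V'] W'(1)]
    by (simp add: Y(2))
  finally show ?thesis using Y(2) by simp
qed

text \<open>\<open>key\<close> tests the derivative against vectors of each factor with the Koszul
  formula. Only the fibre itself contributes, through the change of its metric along
  \<open>X\<close>. The second equation follows because the two lifts commute.\<close>

lemma nabB_base_fibre:
  assumes i: "i < 3" "i \<noteq> 0" and X: "Lf 0 W X" and V: "Lf i W V" and p: "p \<in> W"
  shows "nabB p (X p) V = (X p \<cdot> F i) *\<^sub>R V p" "nabB p (V p) X = (X p \<cdot> F i) *\<^sub>R V p"
proof -
  have i0: "(0::nat) < 3" by simp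
  note Xf = Lf_field[OF i0 X] and Vf = Lf_field[OF i(1) V]
  note x = vector_field_tangent[OF Xf p] and v = vector_field_tangent[OF Vf p]
  have key: "G p (nabB p (X p) V) z = (X p \<cdot> F i) * G p (V p) z" if k: "k < 3" and z: "z \<in> D k p" for k z
  proof -
    obtain W' Z where W': "p \<in> W'" "W' \<subseteq> W" "open W'" and Z: "Lf k W' Z" "Z p = z"
      using Lf_extends_within[OF k z vector_field_open[OF Xf] p] by metis
    have X': "Lf 0 W' X" and V': "Lf i W' V" using Lf_subset[OF i0 X] Lf_subset[OF i(1) V] W' by auto
    note zt = vector_field_tangent[OF Lf_field[OF k Z(1)] W'(1)]
    have xD: "X p \<in> D 0 p" and vD: "V p \<in> D i p" and zD: "Z p \<in> D k p"
      using Lf_D[OF i0 X p] Lf_D[OF i(1) V p] Lf_D[OF k Z(1) W'(1)] by auto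
    have K: "2 * G p (nabB p (X p) V) (Z p) =
      X p \<cdot> (\<lambda>q. G q (V q) (Z q)) + V p \<cdot> (\<lambda>q. G q (X q) (Z q)) - Z p \<cdot> (\<lambda>q. G q (X q) (V q))
      + G p (lie_bracket B X V p) (Z p) - G p (lie_bracket B X Z p) (V p) - G p (lie_bracket B V Z p) (X p)"
      by (rule koszul[OF mB G_inner GG.sym G_lc W'(1) Lf_field[OF i0 X'] Lf_field[OF i(1) V'] Lf_field[OF k Z(1)]])
    have K1: "Z p \<cdot> (\<lambda>q. G q (X q) (V q)) = 0" "lie_bracket B X V p = 0"
      using G_different[OF i0 i(1) i(2)[symmetric] X' V' W'(1) zt]
        lie_bracket_different[OF i0 i(1) i(2)[symmetric] X' V' W'(1)] by auto
    consider "k = i" | "k = 0" | "k \<noteq> i" "k \<noteq> 0" by blast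
    then show ?thesis
    proof cases
      case 1
      have "V p \<cdot> (\<lambda>q. G q (X q) (Z q)) = 0" "lie_bracket B X Z p = 0"
        using G_different[OF i0 k _ X' Z(1) W'(1) v] lie_bracket_different[OF i0 k _ X' Z(1) W'(1)] 1 i by auto
      moreover have "G p (lie_bracket B V Z p) (X p) = 0"
        using D_orth[OF i(1) i0 i(2) lie_bracket_same[OF i(1) V' _ W'(1)] xD] Z(1) 1 by blast
      moreover have "X p \<cdot> (\<lambda>q. G q (V q) (Z q)) = 2 * (X p \<cdot> F i) * G p (V p) (Z p)"
        using metric_deriv[OF i(1) i0 i(2) V' _ W'(1) xD] Z(1) 1 by blast
      ultimately show ?thesis using K K1 zt v unfolding Z(2) by simp
    next
      case 2
      have "X p \<cdot> (\<lambda>q. G q (V q) (Z q)) = 0" "lie_bracket B V Z p = 0"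
        using G_different[OF i(1) k _ V' Z(1) W'(1) x] lie_bracket_different[OF i(1) k _ V' Z(1) W'(1)] 2 i by auto
      moreover have "G p (lie_bracket B X Z p) (V p) = 0"
        using D_orth[OF i0 i(1) i(2)[symmetric] lie_bracket_same[OF i0 X' _ W'(1)] vD] Z(1) 2 by blast
      \<comment> \<open>The metric of the base does not change along a fibre.\<close>
      moreover have "V p \<cdot> (\<lambda>q. G q (X q) (Z q)) = 0"
        using metric_deriv[OF i0 i(1) i(2)[symmetric] X' _ W'(1) vD] Z(1) 2 F_D[OF i(1) i0 i(2) vD] by simp
      moreover have "G p (V p) (Z p) = 0"
        by (rule D_orth[OF i(1) k _ vD zD]) (use 2 i in simp)
      ultimately show ?thesis using K K1 x zt unfolding Z(2) by simp
    next
      case 3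
      have "X p \<cdot> (\<lambda>q. G q (V q) (Z q)) = 0" "V p \<cdot> (\<lambda>q. G q (X q) (Z q)) = 0"
        "lie_bracket B V Z p = 0" "lie_bracket B X Z p = 0"
        using G_different[OF i(1) k _ V' Z(1) W'(1) x] lie_bracket_different[OF i(1) k _ V' Z(1) W'(1)]
          G_different[OF i0 k _ X' Z(1) W'(1) v] lie_bracket_different[OF i0 k _ X' Z(1) W'(1)] 3 by auto
      moreover have "G p (V p) (Z p) = 0"
        by (rule D_orth[OF i(1) k _ vD zD]) (use 3 in simp)
      ultimately show ?thesis using K K1 x v zt unfolding Z(2) by simp
    qed
  qed
  show 1: "nabB p (X p) V = (X p \<cdot> F i) *\<^sub>R V p"
  proof (rule GG.eqI)
    show nt: "nabB p (X p) V \<in> tangent_space B p" by (rule nabB_mem[OF p Vf x])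
    show sv: "(X p \<cdot> F i) *\<^sub>R V p \<in> tangent_space B p" using v by blast
    fix w assume "w \<in> tangent_space B p"
    then obtain v0 v1 v2 where w: "v0 \<in> D 0 p" "v1 \<in> D 1 p" "v2 \<in> D 2 p" "w = v0 + v1 + v2"
      using D_split by blast
    have t: "v0 \<in> tangent_space B p" "v1 \<in> tangent_space B p" "v2 \<in> tangent_space B p"
      using w D_tangent[of 0] D_tangent[of 1] D_tangent[of 2] by auto
    show "G p (nabB p (X p) V) w = G p ((X p \<cdot> F i) *\<^sub>R V p) w"
      using key[of 0 v0] key[of 1 v1] key[of 2 v2] w(1-3) t nt sv v unfolding w(4)
      by (simp add: GG.add_right GG.mem_add GG.scale_left algebra_simps)
  qed
  show "nabB p (V p) X = (X p \<cdot> F i) *\<^sub>R V p"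
    using levi_civita_torsion[OF G_lc p Xf Vf] lie_bracket_different[OF i0 i(1) i(2)[symmetric] X V p] 1 by simp
qed

end

section \<open>Orthonormal bases\<close>

context inner_space
begin

definition orthonormal :: "'v set \<Rightarrow> bool" where
  "orthonormal E \<longleftrightarrow> finite E \<and> E \<subseteq> S \<and> (\<forall>u\<in>E. \<forall>v\<in>E. b u v = (if u = v then 1 else 0))"

lemma orthonormal_finite: "orthonormal E \<Longrightarrow> finite E"
  and orthonormal_mem: "orthonormal E \<Longrightarrow> u \<in> E \<Longrightarrow> u \<in> S"
  and orthonormal_inner: "orthonormal E \<Longrightarrow> u \<in> E \<Longrightarrow> v \<in> E \<Longrightarrow> b u v = (if u = v then 1 else 0)"
  unfolding orthonormal_def by auto

lemma span_subset: "E \<subseteq> S \<Longrightarrow> span E \<subseteq> S"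
  using sub by (rule span_minimal[rotated])

lemma expansion:
  assumes E: "orthonormal E" and u: "u \<in> span E"
  shows "u = (\<Sum>e\<in>E. b u e *\<^sub>R e)"
proof -
  have fin: "finite E" by (rule orthonormal_finite[OF E])
  obtain x where x: "u = (\<Sum>e\<in>E. x e *\<^sub>R e)" using u unfolding span_finite[OF fin] by auto
  have "b u e = x e" if e: "e \<in> E" for e
  proof -
    have "b u e = (\<Sum>e'\<in>E. b (x e' *\<^sub>R e') e)"
      unfolding x using orthonormal_mem[OF E] e by (intro sum_left) auto
    also have "\<dots> = (\<Sum>e'\<in>E. if e' = e then x e' else 0)"
      using orthonormal_mem[OF E] orthonormal_inner[OF E] e by (intro sum.cong refl) (auto simp: scale_left)
    finally show ?thesis using e fin by simp
  qed
  then show ?thesis unfolding x by simp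
qed

lemma orthonormal_independent:
  assumes E: "orthonormal E"
  shows "independent E"
proof (rule independent_if_scalars_zero[OF orthonormal_finite[OF E]])
  fix f x assume 0: "(\<Sum>x\<in>E. f x *\<^sub>R x) = 0" and x: "x \<in> E"
  have "b (\<Sum>e\<in>E. f e *\<^sub>R e) x = (\<Sum>e\<in>E. if e = x then f e else 0)"
    using orthonormal_mem[OF E] orthonormal_inner[OF E] x
    by (subst sum_left) (auto intro!: sum.cong simp: scale_left)
  then show "f x = 0" using x orthonormal_finite[OF E] orthonormal_mem[OF E] by (simp add: 0)
qed

lemma orthonormal_card:
  assumes E: "orthonormal E" and X: "independent X" "span X = span E"
  shows "card E = card X"
  using dim_eq_card_independent[OF orthonormal_independent[OF E]] dim_eq_card_independent[OF X(1)]
    dim_span[of E] dim_span[of X] X(2) by metis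

lemma projection_orthogonal:
  assumes E: "orthonormal E" and u: "u \<in> S" and v: "v \<in> E"
  shows "b (u - (\<Sum>e\<in>E. b u e *\<^sub>R e)) v = 0"
proof -
  have vS: "v \<in> S" by (rule orthonormal_mem[OF E v])
  have m: "(\<Sum>e\<in>E. b u e *\<^sub>R e) \<in> S" using orthonormal_mem[OF E] by auto
  have "b (\<Sum>e\<in>E. b u e *\<^sub>R e) v = (\<Sum>e\<in>E. if e = v then b u e else 0)"
    using orthonormal_mem[OF E] orthonormal_inner[OF E] v
    by (subst sum_left) (auto intro!: sum.cong simp: scale_left)
  then show ?thesis using orthonormal_finite[OF E] v u m vS by (simp add: diff_left)
qed

lemma gram_schmidt:
  assumes "finite X" "X \<subseteq> S"
  shows "\<exists>E. orthonormal E \<and> span E = span X"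
  using assms
proof (induction X rule: finite_induct)
  case empty
  show ?case by (rule exI[of _ "{}"]) (simp add: orthonormal_def)
next
  case (insert x X)
  then obtain E where E: "orthonormal E" "span E = span X" by auto
  have x: "x \<in> S" using insert.prems by simp
  note ES = orthonormal_mem[OF E(1)] and fin = orthonormal_finite[OF E(1)]
  define p where "p = (\<Sum>e\<in>E. b x e *\<^sub>R e)"
  define y where "y = x - p"
  have p: "p \<in> span E" unfolding p_def by (intro span_sum span_scale span_base)
  have "p \<in> S" unfolding p_def using ES by auto
  then have y: "y \<in> S" unfolding y_def using x by blast
  have yE: "b y e = 0" if "e \<in> E" for e unfolding y_def p_def by (rule projection_orthogonal[OF E(1) x that])
  show ?case
  proof (cases "y = 0")
    case True
    then have "x \<in> span X" using p E(2) unfolding y_def by simp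
    then have "span (insert x X) = span X" by (rule span_redundant)
    then show ?thesis using E by blast
  next
    case False
    define z where "z = (1 / sqrt (b y y)) *\<^sub>R y"
    have yy: "b y y > 0" by (rule pos[OF y False])
    have z: "z \<in> S" unfolding z_def using y by blast
    have zz: "b z z = 1"
      unfolding z_def using y yy by (simp add: scale_left scale_right mem_scale real_sqrt_mult_self)
    have zE: "b z e = 0" "b e z = 0" if "e \<in> E" for e
      using yE[OF that] sym[OF z ES[OF that]] unfolding z_def using scale_left[OF y ES[OF that]] by auto
    have ne: "e \<noteq> z" if "e \<in> E" for e using zE(1)[OF that] zz by auto
    have "orthonormal (insert z E)"
      unfolding orthonormal_def using fin ES z ne ne[symmetric] orthonormal_inner[OF E(1)]
      by (auto simp: zz zE)
    moreover have "span (insert z E) = span (insert x X)"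
    proof -
      have "z = (1 / sqrt (b y y)) *\<^sub>R x - (1 / sqrt (b y y)) *\<^sub>R p"
        unfolding z_def y_def by (rule scaleR_diff_right)
      moreover have "p \<in> span (insert x X)" "x \<in> span (insert x X)"
        using p E(2) span_mono[of X "insert x X"] span_base[of x "insert x X"] by auto
      ultimately have "z \<in> span (insert x X)" by (metis span_diff span_scale)
      moreover have "e \<in> span (insert x X)" if "e \<in> E" for e
        using span_base[OF that] E(2) span_mono[of X "insert x X"] by auto
      ultimately have 1: "span (insert z E) \<subseteq> span (insert x X)"
        by (intro span_minimal subspace_span) auto
      have "y = sqrt (b y y) *\<^sub>R z" unfolding z_def using yy by simp
      then have "x = sqrt (b y y) *\<^sub>R z + p" unfolding y_def by (metis diff_add_cancel)
      moreover have "p \<in> span (insert z E)" "z \<in> span (insert z E)"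
        using p span_mono[of E "insert z E"] span_base[of z "insert z E"] by auto
      ultimately have "x \<in> span (insert z E)" by (metis span_add span_scale)
      moreover have "e \<in> span (insert z E)" if "e \<in> X" for e
        using span_base[OF that] E(2) span_mono[of E "insert z E"] by auto
      ultimately have "span (insert x X) \<subseteq> span (insert z E)"
        by (intro span_minimal subspace_span) auto
      with 1 show ?thesis by simp
    qed
    ultimately show ?thesis by blast
  qed
qed

lemma parseval:
  assumes E: "orthonormal E" and u: "u \<in> span E" and v: "v \<in> S"
  shows "b u v = (\<Sum>e\<in>E. b u e * b e v)"
proof -
  have "b u v = b (\<Sum>e\<in>E. b u e *\<^sub>R e) v" using expansion[OF E u] by simp
  also have "\<dots> = (\<Sum>e\<in>E. b u e * b e v)"
    using orthonormal_mem[OF E] v by (subst sum_left) (auto simp: scale_left)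
  finally show ?thesis .
qed

lemma projection_norm:
  assumes E: "orthonormal E" and u: "u \<in> S"
  shows "b (u - (\<Sum>e\<in>E. b u e *\<^sub>R e)) (u - (\<Sum>e\<in>E. b u e *\<^sub>R e)) = b u u - (\<Sum>e\<in>E. (b u e)\<^sup>2)"
proof -
  define p where "p = (\<Sum>e\<in>E. b u e *\<^sub>R e)"
  have p: "p \<in> S" unfolding p_def using orthonormal_mem[OF E] by auto
  have up: "u - p \<in> S" using u p by blast
  have 0: "b (u - p) e = 0" if "e \<in> E" for e
    unfolding p_def by (rule projection_orthogonal[OF E u that])
  have "b w (\<Sum>e\<in>E. b u e *\<^sub>R e) = (\<Sum>e\<in>E. b u e * b w e)" if "w \<in> S" for w
    using that orthonormal_mem[OF E] by (subst sum_right) (auto simp: scale_right)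
  from this[OF up] have "b (u - p) p = (\<Sum>e\<in>E. b u e * b (u - p) e)" unfolding p_def .
  then have 1: "b (u - p) p = 0" using 0 by simp
  have "b (u - p) (u - p) = b (u - p) u" using 1 up u p by (simp add: diff_right)
  also have "\<dots> = b u u - b p u" using u p by (simp add: diff_left)
  also have "b p u = (\<Sum>e\<in>E. (b u e)\<^sup>2)"
    unfolding p_def using orthonormal_mem[OF E] u sym[OF u]
    by (subst sum_left) (auto intro!: sum.cong simp: scale_left power2_eq_square)
  finally show ?thesis unfolding p_def .
qed

lemma bessel:
  assumes E: "orthonormal E" and u: "u \<in> S"
  shows "(\<Sum>e\<in>E. (b u e)\<^sup>2) \<le> b u u"
proof -
  have "u - (\<Sum>e\<in>E. b u e *\<^sub>R e) \<in> S" using orthonormal_mem[OF E] u by (intro mem_diff mem_sum mem_scale)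
  from nonneg[OF this] show ?thesis using projection_norm[OF E u] by simp
qed

text \<open>The sum is the trace of the form pulled back by \<open>L\<close>. It is used with real
  values for the squared norm of a gradient and with ambient values for \<open>h\<close>, one slot
  at a time.\<close>

lemma trace_independent:
  assumes E: "orthonormal E" and E': "orthonormal E'" and span: "span E = span E'"
    and T: "inner_space T t" and L: "\<And>u. u \<in> span E \<Longrightarrow> L u \<in> T"
    and lin: "\<And>I x. finite I \<Longrightarrow> I \<subseteq> span E \<Longrightarrow> L (\<Sum>v\<in>I. x v *\<^sub>R v) = (\<Sum>v\<in>I. x v *\<^sub>R L v)"
  shows "(\<Sum>u\<in>E. t (L u) (L u)) = (\<Sum>v\<in>E'. t (L v) (L v))"
proof -
  interpret T: inner_space T t by (rule T)
  have Es: "e \<in> span E" if "e \<in> E" for e using that by (rule span_base)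
  have Es': "e \<in> span E" if "e \<in> E'" for e using that span span_base by metis
  have "t (L u) (L u) = (\<Sum>v\<in>E'. \<Sum>w\<in>E'. b u v * b u w * t (L v) (L w))" if u: "u \<in> E" for u
  proof -
    have "u = (\<Sum>v\<in>E'. b u v *\<^sub>R v)" using expansion[OF E'] Es[OF u] span by simp
    then have "L u = L (\<Sum>v\<in>E'. b u v *\<^sub>R v)" by simp
    also have "\<dots> = (\<Sum>v\<in>E'. b u v *\<^sub>R L v)" using Es' by (intro lin orthonormal_finite[OF E']) blast
    finally have "L u = (\<Sum>v\<in>E'. b u v *\<^sub>R L v)" .
    then show ?thesis using T.sum_sum_scale[of E' L E' L "b u" "b u"] L[OF Es'] by simp
  qed
  then have "(\<Sum>u\<in>E. t (L u) (L u)) = (\<Sum>u\<in>E. \<Sum>v\<in>E'. \<Sum>w\<in>E'. b u v * b u w * t (L v) (L w))" by simp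
  also have "\<dots> = (\<Sum>v\<in>E'. \<Sum>u\<in>E. \<Sum>w\<in>E'. b u v * b u w * t (L v) (L w))" by (rule sum.swap)
  also have "\<dots> = (\<Sum>v\<in>E'. \<Sum>w\<in>E'. \<Sum>u\<in>E. b u v * b u w * t (L v) (L w))"
    by (intro sum.cong[OF refl] sum.swap)
  also have "\<dots> = (\<Sum>v\<in>E'. \<Sum>w\<in>E'. (if v = w then 1 else 0) * t (L v) (L w))"
  proof (intro sum.cong[OF refl])
    fix v w assume v: "v \<in> E'" and w: "w \<in> E'"
    have "(\<Sum>u\<in>E. b u v * b u w) = (\<Sum>u\<in>E. b v u * b u w)"
      by (intro sum.cong[OF refl]) (metis sym orthonormal_mem[OF E] orthonormal_mem[OF E' v])
    also have "\<dots> = b v w" using parseval[OF E Es'[OF v] orthonormal_mem[OF E' w]] by simp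
    finally show "(\<Sum>u\<in>E. b u v * b u w * t (L v) (L w)) = (if v = w then 1 else 0) * t (L v) (L w)"
      using orthonormal_inner[OF E' v w] by (simp add: sum_distrib_right[symmetric])
  qed
  also have "\<dots> = (\<Sum>v\<in>E'. t (L v) (L v))"
    by (intro sum.cong[OF refl]) (simp add: if_distrib[of "\<lambda>x. x * _"] orthonormal_finite[OF E'] cong: if_cong)
  finally show ?thesis .
qed

end

lemma inner_space_real: "inner_space (UNIV :: real set) (*)"
  unfolding inner_space_def inner_on_def by (auto simp: algebra_simps zero_less_mult_iff linorder_neq_iff)

text \<open>The algebra behind one block of the inequality: \<open>a u v\<close> is the component of \<open>h(X, u)\<close> along
  \<open>F v\<close>. Only the part of the skew matrix \<open>F \<omega> - \<tau> / 3\<close> along \<open>\<omega>\<close> is controlled.\<close>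

lemma skew_block_bound:
  fixes F F' c :: real and \<omega> \<tau> a :: "'v \<Rightarrow> 'v \<Rightarrow> real"
  assumes E: "finite E"
    and a: "\<And>u v. u \<in> E \<Longrightarrow> v \<in> E \<Longrightarrow> a u v = - F' * (if u = v then 1 else 0) + F * \<omega> u v - \<tau> u v / 3"
    and diag: "\<And>u. u \<in> E \<Longrightarrow> \<omega> u u = 0" "\<And>u. u \<in> E \<Longrightarrow> \<tau> u u = 0"
    and \<omega>\<omega>: "(\<Sum>u\<in>E. \<Sum>v\<in>E. (\<omega> u v)\<^sup>2) = c * card E"
    and \<omega>\<tau>: "(\<Sum>u\<in>E. \<Sum>v\<in>E. \<omega> u v * \<tau> u v) = 2 * F * c * card E"
  shows "(\<Sum>u\<in>E. \<Sum>v\<in>E. (a u v)\<^sup>2) \<ge> card E * (F'\<^sup>2 + F\<^sup>2 * c / 9)"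
proof -
  define y where "y u v = F * \<omega> u v - \<tau> u v / 3" for u v
  \<comment> \<open>The skew part vanishes on the diagonal, where the scalar part lives, so the
    squares add without cross terms.\<close>
  have "(\<Sum>u\<in>E. \<Sum>v\<in>E. (a u v)\<^sup>2) = (\<Sum>u\<in>E. \<Sum>v\<in>E. (if u = v then F'\<^sup>2 else 0) + (y u v)\<^sup>2)"
  proof (intro sum.cong refl)
    fix u v assume uv: "u \<in> E" "v \<in> E"
    show "(a u v)\<^sup>2 = (if u = v then F'\<^sup>2 else 0) + (y u v)\<^sup>2"
      using a[OF uv] diag uv by (cases "u = v") (simp_all add: y_def)
  qed
  also have "\<dots> = card E * F'\<^sup>2 + (\<Sum>u\<in>E. \<Sum>v\<in>E. (y u v)\<^sup>2)"
    using E by (simp add: sum.distrib)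
  finally have 1: "(\<Sum>u\<in>E. \<Sum>v\<in>E. (a u v)\<^sup>2) = card E * F'\<^sup>2 + (\<Sum>u\<in>E. \<Sum>v\<in>E. (y u v)\<^sup>2)" .
  \<comment> \<open>\<open>F / 3\<close> is the coefficient of the projection of \<open>y\<close> on
    \<omega>: their pairing is \<open>(F - 2 * F / 3) * c\<close> times the number of frame vectors,
    and \<omega> has squared norm \<open>c\<close> times that number. The square of the remainder is
    dropped afterwards.\<close>
  have "(\<Sum>u\<in>E. \<Sum>v\<in>E. (y u v)\<^sup>2) = (\<Sum>u\<in>E. \<Sum>v\<in>E. (y u v - F / 3 * \<omega> u v)\<^sup>2)
      + (\<Sum>u\<in>E. \<Sum>v\<in>E. 5 / 9 * F\<^sup>2 * (\<omega> u v)\<^sup>2 - 2 / 9 * F * (\<omega> u v * \<tau> u v))"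
    unfolding sum.distrib[symmetric]
    by (intro sum.cong refl) (simp add: y_def power2_eq_square field_simps)
  also have "(\<Sum>u\<in>E. \<Sum>v\<in>E. 5 / 9 * F\<^sup>2 * (\<omega> u v)\<^sup>2 - 2 / 9 * F * (\<omega> u v * \<tau> u v))
      = 5 / 9 * F\<^sup>2 * (c * card E) - 2 / 9 * F * (2 * F * c * card E)"
    unfolding \<omega>\<omega>[symmetric] \<omega>\<tau>[symmetric] by (simp add: sum_subtractf sum_distrib_left)
  also have "\<dots> = F\<^sup>2 * c / 9 * card E" by (simp add: power2_eq_square field_simps)
  finally have "(\<Sum>u\<in>E. \<Sum>v\<in>E. (y u v)\<^sup>2) \<ge> F\<^sup>2 * c / 9 * card E"
    using sum_nonneg[of E "\<lambda>u. \<Sum>v\<in>E. (y u v - F / 3 * \<omega> u v)\<^sup>2"] by (simp add: sum_nonneg)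
  then show ?thesis unfolding 1 by (simp add: algebra_simps)
qed

section \<open>The inequality\<close>

locale nk_warped = nk_immersion B A g nab \<phi> J nabB h + warped_split B "pullback_metric A g \<phi>" nabB D Lf bas F
  for B :: "('n::{t2_space,second_countable_topology}, 'f::euclidean_space) chart set"
    and A :: "('m::{t2_space,second_countable_topology}, 'e::euclidean_space) chart set"
    and g nab \<phi> J nabB h D Lf bas F +
  assumes holo: "\<And>p x. x \<in> D 0 p \<Longrightarrow> \<exists>z\<in>D 0 p. d p z = J (\<phi> p) (d p x)"
    and D0_finite: "\<And>p. \<exists>X. finite X \<and> span X = D 0 p"
begin

text \<open>\<open>J X\<close> is again tangent to the base, which is orthogonal to the
  fibre.\<close>

lemma holo_lift_perp:
  assumes i: "i < 3" "i \<noteq> 0" and X: "Lf 0 W X" and V: "Lf i W V" and q: "q \<in> W"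
  shows "g (\<phi> q) (J (\<phi> q) (d q (X q))) (d q (V q)) = 0"
proof -
  obtain z where z: "z \<in> D 0 q" "d q z = J (\<phi> q) (d q (X q))"
    using holo[OF Lf_D[OF _ X q]] by auto
  have "G q z (V q) = 0" by (rule D_orth[OF _ i(1) i(2)[symmetric] z(1) Lf_D[OF i(1) V q]]) simp
  then show ?thesis unfolding G_eq z(2) .
qed

text \<open>The pointwise form of the identity in the overview: \<open>x\<close> is extended to a
  lift, \<open>z\<close> plays the role of \<open>J X\<close>, and the covariant derivatives on the
  product are those found from the Koszul formula.\<close>

lemma warped_identity:
  assumes i: "i < 3" "i \<noteq> 0" and p: "p \<in> W" and U: "Lf i W U" and V: "Lf i W V"
    and x: "x \<in> D 0 p" and z: "z \<in> D 0 p" "d p z = J (\<phi> p) (d p x)"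
  defines "\<omega> \<equiv> \<lambda>q. g (\<phi> q) (J (\<phi> q) (d q (U q))) (d q (V q))"
  shows "g (\<phi> p) (h p x (U p)) (J (\<phi> p) (d p (V p)))
      = - (z \<cdot> F i) * G p (U p) (V p) + (x \<cdot> F i) * \<omega> p - (x \<cdot> \<omega>) / 3"
    and "smooth_at B p \<omega>"
proof -
  have i0: "(0::nat) < 3" by simp
  obtain W' X where W': "p \<in> W'" "W' \<subseteq> W" "open W'" and X: "Lf 0 W' X" "X p = x"
    using Lf_extends_within[OF i0 x vector_field_open[OF Lf_field[OF i(1) U]] p] by metis
  have U': "Lf i W' U" and V': "Lf i W' V" using Lf_subset[OF i(1)] U V W' by auto
  note Xf = Lf_field[OF i0 X(1)] and Uf = Lf_field[OF i(1) U'] and Vf = Lf_field[OF i(1) V']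
  note id = nk_identity[OF W'(1) Xf Uf Vf holo_lift_perp[OF i X(1) U'] holo_lift_perp[OF i X(1) V']
      D_tangent[OF i0 z(1)] _ nabB_base_fibre[OF i X(1) U' W'(1)] nabB_base_fibre[OF i X(1) V' W'(1)]
      nabB_same_other[OF i(1) i0 i(2) U' V' W'(1) z(1)] nabB_same_other[OF i(1) i0 i(2) V' U' W'(1) z(1)],
      unfolded X(2), OF _ _ z(2)]
  show "g (\<phi> p) (h p x (U p)) (J (\<phi> p) (d p (V p)))
      = - (z \<cdot> F i) * G p (U p) (V p) + (x \<cdot> F i) * \<omega> p - (x \<cdot> \<omega>) / 3"
    unfolding \<omega>_def by (rule id(1))
  show "smooth_at B p \<omega>" unfolding \<omega>_def by (rule id(2))
qed

end

section \<open>Bessel's inequality on a fibre\<close>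

lemma (in inner_space) bessel_family:
  assumes I: "finite I" and f: "\<And>i. i \<in> I \<Longrightarrow> f i \<in> S"
    and \<delta>: "\<And>i j. i \<in> I \<Longrightarrow> j \<in> I \<Longrightarrow> b (f i) (f j) = (if i = j then 1 else 0)" and u: "u \<in> S"
  shows "(\<Sum>i\<in>I. (b u (f i))\<^sup>2) \<le> b u u"
proof -
  have inj: "inj_on f I" by (rule inj_onI) (metis \<delta> zero_neq_one)
  have "orthonormal (f ` I)" unfolding orthonormal_def using I f \<delta> inj_onD[OF inj] by auto
  from bessel[OF this u] show ?thesis by (simp add: sum.reindex[OF inj])
qed

context nk_warped
begin

abbreviation on :: "'n \<Rightarrow> 'n tvec set \<Rightarrow> bool" where
  "on p \<equiv> inner_space.orthonormal (tangent_space B p) (G p)"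

abbreviation \<omega> :: "'n \<Rightarrow> 'n tvec \<Rightarrow> 'n tvec \<Rightarrow> real" where
  "\<omega> q u v \<equiv> g (\<phi> q) (J (\<phi> q) (d q u)) (d q v)"

lemma \<omega>_self: "u \<in> tangent_space B q \<Longrightarrow> \<omega> q u u = 0"
  using J_skew[OF d_tangent d_tangent, of u q u] T.sym[OF J_tangent[OF d_tangent] d_tangent, of u q u] by simp

lemma d_sum: "d p (\<Sum>i\<in>I. x i *\<^sub>R u i) = (\<Sum>i\<in>I. x i *\<^sub>R d p (u i))"
  using linear_differential[of A \<phi> p] by (simp add: linear_sum linear_scale)

text \<open>\<open>m v\<close> is \<open>J v\<close> without its component in the block spanned by
  \<open>E\<close>. The relation \<open>sl\<close> makes the vectors \<open>m v\<close> orthogonal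
  of squared length \<open>1 - c\<close>, and \<open>n\<close> has the same inner product with
  \<open>m v\<close> as with \<open>J v\<close>; Bessel's inequality for the normalized vectors
  gives the bound.\<close>

lemma block_frame:
  assumes E: "on p E" and c: "c < 1"
    and sl: "\<And>u w. u \<in> E \<Longrightarrow> w \<in> E \<Longrightarrow> (\<Sum>v\<in>E. \<omega> p u v * \<omega> p w v) = (if u = w then c else 0)"
    and n: "n \<in> tangent_space A (\<phi> p)" "\<And>v. v \<in> E \<Longrightarrow> g (\<phi> p) n (d p v) = 0"
  shows "(\<Sum>v\<in>E. (g (\<phi> p) n (J (\<phi> p) (d p v)))\<^sup>2) / (1 - c) \<le> g (\<phi> p) n n"
proof -
  let ?g = "g (\<phi> p)" and ?J = "J (\<phi> p)"
  note fin = G.orthonormal_finite[OF E] and Et = G.orthonormal_mem[OF E] and \<delta> = G.orthonormal_inner[OF E]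
  have dE: "d p v \<in> tangent_space A (\<phi> p)" "?J (d p v) \<in> tangent_space A (\<phi> p)" if "v \<in> E" for v
    using d_tangent[OF Et[OF that]] J_tangent by auto
  define m where "m v = ?J (d p v) - (\<Sum>w\<in>E. \<omega> p v w *\<^sub>R d p w)" for v
  define f where "f v = (1 / sqrt (1 - c)) *\<^sub>R m v" for v
  have s: "(\<Sum>w\<in>E. \<omega> p v w *\<^sub>R d p w) \<in> tangent_space A (\<phi> p)" for v
    using dE by (auto intro!: T.mem_sum T.mem_scale)
  have m: "m v \<in> tangent_space A (\<phi> p)" if "v \<in> E" for v
    unfolding m_def using dE(2)[OF that] s by (rule T.mem_diff)
  have sw: "?g (\<Sum>w\<in>E. \<omega> p v w *\<^sub>R d p w) y = (\<Sum>w\<in>E. \<omega> p v w * ?g (d p w) y)"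
    if "y \<in> tangent_space A (\<phi> p)" for v y
    using that dE by (subst T.sum_left) (auto simp: T.scale_left T.mem_scale)
  have mm: "?g (m u) (m w) = (if u = w then 1 - c else 0)" if u: "u \<in> E" and w: "w \<in> E" for u w
  proof -
    \<comment> \<open>For \<open>u = w\<close> the vector \<open>J u\<close> has length 1 and each
      of the three terms with a projection equals \<open>c\<close>, so the total is
      \<open>1 - c - c + c\<close>.\<close>
    have 1: "?g (?J (d p u)) (?J (d p w)) = (if u = w then 1 else 0)"
      using hermitian[OF dE(1)[OF u] dE(1)[OF w]] \<delta>[OF u w] unfolding G_eq by simp
    have 2: "?g (\<Sum>v\<in>E. \<omega> p u v *\<^sub>R d p v) (?J (d p w)) = (if u = w then c else 0)"
      unfolding sw[OF dE(2)[OF w]] sl[OF u w, symmetric] using dE w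
      by (intro sum.cong refl) (simp add: T.sym)
    have 3: "?g (?J (d p u)) (\<Sum>v\<in>E. \<omega> p w v *\<^sub>R d p v) = (if u = w then c else 0)"
      unfolding T.sym[OF dE(2)[OF u] s] sw[OF dE(2)[OF u]] sl[OF u w, symmetric] using dE u
      by (intro sum.cong refl) (simp add: T.sym mult.commute)
    have "?g (d p v) (\<Sum>v\<in>E. \<omega> p w v *\<^sub>R d p v) = \<omega> p w v" if v: "v \<in> E" for v
    proof -
      have "?g (d p v) (\<Sum>v\<in>E. \<omega> p w v *\<^sub>R d p v) = (\<Sum>v'\<in>E. if v' = v then \<omega> p w v' else 0)"
        unfolding T.sym[OF dE(1)[OF v] s] sw[OF dE(1)[OF v]] G_eq[symmetric]
        by (intro sum.cong refl) (simp add: \<delta> v)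
      then show ?thesis using fin v by simp
    qed
    then have 4: "?g (\<Sum>v\<in>E. \<omega> p u v *\<^sub>R d p v) (\<Sum>v\<in>E. \<omega> p w v *\<^sub>R d p v) = (if u = w then c else 0)"
      unfolding sw[OF s] sl[OF u w, symmetric] by (intro sum.cong refl) simp
    show ?thesis
      unfolding m_def using dE(2)[OF u] dE(2)[OF w] s
      by (simp add: T.diff_left T.diff_right T.mem_diff 1 2 3 4)
  qed
  have ff: "?g (f u) (f w) = (if u = w then 1 else 0)" if "u \<in> E" "w \<in> E" for u w
    unfolding f_def using mm[OF that] m that c
    by (simp add: T.scale_left T.scale_right T.mem_scale real_sqrt_mult_self field_simps)
  have nf: "?g n (f v) = ?g n (?J (d p v)) / sqrt (1 - c)" if "v \<in> E" for v
  proof -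
    have "?g n (\<Sum>w\<in>E. \<omega> p v w *\<^sub>R d p w) = 0"
      using n dE by (subst T.sum_right) (auto simp: T.scale_right T.mem_scale)
    then show ?thesis
      unfolding f_def m_def using n(1) dE(2)[OF that] s by (simp add: T.scale_right T.diff_right T.mem_diff)
  qed
  have "(\<Sum>v\<in>E. (?g n (f v))\<^sup>2) \<le> ?g n n"
    by (rule T.bessel_family[OF fin _ ff n(1)]) (auto simp: f_def intro!: T.mem_scale m)
  also have "(\<Sum>v\<in>E. (?g n (f v))\<^sup>2) = (\<Sum>v\<in>E. (?g n (?J (d p v)))\<^sup>2) / (1 - c)"
    using c by (simp add: nf power_divide sum_divide_distrib)
  finally show ?thesis .
qed

text \<open>Here \<tau> is the derivative of \<omega> along \<open>x\<close>. The hypothesis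
  \<open>sd\<close> prescribes the derivative of the squared norm of \<omega>, and half of it is the
  pairing of \<omega> with \<tau> that \<open>skew_block_bound\<close> requires.\<close>

lemma fibre_block:
  assumes i: "i < 3" "i \<noteq> 0" and E: "on p E" and p: "p \<in> W"
    and U: "\<And>e. e \<in> E \<Longrightarrow> Lf i W (U e)" "\<And>e. e \<in> E \<Longrightarrow> U e p = e" and c: "c < 1"
    and sl: "\<And>u w. u \<in> E \<Longrightarrow> w \<in> E \<Longrightarrow> (\<Sum>v\<in>E. \<omega> p u v * \<omega> p w v) = (if u = w then c else 0)"
    and x: "x \<in> D 0 p" and z: "z \<in> D 0 p" "d p z = J (\<phi> p) (d p x)"
    and sd: "x \<cdot> (\<lambda>q. \<Sum>u\<in>E. \<Sum>v\<in>E. (\<omega> q (U u q) (U v q))\<^sup>2) = 4 * (x \<cdot> F i) * c * card E"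
  shows "card E * ((z \<cdot> F i)\<^sup>2 + (x \<cdot> F i)\<^sup>2 * c / 9) / (1 - c) \<le> (\<Sum>u\<in>E. g (\<phi> p) (h p x u) (h p x u))"
proof -
  note fin = G.orthonormal_finite[OF E] and Et = G.orthonormal_mem[OF E] and \<delta> = G.orthonormal_inner[OF E]
  have xt: "x \<in> tangent_space B p" by (rule D_tangent[OF _ x]) simp
  define \<tau> where "\<tau> u v = x \<cdot> (\<lambda>q. \<omega> q (U u q) (U v q))" for u v
  define a where "a u v = g (\<phi> p) (h p x u) (J (\<phi> p) (d p v))" for u v
  have sm: "smooth_at B p (\<lambda>q. \<omega> q (U u q) (U v q))" if "u \<in> E" "v \<in> E" for u v
    by (rule warped_identity(2)[OF i p U(1)[OF that(1)] U(1)[OF that(2)] x z])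
  have a: "a u v = - (z \<cdot> F i) * (if u = v then 1 else 0) + (x \<cdot> F i) * \<omega> p u v - \<tau> u v / 3"
    if "u \<in> E" "v \<in> E" for u v
    using warped_identity(1)[OF i p U(1)[OF that(1)] U(1)[OF that(2)] x z]
    unfolding a_def \<tau>_def by (simp add: U(2) that \<delta>)
  have \<tau>0: "\<tau> u u = 0" if u: "u \<in> E" for u
    unfolding \<tau>_def
    by (rule tangent_act_eq_0I[OF B xt vector_field_open[OF Lf_field[OF i(1) U(1)[OF u]]] p])
      (rule \<omega>_self[OF vector_field_tangent[OF Lf_field[OF i(1) U(1)[OF u]]]])
  have \<omega>\<omega>: "(\<Sum>u\<in>E. \<Sum>v\<in>E. (\<omega> p u v)\<^sup>2) = c * card E"
  proof -
    have "(\<Sum>u\<in>E. \<Sum>v\<in>E. (\<omega> p u v)\<^sup>2) = (\<Sum>u\<in>E. c)"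
      by (intro sum.cong refl) (simp add: power2_eq_square sl)
    then show ?thesis by simp
  qed
  have sm2: "smooth_at B p (\<lambda>q. \<omega> q (U u q) (U v q) * \<omega> q (U u q) (U v q))" if "u \<in> E" "v \<in> E" for u v
    by (rule smooth_at_mult[OF B sm[OF that] sm[OF that]])
  have "x \<cdot> (\<lambda>q. \<Sum>u\<in>E. \<Sum>v\<in>E. (\<omega> q (U u q) (U v q))\<^sup>2)
      = (\<Sum>u\<in>E. x \<cdot> (\<lambda>q. \<Sum>v\<in>E. \<omega> q (U u q) (U v q) * \<omega> q (U u q) (U v q)))"
    unfolding power2_eq_square by (rule tangent_act_sum[OF B xt smooth_at_sum[OF B sm2]])
  also have "\<dots> = (\<Sum>u\<in>E. \<Sum>v\<in>E. x \<cdot> (\<lambda>q. \<omega> q (U u q) (U v q) * \<omega> q (U u q) (U v q)))"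
    by (intro sum.cong[OF refl] tangent_act_sum[OF B xt sm2])
  also have "\<dots> = (\<Sum>u\<in>E. \<Sum>v\<in>E. 2 * (\<omega> p u v * \<tau> u v))"
  proof (intro sum.cong[OF refl])
    fix u v assume uv: "u \<in> E" "v \<in> E"
    show "x \<cdot> (\<lambda>q. \<omega> q (U u q) (U v q) * \<omega> q (U u q) (U v q)) = 2 * (\<omega> p u v * \<tau> u v)"
      unfolding tangent_act_mult[OF B xt sm[OF uv] sm[OF uv]] \<tau>_def by (simp add: U(2) uv)
  qed
  finally have "2 * (\<Sum>u\<in>E. \<Sum>v\<in>E. \<omega> p u v * \<tau> u v) = 4 * (x \<cdot> F i) * c * card E"
    unfolding sd by (simp add: sum_distrib_left)
  then have \<omega>\<tau>: "(\<Sum>u\<in>E. \<Sum>v\<in>E. \<omega> p u v * \<tau> u v) = 2 * (x \<cdot> F i) * c * card E" by simp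
  have "card E * ((z \<cdot> F i)\<^sup>2 + (x \<cdot> F i)\<^sup>2 * c / 9) \<le> (\<Sum>u\<in>E. \<Sum>v\<in>E. (a u v)\<^sup>2)"
    by (rule skew_block_bound[OF fin a \<omega>_self[OF Et] \<tau>0 \<omega>\<omega> \<omega>\<tau>])
  then have "card E * ((z \<cdot> F i)\<^sup>2 + (x \<cdot> F i)\<^sup>2 * c / 9) / (1 - c) \<le> (\<Sum>u\<in>E. \<Sum>v\<in>E. (a u v)\<^sup>2) / (1 - c)"
    using c by (intro divide_right_mono) auto
  also have "\<dots> = (\<Sum>u\<in>E. (\<Sum>v\<in>E. (a u v)\<^sup>2) / (1 - c))" by (rule sum_divide_distrib)
  also have "\<dots> \<le> (\<Sum>u\<in>E. g (\<phi> p) (h p x u) (h p x u))"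
    unfolding a_def
    by (intro sum_mono block_frame[OF E c sl] h_tangent[OF xt] h_normal[OF xt] Et; assumption)
  finally show ?thesis .
qed

text \<open>What the bound uses from one fibre: an orthonormal basis of the distribution at
  \<open>p\<close> extended by lifts, the slant relation with \<open>c\<close> the squared cosine of
  the angle, and the rate of change of the squared norm of \<omega> on these lifts. The lifts need
  not be orthonormal away from \<open>p\<close>; the 4 reflects the fourth power of the warping
  function.\<close>

definition fibre_data :: "nat \<Rightarrow> real \<Rightarrow> nat \<Rightarrow> 'n \<Rightarrow> bool" where
  "fibre_data i c n p \<longleftrightarrow> (\<exists>E U W. on p E \<and> span E = D i p \<and> card E = n \<and> p \<in> W \<and>
     (\<forall>e\<in>E. Lf i W (U e) \<and> U e p = e) \<and>
     (\<forall>u\<in>E. \<forall>w\<in>E. (\<Sum>v\<in>E. \<omega> p u v * \<omega> p w v) = (if u = w then c else 0)) \<and>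
     (\<forall>x\<in>D 0 p. x \<cdot> (\<lambda>q. \<Sum>u\<in>E. \<Sum>v\<in>E. (\<omega> q (U u q) (U v q))\<^sup>2) = 4 * (x \<cdot> F i) * c * n))"

section \<open>Independence of the orthonormal frame\<close>

lemma sum_act_sq_invariant:
  assumes E: "on p E" and E': "on p E'" and "span E = span E'"
  shows "(\<Sum>u\<in>E. (u \<cdot> f)\<^sup>2) = (\<Sum>u\<in>E'. (u \<cdot> f)\<^sup>2)"
  unfolding power2_eq_square
  by (rule G.trace_independent[OF assms inner_space_real]) (simp_all add: act_sum)

lemma gradient_expansion:
  assumes E: "on p E" "span E = tangent_space B p"
  shows "(\<Sum>e\<in>E. (e \<cdot> f) *\<^sub>R e) \<in> tangent_space B p"
    and "v \<in> tangent_space B p \<Longrightarrow> G p (\<Sum>e\<in>E. (e \<cdot> f) *\<^sub>R e) v = v \<cdot> f"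
proof -
  note Et = G.orthonormal_mem[OF E(1)]
  show "(\<Sum>e\<in>E. (e \<cdot> f) *\<^sub>R e) \<in> tangent_space B p" using Et by (auto intro!: G.mem_sum G.mem_scale)
  assume v: "v \<in> tangent_space B p"
  have "v = (\<Sum>e\<in>E. G p v e *\<^sub>R e)" by (rule G.expansion[OF E(1)]) (simp add: E(2) v)
  then have "v \<cdot> f = (\<Sum>e\<in>E. G p v e *\<^sub>R e) \<cdot> f" by simp
  also have "\<dots> = (\<Sum>e\<in>E. (e \<cdot> f) * G p e v)"
    unfolding act_sum using Et v by (intro sum.cong refl) (simp add: G.sym)
  also have "\<dots> = G p (\<Sum>e\<in>E. (e \<cdot> f) *\<^sub>R e) v"
    using Et v by (subst G.sum_left) (auto simp: G.scale_left G.mem_scale)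
  finally show "G p (\<Sum>e\<in>E. (e \<cdot> f) *\<^sub>R e) v = v \<cdot> f" by simp
qed

lemma h_sum_left:
  assumes I: "I \<subseteq> tangent_space B p" and y: "y \<in> tangent_space B p"
  shows "h p (\<Sum>v\<in>I. x v *\<^sub>R v) y = (\<Sum>v\<in>I. x v *\<^sub>R h p v y)"
  using I
proof (induction I rule: infinite_finite_induct)
  case (insert v I)
  have "(\<Sum>v\<in>I. x v *\<^sub>R v) \<in> tangent_space B p" using insert.prems by (auto intro!: G.mem_sum G.mem_scale)
  then show ?case
    using insert h_lin_left[of v p "\<Sum>v\<in>I. x v *\<^sub>R v" y "x v" 1] y by simp
qed (use h_lin_left[of 0 p 0 y 0 0] y in simp_all)

lemma h_sum_right:
  assumes I: "I \<subseteq> tangent_space B p" and y: "y \<in> tangent_space B p"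
  shows "h p y (\<Sum>v\<in>I. x v *\<^sub>R v) = (\<Sum>v\<in>I. x v *\<^sub>R h p y v)"
proof -
  have "(\<Sum>v\<in>I. x v *\<^sub>R v) \<in> tangent_space B p" using I by (auto intro!: G.mem_sum G.mem_scale)
  then have "h p y (\<Sum>v\<in>I. x v *\<^sub>R v) = (\<Sum>v\<in>I. x v *\<^sub>R h p v y)"
    using h_sym[OF y] h_sum_left[OF I y] by simp
  then show ?thesis using I h_sym[OF y] by (auto intro!: sum.cong)
qed

text \<open>The frame in \<open>norm_sq_sff\<close> is an arbitrary choice; this exchanges it for
  one adapted to the three distributions, one argument of \<open>h\<close> at a time.\<close>

lemma norm_h_invariant:
  assumes E: "on p E" and E': "on p E'" and span: "span E = span E'" "span E = tangent_space B p"
  shows "(\<Sum>u\<in>E. \<Sum>v\<in>E. g (\<phi> p) (h p u v) (h p u v)) = (\<Sum>u\<in>E'. \<Sum>v\<in>E'. g (\<phi> p) (h p u v) (h p u v))"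
proof -
  have R: "(\<Sum>v\<in>E. g (\<phi> p) (h p u v) (h p u v)) = (\<Sum>v\<in>E'. g (\<phi> p) (h p u v) (h p u v))"
    if u: "u \<in> tangent_space B p" for u
    by (rule G.trace_independent[OF E E' span(1) T.inner_space_axioms])
      (use u span(2) h_tangent h_sum_right[OF _ u] in auto)
  have L: "(\<Sum>u\<in>E. g (\<phi> p) (h p u v) (h p u v)) = (\<Sum>u\<in>E'. g (\<phi> p) (h p u v) (h p u v))"
    if v: "v \<in> tangent_space B p" for v
    by (rule G.trace_independent[OF E E' span(1) T.inner_space_axioms])
      (use v span(2) h_tangent h_sum_left[OF _ v] in auto)
  have "(\<Sum>u\<in>E. \<Sum>v\<in>E. g (\<phi> p) (h p u v) (h p u v)) = (\<Sum>u\<in>E. \<Sum>v\<in>E'. g (\<phi> p) (h p u v) (h p u v))"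
    by (intro sum.cong refl R G.orthonormal_mem[OF E])
  also have "\<dots> = (\<Sum>v\<in>E'. \<Sum>u\<in>E. g (\<phi> p) (h p u v) (h p u v))" by (rule sum.swap)
  also have "\<dots> = (\<Sum>v\<in>E'. \<Sum>u\<in>E'. g (\<phi> p) (h p u v) (h p u v))"
    by (intro sum.cong refl L G.orthonormal_mem[OF E'])
  also have "\<dots> = (\<Sum>u\<in>E'. \<Sum>v\<in>E'. g (\<phi> p) (h p u v) (h p u v))" by (rule sum.swap)
  finally show ?thesis .
qed

text \<open>\<open>J\<close> maps an orthonormal basis of the holomorphic distribution to another
  one, and the sum of squared derivatives is the same in both.\<close>

lemma holomorphic_basis:
  assumes E: "on p E" and span: "span E = D 0 p"
    and j: "\<And>x. x \<in> E \<Longrightarrow> j x \<in> D 0 p" "\<And>x. x \<in> E \<Longrightarrow> d p (j x) = J (\<phi> p) (d p x)"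
  shows "(\<Sum>x\<in>E. (j x \<cdot> f)\<^sup>2) = (\<Sum>x\<in>E. (x \<cdot> f)\<^sup>2)"
proof -
  have i0: "(0::nat) < 3" by simp
  note Et = G.orthonormal_mem[OF E] and jt = D_tangent[OF i0 j(1)]
  have \<delta>: "G p (j x) (j y) = (if x = y then 1 else 0)" if "x \<in> E" "y \<in> E" for x y
    using hermitian[OF d_tangent[OF Et[OF that(1)]] d_tangent[OF Et[OF that(2)]]] G.orthonormal_inner[OF E that]
    unfolding G_eq j(2)[OF that(1)] j(2)[OF that(2)] by simp
  have inj_j: "inj_on j E" by (rule inj_onI) (metis \<delta> zero_neq_one)
  have on: "on p (j ` E)"
    unfolding G.orthonormal_def using G.orthonormal_finite[OF E] jt \<delta> inj_onD[OF inj_j] by auto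
  have "span (j ` E) \<subseteq> D 0 p"
    by (rule span_minimal[OF _ D_subspace[OF i0]]) (use j(1) in blast)
  moreover have "D 0 p \<subseteq> span (j ` E)"
  proof
    fix v assume v: "v \<in> D 0 p"
    obtain z where z: "z \<in> D 0 p" "d p z = J (\<phi> p) (d p v)" using holo[OF v] by blast
    note vt = D_tangent[OF i0 v]
    have ze: "z = (\<Sum>e\<in>E. G p z e *\<^sub>R e)" using G.expansion[OF E] z(1) span by blast
    \<comment> \<open>Every \<open>v\<close> is \<open>- J\<close> of \<open>J v\<close>, so
      expanding \<open>J v\<close> in \<open>E\<close> expands \<open>v\<close> in the image
      basis.\<close>
    have "d p v = - J (\<phi> p) (d p z)" unfolding z(2) using J_J[OF d_tangent[OF vt]] by simp
    also have "d p z = (\<Sum>e\<in>E. G p z e *\<^sub>R d p e)" using ze d_sum[of p "G p z" "\<lambda>e. e" E] by simp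
    also have "J (\<phi> p) \<dots> = (\<Sum>e\<in>E. G p z e *\<^sub>R J (\<phi> p) (d p e))"
      by (rule J_sum[OF d_tangent[OF Et]])
    also have "\<dots> = d p (\<Sum>e\<in>E. G p z e *\<^sub>R j e)" unfolding d_sum using j(2) by (intro sum.cong refl) simp
    also have "- d p (\<Sum>e\<in>E. G p z e *\<^sub>R j e) = d p (- (\<Sum>e\<in>E. G p z e *\<^sub>R j e))"
      using linear_neg[OF linear_differential[of A \<phi> p]] by simp
    finally have v_eq: "v = - (\<Sum>e\<in>E. G p z e *\<^sub>R j e)"
      by (rule inj_onD[OF inj _ vt]) (intro G.mem_minus G.mem_sum G.mem_scale jt)
    show "v \<in> span (j ` E)"
      by (subst v_eq) (intro span_neg span_sum span_scale span_base imageI)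
  qed
  ultimately have "span E = span (j ` E)" using span by blast
  from sum_act_sq_invariant[OF E on this] show ?thesis by (simp add: sum.reindex[OF inj_j])
qed

text \<open>Summation over a basis of the base distribution replaces \<open>J x\<close> by
  \<open>x\<close>, which merges the two terms of \<open>fibre_block\<close>:
  \<open>(1 + c / 9) / (1 - c) = 1 + 10 / 9 * (c / (1 - c))\<close>.\<close>

lemma fibre_data_bound:
  assumes i: "i < 3" "i \<noteq> 0" and c: "c < 1" and E: "on p E" "span E = D 0 p"
    and fd: "fibre_data i c n p"
  obtains E' where "on p E'" "span E' = D i p"
    "n * (1 + 10 / 9 * (c / (1 - c))) * (\<Sum>x\<in>E. (x \<cdot> F i)\<^sup>2)
       \<le> (\<Sum>x\<in>E. \<Sum>u\<in>E'. g (\<phi> p) (h p x u) (h p x u))"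
proof -
  obtain E' U W where E': "on p E'" "span E' = D i p" "card E' = n" "p \<in> W"
    and U: "\<And>e. e \<in> E' \<Longrightarrow> Lf i W (U e)" "\<And>e. e \<in> E' \<Longrightarrow> U e p = e"
    and sl: "\<And>u w. u \<in> E' \<Longrightarrow> w \<in> E' \<Longrightarrow> (\<Sum>v\<in>E'. \<omega> p u v * \<omega> p w v) = (if u = w then c else 0)"
    and sd: "\<And>x. x \<in> D 0 p \<Longrightarrow>
      x \<cdot> (\<lambda>q. \<Sum>u\<in>E'. \<Sum>v\<in>E'. (\<omega> q (U u q) (U v q))\<^sup>2) = 4 * (x \<cdot> F i) * c * n"
    using fd unfolding fibre_data_def by blast
  have "\<forall>x\<in>E. \<exists>z. z \<in> D 0 p \<and> d p z = J (\<phi> p) (d p x)" using holo E(2) span_base by blast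
  then obtain j where j: "\<And>x. x \<in> E \<Longrightarrow> j x \<in> D 0 p" "\<And>x. x \<in> E \<Longrightarrow> d p (j x) = J (\<phi> p) (d p x)"
    by metis
  have xD: "x \<in> D 0 p" if "x \<in> E" for x using E(2) span_base[OF that] by simp
  let ?Q = "\<Sum>x\<in>E. (x \<cdot> F i)\<^sup>2"
  have "n * (1 + 10 / 9 * (c / (1 - c))) * ?Q = n / (1 - c) * (?Q + ?Q * c / 9)"
    using c by (simp add: field_simps)
  also have "\<dots> = n / (1 - c) * ((\<Sum>x\<in>E. (j x \<cdot> F i)\<^sup>2) + ?Q * c / 9)"
    using holomorphic_basis[OF E j] by simp
  also have "\<dots> = (\<Sum>x\<in>E. n / (1 - c) * ((j x \<cdot> F i)\<^sup>2 + (x \<cdot> F i)\<^sup>2 * c / 9))"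
    by (simp only: sum.distrib sum_distrib_left[symmetric] sum_distrib_right[symmetric] sum_divide_distrib[symmetric])
  also have "\<dots> \<le> (\<Sum>x\<in>E. \<Sum>u\<in>E'. g (\<phi> p) (h p x u) (h p x u))"
  proof (rule sum_mono)
    fix x assume x: "x \<in> E"
    show "n / (1 - c) * ((j x \<cdot> F i)\<^sup>2 + (x \<cdot> F i)\<^sup>2 * c / 9) \<le> (\<Sum>u\<in>E'. g (\<phi> p) (h p x u) (h p x u))"
      using fibre_block[OF i E'(1,4) U c sl xD[OF x] j[OF x]] sd[OF xD[OF x]] E'(3) by simp
  qed
  finally show ?thesis using that[OF E'(1,2)] by blast
qed

lemma h_block_zero:
  assumes E: "on p E" and E': "on p E'"
    and 0: "(\<Sum>u\<in>E. \<Sum>v\<in>E'. g (\<phi> p) (h p u v) (h p u v)) = 0"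
    and u: "u \<in> span E" and v: "v \<in> span E'"
  shows "h p u v = 0"
proof -
  note fin = G.orthonormal_finite[OF E] G.orthonormal_finite[OF E']
  note Et = G.orthonormal_mem[OF E] and Et' = G.orthonormal_mem[OF E']
  have nn: "0 \<le> g (\<phi> p) (h p u v) (h p u v)" if "u \<in> E" "v \<in> E'" for u v
    by (rule T.nonneg[OF h_tangent[OF Et[OF that(1)] Et'[OF that(2)]]])
  have z: "h p u v = 0" if "u \<in> E" "v \<in> E'" for u v
  proof -
    have "(\<Sum>v\<in>E'. g (\<phi> p) (h p u v) (h p u v)) = 0"
      using 0 that(1) by (subst (asm) sum_nonneg_eq_0_iff[OF fin(1)]) (auto intro!: sum_nonneg nn)
    then have "g (\<phi> p) (h p u v) (h p u v) = 0"
      using that by (subst (asm) sum_nonneg_eq_0_iff[OF fin(2)]) (auto intro!: nn)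
    then show ?thesis using T.eq_0_iff[OF h_tangent[OF Et[OF that(1)] Et'[OF that(2)]]] by simp
  qed
  have vt: "v \<in> tangent_space B p" using v G.span_subset[of E' p] Et' by blast
  have z': "h p u v = 0" if u: "u \<in> E" for u
  proof -
    have "v = (\<Sum>e\<in>E'. G p v e *\<^sub>R e)" by (rule G.expansion[OF E' v])
    then have "h p u v = h p u (\<Sum>e\<in>E'. G p v e *\<^sub>R e)" by simp
    also have "\<dots> = (\<Sum>e\<in>E'. G p v e *\<^sub>R h p u e)"
      by (rule h_sum_right[OF _ Et[OF u]]) (use Et' in blast)
    also have "\<dots> = 0" using z[OF u] by simp
    finally show ?thesis .
  qed
  have "u = (\<Sum>e\<in>E. G p u e *\<^sub>R e)" by (rule G.expansion[OF E u])
  then have "h p u v = h p (\<Sum>e\<in>E. G p u e *\<^sub>R e) v" by simp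
  also have "\<dots> = (\<Sum>e\<in>E. G p u e *\<^sub>R h p e v)"
    by (rule h_sum_left[OF _ vt]) (use Et in blast)
  also have "\<dots> = 0" using z' by simp
  finally show ?thesis .
qed

lemma orthonormal_union:
  assumes E: "on p E" "span E = D 0 p" and E1: "on p E1" "span E1 = D 1 p" and E2: "on p E2" "span E2 = D 2 p"
  shows "on p (E \<union> E1 \<union> E2)" "span (E \<union> E1 \<union> E2) = tangent_space B p"
    "E \<inter> E1 = {}" "(E \<union> E1) \<inter> E2 = {}"
proof -
  have m: "u \<in> D 0 p" if "u \<in> E" for u using span_base[OF that] E(2) by simp
  have m1: "u \<in> D 1 p" if "u \<in> E1" for u using span_base[OF that] E1(2) by simp
  have m2: "u \<in> D 2 p" if "u \<in> E2" for u using span_base[OF that] E2(2) by simp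
  have o01: "G p u v = 0" "G p v u = 0" if "u \<in> E" "v \<in> E1" for u v
    using D_orth[of 0 1 u p v] D_orth[of 1 0 v p u] m m1 that by auto
  have o02: "G p u v = 0" "G p v u = 0" if "u \<in> E" "v \<in> E2" for u v
    using D_orth[of 0 2 u p v] D_orth[of 2 0 v p u] m m2 that by auto
  have o12: "G p u v = 0" "G p v u = 0" if "u \<in> E1" "v \<in> E2" for u v
    using D_orth[of 1 2 u p v] D_orth[of 2 1 v p u] m1 m2 that by auto
  note \<delta> = G.orthonormal_inner[OF E(1)] G.orthonormal_inner[OF E1(1)] G.orthonormal_inner[OF E2(1)]
  have n01: "u \<notin> E1" if "u \<in> E" for u using o01(1)[OF that] \<delta>(1)[OF that that] by auto
  have n02: "u \<notin> E2" if "u \<in> E" for u using o02(1)[OF that] \<delta>(1)[OF that that] by auto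
  have n12: "u \<notin> E2" if "u \<in> E1" for u using o12(1)[OF that] \<delta>(2)[OF that that] by auto
  show "E \<inter> E1 = {}" "(E \<union> E1) \<inter> E2 = {}" using n01 n02 n12 by blast+
  have fin: "finite (E \<union> E1 \<union> E2)"
    using G.orthonormal_finite[OF E(1)] G.orthonormal_finite[OF E1(1)] G.orthonormal_finite[OF E2(1)] by simp
  have tan: "E \<union> E1 \<union> E2 \<subseteq> tangent_space B p"
    using G.orthonormal_mem[OF E(1)] G.orthonormal_mem[OF E1(1)] G.orthonormal_mem[OF E2(1)] by blast
  have "G p u v = (if u = v then 1 else 0)" if "u \<in> E \<union> E1 \<union> E2" "v \<in> E \<union> E1 \<union> E2" for u v
    using that \<delta> o01 o02 o12 n01 n02 n12 by (elim UnE) auto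
  with fin tan show "on p (E \<union> E1 \<union> E2)" unfolding G.orthonormal_def by blast
  show "span (E \<union> E1 \<union> E2) = tangent_space B p"
  proof
    show "span (E \<union> E1 \<union> E2) \<subseteq> tangent_space B p" by (rule G.span_subset[OF tan])
    show "tangent_space B p \<subseteq> span (E \<union> E1 \<union> E2)"
    proof
      fix v assume "v \<in> tangent_space B p"
      then obtain v0 v1 v2 where w: "v0 \<in> span E" "v1 \<in> span E1" "v2 \<in> span E2" "v = v0 + v1 + v2"
        using D_split E(2) E1(2) E2(2) by metis
      moreover have "span E \<subseteq> span (E \<union> E1 \<union> E2)" "span E1 \<subseteq> span (E \<union> E1 \<union> E2)"
        "span E2 \<subseteq> span (E \<union> E1 \<union> E2)" by (intro span_mono; blast)+
      ultimately show "v \<in> span (E \<union> E1 \<union> E2)" by (simp add: span_add subset_iff)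
    qed
  qed
qed

text \<open>Only the blocks of \<open>h\<close> between the base and the two fibres are estimated,
  and by symmetry each occurs twice. All other blocks are nonnegative and dropped, so equality
  forces them to vanish, in particular the three diagonal ones.\<close>

theorem second_form_bound:
  assumes c: "c < 1" and fd1: "fibre_data 1 0 n1 p" and fd2: "fibre_data 2 c n2 p"
    and E: "on p E" "span E = tangent_space B p"
  defines "N \<equiv> \<Sum>u\<in>E. \<Sum>v\<in>E. g (\<phi> p) (h p u v) (h p u v)"
    and "R \<equiv> 2 * n1 * (\<Sum>e\<in>E. (e \<cdot> F 1)\<^sup>2) + 2 * n2 * (1 + 10 / 9 * (c / (1 - c))) * (\<Sum>e\<in>E. (e \<cdot> F 2)\<^sup>2)"
  shows "R \<le> N"
    and "N = R \<Longrightarrow> i < 3 \<Longrightarrow> u \<in> D i p \<Longrightarrow> v \<in> D i p \<Longrightarrow> h p u v = 0"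
proof -
  obtain X where X: "finite X" "span X = D 0 p" using D0_finite[of p] by blast
  have i0: "(0::nat) < 3" and i1: "(1::nat) < 3" "(1::nat) \<noteq> 0" and i2: "(2::nat) < 3" "(2::nat) \<noteq> 0" by auto
  have "X \<subseteq> tangent_space B p" using X(2) span_superset D_tangent[OF i0] by blast
  then obtain E0 where E0: "on p E0" "span E0 = D 0 p" using G.gram_schmidt[OF X(1), of p] X(2) by metis
  \<comment> \<open>For the totally real fibre \<open>c = 0\<close>, and the factor in brackets is
    1.\<close>
  obtain E1 where E1: "on p E1" "span E1 = D 1 p"
    and b1: "n1 * (1 + 10 / 9 * (0 / (1 - 0))) * (\<Sum>x\<in>E0. (x \<cdot> F 1)\<^sup>2)
       \<le> (\<Sum>x\<in>E0. \<Sum>u\<in>E1. g (\<phi> p) (h p x u) (h p x u))"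
    by (rule fibre_data_bound[OF i1 _ E0 fd1]) simp
  obtain E2 where E2: "on p E2" "span E2 = D 2 p"
    and b2: "n2 * (1 + 10 / 9 * (c / (1 - c))) * (\<Sum>x\<in>E0. (x \<cdot> F 2)\<^sup>2)
       \<le> (\<Sum>x\<in>E0. \<Sum>u\<in>E2. g (\<phi> p) (h p x u) (h p x u))"
    by (rule fibre_data_bound[OF i2 c E0 fd2])
  note un = orthonormal_union[OF E0 E1 E2]
  note fin = G.orthonormal_finite[OF E0(1)] G.orthonormal_finite[OF E1(1)] G.orthonormal_finite[OF E2(1)]
  let ?s = "\<lambda>u v. g (\<phi> p) (h p u v) (h p u v)"
  define M where "M S T = (\<Sum>u\<in>S. \<Sum>v\<in>T. ?s u v)" for S T
  have grad: "(\<Sum>e\<in>E. (e \<cdot> F k)\<^sup>2) = (\<Sum>x\<in>E0. (x \<cdot> F k)\<^sup>2)" if k: "k < 3" for k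
  proof -
    have "(\<Sum>e\<in>E. (e \<cdot> F k)\<^sup>2) = (\<Sum>e\<in>E0 \<union> E1 \<union> E2. (e \<cdot> F k)\<^sup>2)"
      by (rule sum_act_sq_invariant[OF E(1) un(1)]) (simp add: un(2) E(2))
    also have "\<dots> = (\<Sum>x\<in>E0. (x \<cdot> F k)\<^sup>2) + (\<Sum>x\<in>E1. (x \<cdot> F k)\<^sup>2) + (\<Sum>x\<in>E2. (x \<cdot> F k)\<^sup>2)"
      using fin un(3,4) by (simp add: sum.union_disjoint)
    also have "(\<Sum>x\<in>E1. (x \<cdot> F k)\<^sup>2) = 0"
      using F_D[OF i1(1) k i1(2)] E1(2) span_base[of _ E1] by (intro sum.neutral) auto
    also have "(\<Sum>x\<in>E2. (x \<cdot> F k)\<^sup>2) = 0"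
      using F_D[OF i2(1) k i2(2)] E2(2) span_base[of _ E2] by (intro sum.neutral) auto
    finally show ?thesis by simp
  qed
  have N: "N = M E0 E0 + M E1 E1 + M E2 E2 + 2 * M E0 E1 + 2 * M E0 E2 + (M E1 E2 + M E2 E1)"
  proof -
    have sw: "M S T = M T S" if "S \<subseteq> tangent_space B p" "T \<subseteq> tangent_space B p" for S T
    proof -
      have "M S T = (\<Sum>u\<in>S. \<Sum>v\<in>T. ?s v u)"
        unfolding M_def using that by (intro sum.cong refl) (metis h_sym subsetD)
      also have "\<dots> = M T S" unfolding M_def by (rule sum.swap)
      finally show ?thesis .
    qed
    have t: "E0 \<subseteq> tangent_space B p" "E1 \<subseteq> tangent_space B p" "E2 \<subseteq> tangent_space B p"
      using G.orthonormal_mem[OF E0(1)] G.orthonormal_mem[OF E1(1)] G.orthonormal_mem[OF E2(1)] by auto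
    have "N = M (E0 \<union> E1 \<union> E2) (E0 \<union> E1 \<union> E2)"
      unfolding N_def M_def by (rule norm_h_invariant[OF E(1) un(1) _ E(2)]) (simp add: un(2) E(2))
    also have "\<dots> = (M E0 E0 + M E0 E1 + M E0 E2) + (M E1 E0 + M E1 E1 + M E1 E2) + (M E2 E0 + M E2 E1 + M E2 E2)"
      unfolding M_def using fin un(3,4) by (simp add: sum.union_disjoint sum.distrib)
    finally show ?thesis using sw[OF t(2) t(1)] sw[OF t(3) t(1)] by simp
  qed
  have nn: "0 \<le> M S T" if "on p S" "on p T" for S T
    unfolding M_def
    by (intro sum_nonneg T.nonneg h_tangent G.orthonormal_mem[OF that(1)] G.orthonormal_mem[OF that(2)])
  have R: "R \<le> 2 * M E0 E1 + 2 * M E0 E2"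
    unfolding R_def grad[OF i1(1)] grad[OF i2(1)] using b1 b2 unfolding M_def by simp
  note nns = nn[OF E0(1) E0(1)] nn[OF E1(1) E1(1)] nn[OF E2(1) E2(1)] nn[OF E1(1) E2(1)] nn[OF E2(1) E1(1)]
  show "R \<le> N" using N R nns by simp
  assume eq: "N = R" and i: "i < 3" and u: "u \<in> D i p" and v: "v \<in> D i p"
  have z: "M E0 E0 = 0" "M E1 E1 = 0" "M E2 E2 = 0" using N R nns eq by linarith+
  note block = h_block_zero[OF E0(1) E0(1) z(1)[unfolded M_def], unfolded E0(2)]
    h_block_zero[OF E1(1) E1(1) z(2)[unfolded M_def], unfolded E1(2)]
    h_block_zero[OF E2(1) E2(1) z(3)[unfolded M_def], unfolded E2(2)]
  consider "i = 0" | "i = 1" | "i = 2" using i by linarith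
  then show "h p u v = 0"
  proof cases
    case 1 then show ?thesis using block(1) u v by blast
  next
    case 2 then show ?thesis using block(2) u v by blast
  next
    case 3 then show ?thesis using block(3) u v by blast
  qed
qed

text \<open>This is the diagonal of \<open>warped_identity\<close>, where \<open>\<omega>\<close> vanishes.\<close>

lemma mixed_imp_critical:
  assumes i: "i < 3" "i \<noteq> 0" and mixed: "\<And>x v. x \<in> D 0 p \<Longrightarrow> v \<in> D i p \<Longrightarrow> h p x v = 0"
    and v: "v \<in> D i p" "v \<noteq> 0" and y: "y \<in> D 0 p"
  shows "y \<cdot> F i = 0"
proof -
  have i0: "(0::nat) < 3" by simp
  obtain z where z: "z \<in> D 0 p" "d p z = J (\<phi> p) (d p y)" using holo[OF y] by blast
  \<comment> \<open>The identity is applied to \<open>z = J y\<close>, whose image under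
    \<open>J\<close> is \<open>- y\<close>, so that its scalar term is the derivative along
    \<open>y\<close>.\<close>
  have zy: "J (\<phi> p) (d p z) = d p (- y)"
    unfolding z(2) J_J[OF d_tangent[OF D_tangent[OF i0 y]]] using linear_neg[OF linear_differential] by metis
  have my: "- y \<in> D 0 p" by (rule subspace_neg[OF D_subspace[OF i0] y])
  obtain W V where V: "p \<in> W" "Lf i W V" "V p = v" using Lf_extends[OF i(1) v(1)] by blast
  note Vf = Lf_field[OF i(1) V(2)]
  have "z \<cdot> (\<lambda>q. \<omega> q (V q) (V q)) = 0"
    by (rule tangent_act_eq_0I[OF B D_tangent[OF i0 z(1)] vector_field_open[OF Vf] V(1)])
      (rule \<omega>_self[OF vector_field_tangent[OF Vf]])
  moreover have "\<omega> p v v = 0" by (rule \<omega>_self[OF D_tangent[OF i(1) v(1)]])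
  moreover have "g (\<phi> p) 0 (J (\<phi> p) (d p v)) = 0"
    by (rule T.zero_left[OF J_tangent[OF d_tangent[OF D_tangent[OF i(1) v(1)]]]])
  ultimately have "- (- y \<cdot> F i) * G p v v = 0"
    using warped_identity(1)[OF i V(1,2,2) z(1) my zy[symmetric]] mixed[OF z(1) v(1)] unfolding V(3) by simp
  then show ?thesis using G.pos[OF D_tangent[OF i(1) v(1)] v(2)] by simp
qed

end

section \<open>The leaves\<close>

lemma smooth_fun_on_iff_smooth_at:
  assumes "smooth_manifold A" "open W"
  shows "smooth_fun_on A W f \<longleftrightarrow> (\<forall>p\<in>W. smooth_at A p f)"
  using smooth_fun_on_local[OF assms, of f] smooth_atI[of A W f] unfolding smooth_at_def by metis

lemma smooth_at_inverse:
  assumes A: "smooth_manifold A" and f: "smooth_at A p f" and W: "open W" "p \<in> W" "\<And>q. q \<in> W \<Longrightarrow> f q \<noteq> 0"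
  shows "smooth_at A p (\<lambda>q. inverse (f q))"
proof -
  obtain W' where W': "p \<in> W'" "smooth_fun_on A W' f" using f unfolding smooth_at_def by blast
  have "smooth_fun_on A (W \<inter> W') f"
    by (rule smooth_fun_on_subset[OF W'(2) open_Int[OF W(1) smooth_fun_on_open[OF W'(2)]]]) simp
  then have "smooth_fun_on A (W \<inter> W') (\<lambda>q. inverse (f q))"
    by (rule smooth_fun_on_compose_real[OF A _ smooth_on_inverse]) (auto simp: open_Compl dest: W(3))
  then show ?thesis by (rule smooth_atI) (use W W' in simp)
qed

text \<open>The leaf of the \<open>i\<close>-th factor through \<open>x0\<close>, under the
  vanishing of \<open>h\<close> on \<open>D i\<close> that the equality case provides.\<close>

locale warped_leaf = nk_warped B A g nab \<phi> J nabB h D Lf bas F + fac: factor B N \<pi> s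
  for B :: "('n::{t2_space,second_countable_topology}, 'f::euclidean_space) chart set"
    and A :: "('m::{t2_space,second_countable_topology}, 'e::euclidean_space) chart set"
    and g nab \<phi> J nabB h D Lf bas F
    and N :: "('k::{t2_space,second_countable_topology}, 'd::euclidean_space) chart set"
    and \<pi> s +
  fixes i :: nat and x0 :: 'n
  assumes i: "i < 3" and leaf_D: "\<And>x. fac.leaf x = D i x"
    and lift_Lf: "\<And>W Y. vector_field_on N W Y \<Longrightarrow> Lf i (\<pi> -` W) (fac.lift Y)"
    and proj_kill: "\<And>j p v. j < 3 \<Longrightarrow> j \<noteq> i \<Longrightarrow> v \<in> D j p \<Longrightarrow> differential N \<pi> p v = 0"
    and h_leaf: "\<And>p u v. u \<in> D i p \<Longrightarrow> v \<in> D i p \<Longrightarrow> h p u v = 0"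
begin

abbreviation \<sigma> where "\<sigma> \<equiv> s x0"
abbreviation \<psi> where "\<psi> \<equiv> \<phi> \<circ> \<sigma>"
abbreviation d\<sigma> where "d\<sigma> q \<equiv> differential B \<sigma> q"
abbreviation d\<pi> where "d\<pi> p \<equiv> differential N \<pi> p"
abbreviation K where "K \<equiv> pullback_metric A g \<psi>"

lemma mN: "smooth_manifold N" by (rule fac.B)

lemma pi_sigma: "\<pi> (\<sigma> q) = q" by (rule fac.proj_slice)

lemma lift_sigma: "fac.lift Y (\<sigma> q) = d\<sigma> q (Y q)" by (rule fac.lift_slice)

lemma d_psi: "differential A \<psi> q u = d (\<sigma> q) (d\<sigma> q u)"
  by (rule differential_comp[OF \<phi>])

lemma psi_pullback: "smooth_pullback N A \<psi>"
  by (rule smooth_pullback_comp[OF \<phi> fac.slice])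

lemma sigma_tangent: "u \<in> tangent_space N q \<Longrightarrow> d\<sigma> q u \<in> tangent_space B (\<sigma> q)"
  by (rule differential_tangent[OF B mN fac.slice])

lemma sigma_D: "u \<in> tangent_space N q \<Longrightarrow> d\<sigma> q u \<in> D i (\<sigma> q)"
  using fac.slice_leaf leaf_D by blast

lemma pi_tangent: "v \<in> tangent_space B (\<sigma> q) \<Longrightarrow> d\<pi> (\<sigma> q) v \<in> tangent_space N q"
  using differential_tangent[OF mN B fac.proj, of v "\<sigma> q"] pi_sigma by simp

lemma K_eq: "K q u v = G (\<sigma> q) (d\<sigma> q u) (d\<sigma> q v)"
  unfolding pullback_metric_def d_psi by simp

lemma lift_field: "vector_field_on N W Y \<Longrightarrow> vector_field_on B (\<pi> -` W) (fac.lift Y)"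
  by (rule fac.lift_field)

text \<open>At points of the leaf, \<open>d\<sigma> q\<close> after \<open>d\<pi>\<close> is the
  orthogonal projection onto \<open>D i\<close>: it fixes \<open>D i\<close> and kills the other two
  distributions.\<close>

lemma component:
  assumes v: "v \<in> tangent_space B (\<sigma> q)"
  shows "d\<sigma> q (d\<pi> (\<sigma> q) v) \<in> D i (\<sigma> q)"
    and "\<And>y. y \<in> D i (\<sigma> q) \<Longrightarrow> G (\<sigma> q) (v - d\<sigma> q (d\<pi> (\<sigma> q) v)) y = 0"
    and "\<And>j y. j < 3 \<Longrightarrow> j \<noteq> i \<Longrightarrow> y \<in> D j (\<sigma> q) \<Longrightarrow> G (\<sigma> q) (d\<sigma> q (d\<pi> (\<sigma> q) v)) y = 0"
proof -
  let ?p = "\<sigma> q"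
  show c: "d\<sigma> q (d\<pi> ?p v) \<in> D i ?p" by (rule sigma_D[OF pi_tangent[OF v]])
  show "G ?p (d\<sigma> q (d\<pi> ?p v)) y = 0" if "j < 3" "j \<noteq> i" "y \<in> D j ?p" for j y
    by (rule D_orth[OF i that(1) that(2)[symmetric] c that(3)])
  fix y assume y: "y \<in> D i ?p"
  obtain w where w: "\<And>j. j < 3 \<Longrightarrow> w j \<in> D j ?p" "v = w 0 + w 1 + w 2"
  proof -
    obtain v0 v1 v2 where *: "v0 \<in> D 0 ?p" "v1 \<in> D 1 ?p" "v2 \<in> D 2 ?p" "v = v0 + v1 + v2"
      using D_split[OF v] by blast
    show ?thesis
    proof (rule that[of "\<lambda>j. if j = 0 then v0 else if j = 1 then v1 else v2"])
      fix j :: nat assume "j < 3"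
      then consider "j = 0" | "j = 1" | "j = 2" by linarith
      then show "(if j = 0 then v0 else if j = 1 then v1 else v2) \<in> D j ?p" using * by cases auto
    qed (use * in simp)
  qed
  have wt: "w j \<in> tangent_space B ?p" if "j < 3" for j using D_tangent[OF that w(1)[OF that]] .
  have lin: "linear (\<lambda>v. d\<sigma> q (d\<pi> ?p v))"
    using linear_compose[OF linear_differential[of N \<pi> ?p] linear_differential[of B \<sigma> q]] by (simp add: comp_def)
  have kill: "d\<sigma> q (d\<pi> ?p (w j)) = (if j = i then w j else 0)" if j: "j < 3" for j
  proof (cases "j = i")
    case True
    then have "w j \<in> fac.leaf ?p" using w(1)[OF j] leaf_D by simp
    from fac.leaf_fixed[OF this] show ?thesis
      using True unfolding fac.slice_slice pi_sigma by simp
  next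
    case False
    then show ?thesis using proj_kill[OF j False w(1)[OF j]] linear_0[OF linear_differential[of B \<sigma> q]] by simp
  qed
  have "d\<sigma> q (d\<pi> ?p v) = (if 0 = i then w 0 else 0) + (if 1 = i then w 1 else 0) + (if 2 = i then w 2 else 0)"
    unfolding w(2) linear_add[OF lin] using kill[of 0] kill[of 1] kill[of 2] by simp
  moreover have "G ?p (w j) y = 0" if "j < 3" "j \<noteq> i" for j
    by (rule D_orth[OF that(1) i that(2) w(1)[OF that(1)] y])
  moreover have "i = 0 \<or> i = 1 \<or> i = 2" using i by linarith
  ultimately show "G ?p (v - d\<sigma> q (d\<pi> ?p v)) y = 0"
    using wt[of 0] wt[of 1] wt[of 2] D_tangent[OF i y] unfolding w(2)
    by (elim disjE) (simp_all add: G.add_left)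
qed

lemma gradient_exists: "\<exists>w\<in>tangent_space B p. \<forall>v\<in>tangent_space B p. G p w v = v \<cdot> f"
proof -
  obtain X where X: "finite X" "span X = tangent_space B p" using dim_tangent_space[OF B] by metis
  have "X \<subseteq> tangent_space B p" using X(2) span_superset by blast
  then obtain E where E: "on p E" "span E = tangent_space B p" using G.gram_schmidt[OF X(1), of p] X(2) by metis
  from gradient_expansion[OF this] show ?thesis by blast
qed

text \<open>The gradient of the logarithm of the warping function; its negative is the mean
  curvature vector of the leaf in the warped product.\<close>

definition grad :: "'n \<Rightarrow> 'n tvec" where
  "grad p = (SOME w. w \<in> tangent_space B p \<and> (\<forall>v\<in>tangent_space B p. G p w v = v \<cdot> F i))"

lemma grad: "grad p \<in> tangent_space B p" "v \<in> tangent_space B p \<Longrightarrow> G p (grad p) v = v \<cdot> F i"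
  using someI_ex[of "\<lambda>w. w \<in> tangent_space B p \<and> (\<forall>v\<in>tangent_space B p. G p w v = v \<cdot> F i)"]
    gradient_exists[of p "F i"] unfolding grad_def by blast+

lemma F_leaf: "v \<in> D i p \<Longrightarrow> v \<cdot> F i = 0"
proof (cases "i = 0")
  case True
  assume v: "v \<in> D i p"
  have "F 0 = (\<lambda>p. 0)" using F_0 by blast
  then show ?thesis using True tangent_act_const[OF B D_tangent[OF i v]] by simp
next
  case False
  then show "v \<in> D i p \<Longrightarrow> ?thesis" using F_D[OF i i] by blast
qed

text \<open>Tested against the other factors this is \<open>nabB_same_other\<close>. Against
  \<open>D i\<close> both sides of the normal part vanish, since \<open>F i\<close> is constant
  along its own leaves.\<close>

lemma nabB_perp:
  assumes X: "vector_field_on N W X" and Y: "vector_field_on N W Y" and q: "q \<in> W"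
  defines "v \<equiv> nabB (\<sigma> q) (d\<sigma> q (X q)) (fac.lift Y)"
  shows "v = d\<sigma> q (d\<pi> (\<sigma> q) v) - K q (X q) (Y q) *\<^sub>R grad (\<sigma> q)"
proof -
  let ?p = "\<sigma> q"
  have p: "?p \<in> \<pi> -` W" using q pi_sigma by simp
  have v: "v \<in> tangent_space B ?p"
    unfolding v_def by (rule nabB_mem[OF p lift_field[OF Y] sigma_tangent[OF vector_field_tangent[OF X q]]])
  note c = component[OF v]
  have ct: "d\<sigma> q (d\<pi> ?p v) \<in> tangent_space B ?p" by (rule D_tangent[OF i c(1)])
  have "v - d\<sigma> q (d\<pi> ?p v) = (- K q (X q) (Y q)) *\<^sub>R grad ?p"
  proof (rule G.eqI)
    show 1: "v - d\<sigma> q (d\<pi> ?p v) \<in> tangent_space B ?p" using v ct by blast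
    show 2: "(- K q (X q) (Y q)) *\<^sub>R grad ?p \<in> tangent_space B ?p" using grad(1) by blast
    have key: "G ?p (v - d\<sigma> q (d\<pi> ?p v)) y = - K q (X q) (Y q) * (y \<cdot> F i)"
      if j: "j < 3" and y: "y \<in> D j ?p" for j y
    proof (cases "j = i")
      case True
      then show ?thesis using c(2) y F_leaf by simp
    next
      case False
      have "G ?p v y = - (y \<cdot> F i) * G ?p (fac.lift X ?p) (fac.lift Y ?p)"
        unfolding v_def lift_sigma[symmetric]
        by (rule nabB_same_other[OF i j False[symmetric] lift_Lf[OF X] lift_Lf[OF Y] p y])
      then show ?thesis
        using c(3)[OF j False y] v ct D_tangent[OF j y] unfolding lift_sigma K_eq by (simp add: G.diff_left)
    qed
    fix y assume y: "y \<in> tangent_space B ?p"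
    obtain v0 v1 v2 where w: "v0 \<in> D 0 ?p" "v1 \<in> D 1 ?p" "v2 \<in> D 2 ?p" "y = v0 + v1 + v2"
      using D_split[OF y] by blast
    have t: "v0 \<in> tangent_space B ?p" "v1 \<in> tangent_space B ?p" "v2 \<in> tangent_space B ?p"
      using w D_tangent[of 0] D_tangent[of 1] D_tangent[of 2] by auto
    have "G ?p (v - d\<sigma> q (d\<pi> ?p v)) y = - K q (X q) (Y q) * (y \<cdot> F i)"
      using key[OF _ w(1)] key[OF _ w(2)] key[OF _ w(3)] 1 t unfolding w(4)
      by (simp add: G.add_right G.mem_add algebra_simps)
    also have "\<dots> = G ?p ((- K q (X q) (Y q)) *\<^sub>R grad ?p) y"
      using grad y by (simp only: G.scale_left)
    finally show "G ?p (v - d\<sigma> q (d\<pi> ?p v)) y = G ?p ((- K q (X q) (Y q)) *\<^sub>R grad ?p) y" .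
  qed
  then show ?thesis by (simp add: algebra_simps)
qed

text \<open>A field on the leaf is lifted to the product, differentiated there and projected back.
  This gives the Levi-Civita connection of the induced metric explicitly.\<close>

definition nabN :: "'k connection" where
  "nabN q u Y = d\<pi> (\<sigma> q) (nabB (\<sigma> q) (d\<sigma> q u) (fac.lift Y))"

text \<open>A field \<open>Z\<close> on the product need not be projectable; it is read off along
  the leaf \<sigma> only, which makes its projection a field on the factor.\<close>

lemma push_field:
  assumes Z: "vector_field_on B (\<pi> -` W) Z" and W: "open W"
  shows "vector_field_on N W (\<lambda>q. d\<pi> (\<sigma> q) (Z (\<sigma> q)))"
proof (rule vector_field_onI[OF W])
  show "d\<pi> (\<sigma> q) (Z (\<sigma> q)) \<in> tangent_space N q" if "q \<in> W" for q
    using pi_tangent[OF vector_field_tangent[OF Z]] that pi_sigma by simp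
  fix W' f assume f: "smooth_fun_on N W' f"
  have fp: "smooth_fun_on B (\<pi> -` W') (\<lambda>x. f (\<pi> x))" by (rule smooth_pullbackD[OF fac.proj f])
  have "smooth_fun_on N (\<sigma> -` (\<pi> -` W \<inter> \<pi> -` W')) (\<lambda>q. Z (\<sigma> q) \<cdot> (\<lambda>x. f (\<pi> x)))"
    by (rule smooth_pullbackD[OF fac.slice vector_field_act[OF Z fp]])
  moreover have "\<sigma> -` (\<pi> -` W \<inter> \<pi> -` W') = W \<inter> W'" using pi_sigma by auto
  ultimately have "smooth_fun_on N (W \<inter> W') (\<lambda>q. Z (\<sigma> q) \<cdot> (\<lambda>x. f (\<pi> x)))" by simp
  then show "smooth_fun_on N (W \<inter> W') (\<lambda>q. d\<pi> (\<sigma> q) (Z (\<sigma> q)) \<cdot> f)"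
    by (rule smooth_fun_on_cong[OF mN]) (use smooth_atI[OF f] pi_sigma in \<open>simp add: differential_act\<close>)
qed

lemma nabN_field:
  assumes X: "vector_field_on N W X" and Y: "vector_field_on N W Y"
  shows "vector_field_on N W (\<lambda>q. nabN q (X q) Y)"
  using push_field[OF affine_connection_field[OF levi_civita_affine[OF lcB] lift_field[OF X] lift_field[OF Y]]
      vector_field_open[OF X]]
  unfolding nabN_def lift_sigma .

lemma sigma_act_proj:
  assumes "smooth_at N q f"
  shows "d\<sigma> q u \<cdot> (\<lambda>x. f (\<pi> x)) = u \<cdot> f"
  using smooth_pullback_at[OF fac.proj, of "\<sigma> q" f] assms pi_sigma by (simp add: differential_act)

lemma lift_add: "fac.lift (\<lambda>q. Y q + Z q) = (\<lambda>x. fac.lift Y x + fac.lift Z x)"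
  unfolding fac.lift_def by (intro ext linear_add linear_differential)

lemma lift_scale: "fac.lift (\<lambda>q. f q *\<^sub>R Y q) = (\<lambda>x. f (\<pi> x) *\<^sub>R fac.lift Y x)"
  unfolding fac.lift_def by (intro ext linear_scale linear_differential)

lemma nabN_affine: "affine_connection N nabN"
  unfolding affine_connection_def
proof (intro conjI allI impI ballI; (elim conjE)?)
  fix W X Y assume "vector_field_on N W X" "vector_field_on N W Y"
  then show "vector_field_on N W (\<lambda>q. nabN q (X q) Y)" by (rule nabN_field)
next
  fix W q Y assume q: "q \<in> W" and Y: "vector_field_on N W Y"
  have p: "\<sigma> q \<in> \<pi> -` W" using q pi_sigma by simp
  note aff = levi_civita_affine[OF lcB] and LY = lift_field[OF Y]
  { fix u assume u: "u \<in> tangent_space N q"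
    note su = sigma_tangent[OF u]
    show "nabN q u Y \<in> tangent_space N q"
      unfolding nabN_def by (rule pi_tangent[OF nabB_mem[OF p LY su]])
    { fix v a b assume v: "v \<in> tangent_space N q"
      show "nabN q (a *\<^sub>R u + b *\<^sub>R v) Y = a *\<^sub>R nabN q u Y + b *\<^sub>R nabN q v Y"
        unfolding nabN_def linear_add[OF linear_differential[of B]] linear_scale[OF linear_differential[of B]]
          affine_connection_linear[OF aff p LY su sigma_tangent[OF v]]
        by (simp add: linear_add[OF linear_differential[of N]] linear_scale[OF linear_differential[of N]]) }
    { fix Z assume Z: "vector_field_on N W Z"
      show "nabN q u (\<lambda>q. Y q + Z q) = nabN q u Y + nabN q u Z"
        unfolding nabN_def lift_add affine_connection_add[OF aff p LY lift_field[OF Z] su]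
        by (rule linear_add[OF linear_differential]) }
    { fix f assume f: "smooth_fun_on N W f"
      have fq: "smooth_at N q f" by (rule smooth_atI[OF f q])
      have "d\<pi> (\<sigma> q) (fac.lift Y (\<sigma> q)) = Y q"
        unfolding lift_sigma by (rule fac.differential_proj_slice[OF vector_field_tangent[OF Y q]])
      then show "nabN q u (\<lambda>q. f q *\<^sub>R Y q) = (u \<cdot> f) *\<^sub>R Y q + f q *\<^sub>R nabN q u Y"
        unfolding nabN_def lift_scale affine_connection_scale[OF aff p LY smooth_pullbackD[OF fac.proj f] su]
        by (simp add: linear_add[OF linear_differential[of N]] linear_scale[OF linear_differential[of N]]
            sigma_act_proj[OF fq] pi_sigma) } }
qed

text \<open>Lifts act on functions pulled back along \<pi> as the original fields do, so the bracket
  of two lifts projects to the bracket of the fields.\<close>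

lemma nabN_torsion:
  assumes q: "q \<in> W" and X: "vector_field_on N W X" and Y: "vector_field_on N W Y"
  shows "nabN q (X q) Y - nabN q (Y q) X = lie_bracket N X Y q"
proof -
  have p: "\<sigma> q \<in> \<pi> -` W" using q pi_sigma by simp
  have "nabN q (X q) Y - nabN q (Y q) X = d\<pi> (\<sigma> q) (lie_bracket B (fac.lift X) (fac.lift Y) (\<sigma> q))"
    unfolding nabN_def levi_civita_torsion[OF lcB p lift_field[OF X] lift_field[OF Y], symmetric] lift_sigma
    by (simp add: linear_diff[OF linear_differential])
  also have "\<dots> = lie_bracket N X Y q"
  proof (rule tvec_eqI)
    fix f
    show "d\<pi> (\<sigma> q) (lie_bracket B (fac.lift X) (fac.lift Y) (\<sigma> q)) \<cdot> f = lie_bracket N X Y q \<cdot> f"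
    proof (cases "smooth_at N q f")
      case False
      then show ?thesis by (simp add: differential_act lie_bracket_act pi_sigma)
    next
      case True
      then obtain W' where W': "q \<in> W'" "smooth_fun_on N W' f" unfolding smooth_at_def by blast
      have *: "fac.lift Z (\<sigma> q) \<cdot> (\<lambda>x. fac.lift Z' x \<cdot> (\<lambda>x. f (\<pi> x))) = Z q \<cdot> (\<lambda>q. Z' q \<cdot> f)"
        if Z: "vector_field_on N W Z" and Z': "vector_field_on N W Z'" for Z Z'
      proof -
        have o: "open (\<pi> -` (W \<inter> W'))"
          by (rule smooth_pullback_continuous[OF mN fac.proj
                open_Int[OF vector_field_open[OF Z] smooth_fun_on_open[OF W'(2)]]])
        have "fac.lift Z (\<sigma> q) \<cdot> (\<lambda>x. fac.lift Z' x \<cdot> (\<lambda>x. f (\<pi> x)))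
            = fac.lift Z (\<sigma> q) \<cdot> (\<lambda>x. (\<lambda>q. Z' q \<cdot> f) (\<pi> x))"
          by (rule tangent_act_cong[OF B vector_field_tangent[OF lift_field[OF Z] p] o])
            (use q W' pi_sigma smooth_atI[OF W'(2)] in \<open>auto intro!: fac.lift_act_proj[OF Z']\<close>)
        also have "\<dots> = Z q \<cdot> (\<lambda>q. Z' q \<cdot> f)"
          using fac.lift_act_proj[OF Z, of "\<sigma> q" "\<lambda>q. Z' q \<cdot> f"] q pi_sigma
            vector_field_act_at[OF Z' q True] by simp
        finally show ?thesis .
      qed
      show ?thesis
        using True smooth_pullback_at[OF fac.proj, of "\<sigma> q" f] *[OF X Y] *[OF Y X]
        by (simp add: differential_act lie_bracket_act pi_sigma)
    qed
  qed
  finally show ?thesis .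
qed

text \<open>Fields along \<phi> that have covariant derivatives have smooth inner products. Any
  direction serves, and 0 is tangent at every point.\<close>

lemma metric_smooth_lift:
  assumes Y: "vector_field_on B W Y" and Z: "vector_field_on B W Z" and p: "p \<in> W"
  shows "smooth_at B p (\<lambda>x. G x (Y x) (Z x))"
  unfolding G_eq
  by (rule hcd_metric(2)[OF gauss[OF p G.mem_zero Y] gauss[OF p G.mem_zero Z] G.mem_zero])

lemma nabN_metric:
  assumes q: "q \<in> W" and u: "u \<in> tangent_space N q" and Y: "vector_field_on N W Y" and Z: "vector_field_on N W Z"
  shows "u \<cdot> (\<lambda>q. K q (Y q) (Z q)) = K q (nabN q u Y) (Z q) + K q (Y q) (nabN q u Z)"
proof -
  have p: "\<sigma> q \<in> \<pi> -` W" using q pi_sigma by simp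
  note LY = lift_field[OF Y] and LZ = lift_field[OF Z] and su = sigma_tangent[OF u]
  let ?Q = "\<lambda>x. G x (fac.lift Y x) (fac.lift Z x)"
  have "u \<cdot> (\<lambda>q. K q (Y q) (Z q)) = u \<cdot> (\<lambda>q. ?Q (\<sigma> q))" unfolding K_eq lift_sigma ..
  also have "\<dots> = d\<sigma> q u \<cdot> ?Q"
    using metric_smooth_lift[OF LY LZ p] by (simp add: differential_act)
  also have "\<dots> = G (\<sigma> q) (nabB (\<sigma> q) (d\<sigma> q u) (fac.lift Y)) (fac.lift Z (\<sigma> q))
      + G (\<sigma> q) (fac.lift Y (\<sigma> q)) (nabB (\<sigma> q) (d\<sigma> q u) (fac.lift Z))"
    by (rule levi_civita_metric[OF lcB p su LY LZ])
  also have "G (\<sigma> q) (nabB (\<sigma> q) (d\<sigma> q u) (fac.lift Y)) (fac.lift Z (\<sigma> q)) = K q (nabN q u Y) (Z q)"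
  proof -
    note n = nabB_mem[OF p LY su] and z = sigma_D[OF vector_field_tangent[OF Z q]]
    show ?thesis
      using component(2)[OF n z] D_tangent[OF i component(1)[OF n]] n D_tangent[OF i z]
      unfolding K_eq nabN_def lift_sigma by (simp add: G.diff_left)
  qed
  also have "G (\<sigma> q) (fac.lift Y (\<sigma> q)) (nabB (\<sigma> q) (d\<sigma> q u) (fac.lift Z)) = K q (Y q) (nabN q u Z)"
  proof -
    note n = nabB_mem[OF p LZ su] and y = sigma_D[OF vector_field_tangent[OF Y q]]
    show ?thesis
      using component(2)[OF n y] D_tangent[OF i component(1)[OF n]] n D_tangent[OF i y]
        G.sym[OF D_tangent[OF i y] n] G.sym[OF D_tangent[OF i y] D_tangent[OF i component(1)[OF n]]]
      unfolding K_eq nabN_def lift_sigma by (simp add: G.diff_left)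
  qed
  finally show ?thesis .
qed

lemma nabN_levi_civita: "levi_civita N K nabN"
  unfolding levi_civita_def using nabN_affine nabN_torsion nabN_metric by blast

text \<open>The mean curvature vector of the leaf within the product, carried to the ambient
  manifold; as \<open>h\<close> vanishes on \<open>D i\<close>, it is also the one of the leaf in
  the ambient manifold.\<close>

definition H :: "'k \<Rightarrow> 'm tvec" where "H q = - d (\<sigma> q) (grad (\<sigma> q))"

lemma H_normal: "H q \<in> normal_space N A g \<psi> q"
  unfolding normal_space_def
proof (intro CollectI conjI ballI)
  show "H q \<in> tangent_space A (\<psi> q)" unfolding H_def using d_tangent[OF grad(1)] by auto
  fix u assume u: "u \<in> tangent_space N q"
  have "G (\<sigma> q) (grad (\<sigma> q)) (d\<sigma> q u) = 0"
    using grad(2)[OF sigma_tangent[OF u]] F_leaf[OF sigma_D[OF u]] by simp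
  then show "g (\<psi> q) (H q) (differential A \<psi> q u) = 0"
    unfolding H_def d_psi G_eq using T.minus_left[OF d_tangent[OF grad(1)] d_tangent[OF sigma_tangent[OF u]]] by simp
qed

text \<open>A representation along \<phi> composed with \<sigma> is one along \<psi>: the
  coefficients are pulled back and the ambient fields stay.\<close>

lemma hcd_restrict:
  assumes V: "hcd (\<sigma> q) (d\<sigma> q u) V w"
  shows "has_covariant_derivative_along N A nab \<psi> q u (\<lambda>q. V (\<sigma> q)) w"
proof -
  interpret L: along N A g nab \<psi>
    by unfold_locales (use mN riem lc psi_pullback in auto)
  obtain W W' c E and I :: "nat set" where R: "\<sigma> q \<in> W" "open W" "\<And>q. q \<in> W \<Longrightarrow> \<phi> q \<in> W'" "finite I"
    "\<And>k. k \<in> I \<Longrightarrow> smooth_fun_on B W (c k)" "\<And>k. k \<in> I \<Longrightarrow> vector_field_on A W' (E k)"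
    "\<And>q. q \<in> W \<Longrightarrow> V q = (\<Sum>k\<in>I. c k q *\<^sub>R E k (\<phi> q))"
    "w = (\<Sum>k\<in>I. (d\<sigma> q u \<cdot> c k) *\<^sub>R E k (\<phi> (\<sigma> q)) + c k (\<sigma> q) *\<^sub>R nab (\<phi> (\<sigma> q)) (d (\<sigma> q) (d\<sigma> q u)) (E k))"
    by (rule hcdE[OF V]; rule that)
  show ?thesis
  proof (rule L.hcdI[where W = "\<sigma> -` W" and W' = W' and K = I and c = "\<lambda>k q. c k (\<sigma> q)" and E = E])
    show "open (\<sigma> -` W)" by (rule smooth_pullback_continuous[OF B fac.slice R(2)])
    show "smooth_fun_on N (\<sigma> -` W) (\<lambda>q. c k (\<sigma> q))" if "k \<in> I" for k
      by (rule smooth_pullbackD[OF fac.slice R(5)[OF that]])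
    have "d\<sigma> q u \<cdot> c k = u \<cdot> (\<lambda>q. c k (\<sigma> q))" if "k \<in> I" for k
      using smooth_atI[OF R(5)[OF that] R(1)] by (simp add: differential_act)
    then show "w = (\<Sum>k\<in>I. (u \<cdot> (\<lambda>q. c k (\<sigma> q))) *\<^sub>R E k (\<psi> q)
        + c k (\<sigma> q) *\<^sub>R nab (\<psi> q) (differential A \<psi> q u) (E k))"
      unfolding R(8) d_psi by (intro sum.cong refl) simp
  qed (use R in auto)
qed

text \<open>The Gauss formula of the product, applied to a lift, has no \<open>h\<close> term on
  \<open>D i\<close>; the normal part of its intrinsic term is supplied by
  \<open>nabB_perp\<close>.\<close>

lemma leaf_second_fundamental_form:
  "second_fundamental_form N A g nab \<psi> (\<lambda>q u v. K q u v *\<^sub>R H q)"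
  unfolding second_fundamental_form_def
proof (intro conjI exI[of _ nabN] nabN_levi_civita allI impI ballI; (elim conjE)?)
  fix q u v
  have n: "H q \<in> normal_space N A g \<psi> q" by (rule H_normal)
  show "K q u v *\<^sub>R H q \<in> normal_space N A g \<psi> q"
    using n d_tangent[OF sigma_tangent] unfolding normal_space_def d_psi
    by (auto simp: T.scale_left T.mem_scale)
next
  fix W q u Y assume q: "q \<in> W" and u: "u \<in> tangent_space N q" and Y: "vector_field_on N W Y"
  obtain W' X where X: "q \<in> W'" "vector_field_on N W' X" "X q = u" using tangent_vector_extends[OF mN u] .
  have o: "open (W \<inter> W')" "q \<in> W \<inter> W'" using vector_field_open[OF Y] vector_field_open[OF X(2)] q X(1) by auto
  have X': "vector_field_on N (W \<inter> W') X" and Y': "vector_field_on N (W \<inter> W') Y"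
    using vector_field_subset[OF X(2) o(1)] vector_field_subset[OF Y o(1)] by auto
  have p: "\<sigma> q \<in> \<pi> -` W" using q pi_sigma by simp
  have y: "Y q \<in> tangent_space N q" by (rule vector_field_tangent[OF Y q])
  have "hcd (\<sigma> q) (d\<sigma> q u) (\<lambda>x. d x (fac.lift Y x))
      (d (\<sigma> q) (nabB (\<sigma> q) (d\<sigma> q u) (fac.lift Y)) + h (\<sigma> q) (d\<sigma> q u) (fac.lift Y (\<sigma> q)))"
    by (rule gauss[OF p sigma_tangent[OF u] lift_field[OF Y]])
  from hcd_restrict[OF this]
  have "has_covariant_derivative_along N A nab \<psi> q u (\<lambda>q. differential A \<psi> q (Y q))
      (d (\<sigma> q) (nabB (\<sigma> q) (d\<sigma> q u) (fac.lift Y)))"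
    unfolding lift_sigma h_leaf[OF sigma_D[OF u] sigma_D[OF y]] d_psi by simp
  also have "d (\<sigma> q) (nabB (\<sigma> q) (d\<sigma> q u) (fac.lift Y)) = differential A \<psi> q (nabN q u Y) + K q u (Y q) *\<^sub>R H q"
  proof -
    have "d (\<sigma> q) (nabB (\<sigma> q) (d\<sigma> q u) (fac.lift Y))
       = d (\<sigma> q) (d\<sigma> q (nabN q u Y) - K q u (Y q) *\<^sub>R grad (\<sigma> q))"
      using arg_cong[OF nabB_perp[OF X' Y' o(2)], of "d (\<sigma> q)"] unfolding X(3) nabN_def .
    then show ?thesis
      unfolding H_def d_psi linear_diff[OF linear_differential] linear_scale[OF linear_differential] by simp
  qed
  finally show "has_covariant_derivative_along N A nab \<psi> q u (\<lambda>q. differential A \<psi> q (Y q))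
      (differential A \<psi> q (nabN q u Y) + K q u (Y q) *\<^sub>R H q)" .
qed

text \<open>\<open>grad\<close> is a pointwise choice, so its smoothness is not visible. For a
  nowhere vanishing coordinate field \<open>X\<close> the umbilical equation is solved for
  \<open>H\<close>: it is the difference of the two covariant derivatives of \<open>X\<close> along
  itself, divided by \<open>K(X, X)\<close>, and these are smooth.\<close>

lemma H_smooth: "smooth_field_along N A \<psi> UNIV H"
  unfolding smooth_field_along_def
proof (intro conjI open_UNIV ballI allI impI)
  show "H q \<in> tangent_space A (\<psi> q)" for q using H_normal[of q] unfolding normal_space_def by blast
  fix W' f assume f: "smooth_fun_on A W' f"
  have o: "open (\<psi> -` W')" by (rule smooth_pullback_continuous[OF A psi_pullback smooth_fun_on_open[OF f]])
  have "smooth_at N q (\<lambda>q. H q \<cdot> f)" if q: "q \<in> \<psi> -` W'" for q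
  proof -
    obtain U \<kappa> where U: "(U, \<kappa>) \<in> N" "q \<in> U" by (rule chart_exists[OF mN])
    \<comment> \<open>Any nonzero direction serves; a basis vector exists because the leaf has
      positive dimension.\<close>
    obtain b :: 'd where b: "b \<in> Basis" using nonempty_Basis by blast
    define X where "X q = coord_vec N U \<kappa> q b" for q
    have X: "vector_field_on N U X" unfolding X_def by (rule vector_field_coord_vec[OF mN U(1)])
    have X0: "X q \<noteq> 0" if "q \<in> U" for q
      using injD[OF inj_coord_vec[OF mN U(1) that], of b 0] linear_0[OF linear_coord_vec[OF mN U(1) that]]
        nonzero_Basis[OF b] unfolding X_def by metis
    have K0: "K q (X q) (X q) \<noteq> 0" if "q \<in> U" for q
    proof -
      have x: "X q \<in> tangent_space N q" by (rule vector_field_tangent[OF X that])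
      have "d\<sigma> q (X q) \<noteq> 0"
        using fac.differential_proj_slice[OF x] X0[OF that] linear_0[OF linear_differential[of N \<pi>]] by metis
      then show ?thesis unfolding K_eq using G.pos[OF sigma_tangent[OF x]] by fastforce
    qed
    have p: "\<sigma> q' \<in> \<pi> -` U" if "q' \<in> U" for q' using that pi_sigma by simp
    have ou: "open U" by (rule chart_open[OF mN U(1)])
    let ?Z = "\<lambda>x. nabB x (fac.lift X x) (fac.lift X)"
    \<comment> \<open>The value of \<open>H\<close> on \<open>f\<close> according to the umbilical
      equation, with quotient and difference written through \<open>inverse\<close> and
      \<open>- 1\<close> so that only products and sums of smooth functions occur.\<close>
    let ?k = "\<lambda>q. inverse (K q (X q) (X q)) * (?Z (\<sigma> q) \<cdot> (\<lambda>x. f (\<phi> x)) + (- 1) * (nabN q (X q) X \<cdot> (\<lambda>q. f (\<psi> q))))"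
    have fs: "smooth_at A (\<psi> q) f" using smooth_atI[OF f] q by simp
    have s1: "smooth_at N q (\<lambda>q. K q (X q) (X q))"
      using smooth_pullback_at[OF fac.slice metric_smooth_lift[OF lift_field[OF X] lift_field[OF X] p[OF U(2)]]]
      unfolding K_eq lift_sigma .
    have s2: "smooth_at N q (\<lambda>q. ?Z (\<sigma> q) \<cdot> (\<lambda>x. f (\<phi> x)))"
      by (rule smooth_pullback_at[OF fac.slice vector_field_act_at[OF
            affine_connection_field[OF levi_civita_affine[OF lcB] lift_field[OF X] lift_field[OF X]] p[OF U(2)]
            smooth_pullback_at[OF \<phi>]]]) (use fs in simp)
    have s3: "smooth_at N q (\<lambda>q. nabN q (X q) X \<cdot> (\<lambda>q. f (\<psi> q)))"
      by (rule vector_field_act_at[OF nabN_field[OF X X] U(2) smooth_pullback_at[OF psi_pullback fs]])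
    have ks: "smooth_at N q ?k"
      by (intro smooth_at_mult[OF mN] smooth_at_add[OF mN] smooth_at_const[OF mN] s2 s3
          smooth_at_inverse[OF mN s1 ou U(2) K0])
    have "H q' \<cdot> f = ?k q'" if q': "q' \<in> U \<inter> \<psi> -` W'" for q'
    proof -
      have qU: "q' \<in> U" using q' by simp
      have fs': "smooth_at A (\<psi> q') f" using smooth_atI[OF f] q' by simp
      have "d (\<sigma> q') (?Z (\<sigma> q')) = differential A \<psi> q' (nabN q' (X q') X) + K q' (X q') (X q') *\<^sub>R H q'"
        using arg_cong[OF nabB_perp[OF X X qU], of "d (\<sigma> q')"]
        unfolding H_def d_psi linear_diff[OF linear_differential] linear_scale[OF linear_differential]
          nabN_def lift_sigma by simp
      then have "d (\<sigma> q') (?Z (\<sigma> q')) \<cdot> f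
          = (differential A \<psi> q' (nabN q' (X q') X) + K q' (X q') (X q') *\<^sub>R H q') \<cdot> f" by simp
      then have "?Z (\<sigma> q') \<cdot> (\<lambda>x. f (\<phi> x)) = nabN q' (X q') X \<cdot> (\<lambda>q. f (\<psi> q)) + K q' (X q') (X q') * (H q' \<cdot> f)"
        using fs' by (simp add: differential_act)
      then show ?thesis using K0[OF qU] by (simp add: field_simps)
    qed
    then show ?thesis
      using smooth_at_cong[OF mN open_Int[OF ou o], of q "\<lambda>q. H q \<cdot> f" ?k] ks U(2) q by blast
  qed
  then show "smooth_fun_on N (UNIV \<inter> \<psi> -` W') (\<lambda>q. H q \<cdot> f)"
    using smooth_fun_on_iff_smooth_at[OF mN o] by simp
qed

theorem leaf_totally_umbilical: "totally_umbilical N A g nab \<psi>"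
  unfolding totally_umbilical_def using H_smooth H_normal leaf_second_fundamental_form by blast

text \<open>The base has logarithm \<open>F 0 = 0\<close>, so its mean curvature vector
  vanishes.\<close>

theorem leaf_totally_geodesic:
  assumes "i = 0"
  shows "totally_geodesic N A g nab \<psi>"
proof -
  have "grad p = 0" for p
  proof (rule G.eqI[OF grad(1) G.mem_zero])
    fix v assume v: "v \<in> tangent_space B p"
    have "F i = (\<lambda>p. 0)" using F_0 assms by blast
    then show "G p (grad p) v = G p 0 v" using grad(2)[OF v] tangent_act_const[OF B v] v by simp
  qed
  then have "H = (\<lambda>q. 0)" unfolding H_def by (simp add: linear_0[OF linear_differential])
  then show ?thesis using leaf_second_fundamental_form unfolding totally_geodesic_def by simp
qed

end

section \<open>Lifts and basic functions on a factor\<close>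

lemma vector_field_cong:
  assumes A: "smooth_manifold A" and X: "vector_field_on A W X" and eq: "\<And>q. q \<in> W \<Longrightarrow> X q = X' q"
  shows "vector_field_on A W X'"
proof (rule vector_field_onI[OF vector_field_open[OF X]])
  show "X' q \<in> tangent_space A q" if "q \<in> W" for q using vector_field_tangent[OF X that] eq[OF that] by simp
  show "smooth_fun_on A (W \<inter> W') (\<lambda>q. X' q \<cdot> f)" if "smooth_fun_on A W' f" for W' f
    by (rule smooth_fun_on_cong[OF A vector_field_act[OF X that]]) (simp add: eq)
qed

context factor
begin

text \<open>The domain \<open>W\<close> may be any open part of the preimage of the domain of
  \<open>Y\<close>, so the notion passes to smaller open sets.\<close>

definition Lift :: "'m set \<Rightarrow> ('m \<Rightarrow> 'm tvec) \<Rightarrow> bool" where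
  "Lift W X \<longleftrightarrow> open W \<and> (\<exists>W0 Y. vector_field_on B W0 Y \<and> W \<subseteq> \<pi> -` W0 \<and> (\<forall>q\<in>W. X q = lift Y q))"

definition Basic :: "'m set \<Rightarrow> ('m \<Rightarrow> real) \<Rightarrow> bool" where
  "Basic W f \<longleftrightarrow> (\<exists>W0 f0. smooth_fun_on B W0 f0 \<and> W = \<pi> -` W0 \<and> f = (\<lambda>x. f0 (\<pi> x)))"

lemma Lift_lift: "vector_field_on B W Y \<Longrightarrow> Lift (\<pi> -` W) (lift Y)"
  unfolding Lift_def using vector_field_open[OF lift_field] by blast

lemma LiftE:
  assumes "Lift W X"
  obtains W0 Y where "open W" "vector_field_on B W0 Y" "W \<subseteq> \<pi> -` W0" "\<And>q. q \<in> W \<Longrightarrow> X q = lift Y q"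
  using assms unfolding Lift_def by (elim exE conjE) (rule that, auto)

lemma Lift_field: 
  assumes "Lift W X"
  shows "vector_field_on A W X"
proof -
  obtain W0 Y where Y: "open W" "vector_field_on B W0 Y" "W \<subseteq> \<pi> -` W0" "\<And>q. q \<in> W \<Longrightarrow> X q = lift Y q"
    by (rule LiftE[OF assms]; rule that)
  show ?thesis
    by (rule vector_field_cong[OF A vector_field_subset[OF lift_field[OF Y(2)] Y(1,3)] Y(4)[symmetric]])
qed

lemma Lift_leaf:
  assumes X: "Lift W X" and q: "q \<in> W"
  shows "X q \<in> leaf q"
proof -
  obtain W0 Y where Y: "open W" "vector_field_on B W0 Y" "W \<subseteq> \<pi> -` W0" "\<And>q. q \<in> W \<Longrightarrow> X q = lift Y q"
    by (rule LiftE[OF X]; rule that)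
  show ?thesis unfolding Y(4)[OF q] by (rule lift_leaf[OF Y(2)]) (use Y(3) q in blast)
qed

lemma Lift_subset:
  assumes X: "Lift W X" and W': "open W'" "W' \<subseteq> W"
  shows "Lift W' X"
proof -
  obtain W0 Y where Y: "open W" "vector_field_on B W0 Y" "W \<subseteq> \<pi> -` W0" "\<And>q. q \<in> W \<Longrightarrow> X q = lift Y q"
    by (rule LiftE[OF X]; rule that)
  have "W' \<subseteq> \<pi> -` W0" "\<forall>q\<in>W'. X q = lift Y q" using Y(3,4) W'(2) by auto
  then show ?thesis unfolding Lift_def using W'(1) Y(2) by blast
qed

lemma Lift_extends:
  assumes v: "v \<in> leaf p"
  shows "\<exists>W X. p \<in> W \<and> Lift W X \<and> X p = v"
proof -
  obtain u where u: "u \<in> tangent_space B (\<pi> p)" "v = differential A (s p) (\<pi> p) u"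
    using v unfolding leaf_def by blast
  obtain W Y where Y: "\<pi> p \<in> W" "vector_field_on B W Y" "Y (\<pi> p) = u"
    using tangent_vector_extends[OF B u(1)] .
  have "lift Y p = v" unfolding lift_def Y(3) u(2) ..
  then show ?thesis using Y(1) Lift_lift[OF Y(2)] by blast
qed

lemma Basic_smooth: "Basic W f \<Longrightarrow> smooth_fun_on A W f"
  unfolding Basic_def using smooth_pullbackD[OF proj] by blast

lemma Lift_Basic:
  assumes X: "Lift W X" and f: "Basic W' f"
  shows "\<exists>W'' f'. Basic W'' f' \<and> W \<inter> W' \<subseteq> W'' \<and> (\<forall>q\<in>W \<inter> W'. X q \<cdot> f = f' q)"
proof -
  obtain W0 Y where Y: "open W" "vector_field_on B W0 Y" "W \<subseteq> \<pi> -` W0" "\<And>q. q \<in> W \<Longrightarrow> X q = lift Y q"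
    by (rule LiftE[OF X]; rule that)
  obtain W1 f0 where f0: "smooth_fun_on B W1 f0" "W' = \<pi> -` W1" "f = (\<lambda>x. f0 (\<pi> x))"
    using f unfolding Basic_def by blast
  have "Basic (\<pi> -` (W0 \<inter> W1)) (\<lambda>x. Y (\<pi> x) \<cdot> f0)"
    unfolding Basic_def using vector_field_act[OF Y(2) f0(1)] by blast
  moreover have "X q \<cdot> f = Y (\<pi> q) \<cdot> f0" if q: "q \<in> W \<inter> W'" for q
  proof -
    have "\<pi> q \<in> W0" "\<pi> q \<in> W1" using q Y(3) f0(2) by auto
    then show ?thesis
      using lift_act_proj[OF Y(2), of q f0] smooth_atI[OF f0(1)] Y(4) q unfolding f0(3) by simp
  qed
  moreover have "W \<inter> W' \<subseteq> \<pi> -` (W0 \<inter> W1)" using Y(3) f0(2) by blast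
  ultimately show ?thesis by blast
qed

lemma differential_proj_eq_0:
  assumes "\<And>W f. Basic W f \<Longrightarrow> p \<in> W \<Longrightarrow> v \<cdot> f = 0"
  shows "differential B \<pi> p v = 0"
proof (rule tvec_eqI)
  fix f
  show "differential B \<pi> p v \<cdot> f = 0 \<cdot> f"
  proof (cases "smooth_at B (\<pi> p) f")
    case True
    then obtain W where "\<pi> p \<in> W" "smooth_fun_on B W f" unfolding smooth_at_def by blast
    then have "Basic (\<pi> -` W) (\<lambda>x. f (\<pi> x))" "p \<in> \<pi> -` W" unfolding Basic_def by auto
    from assms[OF this] show ?thesis by (simp add: differential_act)
  qed (simp add: differential_act)
qed

text \<open>A vector tangent to a leaf is the image of a vector of the factor, so it differentiates
  only the restriction of a smooth function to the leaf.\<close>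

lemma leaf_act_cong:
  assumes v: "v \<in> leaf p" and f: "smooth_at A p f" and f': "smooth_at A p f'"
    and eq: "\<And>q. f (s p q) = f' (s p q)"
  shows "v \<cdot> f = v \<cdot> f'"
proof -
  obtain u where "v = differential A (s p) (\<pi> p) u" using v unfolding leaf_def by blast
  then show ?thesis using f f' by (simp add: differential_act slice_proj eq)
qed

lemma leaf_act_const:
  assumes v: "v \<in> leaf p" and f: "smooth_at A p f" and eq: "\<And>q. f (s p q) = c"
  shows "v \<cdot> f = 0"
proof -
  have "v \<cdot> f = v \<cdot> (\<lambda>q. c)" by (rule leaf_act_cong[OF v f smooth_at_const[OF A]]) (rule eq)
  also have "\<dots> = 0" by (rule tangent_act_const[OF A subsetD[OF leaf_tangent v]])
  finally show ?thesis .
qed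

lemma differential_leaf_const:
  assumes v: "v \<in> leaf p" and \<pi>': "smooth_pullback A C \<pi>'" and eq: "\<And>q. \<pi>' (s p q) = c"
  shows "differential C \<pi>' p v = 0"
proof (rule tvec_eqI)
  fix f show "differential C \<pi>' p v \<cdot> f = 0 \<cdot> f"
    using leaf_act_const[OF v smooth_pullback_at[OF \<pi>', of p f], of "f c"] by (simp add: differential_act eq)
qed

text \<open>\<open>v\<close> kills the functions of this factor, so in the product of
  \<open>w * w\<close> with the basic function \<open>b\<close> only \<open>w * w\<close> is
  differentiated; passing to the logarithm restores the square of \<open>w\<close>.\<close>

lemma warped_metric_deriv:
  assumes riem: "riemannian_manifold B gB"
    and G: "\<And>q y z. y \<in> leaf q \<Longrightarrow> z \<in> leaf q \<Longrightarrow>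
      G q y z = (w q)\<^sup>2 * gB (\<pi> q) (differential B \<pi> q y) (differential B \<pi> q z)"
    and w: "\<And>q. w q > 0" "smooth_at A p w" "smooth_at A p (\<lambda>q. ln (w q))"
    and Y: "Lift W Y" and Z: "Lift W Z" and p: "p \<in> W" and v: "v \<in> tangent_space A p"
    and v0: "\<And>W f. Basic W f \<Longrightarrow> p \<in> W \<Longrightarrow> v \<cdot> f = 0"
  shows "v \<cdot> (\<lambda>q. G q (Y q) (Z q)) = 2 * (v \<cdot> (\<lambda>q. ln (w q))) * G p (Y p) (Z p)"
proof -
  obtain W1 Y0 where Y0: "open W" "vector_field_on B W1 Y0" "W \<subseteq> \<pi> -` W1" "\<And>q. q \<in> W \<Longrightarrow> Y q = lift Y0 q"
    by (rule LiftE[OF Y]; rule that)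
  obtain W2 Z0 where Z0: "open W" "vector_field_on B W2 Z0" "W \<subseteq> \<pi> -` W2" "\<And>q. q \<in> W \<Longrightarrow> Z q = lift Z0 q"
    by (rule LiftE[OF Z]; rule that)
  define b where "b = (\<lambda>q. gB (\<pi> q) (Y0 (\<pi> q)) (Z0 (\<pi> q)))"
  have eq: "G q (Y q) (Z q) = (w q * w q) * b q" if q: "q \<in> W" for q
  proof -
    have "differential B \<pi> q (Y q) = Y0 (\<pi> q)" "differential B \<pi> q (Z q) = Z0 (\<pi> q)"
      using differential_proj_lift[OF Y0(2), of q] differential_proj_lift[OF Z0(2), of q]
        Y0(3,4) Z0(3,4) q by auto
    then show ?thesis
      using G[OF Lift_leaf[OF Y q] Lift_leaf[OF Z q]] unfolding b_def by (simp add: power2_eq_square)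
  qed
  have o: "open (W1 \<inter> W2)" using vector_field_open[OF Y0(2)] vector_field_open[OF Z0(2)] by blast
  have "smooth_fun_on B (W1 \<inter> W2) (\<lambda>q. gB q (Y0 q) (Z0 q))"
    using riem vector_field_subset[OF Y0(2) o] vector_field_subset[OF Z0(2) o]
    unfolding riemannian_manifold_def by simp
  then have b: "Basic (\<pi> -` (W1 \<inter> W2)) b" unfolding Basic_def b_def by blast
  have pb: "p \<in> \<pi> -` (W1 \<inter> W2)" using p Y0(3) Z0(3) by blast
  have bs: "smooth_at A p b" by (rule smooth_atI[OF Basic_smooth[OF b] pb])
  have "v \<cdot> (\<lambda>q. G q (Y q) (Z q)) = v \<cdot> (\<lambda>q. (w q * w q) * b q)"
    by (rule tangent_act_cong[OF A v Y0(1) p eq])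
  also have "\<dots> = 2 * w p * (v \<cdot> w) * b p"
    unfolding tangent_act_mult[OF A v smooth_at_mult[OF A w(2) w(2)] bs] tangent_act_mult[OF A v w(2) w(2)]
      v0[OF b pb] by simp
  also have "v \<cdot> (\<lambda>q. ln (w q)) = inverse (w p) * (v \<cdot> w)"
    by (rule tangent_act_compose_real[OF A v w(2,3)]) (use w(1)[of p] in \<open>auto intro!: derivative_eq_intros simp: field_simps\<close>)
  then have "v \<cdot> w = w p * (v \<cdot> (\<lambda>q. ln (w q)))" using w(1)[of p] by (simp add: field_simps)
  finally show ?thesis using eq[OF p] by (simp add: algebra_simps)
qed

end

section \<open>Fibre data from the metric of the factor\<close>

lemma (in nk_immersion) \<omega>_smooth:
  assumes U: "vector_field_on B W U" and V: "vector_field_on B W V" and p: "p \<in> W"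
  shows "smooth_at B p (\<lambda>q. g (\<phi> q) (J (\<phi> q) (d q (U q))) (d q (V q)))"
proof -
  note u = vector_field_tangent[OF U p]
  \<comment> \<open>With both fields equal to \<open>U\<close>, \<open>hcd_J\<close> provides a
    covariant derivative of \<open>J U\<close>.\<close>
  obtain z where "hcd p (U p) (\<lambda>q. J (\<phi> q) (d q (U q))) z"
    using hcd_J[OF U U p gauss[OF p u U] gauss[OF p u U]] by blast
  from hcd_metric(2)[OF this gauss[OF p u V] u] show ?thesis .
qed

text \<open>This covers both fibres: \<open>c = 0\<close> for the totally real one and
  \<open>c = cos^2 \<theta>\<close> for the slant one. The second factor structure,
  \<open>base\<close>, provides the leaves along which frames at different points are
  compared.\<close>

locale warped_fibre = nk_warped B A g nab \<phi> J nabB h D Lf bas F + fac: factor B N \<pi> s + base: factor B N0 \<pi>0 s0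
  for B :: "('n::{t2_space,second_countable_topology}, 'f::euclidean_space) chart set"
    and A :: "('m::{t2_space,second_countable_topology}, 'e::euclidean_space) chart set"
    and g nab \<phi> J nabB h D Lf bas F
    and N :: "('k::{t2_space,second_countable_topology}, 'd::euclidean_space) chart set"
    and \<pi> s
    and N0 :: "('l::{t2_space,second_countable_topology}, 'b::euclidean_space) chart set"
    and \<pi>0 s0 +
  fixes i :: nat and gN :: "'k metric" and w :: "'n \<Rightarrow> real" and c :: real
  assumes i: "i < 3" and leaf_D: "\<And>x. fac.leaf x = D i x" and base_D: "\<And>x. base.leaf x = D 0 x"
    and Lift_Lf: "\<And>W X. fac.Lift W X \<Longrightarrow> Lf i W X"
    and base_slice: "\<And>x a. \<pi> (s0 x a) = \<pi> x"
    and gN: "riemannian_manifold N gN"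
    and w_pos: "\<And>q. w q > 0" and w_smooth: "\<And>q. smooth_at B q w" and F_ln: "F i = (\<lambda>q. ln (w q))"
    and ln_smooth: "\<And>q. smooth_at B q (\<lambda>q. ln (w q))"
    and G_leaf: "\<And>q y z. y \<in> D i q \<Longrightarrow> z \<in> D i q \<Longrightarrow>
      pullback_metric A g \<phi> q y z = (w q)\<^sup>2 * gN (\<pi> q) (differential N \<pi> q y) (differential N \<pi> q z)"
    and slant: "\<And>q E u v. inner_space.orthonormal (tangent_space B q) (pullback_metric A g \<phi> q) E \<Longrightarrow>
      span E = D i q \<Longrightarrow> u \<in> E \<Longrightarrow> v \<in> E \<Longrightarrow>
      (\<Sum>e\<in>E. g (\<phi> q) (J (\<phi> q) (differential A \<phi> q u)) (differential A \<phi> q e) *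
         g (\<phi> q) (J (\<phi> q) (differential A \<phi> q v)) (differential A \<phi> q e)) = (if u = v then c else 0)"
begin

text \<open>A \<open>gN\<close>-orthonormal basis of the tangent space of the fibre, lifted and scaled by \<open>1 / w\<close>, is
  orthonormal at every point over it; so the squared norm of \<open>\<omega>\<close> on the lifts is a constant times
  \<open>w ^ 4\<close> along the leaves of the base.\<close>

lemma fibre_data: "fibre_data i c DIM('d) p"
proof -
  let ?b = "\<pi> p"
  interpret NN: inner_space "tangent_space N ?b" "gN ?b" by (rule inner_on_tangent[OF gN])
  obtain X where X: "finite X" "independent X" "card X = DIM('d)" "span X = tangent_space N ?b"
    using dim_tangent_space[OF fac.B] by metis
  have "X \<subseteq> tangent_space N ?b" using X(4) span_superset by blast
  then obtain E where E: "NN.orthonormal E" "span E = tangent_space N ?b"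
    using NN.gram_schmidt[OF X(1)] X(4) by metis
  have card: "card E = DIM('d)" using NN.orthonormal_card[OF E(1) X(2)] X(3,4) E(2) by simp
  note fin = NN.orthonormal_finite[OF E(1)] and Et = NN.orthonormal_mem[OF E(1)] and \<delta> = NN.orthonormal_inner[OF E(1)]
  have "\<forall>e\<in>E. \<exists>W Y. ?b \<in> W \<and> vector_field_on N W Y \<and> Y ?b = e"
    using tangent_vector_extends[OF fac.B Et] by metis
  then obtain Wf Yf where Yf: "\<And>e. e \<in> E \<Longrightarrow> ?b \<in> Wf e" "\<And>e. e \<in> E \<Longrightarrow> vector_field_on N (Wf e) (Yf e)"
    "\<And>e. e \<in> E \<Longrightarrow> Yf e ?b = e" by metis
  define W where "W = \<Inter> (Wf ` E)"
  have W: "open W" "?b \<in> W" "\<And>e. e \<in> E \<Longrightarrow> W \<subseteq> Wf e"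
    unfolding W_def using fin Yf(1) vector_field_open[OF Yf(2)] by (auto intro!: open_INT)
  have YW: "vector_field_on N W (Yf e)" if "e \<in> E" for e
    by (rule vector_field_subset[OF Yf(2)[OF that] W(1) W(3)[OF that]])
  define l where "l q e = differential B (s q) ?b e" for q e
  define r where "r q e = (1 / w q) *\<^sub>R l q e" for q e
  have lin: "linear (l q)" for q unfolding l_def by (rule linear_differential)
  have lD: "l q e \<in> D i q" if "\<pi> q = ?b" "e \<in> E" for q e
  proof -
    have "l q e \<in> fac.leaf q" using that Et[OF that(2)] unfolding l_def fac.leaf_def by simp
    then show ?thesis using leaf_D by simp
  qed
  have rD: "r q e \<in> D i q" if "\<pi> q = ?b" "e \<in> E" for q e
    unfolding r_def by (rule subspace_scale[OF D_subspace[OF i] lD[OF that]])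
  have dl: "differential N \<pi> q (l q e) = e" if "\<pi> q = ?b" "e \<in> E" for q e
    using fac.differential_proj_slice[of e ?b q] Et[OF that(2)] fac.slice_proj[of q] that(1) unfolding l_def by simp
  have Grr: "G q (r q e) (r q e') = (if e = e' then 1 else 0)" if q: "\<pi> q = ?b" and e: "e \<in> E" "e' \<in> E" for q e e'
  proof -
    have "differential N \<pi> q (r q e) = (1 / w q) *\<^sub>R e" if "e \<in> E" for e
      unfolding r_def by (simp add: linear_scale[OF linear_differential] dl[OF q that])
    then have "G q (r q e) (r q e') = (w q)\<^sup>2 * gN ?b ((1 / w q) *\<^sub>R e) ((1 / w q) *\<^sub>R e')"
      using G_leaf[OF rD[OF q e(1)] rD[OF q e(2)]] q e by simp
    also have "\<dots> = gN ?b e e'"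
      using w_pos[of q] Et[OF e(1)] Et[OF e(2)]
      by (simp add: NN.scale_left NN.scale_right NN.mem_scale power2_eq_square)
    finally show ?thesis using \<delta>[OF e] by simp
  qed
  have inj: "inj_on (r q) E" if q: "\<pi> q = ?b" for q
    by (rule inj_onI) (metis Grr[OF q] zero_neq_one)
  have on: "on q (r q ` E)" if q: "\<pi> q = ?b" for q
    unfolding G.orthonormal_def using fin D_tangent[OF i rD[OF q]] Grr[OF q] inj_onD[OF inj[OF q]] by auto
  have span: "span (r q ` E) = D i q" if q: "\<pi> q = ?b" for q
  proof
    show "span (r q ` E) \<subseteq> D i q" by (rule span_minimal[OF _ D_subspace[OF i]]) (use rD[OF q] in blast)
    have "D i q = l q ` span E" using leaf_D[of q] E(2) q unfolding l_def fac.leaf_def by simp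
    also have "\<dots> = span (l q ` E)" by (rule linear_span_image[OF lin, symmetric])
    also have "\<dots> \<subseteq> span (r q ` E)"
    proof (rule span_minimal[OF _ subspace_span], clarify)
      fix e assume "e \<in> E"
      then have "r q e \<in> span (r q ` E)" by (intro span_base imageI)
      then have "w q *\<^sub>R r q e \<in> span (r q ` E)" by (rule span_scale)
      then show "l q e \<in> span (r q ` E)" unfolding r_def using w_pos[of q] by simp
    qed
    finally show "D i q \<subseteq> span (r q ` E)" .
  qed
  have sl: "(\<Sum>e\<in>E. \<omega> q (r q u) (r q e) * \<omega> q (r q v) (r q e)) = (if u = v then c else 0)"
    if q: "\<pi> q = ?b" and uv: "u \<in> E" "v \<in> E" for q u v
  proof -
    have "(if r q u = r q v then c else 0) = (if u = v then c else 0)" using inj_onD[OF inj[OF q] _ uv] by auto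
    then show ?thesis
      using slant[OF on[OF q] span[OF q] imageI[OF uv(1)] imageI[OF uv(2)]]
      by (simp add: sum.reindex[OF inj[OF q]])
  qed
  \<comment> \<open>Scaling by the constant \<open>1 / w p\<close> keeps the field a lift and makes
    the family orthonormal at \<open>p\<close>. At another point \<open>q\<close> over the same
    point of the fibre it is \<open>w q / w p\<close> times the orthonormal frame
    \<open>r q\<close>.\<close>
  define U where "U e x = (1 / w p) *\<^sub>R fac.lift (Yf e) x" for e x
  have U_alt: "U e = fac.lift (\<lambda>q. (1 / w p) *\<^sub>R Yf e q)" for e
    unfolding U_def fac.lift_def by (intro ext) (simp add: linear_scale[OF linear_differential])
  have YW': "vector_field_on N W (\<lambda>q. (1 / w p) *\<^sub>R Yf e q)" if "e \<in> E" for e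
    by (rule vector_field_scale[OF fac.B smooth_fun_on_const[OF fac.B W(1)] YW[OF that]])
  have ULf: "Lf i (\<pi> -` W) (U e)" if "e \<in> E" for e
    unfolding U_alt by (rule Lift_Lf[OF fac.Lift_lift[OF YW'[OF that]]])
  have Uq: "U e q = (w q / w p) *\<^sub>R r q e" if "\<pi> q = ?b" "e \<in> E" for e q
    unfolding U_def r_def l_def fac.lift_def that(1) Yf(3)[OF that(2)] using w_pos[of q] by simp
  have Up: "U e p = r p e" if "e \<in> E" for e using Uq[OF _ that, of p] w_pos[of p] by simp
  have pW: "p \<in> \<pi> -` W" using W(2) by simp
  define \<Phi> where "\<Phi> q = (\<Sum>u\<in>E. \<Sum>v\<in>E. (\<omega> q (U u q) (U v q))\<^sup>2)" for q
  \<comment> \<open>\<omega> is bilinear in the frame and \<Phi> is quadratic in \<omega>, whence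
    the fourth power; the remaining factor is the squared norm of \<omega> in an orthonormal
    frame.\<close>
  define k where "k = c * DIM('d) / (w p) ^ 4"
  define \<Psi> where "\<Psi> q = k * ((w q * w q) * (w q * w q))" for q
  have \<Phi>_smooth: "smooth_at B p \<Phi>"
    unfolding \<Phi>_def power2_eq_square
    by (intro smooth_at_sum[OF B] smooth_at_mult[OF B] \<omega>_smooth[OF Lf_field[OF i ULf] Lf_field[OF i ULf] pW])
  have \<Psi>_smooth: "smooth_at B p \<Psi>"
    unfolding \<Psi>_def by (intro smooth_at_mult[OF B] smooth_at_const[OF B] w_smooth)
  have \<Phi>\<Psi>: "\<Phi> q = \<Psi> q" if q: "\<pi> q = ?b" for q
  proof -
    have "\<omega> q (U u q) (U v q) = (w q / w p)\<^sup>2 * \<omega> q (r q u) (r q v)" if uv: "u \<in> E" "v \<in> E" for u v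
      unfolding Uq[OF q uv(1)] Uq[OF q uv(2)] d_scale power2_eq_square
      using d_tangent[OF D_tangent[OF i rD[OF q uv(1)]]] d_tangent[OF D_tangent[OF i rD[OF q uv(2)]]]
        J_tangent[OF d_tangent[OF D_tangent[OF i rD[OF q uv(1)]]]]
      by (simp add: J_scale T.scale_left T.scale_right T.mem_scale)
    then have "\<Phi> q = (\<Sum>u\<in>E. (w q / w p) ^ 4 * (\<Sum>v\<in>E. \<omega> q (r q u) (r q v) * \<omega> q (r q u) (r q v)))"
      unfolding \<Phi>_def sum_distrib_left
      by (intro sum.cong refl) (simp add: power_mult_distrib power2_eq_square power4_eq_xxxx mult.assoc mult.left_commute)
    also have "\<dots> = (\<Sum>u\<in>E. (w q / w p) ^ 4 * c)" by (intro sum.cong refl) (simp add: sl[OF q])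
    also have "\<dots> = \<Psi> q" unfolding \<Psi>_def k_def by (simp add: card power_divide power4_eq_xxxx)
    finally show ?thesis .
  qed
  have sd: "x \<cdot> \<Phi> = 4 * (x \<cdot> F i) * c * DIM('d)" if x: "x \<in> D 0 p" for x
  proof -
    have xt: "x \<in> tangent_space B p" by (rule D_tangent[OF _ x]) simp
    have "x \<cdot> \<Phi> = x \<cdot> \<Psi>"
    \<comment> \<open>The two functions are compared only on the leaf of the base through
      \<open>p\<close>, which suffices because \<open>x\<close> is tangent to that leaf.\<close>
    proof (rule base.leaf_act_cong[OF _ \<Phi>_smooth \<Psi>_smooth])
      show "x \<in> base.leaf p" using x base_D by simp
      show "\<Phi> (s0 p a) = \<Psi> (s0 p a)" for a by (rule \<Phi>\<Psi>[OF base_slice])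
    qed
    also have "\<dots> = k * (4 * (w p * w p * w p) * (x \<cdot> w))"
      unfolding \<Psi>_def using w_smooth[of p]
      by (simp add: tangent_act_mult[OF B xt] smooth_at_mult[OF B] smooth_at_const[OF B] tangent_act_const[OF B xt] algebra_simps)
    also have "x \<cdot> F i = inverse (w p) * (x \<cdot> w)"
      unfolding F_ln
      by (rule tangent_act_compose_real[OF B xt w_smooth ln_smooth]) (use w_pos[of p] in \<open>auto intro!: derivative_eq_intros simp: field_simps\<close>)
    then have "x \<cdot> w = w p * (x \<cdot> F i)" using w_pos[of p] by (simp add: field_simps)
    finally show ?thesis unfolding k_def using w_pos[of p] by (simp add: power4_eq_xxxx field_simps)
  qed
  \<comment> \<open>\<open>fibre_data\<close> indexes the lifts by the basis vectors at
    \<open>p\<close>, whereas \<open>U\<close> is indexed by the vectors of the factor.\<close>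
  define V where "V = U \<circ> the_inv_into E (r p)"
  have inv: "the_inv_into E (r p) (r p e) = e" if "e \<in> E" for e
    using the_inv_into_f_f[OF inj[of p] that] by simp
  note ip = inj[of p, OF refl]
  show ?thesis
    unfolding fibre_data_def
  proof (intro exI conjI ballI)
    show "on p (r p ` E)" "span (r p ` E) = D i p" using on[of p] span[of p] by auto
    show "card (r p ` E) = DIM('d)" using card card_image[OF ip] by simp
    show "p \<in> \<pi> -` W" by (rule pW)
    show "Lf i (\<pi> -` W) (V e)" "V e p = e" if "e \<in> r p ` E" for e
      using that ULf Up inv unfolding V_def by auto
    show "(\<Sum>v\<in>r p ` E. \<omega> p u v * \<omega> p y v) = (if u = y then c else 0)"
      if "u \<in> r p ` E" "y \<in> r p ` E" for u y
      by (rule slant[OF on[OF refl] span[OF refl] that])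
    show "x \<cdot> (\<lambda>q. \<Sum>u\<in>r p ` E. \<Sum>v\<in>r p ` E. (\<omega> q (V u q) (V v q))\<^sup>2) = 4 * (x \<cdot> F i) * c * DIM('d)"
      if "x \<in> D 0 p" for x
    proof -
      have "(\<lambda>q. \<Sum>u\<in>r p ` E. \<Sum>v\<in>r p ` E. (\<omega> q (V u q) (V v q))\<^sup>2) = \<Phi>"
        unfolding \<Phi>_def by (intro ext) (simp add: sum.reindex[OF ip] V_def inv cong: sum.cong)
      then show ?thesis using sd[OF that] by simp
    qed
  qed
qed

end

section \<open>The angle between a vector and a subspace\<close>

text \<open>By the Cauchy-Schwarz inequality the least angle is attained at the projection of
  \<open>w\<close> on the span. If that projection is 0, every nonzero vector of the span is
  orthogonal to \<open>w\<close> and attains it.\<close>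

lemma (in inner_space) angle_to_span:
  assumes E: "orthonormal E" "E \<noteq> {}" and w: "w \<in> S" "w \<noteq> 0"
  shows "Inf {arccos (b w s / (sqrt (b w w) * sqrt (b s s))) | s. s \<in> span E \<and> s \<noteq> 0}
     = arccos (sqrt (\<Sum>e\<in>E. (b w e)\<^sup>2) / sqrt (b w w))" (is "Inf ?X = arccos (?r / ?n)")
proof (rule cInf_eq_minimum)
  have ww: "b w w > 0" by (rule pos[OF w])
  have rn: "?r \<le> ?n" using bessel[OF E(1) w(1)] by simp
  have r0: "0 \<le> ?r" by (simp add: sum_nonneg)
  have Es: "span E \<subseteq> S" by (rule span_subset) (use orthonormal_mem[OF E(1)] in blast)
  show "arccos (?r / ?n) \<in> ?X"
  proof (cases "?r = 0")
    case True
    obtain e where e: "e \<in> E" using E(2) by blast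
    have "(\<Sum>e\<in>E. (b w e)\<^sup>2) = 0" using True by simp
    then have "b w e = 0"
      using e orthonormal_finite[OF E(1)] by (subst (asm) sum_nonneg_eq_0_iff) auto
    moreover have "e \<noteq> 0" using orthonormal_inner[OF E(1) e e] zero_left[OF mem_zero] by auto
    ultimately show ?thesis using True span_base[OF e] by (intro CollectI exI[of _ e]) simp
  next
    case False
    define s where "s = (\<Sum>e\<in>E. b w e *\<^sub>R e)"
    have s: "s \<in> span E" unfolding s_def by (intro span_sum span_scale span_base)
    have sS: "s \<in> S" using s Es by blast
    have ws: "b w s = (\<Sum>e\<in>E. (b w e)\<^sup>2)"
      unfolding s_def using orthonormal_mem[OF E(1)] w(1)
      by (subst sum_right) (auto simp: scale_right power2_eq_square)
    have se: "b s e = b w e" if "e \<in> E" for e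
      using projection_orthogonal[OF E(1) w(1) that] diff_left[OF w(1) sS orthonormal_mem[OF E(1) that]]
      unfolding s_def by simp
    have "b s s = (\<Sum>e\<in>E. b s e * b e s)" by (rule parseval[OF E(1) s sS])
    also have "\<dots> = (\<Sum>e\<in>E. (b w e)\<^sup>2)"
      using se sym[OF sS orthonormal_mem[OF E(1)]] by (intro sum.cong refl) (simp add: power2_eq_square)
    finally have ss: "b s s = (\<Sum>e\<in>E. (b w e)\<^sup>2)" .
    have "s \<noteq> 0"
    proof
      assume "s = 0"
      then have "b s s = 0" using zero_left[OF mem_zero] by simp
      then show False using False unfolding ss by simp
    qed
    moreover have "b w s / (sqrt (b w w) * sqrt (b s s)) = ?r / ?n"
    proof -
      have "(\<Sum>e\<in>E. (b w e)\<^sup>2) / (?n * ?r) = (\<Sum>e\<in>E. (b w e)\<^sup>2) / ?r / ?n" by simp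
      also have "(\<Sum>e\<in>E. (b w e)\<^sup>2) / ?r = ?r" by (rule real_div_sqrt) (simp add: sum_nonneg)
      finally show ?thesis unfolding ss ws .
    qed
    ultimately show ?thesis using s by (intro CollectI exI[of _ s]) simp
  qed
  fix x assume "x \<in> ?X"
  then obtain s where s: "s \<in> span E" "s \<noteq> 0" and x: "x = arccos (b w s / (?n * sqrt (b s s)))" by blast
  have sS: "s \<in> S" using s Es by blast
  have ss: "b s s > 0" by (rule pos[OF sS s(2)])
  have CS: "\<bar>b w s\<bar> \<le> ?r * sqrt (b s s)"
  proof -
    have "b w s = (\<Sum>e\<in>E. b w e * b s e)"
      using parseval[OF E(1) s(1) w(1)] sym[OF w(1) sS] sym[OF w(1) orthonormal_mem[OF E(1)]]
      by (simp add: mult.commute)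
    also have "\<bar>\<dots>\<bar> \<le> sqrt (\<Sum>e\<in>E. (b w e)\<^sup>2) * sqrt (\<Sum>e\<in>E. (b s e)\<^sup>2)"
      using L2_set_mult_ineq[of "b w" "b s" E] sum_abs[of "\<lambda>e. b w e * b s e" E]
      unfolding L2_set_def by (simp add: abs_mult)
    also have "(\<Sum>e\<in>E. (b s e)\<^sup>2) = b s s"
      using parseval[OF E(1) s(1) sS] sym[OF sS orthonormal_mem[OF E(1)]] by (simp add: power2_eq_square)
    finally show ?thesis .
  qed
  have "b w s / (?n * sqrt (b s s)) \<le> ?r / ?n" "- 1 \<le> b w s / (?n * sqrt (b s s))"
  proof -
    have "?r * sqrt (b s s) \<le> ?n * sqrt (b s s)" using rn ss by (intro mult_right_mono) auto
    then have "- (?n * sqrt (b s s)) \<le> b w s" using CS by linarith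
    then show "- 1 \<le> b w s / (?n * sqrt (b s s))" using ww ss by (simp add: field_simps)
    have "b w s \<le> ?r * sqrt (b s s)" using CS by linarith
    then show "b w s / (?n * sqrt (b s s)) \<le> ?r / ?n" using ww ss by (simp add: field_simps)
  qed
  moreover have "?r / ?n \<le> 1" using rn ww by simp
  ultimately show "arccos (?r / ?n) \<le> x" unfolding x by (intro arccos_le_arccos)
qed

section \<open>Bases of leaves and their images under an immersion\<close>

context factor
begin

lemma leaf_basis: "\<exists>X. finite X \<and> span X = leaf x"
proof -
  obtain X where X: "finite X" "span X = tangent_space B (\<pi> x)" using dim_tangent_space[OF B] by metis
  have "span (differential A (s x) (\<pi> x) ` X) = leaf x"
    unfolding leaf_def X(2)[symmetric] by (rule linear_span_image[OF linear_differential])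
  then show ?thesis using X(1) by blast
qed

lemma leaf_nonzero: "\<exists>v\<in>leaf x. v \<noteq> 0"
proof -
  obtain X where X: "independent X" "card X = DIM('f)" "span X = tangent_space B (\<pi> x)"
    using dim_tangent_space[OF B] by metis
  have "X \<noteq> {}" using X(2) DIM_positive[where 'a='f] by auto
  then obtain u where "u \<in> X" by blast
  then have u: "u \<in> tangent_space B (\<pi> x)" "u \<noteq> 0"
    using X(1,3) span_base dependent_zero by metis+
  let ?v = "differential A (s x) (\<pi> x) u"
  have "?v \<noteq> 0"
    using differential_proj_slice[OF u(1), of x] u(2) linear_0[OF linear_differential] by metis
  moreover have "?v \<in> leaf x" unfolding leaf_def using u(1) by blast
  ultimately show ?thesis by blast
qed

text \<open>This translates hypotheses on the leaves as submanifolds of the ambient space into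
  statements about \<open>leaf x\<close> at a point of the product.\<close>

lemma tangent_image_leaf:
  assumes "smooth_pullback A C \<phi>"
  shows "tangent_image B C (\<phi> \<circ> s x) (\<pi> x) = differential C \<phi> x ` leaf x"
  unfolding tangent_image_def leaf_def image_image differential_comp[OF assms] slice_proj ..

end

section \<open>Bi-warped products in nearly Kaehler manifolds\<close>

text \<open>\<open>second_fundamental_form\<close> hides the connection of the induced metric behind
  an existential quantifier; here it is the parameter \<open>nabB\<close>.\<close>

locale biwarped =
  fixes A0 :: "('a::{t2_space,second_countable_topology}, 'e0::euclidean_space) chart set"
    and A1 :: "('b::{t2_space,second_countable_topology}, 'e1::euclidean_space) chart set"
    and A2 :: "('c::{t2_space,second_countable_topology}, 'e2::euclidean_space) chart set"
    and At :: "('m::{t2_space,second_countable_topology}, 'e::euclidean_space) chart set"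
    and g0 :: "'a metric" and g1 :: "'b metric" and g2 :: "'c metric"
    and f1 f2 :: "'a \<Rightarrow> real"
    and gt :: "'m metric" and J :: "'m \<Rightarrow> 'm tvec \<Rightarrow> 'm tvec" and nabt :: "'m connection"
    and \<phi> :: "'a \<times> 'b \<times> 'c \<Rightarrow> 'm"
    and h :: "'a \<times> 'b \<times> 'c \<Rightarrow> ('a \<times> 'b \<times> 'c) tvec \<Rightarrow> ('a \<times> 'b \<times> 'c) tvec \<Rightarrow> 'm tvec"
    and nabB :: "('a \<times> 'b \<times> 'c) connection"
    and \<theta> :: real
  assumes ambient: "nearly_kaehler At gt J nabt"
    and factors: "riemannian_manifold A0 g0" "riemannian_manifold A1 g1" "riemannian_manifold A2 g2"
    and warping: "warping_function A0 f1" "warping_function A0 f2"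
    and immersion: "isometric_immersion (triple_atlas A0 A1 A2) (biwarped_metric A0 g0 A1 g1 A2 g2 f1 f2) At gt \<phi>"
    and lc_induced: "levi_civita (triple_atlas A0 A1 A2) (pullback_metric At gt \<phi>) nabB"
    and gauss_formula: "\<And>W p u Y. p \<in> W \<Longrightarrow> u \<in> tangent_space (triple_atlas A0 A1 A2) p \<Longrightarrow>
       vector_field_on (triple_atlas A0 A1 A2) W Y \<Longrightarrow>
       has_covariant_derivative_along (triple_atlas A0 A1 A2) At nabt \<phi> p u (\<lambda>q. differential At \<phi> q (Y q))
         (differential At \<phi> p (nabB p u Y) + h p u (Y p))"
    and h_normal_space: "\<And>p u v. u \<in> tangent_space (triple_atlas A0 A1 A2) p \<Longrightarrow>
       v \<in> tangent_space (triple_atlas A0 A1 A2) p \<Longrightarrow> h p u v \<in> normal_space (triple_atlas A0 A1 A2) At gt \<phi> p"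
    and holomorphic: "\<And>b c. holomorphic_submanifold A0 At J (\<phi> \<circ> slice0 b c)"
    and totally_real: "\<And>a c. totally_real_submanifold A1 At gt J (\<phi> \<circ> slice1 a c)"
    and slant: "\<And>a b. proper_slant_submanifold A2 At gt J (\<phi> \<circ> slice2 a b) \<theta>"
begin

abbreviation M where "M \<equiv> triple_atlas A0 A1 A2"
abbreviation gM where "gM \<equiv> biwarped_metric A0 g0 A1 g1 A2 g2 f1 f2"

lemma mfd: "smooth_manifold A0" "smooth_manifold A1" "smooth_manifold A2" "smooth_manifold At"
  using factors ambient unfolding nearly_kaehler_def riemannian_manifold_def by blast+

sublocale F0: factor M A0 proj0 "\<lambda>x. slice0 (proj1 x) (proj2 x)" by (rule factor0[OF mfd(1-3)])
sublocale F1: factor M A1 proj1 "\<lambda>x. slice1 (proj0 x) (proj2 x)" by (rule factor1[OF mfd(1-3)])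
sublocale F2: factor M A2 proj2 "\<lambda>x. slice2 (proj0 x) (proj1 x)" by (rule factor2[OF mfd(1-3)])

lemma mM: "smooth_manifold M" by (rule smooth_manifold_triple[OF mfd(1-3)])

lemma \<phi>_pullback: "smooth_pullback M At \<phi>"
  using smooth_map_imp_pullback[OF mfd(4) mM] immersion unfolding isometric_immersion_def by blast

sublocale nk_immersion M At gt nabt \<phi> J nabB h
proof unfold_locales
  show "inj_on (differential At \<phi> p) (tangent_space M p)" for p
    using immersion unfolding isometric_immersion_def by blast
qed (use mM ambient \<phi>_pullback lc_induced gauss_formula h_normal_space in \<open>auto simp: nearly_kaehler_def\<close>)

lemma isometric: "u \<in> tangent_space M p \<Longrightarrow> v \<in> tangent_space M p \<Longrightarrow> G p u v = gM p u v"
  using immersion unfolding isometric_immersion_def by blast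

section \<open>The three distributions of a bi-warped product\<close>

lemma projections_of_slices:
  "proj0 (slice0 b c a) = a" "proj1 (slice0 b c a) = b" "proj2 (slice0 b c a) = c"
  "proj0 (slice1 a c b) = a" "proj1 (slice1 a c b) = b" "proj2 (slice1 a c b) = c"
  "proj0 (slice2 a b c) = a" "proj1 (slice2 a b c) = b" "proj2 (slice2 a b c) = c"
  by (simp_all add: slice0_def slice1_def slice2_def proj0_def proj1_def proj2_def)

lemma kill:
  "v \<in> F1.leaf p \<Longrightarrow> differential A0 proj0 p v = 0" "v \<in> F2.leaf p \<Longrightarrow> differential A0 proj0 p v = 0"
  "v \<in> F0.leaf p \<Longrightarrow> differential A1 proj1 p v = 0" "v \<in> F2.leaf p \<Longrightarrow> differential A1 proj1 p v = 0"
  "v \<in> F0.leaf p \<Longrightarrow> differential A2 proj2 p v = 0" "v \<in> F1.leaf p \<Longrightarrow> differential A2 proj2 p v = 0"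
  by (erule F0.differential_leaf_const[OF _ F1.proj] F0.differential_leaf_const[OF _ F2.proj]
      F1.differential_leaf_const[OF _ F0.proj] F1.differential_leaf_const[OF _ F2.proj]
      F2.differential_leaf_const[OF _ F0.proj] F2.differential_leaf_const[OF _ F1.proj],
      rule projections_of_slices)+

lemma form_zero:
  assumes "riemannian_manifold C gC" "u \<in> tangent_space C q"
  shows "gC q 0 u = 0" "gC q u 0 = 0"
  using inner_space.zero_left[OF inner_on_tangent[OF assms(1)] assms(2)]
    inner_space.zero_right[OF inner_on_tangent[OF assms(1)] assms(2)] by auto

lemma d_proj_tangent:
  assumes "v \<in> tangent_space M p"
  shows "differential A0 proj0 p v \<in> tangent_space A0 (proj0 p)"
    "differential A1 proj1 p v \<in> tangent_space A1 (proj1 p)"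
    "differential A2 proj2 p v \<in> tangent_space A2 (proj2 p)"
  using differential_tangent[OF mfd(1) mM F0.proj assms] differential_tangent[OF mfd(2) mM F1.proj assms]
    differential_tangent[OF mfd(3) mM F2.proj assms] by auto

lemma gM_expand: "gM p u v = g0 (proj0 p) (differential A0 proj0 p u) (differential A0 proj0 p v)
    + (f1 (proj0 p))\<^sup>2 * g1 (proj1 p) (differential A1 proj1 p u) (differential A1 proj1 p v)
    + (f2 (proj0 p))\<^sup>2 * g2 (proj2 p) (differential A2 proj2 p u) (differential A2 proj2 p v)"
  unfolding biwarped_metric_def pullback_metric_def ..

definition D :: "nat \<Rightarrow> 'a \<times> 'b \<times> 'c \<Rightarrow> ('a \<times> 'b \<times> 'c) tvec set" where
  "D i = (if i = 0 then F0.leaf else if i = 1 then F1.leaf else F2.leaf)"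

definition Lf :: "nat \<Rightarrow> ('a \<times> 'b \<times> 'c) set \<Rightarrow> ('a \<times> 'b \<times> 'c \<Rightarrow> ('a \<times> 'b \<times> 'c) tvec) \<Rightarrow> bool" where
  "Lf i = (if i = 0 then F0.Lift else if i = 1 then F1.Lift else F2.Lift)"

definition bas :: "nat \<Rightarrow> ('a \<times> 'b \<times> 'c) set \<Rightarrow> ('a \<times> 'b \<times> 'c \<Rightarrow> real) \<Rightarrow> bool" where
  "bas i = (if i = 0 then F0.Basic else if i = 1 then F1.Basic else F2.Basic)"

text \<open>The base counts as a factor of weight 1, whose logarithm is 0, so that all three factors
  are treated alike.\<close>

definition w :: "nat \<Rightarrow> 'a \<times> 'b \<times> 'c \<Rightarrow> real" where
  "w i = (\<lambda>p. if i = 0 then 1 else if i = 1 then f1 (proj0 p) else f2 (proj0 p))"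

definition F :: "nat \<Rightarrow> 'a \<times> 'b \<times> 'c \<Rightarrow> real" where "F i = (\<lambda>p. ln (w i p))"

lemma D_simps: "D 0 = F0.leaf" "D 1 = F1.leaf" "D (Suc 0) = F1.leaf" "D 2 = F2.leaf"
  and Lf_simps: "Lf 0 = F0.Lift" "Lf 1 = F1.Lift" "Lf (Suc 0) = F1.Lift" "Lf 2 = F2.Lift"
  and bas_simps: "bas 0 = F0.Basic" "bas 1 = F1.Basic" "bas (Suc 0) = F1.Basic" "bas 2 = F2.Basic"
  by (simp_all add: D_def Lf_def bas_def)

lemma index_cases:
  assumes "(i::nat) < 3" obtains "i = 0" | "i = 1" | "i = 2"
  using assms by linarith

lemma D_mem_tangent: "v \<in> D i p \<Longrightarrow> v \<in> tangent_space M p"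
  unfolding D_def using F0.leaf_tangent[of p] F1.leaf_tangent[of p] F2.leaf_tangent[of p] by (auto split: if_splits)

lemma w_pos: "w i p > 0"
  using warping unfolding warping_function_def w_def by simp

lemma f_smooth: "smooth_fun_on A0 UNIV f1" "smooth_fun_on A0 UNIV f2"
  "smooth_fun_on A0 UNIV (\<lambda>a. ln (f1 a))" "smooth_fun_on A0 UNIV (\<lambda>a. ln (f2 a))"
  using warping smooth_fun_on_compose_real[OF mfd(1) _ smooth_on_ln open_greaterThan, of UNIV f1]
    smooth_fun_on_compose_real[OF mfd(1) _ smooth_on_ln open_greaterThan, of UNIV f2]
  unfolding warping_function_def by auto

lemma w_smooth: "smooth_at M p (w i)" and F_smooth: "smooth_at M p (\<lambda>q. ln (w i q))"
proof -
  have *: "smooth_at M p (\<lambda>q. f (proj0 q))" if "smooth_fun_on A0 UNIV f" for f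
    using smooth_pullback_at[OF F0.proj smooth_atI[OF that]] by simp
  show "smooth_at M p (w i)"
    unfolding w_def using *[OF f_smooth(1)] *[OF f_smooth(2)] smooth_at_const[OF mM]
    by (cases "i = 0"; cases "i = 1") simp_all
  show "smooth_at M p (\<lambda>q. ln (w i q))"
    unfolding w_def using *[OF f_smooth(3)] *[OF f_smooth(4)] smooth_at_const[OF mM]
    by (cases "i = 0"; cases "i = 1") simp_all
qed

lemma F_act_fibre:
  assumes "i < 3" "i \<noteq> 0" and v: "v \<in> D i p"
  shows "v \<cdot> F k = 0"
proof (rule index_cases[OF assms(1)])
  have s: "smooth_at M p (F k)" unfolding F_def by (rule F_smooth)
  show ?thesis if "i = 1"
    by (rule F1.leaf_act_const[OF _ s, where c = "F k p"])
      (use v that in \<open>auto simp: D_simps F_def w_def projections_of_slices\<close>)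
  show ?thesis if "i = 2"
    by (rule F2.leaf_act_const[OF _ s, where c = "F k p"])
      (use v that in \<open>auto simp: D_simps F_def w_def projections_of_slices\<close>)
qed (use assms in simp)

text \<open>A basic function of one factor is constant on the leaves of the others.\<close>

lemma D_annihilates:
  assumes i: "i < 3" and k: "k < 3" "i \<noteq> k" and v: "v \<in> D i p" and f: "bas k W f" "p \<in> W"
  shows "v \<cdot> f = 0"
proof -
  have c0: "\<exists>f0. f = (\<lambda>x. f0 (proj0 x))" if "k = 0" using f(1) that by (auto simp: bas_simps F0.Basic_def)
  have c1: "\<exists>f0. f = (\<lambda>x. f0 (proj1 x))" if "k = 1" using f(1) that by (auto simp: bas_simps F1.Basic_def)
  have c2: "\<exists>f0. f = (\<lambda>x. f0 (proj2 x))" if "k = 2" using f(1) that by (auto simp: bas_simps F2.Basic_def)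
  have s: "smooth_at M p f"
    using f F0.Basic_smooth[of W f] F1.Basic_smooth[of W f] F2.Basic_smooth[of W f] smooth_atI[of M W f p]
    unfolding bas_def by (auto split: if_splits)
  have k3: "k = 0 \<or> k = 1 \<or> k = 2" using k(1) by linarith
  show ?thesis
  proof (rule index_cases[OF i])
    show ?thesis if "i = 0"
      by (rule F0.leaf_act_const[OF _ s, where c = "f p"])
        (use v that k c1 c2 k3 in \<open>auto simp: D_simps projections_of_slices\<close>)
    show ?thesis if "i = 1"
      by (rule F1.leaf_act_const[OF _ s, where c = "f p"])
        (use v that k c0 c2 k3 in \<open>auto simp: D_simps projections_of_slices\<close>)
    show ?thesis if "i = 2"
      by (rule F2.leaf_act_const[OF _ s, where c = "f p"])
        (use v that k c0 c1 k3 in \<open>auto simp: D_simps projections_of_slices\<close>)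
  qed
qed

lemma split_leaf:
  assumes "v \<in> tangent_space M p"
  shows "v = differential M (slice0 (proj1 p) (proj2 p)) (proj0 p) (differential A0 proj0 p v)
     + differential M (slice1 (proj0 p) (proj2 p)) (proj1 p) (differential A1 proj1 p v)
     + differential M (slice2 (proj0 p) (proj1 p)) (proj2 p) (differential A2 proj2 p v)"
  by (rule tangent_triple_split[OF mfd(1-3) assms])

lemma leaf_images:
  assumes v: "v \<in> tangent_space M p"
  shows "differential M (slice0 (proj1 p) (proj2 p)) (proj0 p) (differential A0 proj0 p v) \<in> F0.leaf p"
    "differential M (slice1 (proj0 p) (proj2 p)) (proj1 p) (differential A1 proj1 p v) \<in> F1.leaf p"
    "differential M (slice2 (proj0 p) (proj1 p)) (proj2 p) (differential A2 proj2 p v) \<in> F2.leaf p"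
  unfolding F0.leaf_def F1.leaf_def F2.leaf_def using d_proj_tangent[OF v] by auto

lemma G_on_D:
  assumes y: "y \<in> D i p" and z: "z \<in> D i p"
  shows "i = 0 \<Longrightarrow> G p y z = (w i p)\<^sup>2 * g0 (proj0 p) (differential A0 proj0 p y) (differential A0 proj0 p z)"
    "i = 1 \<Longrightarrow> G p y z = (w i p)\<^sup>2 * g1 (proj1 p) (differential A1 proj1 p y) (differential A1 proj1 p z)"
    "i = 2 \<Longrightarrow> G p y z = (w i p)\<^sup>2 * g2 (proj2 p) (differential A2 proj2 p y) (differential A2 proj2 p z)"
proof -
  note t = D_mem_tangent[OF y] D_mem_tangent[OF z]
  note 0 = form_zero[OF factors(1) d_proj_tangent(1)[OF t(2)]] form_zero[OF factors(2) d_proj_tangent(2)[OF t(2)]]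
    form_zero[OF factors(3) d_proj_tangent(3)[OF t(2)]]
  show "i = 0 \<Longrightarrow> G p y z = (w i p)\<^sup>2 * g0 (proj0 p) (differential A0 proj0 p y) (differential A0 proj0 p z)"
    using y 0 kill(3,5)[of y p] unfolding isometric[OF t] gM_expand by (simp add: w_def D_simps)
  show "i = 1 \<Longrightarrow> G p y z = (w i p)\<^sup>2 * g1 (proj1 p) (differential A1 proj1 p y) (differential A1 proj1 p z)"
    using y 0 kill(1,6)[of y p] unfolding isometric[OF t] gM_expand by (simp add: w_def D_simps)
  show "i = 2 \<Longrightarrow> G p y z = (w i p)\<^sup>2 * g2 (proj2 p) (differential A2 proj2 p y) (differential A2 proj2 p z)"
    using y 0 kill(2,4)[of y p] unfolding isometric[OF t] gM_expand by (simp add: w_def D_simps)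
qed

lemma D_orthogonal:
  assumes i: "i < 3" and j: "j < 3" and ij: "i \<noteq> j" and u: "u \<in> D i p" and v: "v \<in> D j p"
  shows "G p u v = 0"
proof -
  note t = D_mem_tangent[OF u] D_mem_tangent[OF v]
  note 0 = form_zero[OF factors(1) d_proj_tangent(1)[OF t(1)]] form_zero[OF factors(2) d_proj_tangent(2)[OF t(1)]]
    form_zero[OF factors(3) d_proj_tangent(3)[OF t(1)]]
    form_zero[OF factors(1) d_proj_tangent(1)[OF t(2)]] form_zero[OF factors(2) d_proj_tangent(2)[OF t(2)]]
    form_zero[OF factors(3) d_proj_tangent(3)[OF t(2)]]
  show ?thesis
    unfolding isometric[OF t] gM_expand
    by (rule index_cases[OF i]; rule index_cases[OF j])
      (use ij u v kill[of u p] kill[of v p] 0 in \<open>auto simp: D_simps\<close>)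
qed

sublocale warped_split M G nabB D Lf bas F
proof
  show "smooth_manifold M" by (rule mM)
  show "levi_civita M G nabB" by (rule lcB)
  show "subspace (D i p)" for i p
    unfolding D_def using F0.subspace_leaf F1.subspace_leaf F2.subspace_leaf by simp
  show "v \<in> tangent_space M p" if "v \<in> D i p" for i p v by (rule D_mem_tangent[OF that])
  show "\<exists>v0\<in>D 0 p. \<exists>v1\<in>D 1 p. \<exists>v2\<in>D 2 p. v = v0 + v1 + v2" if "v \<in> tangent_space M p" for p v
    unfolding D_simps using split_leaf[OF that] leaf_images[OF that] by blast
  show "G p u v = 0" if "i < 3" "j < 3" "i \<noteq> j" "u \<in> D i p" "v \<in> D j p" for i j p u v
    by (rule D_orthogonal[OF that])
  show "v \<in> D i p" if i: "i < 3" and v: "v \<in> tangent_space M p"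
    and 0: "\<And>k W f. k < 3 \<Longrightarrow> k \<noteq> i \<Longrightarrow> bas k W f \<Longrightarrow> p \<in> W \<Longrightarrow> v \<cdot> f = 0" for i p v
  proof -
    \<comment> \<open>A vector that annihilates all functions of a factor projects to 0 there; the
      splitting of \<open>v\<close> then leaves only its \<open>i\<close>-th component.\<close>
    have z: "differential A0 proj0 p v = 0" if "i \<noteq> 0"
      by (rule F0.differential_proj_eq_0) (use 0[of 0] that in \<open>simp add: bas_simps\<close>)
    have z1: "differential A1 proj1 p v = 0" if "i \<noteq> 1"
      by (rule F1.differential_proj_eq_0) (use 0[of 1] that in \<open>simp add: bas_simps\<close>)
    have z2: "differential A2 proj2 p v = 0" if "i \<noteq> 2"
      by (rule F2.differential_proj_eq_0) (use 0[of 2] that in \<open>simp add: bas_simps\<close>)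
    note l0 = linear_0[OF linear_differential[of M "slice0 (proj1 p) (proj2 p)" "proj0 p"]]
      linear_0[OF linear_differential[of M "slice1 (proj0 p) (proj2 p)" "proj1 p"]]
      linear_0[OF linear_differential[of M "slice2 (proj0 p) (proj1 p)" "proj2 p"]]
    show ?thesis
    proof (rule index_cases[OF i])
      show ?thesis if "i = 0"
        using split_leaf[OF v] leaf_images(1)[OF v] z1 z2 that unfolding D_simps by (simp add: l0 D_simps)
      show ?thesis if "i = 1"
        using split_leaf[OF v] leaf_images(2)[OF v] z z2 that unfolding D_simps by (simp add: l0 D_simps)
      show ?thesis if "i = 2"
        using split_leaf[OF v] leaf_images(3)[OF v] z z1 that unfolding D_simps by (simp add: l0 D_simps)
    qed
  qed
  show "smooth_fun_on M W f" if "bas k W f" for k W f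
    using that F0.Basic_smooth F1.Basic_smooth F2.Basic_smooth unfolding bas_def by (auto split: if_splits)
  show "v \<cdot> f = 0" if "i < 3" "k < 3" "i \<noteq> k" "v \<in> D i p" "bas k W f" "p \<in> W" for i k p v W f
    by (rule D_annihilates[OF that])
  show "vector_field_on M W X" if "Lf i W X" for i W X
    using that F0.Lift_field F1.Lift_field F2.Lift_field unfolding Lf_def by (auto split: if_splits)
  show "X q \<in> D i q" if "Lf i W X" "q \<in> W" for i W X q
    using that F0.Lift_leaf F1.Lift_leaf F2.Lift_leaf unfolding Lf_def D_def by (auto split: if_splits)
  show "\<exists>W'' f'. bas i W'' f' \<and> W \<inter> W' \<subseteq> W'' \<and> (\<forall>q\<in>W \<inter> W'. X q \<cdot> f = f' q)"
    if "Lf i W X" "bas i W' f" for i W X W' f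
    using that F0.Lift_Basic[of W X W' f] F1.Lift_Basic[of W X W' f] F2.Lift_Basic[of W X W' f]
    unfolding Lf_def bas_def by (simp split: if_splits)
  show "Lf i W' X" if "Lf i W X" "open W'" "W' \<subseteq> W" for i W X W'
    using that F0.Lift_subset F1.Lift_subset F2.Lift_subset unfolding Lf_def by (simp split: if_splits)
  show "\<exists>W X. p \<in> W \<and> Lf i W X \<and> X p = v" if "v \<in> D i p" for i p v
    using that F0.Lift_extends[of v p] F1.Lift_extends[of v p] F2.Lift_extends[of v p]
    unfolding Lf_def D_def by (simp split: if_splits)
  show "F 0 p = 0" for p by (simp add: F_def w_def)
  show "v \<cdot> F k = 0" if "i < 3" "k < 3" "i \<noteq> 0" "v \<in> D i p" for i k p v
    by (rule F_act_fibre[OF that(1,3,4)])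
  show "v \<cdot> (\<lambda>q. G q (Y q) (Z q)) = 2 * (v \<cdot> F i) * G p (Y p) (Z p)"
    if i: "i < 3" and j: "j < 3" "i \<noteq> j" and Y: "Lf i W Y" and Z: "Lf i W Z" and p: "p \<in> W" and v: "v \<in> D j p"
    for i j W Y Z p v
  proof -
    note vt = D_mem_tangent[OF v]
    have v0: "v \<cdot> f = 0" if "bas i W f" "p \<in> W" for W f
      by (rule D_annihilates[OF j(1) i j(2)[symmetric] v that])
    show ?thesis
      unfolding F_def
    proof (rule index_cases[OF i])
      show "v \<cdot> (\<lambda>q. G q (Y q) (Z q)) = 2 * (v \<cdot> (\<lambda>q. ln (w i q))) * G p (Y p) (Z p)" if i: "i = 0"
        by (rule F0.warped_metric_deriv[OF factors(1) G_on_D(1) w_pos w_smooth F_smooth _ _ p vt])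
          (use i Y Z v0 in \<open>auto simp: D_simps Lf_simps bas_simps\<close>)
      show "v \<cdot> (\<lambda>q. G q (Y q) (Z q)) = 2 * (v \<cdot> (\<lambda>q. ln (w i q))) * G p (Y p) (Z p)" if i: "i = 1"
        by (rule F1.warped_metric_deriv[OF factors(2) G_on_D(2) w_pos w_smooth F_smooth _ _ p vt])
          (use i Y Z v0 in \<open>auto simp: D_simps Lf_simps bas_simps\<close>)
      show "v \<cdot> (\<lambda>q. G q (Y q) (Z q)) = 2 * (v \<cdot> (\<lambda>q. ln (w i q))) * G p (Y p) (Z p)" if i: "i = 2"
        by (rule F2.warped_metric_deriv[OF factors(3) G_on_D(3) w_pos w_smooth F_smooth _ _ p vt])
          (use i Y Z v0 in \<open>auto simp: D_simps Lf_simps bas_simps\<close>)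
    qed
  qed
qed

end

context biwarped
begin

section \<open>Holomorphic, totally real and slant leaves\<close>

sublocale nk_warped M At gt nabt \<phi> J nabB h D Lf bas F
proof unfold_locales
  fix p x assume x: "x \<in> D 0 p"
  let ?I = "tangent_image A0 At (\<phi> \<circ> slice0 (proj1 p) (proj2 p)) (proj0 p)"
  have I: "?I = d p ` D 0 p"
    unfolding D_simps by (rule F0.tangent_image_leaf[OF \<phi>_pullback])
  have "J ((\<phi> \<circ> slice0 (proj1 p) (proj2 p)) (proj0 p)) ` ?I = ?I"
    using holomorphic[of "proj1 p" "proj2 p"] unfolding holomorphic_submanifold_def by blast
  moreover have "(\<phi> \<circ> slice0 (proj1 p) (proj2 p)) (proj0 p) = \<phi> p"
    unfolding comp_def F0.slice_proj ..
  ultimately have "J (\<phi> p) ` d p ` D 0 p = d p ` D 0 p" unfolding I by simp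
  then have "J (\<phi> p) (d p x) \<in> d p ` D 0 p" using x by blast
  then show "\<exists>z\<in>D 0 p. d p z = J (\<phi> p) (d p x)" by (metis imageE)
next
  show "\<exists>X. finite X \<and> span X = D 0 p" for p unfolding D_simps by (rule F0.leaf_basis)
qed

lemma \<omega>_D1:
  assumes u: "u \<in> D 1 p" and v: "v \<in> D 1 p"
  shows "\<omega> p u v = 0"
proof -
  let ?\<psi> = "\<phi> \<circ> slice1 (proj0 p) (proj2 p)"
  have I: "tangent_image A1 At ?\<psi> (proj1 p) = d p ` D 1 p"
    unfolding D_simps by (rule F1.tangent_image_leaf[OF \<phi>_pullback])
  have \<psi>: "?\<psi> (proj1 p) = \<phi> p" unfolding comp_def F1.slice_proj ..
  have "J (\<phi> p) (d p u) \<in> normal_space A1 At gt ?\<psi> (proj1 p)"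
    using totally_real[of "proj0 p" "proj2 p"] u I \<psi> unfolding totally_real_submanifold_def by fastforce
  moreover obtain v' where "v' \<in> tangent_space A1 (proj1 p)" "d p v = differential At ?\<psi> (proj1 p) v'"
    using v I unfolding tangent_image_def by blast
  ultimately show ?thesis using \<psi> unfolding normal_space_def by auto
qed

lemma d_orthonormal:
  assumes E: "on p E"
  shows "inner_space.orthonormal (tangent_space At (\<phi> p)) (gt (\<phi> p)) (d p ` E)" "inj_on (d p) E"
proof -
  note Et = G.orthonormal_mem[OF E]
  show inj_E: "inj_on (d p) E" using inj Et by (meson inj_on_subset subsetI)
  show "inner_space.orthonormal (tangent_space At (\<phi> p)) (gt (\<phi> p)) (d p ` E)"
    unfolding T.orthonormal_def
    using G.orthonormal_finite[OF E] G.orthonormal_inner[OF E] d_tangent[OF Et] inj_onD[OF inj_E]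
    unfolding G_eq by auto
qed

text \<open>The sum is the squared length of the projection of \<open>J x\<close> on the tangent
  space of the leaf, so its ratio to \<open>G p x x\<close> is the squared cosine of the slant
  angle.\<close>

lemma slant_norm:
  assumes E: "on p E" "span E = D 2 p" and x: "x \<in> D 2 p"
  shows "(\<Sum>e\<in>E. (\<omega> p x e)\<^sup>2) = (cos \<theta>)\<^sup>2 * G p x x"
proof (cases "x = 0")
  case True
  have "J (\<phi> p) (d p 0) = 0"
    using J_scale[OF T.mem_zero, of "\<phi> p" 0] by (simp add: linear_0[OF linear_differential])
  moreover have "gt (\<phi> p) 0 (d p e) = 0" if "e \<in> E" for e
    by (rule T.zero_left[OF d_tangent[OF G.orthonormal_mem[OF E(1) that]]])
  ultimately show ?thesis using True by simp
next
  case False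
  let ?\<psi> = "\<phi> \<circ> slice2 (proj0 p) (proj1 p)"
  define y where "y = J (\<phi> p) (d p x)"
  note xt = D_mem_tangent[OF x]
  have y: "y \<in> tangent_space At (\<phi> p)" unfolding y_def by (rule J_tangent[OF d_tangent[OF xt]])
  have yy: "gt (\<phi> p) y y = G p x x" unfolding y_def G_eq by (rule hermitian[OF d_tangent[OF xt] d_tangent[OF xt]])
  have Gx: "G p x x > 0" by (rule G.pos[OF xt False])
  have y0: "y \<noteq> 0" using yy Gx T.zero_left[OF T.mem_zero] by force
  have dx: "d p x \<noteq> 0" using Gx T.zero_left[OF T.mem_zero] unfolding G_eq by force
  have I: "tangent_image A2 At ?\<psi> (proj2 p) = d p ` D 2 p"
    unfolding D_simps by (rule F2.tangent_image_leaf[OF \<phi>_pullback])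
  have \<psi>: "?\<psi> (proj2 p) = \<phi> p" unfolding comp_def F2.slice_proj ..
  note E' = d_orthonormal[OF E(1)]
  have spanE': "span (d p ` E) = d p ` D 2 p"
    unfolding E(2)[symmetric] by (rule linear_span_image[OF linear_differential])
  have "E \<noteq> {}" using x False E(2) by auto
  then have "d p ` E \<noteq> {}" by simp
  define t where "t = sqrt (\<Sum>e\<in>d p ` E. (gt (\<phi> p) y e)\<^sup>2) / sqrt (gt (\<phi> p) y y)"
  have s: "(\<Sum>e\<in>d p ` E. (gt (\<phi> p) y e)\<^sup>2) = (\<Sum>e\<in>E. (\<omega> p x e)\<^sup>2)"
    unfolding y_def by (simp add: sum.reindex[OF E'(2)])
  have "angle_to_subspace gt (\<phi> p) y (d p ` D 2 p) = \<theta>"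
    using slant[of "proj0 p" "proj1 p"] x dx I \<psi>
    unfolding proper_slant_submanifold_def slant_submanifold_def y_def by (metis imageI)
  then have "\<theta> = arccos t"
    unfolding angle_to_subspace_def spanE'[symmetric] t_def
    using T.angle_to_span[OF E'(1) \<open>d p ` E \<noteq> {}\<close> y y0] by simp
  moreover have "0 \<le> t" unfolding t_def by (intro divide_nonneg_nonneg) (simp_all add: sum_nonneg T.nonneg[OF y])
  moreover have "t \<le> 1"
    unfolding t_def using T.bessel[OF E'(1) y] yy Gx by simp
  \<comment> \<open>\<open>cos (arccos t) = t\<close> holds only for \<open>t\<close> between -1 and
    1, hence the bounds just obtained.\<close>
  ultimately have "cos \<theta> = t" by simp
  then have "(cos \<theta>)\<^sup>2 = (\<Sum>e\<in>E. (\<omega> p x e)\<^sup>2) / G p x x"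
    unfolding t_def s yy using Gx by (simp add: power_divide sum_nonneg)
  then show ?thesis using Gx by simp
qed

lemma D_basis:
  assumes i: "i < 3"
  shows "\<exists>E. on p E \<and> span E = D i p"
proof -
  have "\<exists>X. finite X \<and> span X = D i p"
    by (rule index_cases[OF i])
      (use F0.leaf_basis[of p] F1.leaf_basis[of p] F2.leaf_basis[of p] in \<open>simp_all add: D_simps\<close>)
  then obtain X where X: "finite X" "span X = D i p" by (elim exE conjE)
  have "x \<in> tangent_space M p" if "x \<in> X" for x
    using D_mem_tangent[of x i p] span_base[OF that] X(2) by simp
  then have "X \<subseteq> tangent_space M p" by (rule subsetI)
  from G.gram_schmidt[OF X(1) this] show ?thesis unfolding X(2) .
qed

text \<open>A squared cosine equal to 1 would make \<open>J x\<close> equal to its projection on the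
  leaf, so the leaves would be holomorphic. The strict bound makes \<open>1 - c\<close> a legitimate
  divisor.\<close>

lemma slant_angle_less: "(cos \<theta>)\<^sup>2 < 1"
proof (rule ccontr)
  assume "\<not> (cos \<theta>)\<^sup>2 < 1"
  moreover have "(cos \<theta>)\<^sup>2 \<le> 1" using sin_cos_squared_add[of \<theta>] zero_le_power2[of "sin \<theta>"] by linarith
  ultimately have 1: "(cos \<theta>)\<^sup>2 = 1" by simp
  have sub: "J (\<phi> p) (d p x) \<in> d p ` D 2 p" if x: "x \<in> D 2 p" for p x
  proof -
    obtain E where E: "on p E" "span E = D 2 p" using D_basis[of 2 p] by auto
    note E' = d_orthonormal[OF E(1)] and xt = D_mem_tangent[OF x]
    define y where "y = J (\<phi> p) (d p x)"
    have y: "y \<in> tangent_space At (\<phi> p)" unfolding y_def by (rule J_tangent[OF d_tangent[OF xt]])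
    have yy: "gt (\<phi> p) y y = G p x x" unfolding y_def G_eq by (rule hermitian[OF d_tangent[OF xt] d_tangent[OF xt]])
    let ?s = "\<Sum>e\<in>d p ` E. gt (\<phi> p) y e *\<^sub>R e"
    have s: "?s \<in> span (d p ` E)" by (intro span_sum span_scale span_base)
    also have "span (d p ` E) = d p ` D 2 p"
      unfolding E(2)[symmetric] by (rule linear_span_image[OF linear_differential])
    finally have s: "?s \<in> d p ` D 2 p" .
    have "d p ` D 2 p \<subseteq> tangent_space At (\<phi> p)" by (rule image_subsetI) (rule d_tangent[OF D_mem_tangent])
    from subsetD[OF this s] have st: "?s \<in> tangent_space At (\<phi> p)" .
    have "(\<Sum>e\<in>d p ` E. (gt (\<phi> p) y e)\<^sup>2) = G p x x"
      using slant_norm[OF E x] unfolding 1 y_def by (simp add: sum.reindex[OF E'(2)])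
    then have "gt (\<phi> p) (y - ?s) (y - ?s) = 0"
      using T.projection_norm[OF E'(1) y] yy by simp
    then have "y = ?s" using T.eq_0_iff[OF T.mem_diff[OF y st]] by simp
    then show ?thesis using s unfolding y_def by simp
  qed
  have "holomorphic_submanifold A2 At J (\<phi> \<circ> slice2 a b)" for a b
    unfolding holomorphic_submanifold_def
  proof
    fix c :: 'c
    let ?p = "(a, b, c)"
    have pr: "proj0 ?p = a" "proj1 ?p = b" "proj2 ?p = c" by (simp_all add: proj0_def proj1_def proj2_def)
    have I: "tangent_image A2 At (\<phi> \<circ> slice2 a b) c = d ?p ` D 2 ?p"
      using F2.tangent_image_leaf[OF \<phi>_pullback, of ?p] unfolding pr D_simps .
    have \<psi>: "(\<phi> \<circ> slice2 a b) c = \<phi> ?p" by (simp add: slice2_def)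
    \<comment> \<open>\<open>holomorphic_submanifold\<close> asks for equality of the two spaces;
      \<open>y = J (- J y)\<close> gives this inclusion.\<close>
    have "d ?p ` D 2 ?p \<subseteq> J (\<phi> ?p) ` d ?p ` D 2 ?p"
    proof
      fix y assume y: "y \<in> d ?p ` D 2 ?p"
      then obtain x where x: "x \<in> D 2 ?p" "y = d ?p x" by blast
      have t: "d ?p x \<in> tangent_space At (\<phi> ?p)" by (rule d_tangent[OF D_mem_tangent[OF x(1)]])
      obtain z where z: "z \<in> D 2 ?p" "J (\<phi> ?p) (d ?p x) = d ?p z" using sub[OF x(1)] by blast
      have "J (\<phi> ?p) (d ?p (- z)) = - J (\<phi> ?p) (d ?p z)"
        using J_scale[OF d_tangent[OF D_mem_tangent[OF z(1)]], of "- 1"] linear_neg[OF linear_differential[of At \<phi> ?p]]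
        by simp
      also have "\<dots> = y" unfolding z(2)[symmetric] J_J[OF t] x(2) by simp
      finally have "y = J (\<phi> ?p) (d ?p (- z))" by simp
      moreover have "- z \<in> D 2 ?p" by (rule subspace_neg[OF D_subspace z(1)]) simp
      ultimately show "y \<in> J (\<phi> ?p) ` d ?p ` D 2 ?p" by blast
    qed
    moreover have "J (\<phi> ?p) ` d ?p ` D 2 ?p \<subseteq> d ?p ` D 2 ?p" using sub by blast
    ultimately show "J ((\<phi> \<circ> slice2 a b) c) ` tangent_image A2 At (\<phi> \<circ> slice2 a b) c
        = tangent_image A2 At (\<phi> \<circ> slice2 a b) c"
      unfolding I \<psi> by blast
  qed
  then show False using slant unfolding proper_slant_submanifold_def by blast
qed

text \<open>Polarization of \<open>slant_norm\<close>; for distinct basis vectors it says that the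
  rows of \<omega> are orthogonal.\<close>

lemma slant_sum:
  assumes E: "on p E" "span E = D 2 p" and u: "u \<in> E" and v: "v \<in> E"
  shows "(\<Sum>e\<in>E. \<omega> p u e * \<omega> p v e) = (if u = v then (cos \<theta>)\<^sup>2 else 0)"
proof -
  have uD: "u \<in> D 2 p" "v \<in> D 2 p" using E(2) span_base u v by metis+
  have s: "u + v \<in> D 2 p" by (rule subspace_add[OF D_subspace uD]) simp
  note ut = D_mem_tangent[OF uD(1)] and vt = D_mem_tangent[OF uD(2)]
  have "\<omega> p (u + v) e = \<omega> p u e + \<omega> p v e" if "e \<in> E" for e
    using d_tangent[OF ut] d_tangent[OF vt] d_tangent[OF G.orthonormal_mem[OF E(1) that]]
    by (simp add: d_add J_add T.add_left J_tangent)
  then have "(\<Sum>e\<in>E. (\<omega> p (u + v) e)\<^sup>2)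
      = (\<Sum>e\<in>E. (\<omega> p u e)\<^sup>2 + (\<omega> p v e)\<^sup>2 + 2 * (\<omega> p u e * \<omega> p v e))"
    by (intro sum.cong refl) (simp add: power2_sum)
  then have "(cos \<theta>)\<^sup>2 * G p (u + v) (u + v) = (cos \<theta>)\<^sup>2 * G p u u + (cos \<theta>)\<^sup>2 * G p v v
      + 2 * (\<Sum>e\<in>E. \<omega> p u e * \<omega> p v e)"
    unfolding slant_norm[OF E s] sum.distrib slant_norm[OF E uD(1)] slant_norm[OF E uD(2)] sum_distrib_left .
  moreover have "G p (u + v) (u + v) = G p u u + G p v v + 2 * G p u v"
    using ut vt by (simp add: G.add_left G.add_right G.mem_add G.sym[OF vt ut])
  ultimately have "(\<Sum>e\<in>E. \<omega> p u e * \<omega> p v e) = (cos \<theta>)\<^sup>2 * G p u v" by (simp add: algebra_simps)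
  then show ?thesis using G.orthonormal_inner[OF E(1) u v] by simp
qed

section \<open>The two fibres and the final bound\<close>

lemma fibre_data_1: "fibre_data 1 0 DIM('e1) p"
proof -
  interpret warped_fibre M At gt nabt \<phi> J nabB h D Lf bas F A1 proj1 "\<lambda>x. slice1 (proj0 x) (proj2 x)"
    A0 proj0 "\<lambda>x. slice0 (proj1 x) (proj2 x)" 1 g1 "w 1" 0
  proof unfold_locales
    show "G q y z = (w 1 q)\<^sup>2 * g1 (proj1 q) (differential A1 proj1 q y) (differential A1 proj1 q z)"
      if "y \<in> D 1 q" "z \<in> D 1 q" for q y z
      by (rule G_on_D(2)[OF that refl])
    fix q E u v assume E: "on q E" "span E = D 1 q" and uv: "u \<in> E" "v \<in> E"
    have "e \<in> D 1 q" if "e \<in> E" for e using span_base[OF that] E(2) by simp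
    then show "(\<Sum>e\<in>E. \<omega> q u e * \<omega> q v e) = (if u = v then 0 else 0)"
      using \<omega>_D1 uv by simp
  qed (auto simp: D_simps Lf_simps F_def w_pos w_smooth F_smooth factors projections_of_slices)
  show ?thesis by (rule fibre_data)
qed

lemma fibre_data_2: "fibre_data 2 ((cos \<theta>)\<^sup>2) DIM('e2) p"
proof -
  interpret warped_fibre M At gt nabt \<phi> J nabB h D Lf bas F A2 proj2 "\<lambda>x. slice2 (proj0 x) (proj1 x)"
    A0 proj0 "\<lambda>x. slice0 (proj1 x) (proj2 x)" 2 g2 "w 2" "(cos \<theta>)\<^sup>2"
  proof unfold_locales
    show "G q y z = (w 2 q)\<^sup>2 * g2 (proj2 q) (differential A2 proj2 q y) (differential A2 proj2 q z)"
      if "y \<in> D 2 q" "z \<in> D 2 q" for q y z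
      by (rule G_on_D(3)[OF that refl])
    show "(\<Sum>e\<in>E. \<omega> q u e * \<omega> q v e) = (if u = v then (cos \<theta>)\<^sup>2 else 0)"
      if "on q E" "span E = D 2 q" "u \<in> E" "v \<in> E" for q E u v
      by (rule slant_sum[OF that])
  qed (auto simp: D_simps Lf_simps F_def w_pos w_smooth F_smooth factors projections_of_slices)
  show ?thesis by (rule fibre_data)
qed

text \<open>The inequality is stated with the product metric \<open>gM\<close>, while the argument
  runs with the induced metric \<open>G\<close>; they agree on tangent vectors.\<close>

lemma orthonormal_basis_iff: "orthonormal_basis M gM p E \<longleftrightarrow> on p E \<and> span E = tangent_space M p"
proof -
  have "gM p u v = G p u v" if "span E = tangent_space M p" "u \<in> E" "v \<in> E" for u v
    using isometric[of u p v] span_base that by metis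
  moreover have "E \<subseteq> tangent_space M p" if "span E = tangent_space M p" using that span_superset by metis
  ultimately show ?thesis unfolding orthonormal_basis_def G.orthonormal_def by auto
qed

lemma orthonormal_basis_exists: "\<exists>E. orthonormal_basis M gM p E"
proof -
  obtain X where X: "finite X" "span X = tangent_space M p" using dim_tangent_space[OF mM] by metis
  have "X \<subseteq> tangent_space M p" using X(2) span_superset by blast
  then show ?thesis unfolding orthonormal_basis_iff using G.gram_schmidt[OF X(1), of p] X(2) by metis
qed

lemma grad_norm_sq_eq:
  assumes E: "on p E" "span E = tangent_space M p"
  shows "grad_norm_sq M gM f p = (\<Sum>e\<in>E. (e \<cdot> f)\<^sup>2)"
proof -
  let ?w = "\<Sum>e\<in>E. (e \<cdot> f) *\<^sub>R e"
  note gr = gradient_expansion[OF E, where f = f]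
  note Et = G.orthonormal_mem[OF E(1)]
  have "gradient M gM f p = ?w"
    unfolding gradient_def
  proof (rule the_equality)
    show "?w \<in> tangent_space M p \<and> (\<forall>v\<in>tangent_space M p. gM p ?w v = v \<cdot> f)"
      using gr isometric[OF gr(1)] by simp
    fix y assume y: "y \<in> tangent_space M p \<and> (\<forall>v\<in>tangent_space M p. gM p y v = v \<cdot> f)"
    show "y = ?w"
      by (rule G.eqI) (use y gr isometric[where p = p] in auto)
  qed
  then have "grad_norm_sq M gM f p = G p ?w ?w" unfolding grad_norm_sq_def using isometric[OF gr(1) gr(1)] by simp
  also have "\<dots> = ?w \<cdot> f" by (rule gr(2)[OF gr(1)])
  also have "\<dots> = (\<Sum>e\<in>E. (e \<cdot> f)\<^sup>2)" by (simp add: act_sum power2_eq_square)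
  finally show ?thesis .
qed

abbreviation RHS where
  "RHS x \<equiv> 2 * real DIM('e1) * grad_norm_sq M gM (\<lambda>y. ln (f1 (proj0 y))) x
     + 4 * (real DIM('e2) / 2) * (1 + 10 / 9 * (cot \<theta>)\<^sup>2) * grad_norm_sq M gM (\<lambda>y. ln (f2 (proj0 y))) x"

lemma norm_sq_sff_bound:
  shows "norm_sq_sff M gM gt \<phi> h x \<ge> RHS x"
    and "norm_sq_sff M gM gt \<phi> h x = RHS x \<Longrightarrow> i < 3 \<Longrightarrow> u \<in> D i x \<Longrightarrow> v \<in> D i x \<Longrightarrow> h x u v = 0"
proof -
  define E where "E = (SOME E. orthonormal_basis M gM x E)"
  have "orthonormal_basis M gM x E" unfolding E_def by (rule someI_ex[OF orthonormal_basis_exists])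
  then have E: "on x E" "span E = tangent_space M x" unfolding orthonormal_basis_iff by auto
  have N: "norm_sq_sff M gM gt \<phi> h x = (\<Sum>u\<in>E. \<Sum>v\<in>E. gt (\<phi> x) (h x u v) (h x u v))"
    unfolding norm_sq_sff_def E_def Let_def ..
  have F: "F 1 = (\<lambda>y. ln (f1 (proj0 y)))" "F 2 = (\<lambda>y. ln (f2 (proj0 y)))"
    unfolding F_def w_def by auto
  have cot: "(cot \<theta>)\<^sup>2 = (cos \<theta>)\<^sup>2 / (1 - (cos \<theta>)\<^sup>2)"
    unfolding cot_def power_divide sin_squared_eq ..
  \<comment> \<open>The coefficient \<open>4 q\<close> is twice the dimension of the slant
    fibre.\<close>
  have R: "RHS x = 2 * real DIM('e1) * (\<Sum>e\<in>E. (e \<cdot> F 1)\<^sup>2)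
      + 2 * real DIM('e2) * (1 + 10 / 9 * ((cos \<theta>)\<^sup>2 / (1 - (cos \<theta>)\<^sup>2))) * (\<Sum>e\<in>E. (e \<cdot> F 2)\<^sup>2)"
    unfolding F grad_norm_sq_eq[OF E] cot by simp
  note * = second_form_bound[OF slant_angle_less fibre_data_1 fibre_data_2 E]
  show "RHS x \<le> norm_sq_sff M gM gt \<phi> h x" unfolding N R by (rule *(1))
  show "norm_sq_sff M gM gt \<phi> h x = RHS x \<Longrightarrow> i < 3 \<Longrightarrow> u \<in> D i x \<Longrightarrow> v \<in> D i x \<Longrightarrow> h x u v = 0"
    unfolding N R by (rule *(2))
qed

section \<open>The equality case\<close>

context
  assumes eq: "\<And>x. norm_sq_sff M gM gt \<phi> h x = RHS x"
begin

lemma h_D: "i < 3 \<Longrightarrow> u \<in> D i x \<Longrightarrow> v \<in> D i x \<Longrightarrow> h x u v = 0"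
  by (rule norm_sq_sff_bound(2)[OF eq])

lemma leaf0_totally_geodesic: "totally_geodesic A0 At gt nabt (\<phi> \<circ> slice0 b c)"
proof -
  \<comment> \<open>The first coordinate of the base point does not enter the slice, so any value
    serves.\<close>
  interpret warped_leaf M At gt nabt \<phi> J nabB h D Lf bas F A0 proj0 "\<lambda>x. slice0 (proj1 x) (proj2 x)"
    0 "(undefined, b, c)"
  proof unfold_locales
    show "differential A0 proj0 p v = 0" if "j < 3" "j \<noteq> 0" "v \<in> D j p" for j p v
      using that kill[of v p] by (elim index_cases) (simp_all add: D_simps)
    show "h p u v = 0" if "u \<in> D 0 p" "v \<in> D 0 p" for p u v by (rule h_D[OF _ that]) simp
  qed (auto simp: D_simps Lf_simps F0.Lift_lift)
  show ?thesis using leaf_totally_geodesic by (simp add: proj1_def proj2_def)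
qed

lemma leaf1_totally_umbilical: "totally_umbilical A1 At gt nabt (\<phi> \<circ> slice1 a c)"
proof -
  interpret warped_leaf M At gt nabt \<phi> J nabB h D Lf bas F A1 proj1 "\<lambda>x. slice1 (proj0 x) (proj2 x)"
    1 "(a, undefined, c)"
  proof unfold_locales
    show "differential A1 proj1 p v = 0" if "j < 3" "j \<noteq> 1" "v \<in> D j p" for j p v
      using that kill[of v p] by (elim index_cases) (simp_all add: D_simps)
    show "h p u v = 0" if "u \<in> D 1 p" "v \<in> D 1 p" for p u v by (rule h_D[OF _ that]) simp
  qed (auto simp: D_simps Lf_simps F1.Lift_lift)
  show ?thesis using leaf_totally_umbilical by (simp add: proj0_def proj2_def)
qed

lemma leaf2_totally_umbilical: "totally_umbilical A2 At gt nabt (\<phi> \<circ> slice2 a b)"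
proof -
  interpret warped_leaf M At gt nabt \<phi> J nabB h D Lf bas F A2 proj2 "\<lambda>x. slice2 (proj0 x) (proj1 x)"
    2 "(a, b, undefined)"
  proof unfold_locales
    show "differential A2 proj2 p v = 0" if "j < 3" "j \<noteq> 2" "v \<in> D j p" for j p v
      using that kill[of v p] by (elim index_cases) (simp_all add: D_simps)
    show "h p u v = 0" if "u \<in> D 2 p" "v \<in> D 2 p" for p u v by (rule h_D[OF _ that]) simp
  qed (auto simp: D_simps Lf_simps F2.Lift_lift)
  show ?thesis using leaf_totally_umbilical by (simp add: proj0_def proj1_def)
qed

end

text \<open>Any one leaf of the base carries the hypothesis back to \<open>A0\<close>, where
  connectedness makes the logarithm constant.\<close>

lemma constant_if_base_critical:
  assumes f: "smooth_fun_on A0 UNIV (\<lambda>a. ln (f a))" and pos: "\<And>a. f a > 0"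
    and crit: "\<And>p y. y \<in> D 0 p \<Longrightarrow> y \<cdot> (\<lambda>q. ln (f (proj0 q))) = 0"
  shows "f constant_on UNIV"
proof -
  have "v \<cdot> (\<lambda>a. ln (f a)) = 0" if v: "v \<in> tangent_space A0 a" for a v
  proof -
    let ?p = "(a, undefined, undefined) :: 'a \<times> 'b \<times> 'c"
    have p: "slice0 undefined undefined a = ?p" by (simp add: slice0_def)
    have y: "differential M (slice0 undefined undefined) a v \<in> D 0 ?p"
      using F0.slice_leaf[OF v, of ?p] p unfolding D_simps proj1_def proj2_def by simp
    have "smooth_at M ?p (\<lambda>q. ln (f (proj0 q)))"
      using smooth_pullback_at[OF F0.proj smooth_atI[OF f]] by simp
    then show ?thesis
      using crit[OF y] p by (simp add: differential_act projections_of_slices)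
  qed
  from constant_if_tangent_act_0[OF mfd(1) f this]
  have "(\<lambda>a. ln (f a)) constant_on UNIV" .
  then obtain k where "\<And>a. ln (f a) = k" unfolding constant_on_def by blast
  then have "f a = exp k" for a using exp_ln[OF pos[of a]] by simp
  then show ?thesis unfolding constant_on_def by blast
qed

lemma dist_eq: "dist0 A0 A1 A2 = D 0" "dist1 A0 A1 A2 = D 1" "dist2 A0 A1 A2 = D 2"
  unfolding D_simps dist0_def dist1_def dist2_def tangent_image_def F0.leaf_def F1.leaf_def F2.leaf_def by auto

text \<open>The fibre has positive dimension, so at every point there is a nonzero \<open>v\<close>
  to which \<open>mixed_imp_critical\<close> applies; all derivatives of the logarithm along the
  base then vanish.\<close>

lemma not_mixed_1:
  assumes "\<not> f1 constant_on UNIV"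
  shows "\<not> mixed_totally_geodesic h (dist0 A0 A1 A2) (dist1 A0 A1 A2)"
proof
  assume m: "mixed_totally_geodesic h (dist0 A0 A1 A2) (dist1 A0 A1 A2)"
  have crit: "y \<cdot> (\<lambda>q. ln (f1 (proj0 q))) = 0" if y: "y \<in> D 0 p" for p y
  proof -
    obtain v where v: "v \<in> D 1 p" "v \<noteq> 0" using F1.leaf_nonzero[of p] unfolding D_simps by blast
    have "y \<cdot> F 1 = 0"
      by (rule mixed_imp_critical[OF _ _ m[unfolded mixed_totally_geodesic_def dist_eq, rule_format] v y]) simp_all
    then show ?thesis unfolding F_def w_def by simp
  qed
  have "f1 constant_on UNIV"
    by (rule constant_if_base_critical[OF f_smooth(3) _ crit]) (use warping in \<open>simp_all add: warping_function_def\<close>)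
  then show False using assms by blast
qed

lemma not_mixed_2:
  assumes "\<not> f2 constant_on UNIV"
  shows "\<not> mixed_totally_geodesic h (dist0 A0 A1 A2) (dist2 A0 A1 A2)"
proof
  assume m: "mixed_totally_geodesic h (dist0 A0 A1 A2) (dist2 A0 A1 A2)"
  have crit: "y \<cdot> (\<lambda>q. ln (f2 (proj0 q))) = 0" if y: "y \<in> D 0 p" for p y
  proof -
    obtain v where v: "v \<in> D 2 p" "v \<noteq> 0" using F2.leaf_nonzero[of p] unfolding D_simps by blast
    have "y \<cdot> F 2 = 0"
      by (rule mixed_imp_critical[OF _ _ m[unfolded mixed_totally_geodesic_def dist_eq, rule_format] v y]) simp_all
    then show ?thesis unfolding F_def w_def by simp
  qed
  have "f2 constant_on UNIV"
    by (rule constant_if_base_critical[OF f_smooth(4) _ crit]) (use warping in \<open>simp_all add: warping_function_def\<close>)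
  then show False using assms by blast
qed

end

theorem theorem4p1:
  fixes A0 :: "('a::{t2_space,second_countable_topology}, 'e0::euclidean_space) chart set"
    and A1 :: "('b::{t2_space,second_countable_topology}, 'e1::euclidean_space) chart set"
    and A2 :: "('c::{t2_space,second_countable_topology}, 'e2::euclidean_space) chart set"
    and At :: "('m::{t2_space,second_countable_topology}, 'e::euclidean_space) chart set"
    and g0 :: "'a metric" and g1 :: "'b metric" and g2 :: "'c metric"
    and f1 f2 :: "'a \<Rightarrow> real"
    and gt :: "'m metric" and J :: "'m \<Rightarrow> 'm tvec \<Rightarrow> 'm tvec" and nabt :: "'m connection"
    and A :: "('a \<times> 'b \<times> 'c, 'e0 \<times> 'e1 \<times> 'e2) chart set"
    and g :: "('a \<times> 'b \<times> 'c) metric"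
    and \<phi> :: "'a \<times> 'b \<times> 'c \<Rightarrow> 'm"
    and h :: "'a \<times> 'b \<times> 'c \<Rightarrow> ('a \<times> 'b \<times> 'c) tvec \<Rightarrow> ('a \<times> 'b \<times> 'c) tvec \<Rightarrow> 'm tvec"
    and \<mu> :: "'a \<times> 'b \<times> 'c \<Rightarrow> 'm tvec set"
    and \<theta> q :: real and p :: nat
  assumes ambient: "nearly_kaehler At gt J nabt"
    and factors: "riemannian_manifold A0 g0" "riemannian_manifold A1 g1" "riemannian_manifold A2 g2"
    and warping: "warping_function A0 f1" "warping_function A0 f2"
    and product: "A = triple_atlas A0 A1 A2" "g = biwarped_metric A0 g0 A1 g1 A2 g2 f1 f2"
    and immersion: "isometric_immersion A g At gt \<phi>"
    and sff: "second_fundamental_form A At gt nabt \<phi> h"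
    and holomorphic: "\<And>b c. holomorphic_submanifold A0 At J (\<phi> \<circ> slice0 b c)"
    and totally_real: "\<And>a c. totally_real_submanifold A1 At gt J (\<phi> \<circ> slice1 a c)"
    and slant: "\<And>a b. proper_slant_submanifold A2 At gt J (\<phi> \<circ> slice2 a b) \<theta>"
    and normal_bundle: "normal_bundle_splits A At gt J \<phi> (dist1 A0 A1 A2) (dist2 A0 A1 A2) \<mu>"
    and dims: "p = DIM('e1)" "q = real DIM('e2) / 2"
  shows
    "(\<forall>x. norm_sq_sff A g gt \<phi> h x \<ge>
          2 * real p * grad_norm_sq A g (\<lambda>y. ln (f1 (proj0 y))) x
          + 4 * q * (1 + 10 / 9 * (cot \<theta>)\<^sup>2) * grad_norm_sq A g (\<lambda>y. ln (f2 (proj0 y))) x) \<and>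
     ((\<forall>x. norm_sq_sff A g gt \<phi> h x =
          2 * real p * grad_norm_sq A g (\<lambda>y. ln (f1 (proj0 y))) x
          + 4 * q * (1 + 10 / 9 * (cot \<theta>)\<^sup>2) * grad_norm_sq A g (\<lambda>y. ln (f2 (proj0 y))) x) \<longrightarrow>
        (\<forall>b c. totally_geodesic A0 At gt nabt (\<phi> \<circ> slice0 b c)) \<and>
        (\<forall>a c. totally_umbilical A1 At gt nabt (\<phi> \<circ> slice1 a c)) \<and>
        (\<forall>a b. totally_umbilical A2 At gt nabt (\<phi> \<circ> slice2 a b)) \<and>
        (\<not> f1 constant_on UNIV \<and> \<not> f2 constant_on UNIV \<longrightarrow>
           \<not> mixed_totally_geodesic h (dist0 A0 A1 A2) (dist1 A0 A1 A2) \<and>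
           \<not> mixed_totally_geodesic h (dist0 A0 A1 A2) (dist2 A0 A1 A2)))"
proof -
  \<comment> \<open>This fixes the Levi-Civita connection of the induced metric for which the Gauss
    formula with \<open>h\<close> holds.\<close>
  obtain nabB where lcB: "levi_civita A (pullback_metric At gt \<phi>) nabB"
    and gauss: "\<forall>W p u Y. p \<in> W \<and> u \<in> tangent_space A p \<and> vector_field_on A W Y \<longrightarrow>
       has_covariant_derivative_along A At nabt \<phi> p u (\<lambda>q. differential At \<phi> q (Y q))
         (differential At \<phi> p (nabB p u Y) + h p u (Y p))"
    and normal: "\<forall>p. \<forall>u\<in>tangent_space A p. \<forall>v\<in>tangent_space A p. h p u v \<in> normal_space A At gt \<phi> p"
    using sff unfolding second_fundamental_form_def by (elim conjE exE) (rule that)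
  interpret biwarped A0 A1 A2 At g0 g1 g2 f1 f2 gt J nabt \<phi> h nabB \<theta>
  proof (rule biwarped.intro)
    show "isometric_immersion (triple_atlas A0 A1 A2) (biwarped_metric A0 g0 A1 g1 A2 g2 f1 f2) At gt \<phi>"
      using immersion unfolding product .
  next
    fix W p u Y
    assume "p \<in> W" "u \<in> tangent_space (triple_atlas A0 A1 A2) p" "vector_field_on (triple_atlas A0 A1 A2) W Y"
    then show "has_covariant_derivative_along (triple_atlas A0 A1 A2) At nabt \<phi> p u (\<lambda>q. differential At \<phi> q (Y q))
         (differential At \<phi> p (nabB p u Y) + h p u (Y p))"
      using gauss unfolding product(1) by blast
  next
    fix p u v
    assume "u \<in> tangent_space (triple_atlas A0 A1 A2) p" "v \<in> tangent_space (triple_atlas A0 A1 A2) p"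
    then show "h p u v \<in> normal_space (triple_atlas A0 A1 A2) At gt \<phi> p"
      using normal unfolding product(1) by blast
  qed (use ambient factors warping lcB holomorphic totally_real slant product in simp_all)
  show ?thesis
    unfolding dims product
    using norm_sq_sff_bound(1) leaf0_totally_geodesic leaf1_totally_umbilical leaf2_totally_umbilical
      not_mixed_1 not_mixed_2
    by (intro conjI allI impI) (assumption | simp)+
qed

end
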